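(* Let $p_*=(b_*,\tau_{0,*})\in\mathcal T$ be an isolated critical parameter point (an isolated point of $\mathcal T$). If $\omega[p_*,0]\neq0$ in $A_1(G)$, then $(p_*,0)$ is a bifurcation point of the trivial branch $\{(p,0):p\in\mathfrak P\}$ of solutions of $\Psi_p(x)=0$. Moreover, if $(H)$ is maximal among the orbit types occurring with nonzero coefficient in the contribution to $\omega[p_*,0]$ from a temporal mode $m>0$, then nonconstant $2\pi$-periodic solutions bifurcate from $(p_*,0)$ with isotropy containing a subgroup conjugate to $H$; that is, every neighbourhood of $(p_*,0)$ in $\mathfrak P\times\mathcal X$ contains a pair $(p,x)$ with $\Psi_p(x)=0$, $x$ nonconstant, and $gHg^{-1}\le G_x$ for some $g\in G$.
   Context: MODEL. Fix a positive integer $n$ and constants $a>0$, $\delta>0$, $c\ge 0$, $\beta>0$, $\tau_c\ge 0$; put $\eta=a+\delta$, $\alpha=a\delta$. Parameters $p=(b,\tau_0)\in\mathfrak P=(0,\infty)\times[0,\infty)$. Indices $k$ are modulo $n$. $\mathcal X=H^2_{\mathrm{per}}([0,2\pi],\mathbb R^n)$ with $\langle x,z\rangle_{\mathcal X}=\int_0^{2\pi}(x''\cdot z''+x'\cdot z'+x\cdot z)\,dt$; $\mathcal Y=L^2([0,2\pi],\mathbb R^n)$. $G=D_n\times\mathbb Z_2\times S^1$ acts by $((\gamma,\iota,\theta)x)(t)=\gamma\,\iota\,x(t+\theta)$, where the dihedral group $D_n$ permutes coordinates (rotations and reflections of the index ring), $\mathbb Z_2=\{\pm1\}$ acts by sign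 and $S^1=\mathbb R/2\pi\mathbb Z$. Let $$\mathscr F_{p,k}(x)(t)=-\eta x_k'(t)-\alpha x_k(t)-b x_k(t-\tau_0)+c\bigl(x_{k+1}(t-\tau_c)-2x_k(t)+x_{k-1}(t-\tau_c)\bigr)-\beta x_k^3(t),$$ $\mathcal A x=x''-x$ (an isomorphism $\mathcal X\to\mathcal Y$), and $\Psi_p(x)=x-\mathcal A^{-1}(\mathscr F_p(x)-x)$. Zeros of $\Psi_p$ are exactly the $2\pi$-periodic solutions of $x''=\mathscr F_p(x)$. $\Psi_p$ is a $G$-equivariant compact perturbation of the identity. $(p_*,0)$ is a bifurcation point if every neighbourhood of it in $\mathfrak P\times\mathcal X$ contains $(p,x)$ with $x\ne0$, $\Psi_p(x)=0$. $G_x=\{g\in G:gx=x\}$. CRITICAL SET. $\Lambda_n=\{0,1,\dots,\lfloor n/2\rfloor\}$, $\vartheta_\ell=2\pi\ell/n$, $$\Delta_\ell(\nu,b,\tau_0)=\nu^2+\eta\nu+\alpha+2c+be^{-\nu\tau_0}-2c\cos(\vartheta_\ell)e^{-\nu\tau_c}.$$ $\mathcal T_{\ell,m}=\{(b,\tau_0)\in\mathfrak P:\Delta_\ell(im,b,\tau_0)=0\}$ and $\mathcal T=\bigcup_{\ell\in\Lambda_n}\bigcup_{m\ge1}\mathcal T_{\ell,m}$. For $p_*\in\mathcal T$, $\mathcal K=\{(\ell,m)\in\Lambda_n\times\mathbb N_+:\Delta_\ell(im,b_*,\tau_{0,*})=0\}$. REPRESENTATIONS. $V_\ell=\mathrm{span}\{(\cos(\vartheta_\ell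 k))_{k},(\sin(\vartheta_\ell k))_{k}\}\subset\mathbb R^n$, so $\mathbb R^n=\bigoplus_{\ell\in\Lambda_n}V_\ell$. $\mathcal V_\ell=\mathcal V_{\ell,0}=V_\ell$ (constant functions), and for $m\ge1$, $\mathcal V_{\ell,m}=\{u\cos(mt)+v\sin(mt):u,v\in V_\ell\}$. $\mathcal X$ is the closure of the sum of all $\mathcal V_{\ell,m}$, $m\geq 0$. $E_0$ denotes the constant functions. ORBIT TYPES. $(H)$ is the conjugacy class of a closed subgroup $H\le G$; $(H)\le(K)$ if $gHg^{-1}\le K$ for some $g\in G$. $N(H)$ is the normalizer, $W(H)=N(H)/H$, $\Phi_k(G)=\{(H):\dim W(H)=k\}$, $A_k(G)=\mathbb Z[\Phi_k(G)]$ the free abelian group on $\Phi_k(G)$, $k=0,1$. $n(L,H)$ is the number of subgroups conjugate to $H$ that contain $L$. $A_0(G)$ is the Burnside ring: $(H)\cdot(K)=\sum_{(L)\in\Phi_0(G)} n_L(L)$, with $n_L$ the number of $G$-orbits of type $(L)$ in $G/H\times G/K$; the same formula with $(H)\in\Phi_0(G)$, $(K),(L)\in\Phi_1(G)$ makes $A_1(G)$ an $A_0(G)$-module. BASIC DEGREES. For $m=0$: $\deg_{\mathcal V_\ell}\in A_0(G)$ is the $G$-equivariant Brouwer degree of $-\mathrm{Id}$ on a small ball of $\mathcal V_\ell$; $\deg_{\mathcal V_\ell}=\sum_{(H)\in\Phi_0(G)} n_H(H)$ with $$n_H=\frac{(-1)^{\dim\mathcal V_\ell^H}-\sum_{(K)>(H)}n_K\,n(H,K)\,|W(K)|}{|W(H)|}.$$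 For $m\ge1$: $\deg_{\mathcal V_{\ell,m}}\in A_1(G)$ is the one-parameter (twisted) basic degree $\sum n_H(H)$ over the orbit types $(H)\in\Phi_1(G)$ occurring in $\mathcal V_{\ell,m}$, with $$n_H=\frac{\tfrac12\dim\mathcal V_{\ell,m}^{H}-\sum_{(K)>(H)}n_K\,n(H,K)\,|W(K)/S^1|}{|W(H)/S^1|},$$ where $W(H)/S^1$ is the quotient of $W(H)$ by the image of $S^1$. CROSSING NUMBERS. For $(\ell,m)\in\mathcal K$ set $$A_{\ell,m}=\eta-b_*\tau_{0,*}\cos(m\tau_{0,*})+2c\tau_c\cos(\vartheta_\ell)\cos(m\tau_c),$$ $$B_{\ell,m}=-2m-b_*\tau_{0,*}\sin(m\tau_{0,*})+2c\tau_c\cos(\vartheta_\ell)\sin(m\tau_c).$$ The transversality condition $A_{\ell,m}\cos(m\tau_{0,*})+B_{\ell,m}\sin(m\tau_{0,*})\ne0$ is assumed for all $(\ell,m)\in\mathcal K$ (the critical root $im$ is then simple and crosses the imaginary axis with nonzero speed as $b$ passes through $b_*$ with $\tau_0=\tau_{0,*}$ fixed). The crossing number is $$\mathfrak t_{\ell,m}(p_* )=d_{\ell,m}\,\mathrm{sign}\bigl(A_{\ell,m}\cos(m\tau_{0,*})+B_{\ell,m}\sin(m\tau_{0,*})\bigr),$$ where $d_{\ell,m}$ is the number of copies of $\mathcal V_{\ell,m}$ contained in the critical eigenspace (kernel of $D_x\Psi_{p_*}(0)$) corresponding to $\nu=\pm im$. INVARIANT. Let $\Sigma_-$ be the set of negative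 eigenvalues of $D_x\Psi_{p_*}(0)$ on $E_0$, and $\mathfrak m_\ell(\mu)$ the multiplicity of $\mathcal V_\ell$ in the eigenspace of $\mu\in\Sigma_-$. The local bifurcation invariant is $$\omega[p_*,0]=\prod_{\mu\in\Sigma_-}\prod_{\ell\in\Lambda_n}(\deg_{\mathcal V_\ell})^{\mathfrak m_\ell(\mu)}\cdot\sum_{(\ell,m)\in\mathcal K}\mathfrak t_{\ell,m}(p_* )\deg_{\mathcal V_{\ell,m}}\in A_1(G).$$ The contribution from a temporal mode $m\geq 1$ is the same expression with the sum restricted to pairs in $\mathcal K$ having that $m$. *)

theory Defs
  imports "HOL-Analysis.Analysis" "HOL-Algebra.Group_Action" "HOL-Algebra.Ring"
    "HOL-Library.Poly_Mapping" "Berlekamp_Zassenhaus.Finite_Field"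
begin

definition L2per :: "(real \<Rightarrow> 'e::euclidean_space) set" where
  "L2per = {y. y \<in> borel_measurable lebesgue \<and> (\<forall>t. y (t + 2 * pi) = y t) \<and>
               (\<lambda>t. (norm (y t))\<^sup>2) integrable_on {0..2 * pi}}"

text \<open>Elements of \<open>H\<^sup>2\<^sub>p\<^sub>e\<^sub>r\<close> are represented by their unique \<open>C\<^sup>1\<close> representatives, extended
  \<open>2\<pi>\<close>-periodically to the real line: \<open>y\<close> is the weak second derivative of \<open>x\<close> when \<open>x'\<close> is an
  indefinite integral of \<open>y \<in> L\<^sup>2\<close>.\<close>

definition weak_d2 :: "(real \<Rightarrow> 'e::euclidean_space) \<Rightarrow> (real \<Rightarrow> 'e) \<Rightarrow> bool" where
  "weak_d2 x y \<longleftrightarrow> y \<in> L2per \<and> (\<forall>t. x differentiable (at t)) \<and>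
     (\<forall>s t. s \<le> t \<longrightarrow>
        (y has_integral (vector_derivative x (at t) - vector_derivative x (at s))) {s..t})"

definition H2per :: "(real \<Rightarrow> 'e::euclidean_space) set" where
  "H2per = {x. (\<forall>t. x (t + 2 * pi) = x t) \<and> (\<exists>y. weak_d2 x y)}"

lemma L2_inner_integrable:
  fixes u v :: "real \<Rightarrow> 'e::euclidean_space"
  assumes "u \<in> L2per" "v \<in> L2per"
  shows "(\<lambda>t. u t \<bullet> v t) integrable_on {0..2 * pi}"
proof (rule measurable_bounded_by_integrable_imp_integrable)
  have "u \<in> borel_measurable lebesgue" "v \<in> borel_measurable lebesgue"
    using assms by (auto simp: L2per_def)
  then show "(\<lambda>t. u t \<bullet> v t) \<in> borel_measurable (lebesgue_on {0..2 * pi})"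
    by (intro measurable_restrict_space1 borel_measurable_inner)
  show "(\<lambda>t. (norm (u t))\<^sup>2 + (norm (v t))\<^sup>2) integrable_on {0..2 * pi}"
    using assms by (auto simp: L2per_def intro: integrable_add)
  show "norm (u t \<bullet> v t) \<le> (norm (u t))\<^sup>2 + (norm (v t))\<^sup>2" for t
  proof -
    have "\<bar>u t \<bullet> v t\<bar> \<le> norm (u t) * norm (v t)" by (rule Cauchy_Schwarz_ineq2)
    also have "\<dots> \<le> (norm (u t))\<^sup>2 + (norm (v t))\<^sup>2"
      using sum_squares_bound[of "norm (u t)" "norm (v t)"]
        mult_nonneg_nonneg[OF norm_ge_zero norm_ge_zero, of "u t" "v t"] by linarith
    finally show ?thesis by simp
  qed
qed auto

lemma L2_add:
  assumes "u \<in> L2per" "v \<in> L2per" shows "(\<lambda>t. u t + v t) \<in> L2per"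
proof -
  have "(\<lambda>t. (norm (u t))\<^sup>2 + (2 * (u t \<bullet> v t)) + (norm (v t))\<^sup>2) integrable_on {0..2 * pi}"
    using assms L2_inner_integrable[OF assms] by (intro integrable_add integrable_on_cmult_left) (auto simp: L2per_def)
  moreover have "(norm (u t + v t))\<^sup>2 = (norm (u t))\<^sup>2 + (2 * (u t \<bullet> v t)) + (norm (v t))\<^sup>2" for t
    by (simp add: power2_norm_eq_inner inner_add_left inner_add_right inner_commute)
  ultimately show ?thesis using assms by (auto simp: L2per_def)
qed

lemma L2_scaleR:
  assumes "u \<in> L2per" shows "(\<lambda>t. r *\<^sub>R u t) \<in> L2per"
proof -
  have "(\<lambda>t. r\<^sup>2 *\<^sub>R (norm (u t))\<^sup>2) integrable_on {0..2 * pi}"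
    using assms by (intro integrable_cmul) (auto simp: L2per_def)
  then show ?thesis using assms by (auto simp: L2per_def power_mult_distrib)
qed

lemma zero_integrals_negligible:
  fixes w :: "real \<Rightarrow> 'e::euclidean_space"
  assumes z: "\<And>s t. s \<le> t \<Longrightarrow> (w has_integral 0) {s..t}"
  shows "negligible {t \<in> {a..b}. w t \<noteq> 0}"
proof -
  have "((\<lambda>t. norm (w t)) has_integral 0) (cbox a b)"
    unfolding has_integral
  proof (intro allI impI)
    fix e :: real assume "e > 0"
    have int: "w integrable_on cbox a b"
      using z by (cases "a \<le> b") (auto simp: integrable_on_def)
    obtain \<gamma> where g: "gauge \<gamma>" and \<gamma>: "\<And>p. \<lbrakk>p tagged_partial_division_of (cbox a b); \<gamma> fine p\<rbrakk> \<Longrightarrow>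
             sum (\<lambda>(x,k). norm (measure lborel k *\<^sub>R w x - integral k w)) p < e"
      using Henstock_lemma[OF int \<open>e > 0\<close>] by blast
    have "norm ((\<Sum>(x,K)\<in>p. measure lborel K *\<^sub>R norm (w x)) - 0) < e"
      if p: "p tagged_division_of (cbox a b)" "\<gamma> fine p" for p
    proof -
      have "(\<Sum>(x,K)\<in>p. measure lborel K *\<^sub>R norm (w x)) =
            (\<Sum>(x,K)\<in>p. norm (measure lborel K *\<^sub>R w x - integral K w))"
      proof (rule sum.cong[OF refl], clarify)
        fix x K assume "(x, K) \<in> p"
        then obtain c d where K: "K = cbox c d" and "x \<in> K"
          using p(1) by (meson tagged_division_ofD(2,4))
        then have "integral K w = 0"
          using z[of c d] by (intro integral_unique) (auto simp: cbox_interval)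
        then show "measure lborel K *\<^sub>R norm (w x) = norm (measure lborel K *\<^sub>R w x - integral K w)" by simp
      qed
      also have "\<dots> < e"
        using \<gamma>[OF _ p(2)] p(1) by (simp add: tagged_division_of_def)
      finally show ?thesis
        by (simp add: sum_nonneg case_prod_beta)
    qed
    with g show "\<exists>\<gamma>. gauge \<gamma> \<and> (\<forall>\<D>. \<D> tagged_division_of cbox a b \<and> \<gamma> fine \<D> \<longrightarrow>
        norm ((\<Sum>(x, k)\<in>\<D>. measure lborel k *\<^sub>R norm (w x)) - 0) < e)"
      by (intro exI[of _ \<gamma>] conjI allI impI) (simp_all only:)
  qed
  then have "((\<lambda>t. if t \<in> {a..b} then norm (w t) else 0) has_integral 0) UNIV"
    by (subst has_integral_restrict_UNIV) simp
  then have m: "(\<lambda>t. if t \<in> {a..b} then norm (w t) else 0) \<in> borel_measurable lebesgue"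
    and n: "integral\<^sup>N lebesgue (\<lambda>t. ennreal (if t \<in> {a..b} then norm (w t) else 0)) = 0"
    by (subst (asm) has_integral_iff_nn_integral_lebesgue; simp)+
  from n have "AE t in lebesgue. ennreal (if t \<in> {a..b} then norm (w t) else 0) = 0"
    by (subst (asm) nn_integral_0_iff_AE) (use m in auto)
  then have "AE t in lebesgue. t \<notin> {t \<in> {a..b}. w t \<noteq> 0}"
    by (rule eventually_mono) (auto split: if_splits)
  then show ?thesis
    unfolding negligible_iff_null_sets eventually_ae_filter
    by (auto intro: null_sets_completion_subset)
qed

lemma weak_d2_unique:
  assumes "weak_d2 x y" "weak_d2 x z"
  shows "negligible {t \<in> {0..2 * pi}. y t \<noteq> z t}"
proof -
  have "negligible {t \<in> {0..2 * pi}. y t - z t \<noteq> 0}"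
  proof (rule zero_integrals_negligible)
    fix s t :: real assume "s \<le> t"
    then have "(y has_integral (vector_derivative x (at t) - vector_derivative x (at s))) {s..t}"
      "(z has_integral (vector_derivative x (at t) - vector_derivative x (at s))) {s..t}"
      using assms by (auto simp: weak_d2_def)
    from has_integral_diff[OF this] show "((\<lambda>t. y t - z t) has_integral 0) {s..t}" by simp
  qed
  then show ?thesis by simp
qed

lemma weak_d2_add:
  assumes "weak_d2 x y" "weak_d2 u v"
  shows "weak_d2 (\<lambda>t. x t + u t) (\<lambda>t. y t + v t)"
  unfolding weak_d2_def
proof (intro conjI allI impI)
  have diff: "x differentiable (at t)" "u differentiable (at t)" for t
    using assms by (auto simp: weak_d2_def)
  show "(\<lambda>t. y t + v t) \<in> L2per" using assms by (intro L2_add) (auto simp: weak_d2_def)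
  show "(\<lambda>t. x t + u t) differentiable (at t)" for t
    by (rule differentiable_add[OF diff])
  fix s t :: real assume "s \<le> t"
  then have "((\<lambda>t. y t + v t) has_integral
      (vector_derivative x (at t) - vector_derivative x (at s)) +
      (vector_derivative u (at t) - vector_derivative u (at s))) {s..t}"
    using assms by (intro has_integral_add) (auto simp: weak_d2_def)
  then show "((\<lambda>t. y t + v t) has_integral
      (vector_derivative (\<lambda>t. x t + u t) (at t) - vector_derivative (\<lambda>t. x t + u t) (at s))) {s..t}"
    by (simp add: vector_derivative_add_at[OF diff] add_diff_add)
qed

lemma weak_d2_scaleR:
  assumes "weak_d2 x y"
  shows "weak_d2 (\<lambda>t. r *\<^sub>R x t) (\<lambda>t. r *\<^sub>R y t)"
  unfolding weak_d2_def
proof (intro conjI allI impI)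
  have diff: "x differentiable (at t)" for t
    using assms by (auto simp: weak_d2_def)
  have D: "((\<lambda>t. r *\<^sub>R x t) has_vector_derivative r *\<^sub>R vector_derivative x (at t)) (at t)" for t
    using bounded_linear.has_vector_derivative[OF bounded_linear_scaleR_right]
      diff[of t] vector_derivative_works by blast
  show "(\<lambda>t. r *\<^sub>R y t) \<in> L2per" using assms by (intro L2_scaleR) (auto simp: weak_d2_def)
  show "(\<lambda>t. r *\<^sub>R x t) differentiable (at t)" for t
    using D differentiableI_vector by blast
  fix s t :: real assume "s \<le> t"
  then have "((\<lambda>t. r *\<^sub>R y t) has_integral
      r *\<^sub>R (vector_derivative x (at t) - vector_derivative x (at s))) {s..t}"
    using assms by (intro has_integral_cmul) (auto simp: weak_d2_def)
  then show "((\<lambda>t. r *\<^sub>R y t) has_integral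
      (vector_derivative (\<lambda>t. r *\<^sub>R x t) (at t) - vector_derivative (\<lambda>t. r *\<^sub>R x t) (at s))) {s..t}"
    by (simp add: vector_derivative_at[OF D] scaleR_diff_right)
qed

lemma weak_d2_zero: "weak_d2 (\<lambda>_. 0) (\<lambda>_. 0)"
  by (auto simp: weak_d2_def L2per_def)

lemma H2per_zero: "(\<lambda>_. 0) \<in> H2per"
  using weak_d2_zero by (auto simp: H2per_def)

lemma H2per_add:
  assumes "x \<in> H2per" "z \<in> H2per" shows "(\<lambda>t. x t + z t) \<in> H2per"
proof -
  obtain y v where "weak_d2 x y" "weak_d2 z v" using assms by (auto simp: H2per_def)
  from weak_d2_add[OF this] assms show ?thesis by (auto simp: H2per_def)
qed

lemma H2per_scaleR:
  assumes "x \<in> H2per" shows "(\<lambda>t. r *\<^sub>R x t) \<in> H2per"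
proof -
  obtain y where "weak_d2 x y" using assms by (auto simp: H2per_def)
  from weak_d2_scaleR[OF this, of r] assms show ?thesis by (auto simp: H2per_def)
qed

typedef (overloaded) 'e h2per = "H2per :: (real \<Rightarrow> 'e::euclidean_space) set"
  morphisms h2fun Abs_h2per
  using H2per_zero by blast

setup_lifting type_definition_h2per

definition d1 :: "'e::euclidean_space h2per \<Rightarrow> real \<Rightarrow> 'e" where
  "d1 x t = vector_derivative (h2fun x) (at t)"

text \<open>\<open>d2 x\<close> is determined only almost everywhere; it is used only under integrals and in
  almost-everywhere statements.\<close>

definition d2 :: "'e::euclidean_space h2per \<Rightarrow> real \<Rightarrow> 'e" where
  "d2 x = (SOME y. weak_d2 (h2fun x) y)"

lemma weak_d2_d2: "weak_d2 (h2fun x) (d2 x)"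
proof -
  obtain y where "weak_d2 (h2fun x) y" using h2fun[of x] by (auto simp: H2per_def)
  then show ?thesis unfolding d2_def by (rule someI[where P = "weak_d2 (h2fun x)"])
qed

instantiation h2per :: (euclidean_space) real_vector
begin

lift_definition zero_h2per :: "'a h2per" is "\<lambda>_. 0" by (rule H2per_zero)
lift_definition plus_h2per :: "'a h2per \<Rightarrow> 'a h2per \<Rightarrow> 'a h2per" is "\<lambda>x z t. x t + z t"
  by (rule H2per_add)
lift_definition scaleR_h2per :: "real \<Rightarrow> 'a h2per \<Rightarrow> 'a h2per" is "\<lambda>r x t. r *\<^sub>R x t"
  by (rule H2per_scaleR)
definition "uminus x = (-1) *\<^sub>R (x :: 'a h2per)"
definition "x - z = x + - (z :: 'a h2per)"

instance
proof
  fix x y z :: "'a h2per" and r s :: real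
  note ops = h2fun_inject[symmetric] uminus_h2per_def minus_h2per_def
    zero_h2per.rep_eq plus_h2per.rep_eq scaleR_h2per.rep_eq fun_eq_iff
  show "x + y + z = x + (y + z)" by (simp add: ops add.assoc)
  show "x + y = y + x" by (simp add: ops add.commute)
  show "0 + x = x" by (simp add: ops)
  show "- x + x = 0" by (simp add: ops)
  show "x - y = x + - y" by (simp add: minus_h2per_def)
  show "r *\<^sub>R (x + y) = r *\<^sub>R x + r *\<^sub>R y" by (simp add: ops scaleR_add_right)
  show "(r + s) *\<^sub>R x = r *\<^sub>R x + s *\<^sub>R x" by (simp add: ops scaleR_add_left)
  show "r *\<^sub>R s *\<^sub>R x = (r * s) *\<^sub>R x" by (simp add: ops)
  show "1 *\<^sub>R x = x" by (simp add: ops)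
qed

end

lemma h2per_continuous_d1: "continuous_on {a..b} (d1 x)"
proof -
  have i: "(d2 x has_integral (d1 x t - d1 x s)) {s..t}" if "s \<le> t" for s t
    using weak_d2_d2[of x] that by (auto simp: weak_d2_def d1_def)
  show ?thesis
  proof (cases "a \<le> b")
    case True
    have "continuous_on {a..b} (\<lambda>t. d1 x a + integral {a..t} (d2 x))"
      using i[OF True] by (intro continuous_intros indefinite_integral_continuous_1) (auto simp: integrable_on_def)
    then show ?thesis
      by (rule continuous_on_eq) (simp add: integral_unique[OF i])
  next
    case False
    then have "{a..b} = {}" by simp
    then show ?thesis by (simp only: continuous_on_empty)
  qed
qed

lemma h2per_continuous_fun: "continuous_on S (h2fun x)"
proof (rule continuous_at_imp_continuous_on, rule ballI)
  fix t
  have "h2fun x differentiable (at t)" using weak_d2_d2[of x] by (simp add: weak_d2_def)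
  then show "isCont (h2fun x) t" by (rule differentiable_imp_continuous_within)
qed

lemma d2_spike:
  assumes "weak_d2 (h2fun x) y"
  shows "\<exists>N. negligible N \<and> (\<forall>t \<in> {0..2 * pi} - N. d2 x t = y t)"
  using weak_d2_unique[OF weak_d2_d2 assms] by (intro exI conjI) auto

definition h2_inner_integrand :: "'e::euclidean_space h2per \<Rightarrow> 'e h2per \<Rightarrow> real \<Rightarrow> real" where
  "h2_inner_integrand x z t = d2 x t \<bullet> d2 z t + d1 x t \<bullet> d1 z t + h2fun x t \<bullet> h2fun z t"

lemma h2_parts_integrable:
  "(\<lambda>t. d2 x t \<bullet> d2 z t) integrable_on {0..2 * pi}"
  "(\<lambda>t. d1 x t \<bullet> d1 z t) integrable_on {0..2 * pi}"
  "(\<lambda>t. h2fun x t \<bullet> h2fun z t) integrable_on {0..2 * pi}"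
proof -
  have "d2 x \<in> L2per" for x :: "'a h2per" using weak_d2_d2[of x] by (simp add: weak_d2_def)
  then show "(\<lambda>t. d2 x t \<bullet> d2 z t) integrable_on {0..2 * pi}" by (intro L2_inner_integrable)
  show "(\<lambda>t. d1 x t \<bullet> d1 z t) integrable_on {0..2 * pi}"
    by (intro integrable_continuous_real continuous_on_inner h2per_continuous_d1)
  show "(\<lambda>t. h2fun x t \<bullet> h2fun z t) integrable_on {0..2 * pi}"
    by (intro integrable_continuous_real continuous_on_inner h2per_continuous_fun)
qed

lemma h2_integrable: "h2_inner_integrand x z integrable_on {0..2 * pi}"
  unfolding h2_inner_integrand_def[abs_def]
  by (rule integrable_add[OF integrable_add[OF h2_parts_integrable(1,2)] h2_parts_integrable(3)])

instantiation h2per :: (euclidean_space) real_inner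
begin

definition inner_h2per :: "'a h2per \<Rightarrow> 'a h2per \<Rightarrow> real" where
  "inner_h2per x z = integral {0..2 * pi} (\<lambda>t. d2 x t \<bullet> d2 z t + d1 x t \<bullet> d1 z t + h2fun x t \<bullet> h2fun z t)"
definition norm_h2per :: "'a h2per \<Rightarrow> real" where "norm_h2per x = sqrt (inner x x)"
definition sgn_h2per :: "'a h2per \<Rightarrow> 'a h2per" where "sgn_h2per x = x /\<^sub>R norm x"
definition dist_h2per :: "'a h2per \<Rightarrow> 'a h2per \<Rightarrow> real" where "dist_h2per x z = norm (x - z)"
definition uniformity_h2per :: "('a h2per \<times> 'a h2per) filter" where
  "uniformity_h2per = (INF e\<in>{0<..}. principal {(x, z). dist x z < e})"
definition open_h2per :: "'a h2per set \<Rightarrow> bool" where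
  "open_h2per U \<longleftrightarrow> (\<forall>x\<in>U. \<forall>\<^sub>F (x', z) in uniformity. x' = x \<longrightarrow> z \<in> U)"

instance
proof
  have inn: "inner x z = integral {0..2 * pi} (h2_inner_integrand x z)" for x z :: "'a h2per"
    by (simp add: inner_h2per_def h2_inner_integrand_def[abs_def])
  have add: "inner (x + z) u = inner x u + inner z u" for x z u :: "'a h2per"
  proof -
    have d2x: "weak_d2 (h2fun x) (d2 x)" "weak_d2 (h2fun z) (d2 z)" by (rule weak_d2_d2)+
    then have diff: "h2fun x differentiable (at t)" "h2fun z differentiable (at t)" for t
      by (auto simp: weak_d2_def)
    have "weak_d2 (h2fun (x + z)) (\<lambda>t. d2 x t + d2 z t)"
      using weak_d2_add[OF d2x] by (simp add: plus_h2per.rep_eq)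
    from d2_spike[OF this]
  obtain N where N: "negligible N" "\<forall>t \<in> {0..2 * pi} - N. d2 (x + z) t = d2 x t + d2 z t"
    by blast
    have d1: "d1 (x + z) t = d1 x t + d1 z t" for t
      using vector_derivative_add_at[OF diff] by (simp add: d1_def plus_h2per.rep_eq)
    have "integral {0..2 * pi} (h2_inner_integrand (x + z) u) =
               integral {0..2 * pi} (\<lambda>t. h2_inner_integrand x u t + h2_inner_integrand z u t)"
      by (rule integral_spike[OF N(1)]) (simp add: N(2)[rule_format] d1 h2_inner_integrand_def plus_h2per.rep_eq inner_add_left)
    then show ?thesis
      by (simp add: inn h2_integrable integral_add)
  qed
  fix x z u :: "'a h2per" and r :: real
  show "inner x z = inner z x" by (simp add: inner_h2per_def inner_commute)
  show "inner (x + z) u = inner x u + inner z u" by (rule add)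
  have d2x: "weak_d2 (h2fun x) (d2 x)" by (rule weak_d2_d2)
  then have diff: "h2fun x differentiable (at t)" for t
    by (auto simp: weak_d2_def)
  have "weak_d2 (h2fun (r *\<^sub>R x)) (\<lambda>t. r *\<^sub>R d2 x t)"
    using weak_d2_scaleR[OF d2x] by (simp add: scaleR_h2per.rep_eq)
  from d2_spike[OF this]
  obtain N where N: "negligible N" "\<forall>t \<in> {0..2 * pi} - N. d2 (r *\<^sub>R x) t = r *\<^sub>R d2 x t"
    by blast
  have d1: "d1 (r *\<^sub>R x) t = r *\<^sub>R d1 x t" for t
    unfolding d1_def scaleR_h2per.rep_eq
    by (intro vector_derivative_at bounded_linear.has_vector_derivative[OF bounded_linear_scaleR_right])
      (use diff vector_derivative_works in blast)
  have "integral {0..2 * pi} (h2_inner_integrand (r *\<^sub>R x) z) =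
             integral {0..2 * pi} (\<lambda>t. r * h2_inner_integrand x z t)"
    by (rule integral_spike[OF N(1)])
      (simp add: N(2)[rule_format] d1 h2_inner_integrand_def scaleR_h2per.rep_eq algebra_simps)
  then show "inner (r *\<^sub>R x) z = r * inner x z"
    by (simp add: inn)
  show nn: "0 \<le> inner x x"
    unfolding inn by (intro integral_nonneg h2_integrable) (simp add: h2_inner_integrand_def)
  show "inner x x = 0 \<longleftrightarrow> x = 0"
  proof
    assume "inner x x = 0"
    moreover have "integral {0..2 * pi} (\<lambda>t. h2fun x t \<bullet> h2fun x t) \<le> inner x x"
      unfolding inn by (intro integral_le h2_integrable h2_parts_integrable) (simp add: h2_inner_integrand_def)
    moreover have "integral {0..2 * pi} (\<lambda>t. h2fun x t \<bullet> h2fun x t) \<ge> 0"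
      by (intro integral_nonneg h2_parts_integrable) simp
    ultimately have "integral {0..2 * pi} (\<lambda>t. h2fun x t \<bullet> h2fun x t) = 0" by linarith
    then have z: "h2fun x t = 0" if "t \<in> {0..2 * pi}" for t
      using that by (subst (asm) integral_eq_0_iff) (auto intro!: continuous_on_inner h2per_continuous_fun)
    have per: "h2fun x (t + 2 * pi) = h2fun x t" for t
      using h2fun[of x] by (auto simp: H2per_def)
    have "h2fun x t = 0" for t
    proof -
      interpret periodic_fun_simple "h2fun x" "2 * pi" by standard (rule per)
      define k where "k = \<lfloor>t / (2 * pi)\<rfloor>"
      have "h2fun x t = h2fun x (t - of_int k * (2 * pi))" by (simp add: minus_of_int)
      moreover have "t - of_int k * (2 * pi) \<in> {0..2 * pi}"
        using floor_divide_lower[of "2 * pi" t] floor_divide_upper[of "2 * pi" t]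
        by (auto simp: k_def algebra_simps)
      ultimately show ?thesis using z by simp
    qed
    then show "x = 0" by (simp add: h2fun_inject[symmetric] zero_h2per.rep_eq fun_eq_iff)
  next
    assume "x = 0"
    then have "x + x = x" by simp
    with add[of x x x] show "inner x x = 0" by simp
  qed
  show "norm x = sqrt (inner x x)" by (rule norm_h2per_def)
  show "sgn x = x /\<^sub>R norm x" by (rule sgn_h2per_def)
  show "dist x z = norm (x - z)" by (rule dist_h2per_def)
  show "uniformity = (INF e\<in>{0<..}. principal {(x::'a h2per, z). dist x z < e})"
    by (rule uniformity_h2per_def)
  show "open U \<longleftrightarrow> (\<forall>x\<in>U. \<forall>\<^sub>F (x', z) in uniformity. x' = x \<longrightarrow> z \<in> U)" for U :: "'a h2per set"
    by (rule open_h2per_def)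
qed

end

text \<open>The index ring \<open>\<int>/n\<close> is the type \<open>'n mod_ring\<close> with \<open>n = CARD('n)\<close>.
  The neighbours of \<open>k\<close> are written \<open>k \<plusminus> of_int_mod_ring 1\<close> because the constant \<open>1\<close>
  is not available for \<open>n = 1\<close>.\<close>

type_synonym 'n osc = "(real ^ 'n mod_ring) h2per"
type_synonym 'n gelem = "('n mod_ring \<times> int) \<times> (int \<times> complex)"
type_synonym 'n orbit_type = "'n gelem set set"

text \<open>The element \<open>(r, s)\<close> stands for the map \<open>k \<mapsto> r + s k\<close> of the index ring, \<open>s = \<plusminus>1\<close>.
  The group has order \<open>2n\<close> for every \<open>n\<close>; for \<open>n \<le> 2\<close> its action on indices is not faithful.\<close>

definition dihedral :: "('n::finite mod_ring \<times> int) monoid" where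
  "dihedral = \<lparr>carrier = UNIV \<times> {1, -1},
     monoid.mult = (\<lambda>(r, s) (r', s'). (if s = 1 then r + r' else r - r', s * s')),
     one = (0, 1)\<rparr>"

definition sign_group :: "int monoid" where
  "sign_group = \<lparr>carrier = {1, -1}, monoid.mult = (*), one = 1\<rparr>"

text \<open>\<open>S\<^sup>1 = \<real>/2\<pi>\<int>\<close>, identified with the unit circle by \<open>\<theta> \<mapsto> cis \<theta>\<close>.\<close>

definition circle_group :: "complex monoid" where
  "circle_group = \<lparr>carrier = sphere 0 1, monoid.mult = (*), one = 1\<rparr>"

definition GG :: "'n::finite gelem monoid" where
  "GG = dihedral \<times>\<times> (sign_group \<times>\<times> circle_group)"

definition GG_topology :: "'n::finite gelem topology" where
  "GG_topology = prod_topology (discrete_topology (carrier dihedral))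
     (prod_topology (discrete_topology (carrier sign_group)) (top_of_set (carrier circle_group)))"

definition circle_elem :: "complex \<Rightarrow> 'n::finite gelem" where
  "circle_elem z = ((0, 1), (1, z))"

text \<open>The time shift by \<open>\<theta>\<close> may be taken to be \<open>Arg z\<close> for \<open>z = cis \<theta>\<close>, by periodicity.
  On indices, \<open>(\<gamma>x)\<^sub>k = x\<^sub>j\<close> with \<open>j = \<gamma>\<inverse>k\<close>, and \<open>\<gamma>\<inverse>k = s (k - r)\<close>.\<close>

definition act :: "'n::finite gelem \<Rightarrow> 'n osc \<Rightarrow> 'n osc" where
  "act = (\<lambda>((r, s), (\<iota>, z)) x. Abs_h2per (\<lambda>t.
     of_int \<iota> *\<^sub>R (\<chi> k. h2fun x (t + Arg z) $ (if s = 1 then k - r else r - k))))"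

definition closed_subgroup :: "'n::finite gelem set \<Rightarrow> bool" where
  "closed_subgroup H \<longleftrightarrow> subgroup H GG \<and> closedin GG_topology H"

definition conjugate :: "'n::finite gelem \<Rightarrow> 'n gelem set \<Rightarrow> 'n gelem set" where
  "conjugate g H = g <#\<^bsub>GG\<^esub> H #>\<^bsub>GG\<^esub> inv\<^bsub>GG\<^esub> g"

definition orbit_type :: "'n::finite gelem set \<Rightarrow> 'n orbit_type" where
  "orbit_type H = {conjugate g H | g. g \<in> carrier GG}"

definition rep :: "'n::finite orbit_type \<Rightarrow> 'n gelem set" where
  "rep \<H> = (SOME H. H \<in> \<H>)"

definition otype_le :: "'n::finite orbit_type \<Rightarrow> 'n orbit_type \<Rightarrow> bool" where
  "otype_le \<H> \<K> \<longleftrightarrow> (\<exists>H\<in>\<H>. \<exists>K\<in>\<K>. H \<subseteq> K)"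

definition otype_less :: "'n::finite orbit_type \<Rightarrow> 'n orbit_type \<Rightarrow> bool" where
  "otype_less \<H> \<K> \<longleftrightarrow> otype_le \<H> \<K> \<and> \<H> \<noteq> \<K>"

definition weyl :: "'n::finite gelem set \<Rightarrow> 'n gelem set monoid" where
  "weyl H = GG\<lparr>carrier := normalizer GG H\<rparr> Mod H"

text \<open>The Lie algebra of \<open>G\<close> is \<open>\<real>\<close> with exponential map \<open>v \<mapsto> (1, 1, cis v)\<close>.  The dimension of
  a closed subgroup \<open>K\<close> is that of its Lie algebra \<open>{v. \<forall>s. exp (s v) \<in> K}\<close>, and
  \<open>dim (N(H)/H) = dim N(H) - dim H\<close>.\<close>

definition lie_dim :: "'n::finite gelem set \<Rightarrow> nat" where
  "lie_dim K = dim {v::real. \<forall>s::real. circle_elem (cis (s * v)) \<in> K}"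

definition weyl_dim :: "'n::finite gelem set \<Rightarrow> nat" where
  "weyl_dim H = lie_dim (normalizer GG H) - lie_dim H"

definition Phi :: "nat \<Rightarrow> 'n::finite orbit_type set" where
  "Phi k = {orbit_type H | H. closed_subgroup H \<and> weyl_dim H = k}"

definition num_containing :: "'n::finite orbit_type \<Rightarrow> 'n orbit_type \<Rightarrow> nat" where
  "num_containing \<L> \<H> = card {H \<in> \<H>. rep \<L> \<subseteq> H}"

definition weyl_order :: "'n::finite orbit_type \<Rightarrow> nat" where
  "weyl_order \<H> = card (carrier (weyl (rep \<H>)))"

definition weyl_mod_circle_order :: "'n::finite orbit_type \<Rightarrow> nat" where
  "weyl_mod_circle_order \<H> = card (carrier
     (weyl (rep \<H>) Mod ((\<lambda>z. rep \<H> #>\<^bsub>GG\<^esub> circle_elem z) ` carrier circle_group)))"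

definition left_cosets :: "'n::finite gelem set \<Rightarrow> 'n gelem set set" where
  "left_cosets H = {g <#\<^bsub>GG\<^esub> H | g. g \<in> carrier GG}"

definition diag_act :: "'n::finite gelem \<Rightarrow> 'n gelem set \<times> 'n gelem set \<Rightarrow> 'n gelem set \<times> 'n gelem set" where
  "diag_act g = (\<lambda>(A, B). (g <#\<^bsub>GG\<^esub> A, g <#\<^bsub>GG\<^esub> B))"

definition num_orbits :: "'n::finite orbit_type \<Rightarrow> 'n orbit_type \<Rightarrow> 'n orbit_type \<Rightarrow> nat" where
  "num_orbits \<H> \<K> \<L> = card {Q \<in> orbits GG (left_cosets (rep \<H>) \<times> left_cosets (rep \<K>)) diag_act.
     \<exists>y\<in>Q. orbit_type (stabilizer GG diag_act y) = \<L>}"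

text \<open>The bilinear extension of \<open>(H)(K) = \<Sum>\<^sub>L n\<^sub>L (L)\<close> with \<open>(L)\<close> ranging over \<open>\<Phi>\<^sub>k(G)\<close>:
  \<open>k = 0\<close> is the product of \<open>A\<^sub>0(G)\<close>, and \<open>k = 1\<close> the action of \<open>A\<^sub>0(G)\<close> on \<open>A\<^sub>1(G)\<close>.\<close>

definition burnside_mult ::
  "nat \<Rightarrow> ('n::finite orbit_type \<Rightarrow>\<^sub>0 int) \<Rightarrow> ('n orbit_type \<Rightarrow>\<^sub>0 int) \<Rightarrow> ('n orbit_type \<Rightarrow>\<^sub>0 int)" where
  "burnside_mult k x y = (\<Sum>\<H>\<in>Poly_Mapping.keys x. \<Sum>\<K>\<in>Poly_Mapping.keys y.
     \<Sum>\<L> | \<L> \<in> Phi k \<and> num_orbits \<H> \<K> \<L> \<noteq> 0.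
       frag_cmul (Poly_Mapping.lookup x \<H> * Poly_Mapping.lookup y \<K> * int (num_orbits \<H> \<K> \<L>)) (frag_of \<L>))"

definition burnside_ring :: "('n::finite orbit_type \<Rightarrow>\<^sub>0 int) ring" where
  "burnside_ring = \<lparr>carrier = {x. Poly_Mapping.keys x \<subseteq> Phi 0},
     monoid.mult = burnside_mult 0, one = frag_of (orbit_type (carrier GG)),
     ring.zero = 0, add = (+)\<rparr>"

definition theta :: "nat \<Rightarrow> nat \<Rightarrow> real" where
  "theta n l = 2 * pi * real l / real n"

definition Lam :: "nat \<Rightarrow> nat set" where
  "Lam n = {0..n div 2}"

definition V_space :: "nat \<Rightarrow> (real ^ 'n::finite mod_ring) set" where
  "V_space l = span {\<chi> k. cos (theta CARD('n) l * of_int (to_int_mod_ring k)),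
                     \<chi> k. sin (theta CARD('n) l * of_int (to_int_mod_ring k))}"

text \<open>For \<open>m = 0\<close> this is the space of constant functions with values in \<open>V_space l\<close>.\<close>

definition V_mode :: "nat \<Rightarrow> nat \<Rightarrow> 'n::finite osc set" where
  "V_mode l m = {x. \<exists>u \<in> V_space l. \<exists>v \<in> V_space l.
     \<forall>t. h2fun x t = cos (real m * t) *\<^sub>R u + sin (real m * t) *\<^sub>R v}"

definition const_space :: "'n::finite osc set" where
  "const_space = {x. \<exists>u. \<forall>t. h2fun x t = u}"

definition fixed_dim :: "'n::finite osc set \<Rightarrow> 'n orbit_type \<Rightarrow> nat" where
  "fixed_dim V \<H> = dim {x \<in> V. \<forall>h \<in> rep \<H>. act h x = x}"

text \<open>The element \<open>\<Sum> n\<^sub>H (H)\<close>, \<open>(H) \<in> S\<close>, whose coefficients are determined from the top of \<open>S\<close>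
  downwards by \<open>n\<^sub>H = (\<nu>(H) - \<Sum>\<^sub>K n\<^sub>K n(H,K) w(K)) / w(H)\<close>, the sum being over \<open>(K) > (H)\<close>.\<close>

definition degree_of_recurrence ::
  "'n::finite orbit_type set \<Rightarrow> ('n orbit_type \<Rightarrow> real) \<Rightarrow> ('n orbit_type \<Rightarrow> nat) \<Rightarrow> ('n orbit_type \<Rightarrow>\<^sub>0 int)" where
  "degree_of_recurrence S \<nu> w = (THE d. Poly_Mapping.keys d \<subseteq> S \<and>
     (\<forall>\<H>\<in>S. real_of_int (Poly_Mapping.lookup d \<H>) =
        (\<nu> \<H> - (\<Sum>\<K> | \<K> \<in> S \<and> otype_less \<H> \<K>.
                   of_int (Poly_Mapping.lookup d \<K>) * real (num_containing \<H> \<K>) * real (w \<K>)))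
        / real (w \<H>)))"

definition deg_const :: "nat \<Rightarrow> ('n::finite orbit_type \<Rightarrow>\<^sub>0 int)" where
  "deg_const l = degree_of_recurrence (Phi 0) (\<lambda>\<H>. (-1) ^ fixed_dim (V_mode l 0) \<H>) weyl_order"

definition deg_mode :: "nat \<Rightarrow> nat \<Rightarrow> ('n::finite orbit_type \<Rightarrow>\<^sub>0 int)" where
  "deg_mode l m = degree_of_recurrence
     (Phi 1 \<inter> {orbit_type (stabilizer GG act x) | x. x \<in> V_mode l m})
     (\<lambda>\<H>. real (fixed_dim (V_mode l m) \<H>) / 2) weyl_mod_circle_order"

definition G_isomorphic :: "'n::finite osc set \<Rightarrow> 'n osc set \<Rightarrow> bool" where
  "G_isomorphic U V \<longleftrightarrow> (\<exists>\<phi>. linear \<phi> \<and> inj_on \<phi> U \<and> \<phi> ` U = V \<and>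
     (\<forall>g \<in> carrier GG. \<forall>x\<in>U. \<phi> (act g x) = act g (\<phi> x)))"

text \<open>The largest number of copies of \<open>V\<close> in a direct sum of subrepresentations of \<open>U\<close>.\<close>

definition copies :: "'n::finite osc set \<Rightarrow> 'n osc set \<Rightarrow> nat" where
  "copies V U = Max {d. \<exists>W :: nat \<Rightarrow> 'n osc set.
     (\<forall>i<d. subspace (W i) \<and> W i \<subseteq> U \<and> (\<forall>g \<in> carrier GG. act g ` W i \<subseteq> W i) \<and> G_isomorphic (W i) V) \<and>
     (\<forall>w. (\<forall>i<d. w i \<in> W i) \<and> (\<Sum>i<d. w i) = 0 \<longrightarrow> (\<forall>i<d. w i = 0))}"

definition param_space :: "(real \<times> real) set" where
  "param_space = {0<..} \<times> {0..}"

text \<open>\<open>\<A>\<inverse> y\<close>, where \<open>\<A> x = x'' - x\<close> and \<open>y\<close> represents an element of \<open>L\<^sup>2([0,2\<pi>])\<close>.\<close>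

definition A_inv :: "(real \<Rightarrow> 'e::euclidean_space) \<Rightarrow> 'e h2per" where
  "A_inv y = (THE x. AE t in lebesgue_on {0..2 * pi}. d2 x t - h2fun x t = y t)"

context
  fixes a \<delta> c \<beta> \<tau>\<^sub>c :: real
begin

definition F_rhs :: "real \<times> real \<Rightarrow> 'n::finite osc \<Rightarrow> real \<Rightarrow> real ^ 'n mod_ring" where
  "F_rhs = (\<lambda>(b, \<tau>\<^sub>0) x t. \<chi> k.
     - (a + \<delta>) * d1 x t $ k - a * \<delta> * h2fun x t $ k - b * h2fun x (t - \<tau>\<^sub>0) $ k
     + c * (h2fun x (t - \<tau>\<^sub>c) $ (k + of_int_mod_ring 1) - 2 * h2fun x t $ k
            + h2fun x (t - \<tau>\<^sub>c) $ (k - of_int_mod_ring 1))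
     - \<beta> * (h2fun x t $ k) ^ 3)"

definition Psi :: "real \<times> real \<Rightarrow> 'n::finite osc \<Rightarrow> 'n osc" where
  "Psi p x = x - A_inv (\<lambda>t. F_rhs p x t - h2fun x t)"

definition Delta :: "nat \<Rightarrow> nat \<Rightarrow> complex \<Rightarrow> real \<times> real \<Rightarrow> complex" where
  "Delta n l \<nu> = (\<lambda>(b, \<tau>\<^sub>0). \<nu>\<^sup>2 + of_real (a + \<delta>) * \<nu> + of_real (a * \<delta>) + 2 * of_real c
     + of_real b * exp (- \<nu> * of_real \<tau>\<^sub>0)
     - 2 * of_real c * of_real (cos (theta n l)) * exp (- \<nu> * of_real \<tau>\<^sub>c))"

definition critical_set :: "nat \<Rightarrow> (real \<times> real) set" where
  "critical_set n = (\<Union>l \<in> Lam n. \<Union>m \<in> {1::nat..}.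
     {p \<in> param_space. Delta n l (\<i> * of_nat m) p = 0})"

definition critical_pairs :: "nat \<Rightarrow> real \<times> real \<Rightarrow> (nat \<times> nat) set" where
  "critical_pairs n p = {(l, m). l \<in> Lam n \<and> 1 \<le> m \<and> Delta n l (\<i> * of_nat m) p = 0}"

definition A_coeff :: "nat \<Rightarrow> real \<times> real \<Rightarrow> nat \<Rightarrow> nat \<Rightarrow> real" where
  "A_coeff n = (\<lambda>(b, \<tau>\<^sub>0) l m. (a + \<delta>) - b * \<tau>\<^sub>0 * cos (m * \<tau>\<^sub>0)
     + 2 * c * \<tau>\<^sub>c * cos (theta n l) * cos (m * \<tau>\<^sub>c))"

definition B_coeff :: "nat \<Rightarrow> real \<times> real \<Rightarrow> nat \<Rightarrow> nat \<Rightarrow> real" where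
  "B_coeff n = (\<lambda>(b, \<tau>\<^sub>0) l m. - 2 * m - b * \<tau>\<^sub>0 * sin (m * \<tau>\<^sub>0)
     + 2 * c * \<tau>\<^sub>c * cos (theta n l) * sin (m * \<tau>\<^sub>c))"

definition crossing_speed :: "nat \<Rightarrow> real \<times> real \<Rightarrow> nat \<Rightarrow> nat \<Rightarrow> real" where
  "crossing_speed n p l m =
     A_coeff n p l m * cos (m * snd p) + B_coeff n p l m * sin (m * snd p)"

definition DPsi0 :: "real \<times> real \<Rightarrow> 'n::finite osc \<Rightarrow> 'n osc" where
  "DPsi0 p = frechet_derivative (Psi p) (at 0)"

definition crossing_number :: "'n::finite itself \<Rightarrow> real \<times> real \<Rightarrow> nat \<Rightarrow> nat \<Rightarrow> int" where
  "crossing_number _ p l m =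
     int (copies (V_mode l m :: 'n osc set) {x. DPsi0 p x = 0}) * \<lfloor>sgn (crossing_speed CARD('n) p l m)\<rfloor>"

definition const_eigenspace :: "real \<times> real \<Rightarrow> real \<Rightarrow> 'n::finite osc set" where
  "const_eigenspace p \<mu> = {x \<in> const_space. DPsi0 p x = \<mu> *\<^sub>R x}"

definition Sigma_neg :: "'n::finite itself \<Rightarrow> real \<times> real \<Rightarrow> real set" where
  "Sigma_neg _ p = {\<mu>. \<mu> < 0 \<and> (\<exists>x \<in> const_eigenspace p \<mu> :: 'n osc set. x \<noteq> 0)}"

definition omega_restricted :: "real \<times> real \<Rightarrow> (nat \<times> nat) set \<Rightarrow> ('n::finite orbit_type \<Rightarrow>\<^sub>0 int)" where
  "omega_restricted p S = burnside_mult 1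
     (\<Otimes>\<^bsub>burnside_ring\<^esub>\<mu>\<in>Sigma_neg TYPE('n) p. \<Otimes>\<^bsub>burnside_ring\<^esub>l\<in>Lam CARD('n).
        deg_const l [^]\<^bsub>burnside_ring\<^esub> copies (V_mode l 0) (const_eigenspace p \<mu> :: 'n osc set))
     (\<Sum>(l, m)\<in>S. frag_cmul (crossing_number TYPE('n) p l m) (deg_mode l m))"

definition omega :: "real \<times> real \<Rightarrow> ('n::finite orbit_type \<Rightarrow>\<^sub>0 int)" where
  "omega p = omega_restricted p (critical_pairs CARD('n) p)"

definition omega_mode :: "real \<times> real \<Rightarrow> nat \<Rightarrow> ('n::finite orbit_type \<Rightarrow>\<^sub>0 int)" where
  "omega_mode p m = omega_restricted p {q \<in> critical_pairs CARD('n) p. snd q = m}"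

definition bifurcation_point :: "'n::finite itself \<Rightarrow> real \<times> real \<Rightarrow> bool" where
  "bifurcation_point _ p \<longleftrightarrow> (\<forall>U :: ((real \<times> real) \<times> 'n osc) set. open U \<and> (p, 0) \<in> U \<longrightarrow>
     (\<exists>q x. (q, x) \<in> U \<and> q \<in> param_space \<and> x \<noteq> 0 \<and> Psi q x = 0))"

end

definition maximal_occurring :: "'n::finite orbit_type \<Rightarrow> ('n orbit_type \<Rightarrow>\<^sub>0 int) \<Rightarrow> bool" where
  "maximal_occurring \<H> \<omega> \<longleftrightarrow> \<H> \<in> Poly_Mapping.keys \<omega> \<and>
     (\<forall>\<K> \<in> Poly_Mapping.keys \<omega>. \<not> otype_less \<H> \<K>)"

end

theory Submission
  imports Defs "HOL-Algebra.Zassenhaus"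
begin

text \<open>Let \<open>(\<ell>, m)\<close> be critical at \<open>p = (b\<^sub>*, \<tau>\<^sub>*)\<close>, let \<open>x\<^sub>0 \<noteq> 0\<close> lie in its mode space, and restrict the equation
  to the fixed space of the isotropy group of \<open>x\<^sub>0\<close>.  For Fourier coefficients with summable weights the
  modes that are not resonant are found by contraction, and one complex bifurcation equation remains, which
  \<open>b e\<^sup>-\<^sup>i\<^sup>m\<^sup>\<tau>\<close> solves directly because both parameters are free.  If \<open>\<tau>\<^sub>* = 0\<close>, only \<open>\<tau> \<ge> 0\<close> is admissible; the
  identity \<open>\<integral> x\<^sup>3 x' = 0\<close> then shows that the third harmonic forces \<open>\<tau> > 0\<close>.  Hence bifurcation with isotropy
  containing that of \<open>x\<^sub>0\<close> occurs for every such \<open>x\<^sub>0\<close>.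

  The basic degree of a mode is supported on isotropy groups of its nonzero elements once its recurrence is
  shown to have a solution: the groups whose fixed space is a complex line get the coefficient 1, the kernel of
  the representation gets -1.  A point of \<open>G/H \<times> G/K\<close> has its stabilizer inside a conjugate of \<open>K\<close>, so
  every orbit type in \<open>\<omega>\<close> is contained in one of these isotropy groups.\<close>

section \<open>Convolution of Fourier coefficients\<close>

text \<open>The obstacle is resonance. Several pairs (l, m) can be critical at the same point, and
  the fixed space of an isotropy group can meet more than one of them, so the bifurcation equation
  is not automatically one complex equation. Two choices repair this. Among the critical modes that
  survive in the fixed space one of largest frequency m is taken, and only frequencies that are odd
  multiples of m are kept: the cubic preserves them, and none beyond m is critical there. What
  remains at frequency m is cut down to one complex dimension, either by adding the symmetry of a
  travelling wave or by a reflection already present, which ties the classes j and -j. The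
  reflection argument uses c > 0; for c = 0 all classes are critical at once, and the cells are
  treated separately. After the scaling z = s (e + w) the cubic carries the factor s^2, and with b
  exp(-im tau) = qs exp(zeta) the remaining equation qs (exp(zeta) - 1) = O(s^2) is solved by a
  logarithm. Solutions are nonconstant because e changes sign under the shift by half its
  period.\<close>

definition wt :: "'i \<times> int \<Rightarrow> real" where
  "wt a = 1 / (1 + (of_int (snd a))\<^sup>2)\<^sup>2"

text \<open>Decay of order k^-4: strong enough for an algebra under \<open>conv\<close>, and
  together with the factor 1 / (1 + k^2) gained by dividing by the symbol it makes the Fourier
  series twice differentiable.\<close>

definition decays :: "real \<Rightarrow> ('i \<times> int \<Rightarrow> complex) \<Rightarrow> bool" where
  "decays M f \<longleftrightarrow> (\<forall>a. norm (f a) \<le> M * wt a)"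

definition conv :: "('i::ab_group_add \<times> int \<Rightarrow> complex) \<Rightarrow> ('i \<times> int \<Rightarrow> complex) \<Rightarrow> 'i \<times> int \<Rightarrow> complex" where
  "conv f g a = (\<Sum>\<^sub>\<infinity>b. f b * g (a - b))"

lemma wt_pos: "0 < wt a"
proof -
  have "0 < 1 + (of_int (snd a) :: real)\<^sup>2" by (simp add: add_pos_nonneg)
  then show ?thesis unfolding wt_def by simp
qed

lemma wt_le_1: "wt a \<le> 1"
  unfolding wt_def by (simp add: divide_le_eq_1 one_le_power)

lemma summable_on_int_iff_nat:
  fixes f :: "int \<Rightarrow> real"
  assumes "(\<lambda>n. f (int n)) summable_on UNIV" "(\<lambda>n. f (- int n)) summable_on UNIV"
  shows "f summable_on UNIV"
proof -
  have "f summable_on range int"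
    using assms(1) by (subst summable_on_reindex) (auto simp: o_def inj_def)
  moreover have "f summable_on range (\<lambda>n. - int n)"
    using assms(2) by (subst summable_on_reindex) (auto simp: o_def inj_def)
  ultimately have "f summable_on (range int \<union> range (\<lambda>n. - int n))"
    by (rule summable_on_union)
  moreover have "range int \<union> range (\<lambda>n. - int n) = UNIV"
    by (auto simp: image_iff) (metis int_cases2)
  ultimately show ?thesis by simp
qed

lemma wt_summable_int: "(\<lambda>k::int. 1 / (1 + (of_int k)\<^sup>2)\<^sup>2 :: real) summable_on UNIV"
proof -
  have "summable (\<lambda>n::nat. 1 / (1 + (real n)\<^sup>2)\<^sup>2 :: real)"
  proof (rule summable_comparison_test_ev)
    show "summable (\<lambda>n. inverse ((real n)\<^sup>2))"
      using inverse_power_summable[of 2, where 'a = real] by simp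
    show "\<forall>\<^sub>F n in sequentially. norm (1 / (1 + (real n)\<^sup>2)\<^sup>2) \<le> inverse ((real n)\<^sup>2)"
      unfolding eventually_sequentially
    proof (intro exI[of _ 1] allI impI)
      fix n :: nat assume "n \<ge> 1"
      have "(real n)\<^sup>2 \<le> (1 + (real n)\<^sup>2) * 1" by simp
      also have "\<dots> \<le> (1 + (real n)\<^sup>2) * (1 + (real n)\<^sup>2)" by (intro mult_left_mono) auto
      finally show "norm (1 / (1 + (real n)\<^sup>2)\<^sup>2) \<le> inverse ((real n)\<^sup>2)"
        using \<open>n \<ge> 1\<close> by (simp add: inverse_eq_divide power2_eq_square[of "1 + (real n)\<^sup>2"] frac_le)
    qed
  qed
  then have "(\<lambda>n::nat. 1 / (1 + (real n)\<^sup>2)\<^sup>2 :: real) summable_on UNIV"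
    by (intro summable_nonneg_imp_summable_on) auto
  then show ?thesis by (intro summable_on_int_iff_nat) auto
qed

lemma wt_summable: "(wt :: 'i::finite \<times> int \<Rightarrow> real) summable_on UNIV"
proof -
  have "(wt :: 'i \<times> int \<Rightarrow> real) summable_on (UNIV \<times> UNIV)"
  proof (rule summable_on_SigmaI)
    fix x :: 'i
    show "((\<lambda>y. wt (x, y)) has_sum (\<Sum>\<^sub>\<infinity>k::int. 1 / (1 + (of_int k)\<^sup>2)\<^sup>2)) UNIV"
      unfolding wt_def snd_conv by (rule has_sum_infsum[OF wt_summable_int])
  qed (auto intro: less_imp_le[OF wt_pos])
  then show ?thesis by simp
qed

lemma decays_nonneg: assumes "decays M f" shows "0 \<le> M"
proof -
  obtain a where a: "norm (f a) \<le> M * wt a" using assms unfolding decays_def by fastforce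
  then have "0 \<le> M * wt a" using norm_ge_zero[of "f a"] by linarith
  then show ?thesis using wt_pos[of a] by (simp add: zero_le_mult_iff)
qed

lemma decays_mono: "decays M f \<Longrightarrow> M \<le> N \<Longrightarrow> decays N f"
  unfolding decays_def by (meson mult_right_mono order_trans wt_pos less_imp_le)

lemma decays_add: "decays M f \<Longrightarrow> decays N g \<Longrightarrow> decays (M + N) (\<lambda>a. f a + g a)"
  unfolding decays_def distrib_right by (intro allI norm_triangle_le add_mono) auto

lemma decays_cmult: "decays M f \<Longrightarrow> decays (norm c * M) (\<lambda>a. c * f a)"
  unfolding decays_def by (simp add: norm_mult mult.assoc mult_left_mono)

lemma decays_zero: "0 \<le> M \<Longrightarrow> decays M (\<lambda>_. 0)"
  unfolding decays_def using mult_nonneg_nonneg[OF _ less_imp_le[OF wt_pos]] by auto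

lemma decays_summable:
  fixes f :: "'i::finite \<times> int \<Rightarrow> complex"
  assumes "decays M f" shows "(\<lambda>a. norm (f a)) summable_on UNIV"
proof (rule summable_on_comparison_test)
  show "(\<lambda>a. M * wt a) summable_on (UNIV :: ('i \<times> int) set)"
    by (intro summable_on_cmult_right wt_summable)
qed (use assms in \<open>auto simp: decays_def\<close>)

lemma decays_imp_summable:
  fixes f :: "'i::finite \<times> int \<Rightarrow> complex"
  assumes "decays M f" shows "f summable_on UNIV"
  by (rule abs_summable_summable[OF decays_summable[OF assms]])

text \<open>With x, y, z the numbers 1 + k^2 at b, a - b and a, convexity gives z <= 2x + 2y and
  then z^2 <= 8 (x^2 + y^2); division by x^2 y^2 z^2 is the claim. It makes the families of this
  decay closed under \<open>conv\<close>.\<close>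

lemma wt_product:
  "wt b * wt (a - b) \<le> 8 * wt a * (wt b + wt (a - b))"
proof -
  define x where "x = 1 + (of_int (snd b) :: real)\<^sup>2"
  define y where "y = 1 + (of_int (snd (a - b)) :: real)\<^sup>2"
  define z where "z = 1 + (of_int (snd a) :: real)\<^sup>2"
  have pos: "x > 0" "y > 0" "z > 0" unfolding x_def y_def z_def by (simp_all add: add_pos_nonneg)
  have "z \<le> 2 * x + 2 * y"
  proof -
    have "0 \<le> (of_int (snd b) - of_int (snd a - snd b) :: real)\<^sup>2" by simp
    then show ?thesis unfolding x_def y_def z_def by (simp add: power2_eq_square algebra_simps)
  qed
  then have "z\<^sup>2 \<le> (2 * x + 2 * y)\<^sup>2" using pos by (intro power_mono) auto
  also have "\<dots> \<le> 8 * (x\<^sup>2 + y\<^sup>2)"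
  proof -
    have "0 \<le> (x - y)\<^sup>2" by simp
    then show ?thesis by (simp add: power2_eq_square algebra_simps)
  qed
  finally have "z\<^sup>2 \<le> 8 * (x\<^sup>2 + y\<^sup>2)" .
  then have "1 / x\<^sup>2 * (1 / y\<^sup>2) \<le> 8 * (1 / z\<^sup>2) * (1 / x\<^sup>2 + 1 / y\<^sup>2)"
    using pos by (simp add: field_simps)
  then show ?thesis unfolding wt_def x_def y_def z_def .
qed

text \<open>16 is the 8 of \<open>wt_product\<close> times the two equal sums that it produces; the
  added 1 keeps the constant at least 1.\<close>

definition conv_const :: "'i::finite itself \<Rightarrow> real" where
  "conv_const _ = 16 * (\<Sum>\<^sub>\<infinity>a::'i \<times> int. wt a) + 1"

lemma conv_const_ge_1: "1 \<le> conv_const TYPE('i::finite)"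
  unfolding conv_const_def by (simp add: infsum_nonneg less_imp_le[OF wt_pos])

lemma bij_minus_left: "bij (\<lambda>b::'a::ab_group_add. a - b)"
  by (rule bij_betwI[where g = "\<lambda>b. a - b"]) auto

lemma infsum_minus_left:
  fixes a :: "'a::ab_group_add"
  shows "(\<Sum>\<^sub>\<infinity>b. f (a - b)) = (\<Sum>\<^sub>\<infinity>b. f b)"
  by (rule infsum_reindex_bij_betw[OF bij_minus_left])

lemma summable_minus_left:
  fixes a :: "'a::ab_group_add"
  shows "(\<lambda>b. f (a - b)) summable_on UNIV \<longleftrightarrow> f summable_on UNIV"
  by (rule summable_on_reindex_bij_betw[OF bij_minus_left])

lemma conv_summable:
  fixes f g :: "'i::{finite,ab_group_add} \<times> int \<Rightarrow> complex"
  assumes "decays M f" "decays N g"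
  shows "(\<lambda>b. norm (f b * g (a - b))) summable_on UNIV"
    and "(\<Sum>\<^sub>\<infinity>b. norm (f b * g (a - b))) \<le> conv_const TYPE('i) * M * N * wt a"
proof -
  have M: "0 \<le> M" and N: "0 \<le> N" using assms decays_nonneg by auto
  have le: "norm (f b * g (a - b)) \<le> (M * N * 8 * wt a) * (wt b + wt (a - b))" for b
  proof -
    have "norm (f b * g (a - b)) \<le> (M * wt b) * (N * wt (a - b))"
      unfolding norm_mult
      by (intro mult_mono mult_nonneg_nonneg M less_imp_le[OF wt_pos] norm_ge_zero)
        (use assms in \<open>auto simp only: decays_def\<close>)
    also have "\<dots> = (M * N) * (wt b * wt (a - b))" by simp
    also have "\<dots> \<le> (M * N) * (8 * wt a * (wt b + wt (a - b)))"
      using M N by (intro mult_left_mono wt_product) auto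
    finally show ?thesis by (simp add: mult_ac)
  qed
  have s: "(\<lambda>b. wt b + wt (a - b)) summable_on UNIV"
    by (intro summable_on_add wt_summable) (simp add: summable_minus_left wt_summable)
  then have s': "(\<lambda>b. (M * N * 8 * wt a) * (wt b + wt (a - b))) summable_on UNIV"
    by (rule summable_on_cmult_right)
  show 1: "(\<lambda>b. norm (f b * g (a - b))) summable_on UNIV"
    by (rule summable_on_comparison_test[OF s']) (use le in auto)
  have "(\<Sum>\<^sub>\<infinity>b. norm (f b * g (a - b))) \<le> (\<Sum>\<^sub>\<infinity>b. (M * N * 8 * wt a) * (wt b + wt (a - b)))"
    by (rule infsum_mono[OF 1 s' le])
  also have "\<dots> = (M * N * 8 * wt a) * (\<Sum>\<^sub>\<infinity>b. wt b + wt (a - b))"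
    by (rule infsum_cmult_right[OF s])
  also have "(\<Sum>\<^sub>\<infinity>b. wt b + wt (a - b)) = 2 * (\<Sum>\<^sub>\<infinity>b::'i \<times> int. wt b)"
    by (subst infsum_add) (auto simp: wt_summable summable_minus_left infsum_minus_left)
  also have "M * N * 8 * wt a * (2 * (\<Sum>\<^sub>\<infinity>b::'i \<times> int. wt b)) \<le> conv_const TYPE('i) * M * N * wt a"
  proof -
    have "M * N * wt a \<ge> 0" using M N wt_pos[of a] by simp
    then show ?thesis unfolding conv_const_def by (simp add: algebra_simps)
  qed
  finally show "(\<Sum>\<^sub>\<infinity>b. norm (f b * g (a - b))) \<le> conv_const TYPE('i) * M * N * wt a" .
qed

lemma decays_conv:
  fixes f g :: "'i::{finite,ab_group_add} \<times> int \<Rightarrow> complex"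
  assumes "decays M f" "decays N g"
  shows "decays (conv_const TYPE('i) * M * N) (conv f g)"
  unfolding decays_def conv_def
proof
  fix a
  have "norm (\<Sum>\<^sub>\<infinity>b. f b * g (a - b)) \<le> (\<Sum>\<^sub>\<infinity>b. norm (f b * g (a - b)))"
    by (rule norm_infsum_bound[OF conv_summable(1)[OF assms]])
  with conv_summable(2)[OF assms, of a]
  show "norm (\<Sum>\<^sub>\<infinity>b. f b * g (a - b)) \<le> conv_const TYPE('i) * M * N * wt a" by linarith
qed

lemma conv_commute: "conv f g = conv g f"
proof
  fix a
  have "conv f g a = (\<Sum>\<^sub>\<infinity>b. f (a - b) * g (a - (a - b)))"
    unfolding conv_def by (rule infsum_minus_left[where f = "\<lambda>b. f b * g (a - b)", symmetric])
  then show "conv f g a = conv g f a" by (simp add: conv_def mult.commute)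
qed

lemma conv_summable':
  fixes f g :: "'i::{finite,ab_group_add} \<times> int \<Rightarrow> complex"
  assumes "decays M f" "decays N g"
  shows "(\<lambda>b. f b * g (a - b)) summable_on UNIV"
  by (rule abs_summable_summable[OF conv_summable(1)[OF assms]])

lemma conv_diff_right:
  fixes f g :: "'i::{finite,ab_group_add} \<times> int \<Rightarrow> complex"
  assumes "decays M f" "decays N g" "decays K h"
  shows "conv f (\<lambda>a. g a - h a) = (\<lambda>a. conv f g a - conv f h a)"
proof
  fix a
  have "(\<lambda>b. - (f b * h (a - b))) summable_on UNIV"
    using conv_summable'[OF assms(1,3)] by (simp add: summable_on_uminus)
  from infsum_add[OF conv_summable'[OF assms(1,2), of a] this]
  show "conv f (\<lambda>a. g a - h a) a = conv f g a - conv f h a"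
    unfolding conv_def by (simp add: infsum_uminus right_diff_distrib)
qed

lemma conv_diff_left:
  fixes f g :: "'i::{finite,ab_group_add} \<times> int \<Rightarrow> complex"
  assumes "decays M f" "decays N g" "decays K h"
  shows "conv (\<lambda>a. g a - h a) f = (\<lambda>a. conv g f a - conv h f a)"
  by (subst (1 2 3) conv_commute) (rule conv_diff_right[OF assms])

lemma conv_cmult_right: "conv f (\<lambda>a. c * g a) = (\<lambda>a. c * conv f g a)"
  unfolding conv_def fun_eq_iff
  by (simp add: mult.left_commute[of _ c] infsum_cmult_right')

lemma conv_cmult_left: "conv (\<lambda>a. c * f a) g = (\<lambda>a. c * conv f g a)"
  using conv_cmult_right[of g c f] by (simp add: conv_commute[of _ g])

text \<open>Fubini for the double family F (b, c). Its norms are summable because for each b the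
  inner sum over c is a convolution taken at a - b, bounded uniformly in b, and f is
  summable.\<close>

lemma conv_assoc:
  fixes f g h :: "'i::{finite,ab_group_add} \<times> int \<Rightarrow> complex"
  assumes f: "decays M f" and g: "decays N g" and h: "decays K h"
  shows "conv (conv f g) h = conv f (conv g h)"
proof
  fix a
  define F where "F = (\<lambda>(b, c). f b * g (c - b) * h (a - c))"
  let ?Q = "conv_const TYPE('i)"
  have shift: "(\<lambda>c. norm (g (c - b)) * norm (h (a - c))) summable_on UNIV"
    and shift_eq: "(\<Sum>\<^sub>\<infinity>c. g (c - b) * h (a - c)) = conv g h (a - b)"
    and shift_bound: "(\<Sum>\<^sub>\<infinity>c. norm (g (c - b)) * norm (h (a - c))) \<le> ?Q * N * K * wt (a - b)" for b
  proof -
    have bij: "bij (\<lambda>c. c - b)" by (rule bij_betwI[where g = "\<lambda>c. c + b"]) auto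
    have eq: "a - b - (c - b) = a - c" for c by simp
    show "(\<lambda>c. norm (g (c - b)) * norm (h (a - c))) summable_on UNIV"
      using summable_on_reindex_bij_betw[OF bij, of "\<lambda>c. norm (g c) * norm (h (a - b - c))"]
        conv_summable(1)[OF g h, of "a - b"]
      by (simp add: norm_mult eq)
    show "(\<Sum>\<^sub>\<infinity>c. g (c - b) * h (a - c)) = conv g h (a - b)"
      using infsum_reindex_bij_betw[OF bij, of "\<lambda>c. g c * h (a - b - c)"]
      by (simp add: conv_def eq)
    show "(\<Sum>\<^sub>\<infinity>c. norm (g (c - b)) * norm (h (a - c))) \<le> ?Q * N * K * wt (a - b)"
      using infsum_reindex_bij_betw[OF bij, of "\<lambda>c. norm (g c) * norm (h (a - b - c))"]
        conv_summable(2)[OF g h, of "a - b"]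
      by (simp add: norm_mult eq)
  qed
  have "(\<lambda>x. norm (F x)) summable_on (UNIV \<times> UNIV)"
    unfolding Infinite_Sum.abs_summable_on_Sigma_iff
  proof (intro conjI ballI)
    fix b :: "'i \<times> int"
    show "(\<lambda>c. norm (F (b, c))) summable_on UNIV"
      unfolding F_def by (simp add: norm_mult mult.assoc summable_on_cmult_right shift)
    have row: "(\<Sum>\<^sub>\<infinity>c. norm (F (b, c))) = norm (f b) * (\<Sum>\<^sub>\<infinity>c. norm (g (c - b)) * norm (h (a - c)))" for b
      unfolding F_def by (simp add: norm_mult mult.assoc infsum_cmult_right')
    have nn: "0 \<le> (\<Sum>\<^sub>\<infinity>c. norm (F (b, c)))" for b by (intro infsum_nonneg) simp
    show "(\<lambda>b. norm (\<Sum>\<^sub>\<infinity>c. norm (F (b, c)))) summable_on UNIV"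
    proof (rule summable_on_comparison_test)
      show "(\<lambda>b. norm (f b) * (?Q * N * K)) summable_on UNIV"
        by (rule summable_on_cmult_left[OF decays_summable[OF f]])
      have "?Q * N * K \<ge> 0" using conv_const_ge_1[where 'i = 'i] decays_nonneg[OF g] decays_nonneg[OF h] by simp
      then have "?Q * N * K * wt c \<le> ?Q * N * K * 1" for c :: "'i \<times> int"
        by (intro mult_left_mono wt_le_1)
      then show "norm (\<Sum>\<^sub>\<infinity>c. norm (F (b, c))) \<le> norm (f b) * (?Q * N * K)" for b
        using nn[of b] mult_left_mono[OF order_trans[OF shift_bound[of b]], of _ "norm (f b)"]
        unfolding row by simp
    qed simp
  qed
  then have "F summable_on (UNIV \<times> UNIV)" by (rule abs_summable_summable)
  then have "(\<Sum>\<^sub>\<infinity>b. \<Sum>\<^sub>\<infinity>c. F (b, c)) = (\<Sum>\<^sub>\<infinity>c. \<Sum>\<^sub>\<infinity>b. F (b, c))"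
    using infsum_swap_banach[of "\<lambda>b c. F (b, c)" UNIV UNIV] by simp
  moreover have "(\<Sum>\<^sub>\<infinity>c. F (b, c)) = f b * conv g h (a - b)" for b
    unfolding F_def by (simp add: mult.assoc infsum_cmult_right' shift_eq)
  moreover have "(\<Sum>\<^sub>\<infinity>b. F (b, c)) = conv f g c * h (a - c)" for c
    unfolding F_def conv_def by (simp add: infsum_cmult_left')
  ultimately show "conv (conv f g) h a = conv f (conv g h) a"
    unfolding conv_def by simp
qed

definition cube :: "('i::ab_group_add \<times> int \<Rightarrow> complex) \<Rightarrow> 'i \<times> int \<Rightarrow> complex" where
  "cube f = conv f (conv f f)"

lemma decays_cube:
  fixes f :: "'i::{finite,ab_group_add} \<times> int \<Rightarrow> complex"
  assumes "decays M f"
  shows "decays ((conv_const TYPE('i))\<^sup>2 * M ^ 3) (cube f)"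
  using decays_conv[OF assms decays_conv[OF assms assms]]
  by (simp add: cube_def power2_eq_square power3_eq_cube mult_ac)

lemma cube_cmult: "cube (\<lambda>a. c * f a) = (\<lambda>a. c ^ 3 * cube f a)"
proof -
  have "conv (\<lambda>a. c * f a) (\<lambda>a. c * f a) = (\<lambda>a. c * (c * conv f f a))"
    by (simp only: conv_cmult_left[of c f] conv_cmult_right[of _ c f])
  moreover have "conv (\<lambda>a. c * f a) (\<lambda>a. c * (c * conv f f a)) = (\<lambda>a. c * (c * (c * conv f (conv f f) a)))"
    by (simp only: conv_cmult_left[of c f] conv_cmult_right[of f c])
  ultimately show ?thesis by (simp add: cube_def power3_eq_cube mult.assoc)
qed

text \<open>With d = f - g the difference of cubes telescopes to d f^2 + g (d f + g d): three
  products, each with two convolutions, which explains the constant.\<close>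

lemma decays_cube_diff:
  fixes f g :: "'i::{finite,ab_group_add} \<times> int \<Rightarrow> complex"
  assumes f: "decays M f" and g: "decays M g" and d: "decays d (\<lambda>a. f a - g a)"
  shows "decays (3 * (conv_const TYPE('i))\<^sup>2 * M\<^sup>2 * d) (\<lambda>a. cube f a - cube g a)"
proof -
  let ?d = "\<lambda>a. f a - g a" and ?Q = "conv_const TYPE('i)"
  note ff = decays_conv[OF f f] and gg = decays_conv[OF g g] and fg = decays_conv[OF g f]
  have 1: "conv f (conv f f) a - conv g (conv f f) a = conv ?d (conv f f) a" for a
    using conv_diff_left[OF ff f g] by simp
  have 2: "conv f f a - conv g f a = conv ?d f a" for a
    using conv_diff_left[OF f f g] by simp
  have 3: "conv g f a - conv g g a = conv g ?d a" for a
    using conv_diff_right[OF g f g] by simp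
  have 4: "conv f f a - conv g g a = conv ?d f a + conv g ?d a" for a
    using 2[of a] 3[of a] by (simp only: algebra_simps)
  have 5: "conv g (conv f f) a - conv g (conv g g) a = conv g (\<lambda>a. conv ?d f a + conv g ?d a) a" for a
    using conv_diff_right[OF g ff gg] unfolding 4 by (simp only:)
  have "decays (?Q * d * (?Q * M * M) + ?Q * M * (?Q * d * M + ?Q * M * d))
          (\<lambda>a. conv ?d (conv f f) a + conv g (\<lambda>a. conv ?d f a + conv g ?d a) a)"
    by (intro decays_add decays_conv f g d)
  moreover have "(\<lambda>a. conv ?d (conv f f) a + conv g (\<lambda>a. conv ?d f a + conv g ?d a) a) = (\<lambda>a. cube f a - cube g a)"
    unfolding cube_def using 1 5 by (simp add: fun_eq_iff algebra_simps)
  ultimately show ?thesis by (simp add: power2_eq_square algebra_simps)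
qed

text \<open>Evaluating a Fourier series at a point means summing against a character \<phi>; by
  Fubini such a sum turns convolution into a product.\<close>

lemma infsum_conv_char:
  fixes f g :: "'i::{finite,ab_group_add} \<times> int \<Rightarrow> complex" and \<phi> :: "'i \<times> int \<Rightarrow> complex"
  assumes f: "decays M f" and g: "decays N g"
    and \<phi>: "\<And>a. norm (\<phi> a) = 1" "\<And>a b. \<phi> (a + b) = \<phi> a * \<phi> b"
  shows "(\<Sum>\<^sub>\<infinity>a. conv f g a * \<phi> a) = (\<Sum>\<^sub>\<infinity>a. f a * \<phi> a) * (\<Sum>\<^sub>\<infinity>a. g a * \<phi> a)"
proof -
  define F where "F = (\<lambda>(a, b). f b * g (a - b) * \<phi> a)"
  have sh: "(\<lambda>a. g (a - b) * \<phi> (a - b)) summable_on UNIV"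
    "(\<Sum>\<^sub>\<infinity>a. g (a - b) * \<phi> (a - b)) = (\<Sum>\<^sub>\<infinity>a. g a * \<phi> a)" for b
  proof -
    have bij: "bij (\<lambda>c. c - b)" by (rule bij_betwI[where g = "\<lambda>c. c + b"]) auto
    have "decays N (\<lambda>a. g a * \<phi> a)" using g \<phi>(1) by (simp add: decays_def norm_mult)
    then show "(\<lambda>a. g (a - b) * \<phi> (a - b)) summable_on UNIV"
      by (subst summable_on_reindex_bij_betw[OF bij, of "\<lambda>a. g a * \<phi> a"]) (rule decays_imp_summable)
    show "(\<Sum>\<^sub>\<infinity>a. g (a - b) * \<phi> (a - b)) = (\<Sum>\<^sub>\<infinity>a. g a * \<phi> a)"
      by (rule infsum_reindex_bij_betw[OF bij])
  qed
  have \<phi>': "\<phi> a = \<phi> (a - b) * \<phi> b" for a b using \<phi>(2)[of "a - b" b] by simp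
  have "(\<lambda>x. norm (F x)) summable_on (UNIV \<times> UNIV)"
    unfolding Infinite_Sum.abs_summable_on_Sigma_iff
  proof (intro conjI ballI)
    fix a :: "'i \<times> int"
    show "(\<lambda>b. norm (F (a, b))) summable_on UNIV"
      using conv_summable(1)[OF f g, of a] by (simp add: F_def norm_mult \<phi>(1))
    have nn: "0 \<le> (\<Sum>\<^sub>\<infinity>b. norm (F (a, b)))" for a by (intro infsum_nonneg) simp
    show "(\<lambda>a. norm (\<Sum>\<^sub>\<infinity>b. norm (F (a, b)))) summable_on UNIV"
    proof (rule summable_on_comparison_test)
      show "(\<lambda>a. conv_const TYPE('i) * M * N * wt a) summable_on (UNIV :: ('i \<times> int) set)"
        by (intro summable_on_cmult_right wt_summable)
      show "norm (\<Sum>\<^sub>\<infinity>b. norm (F (a, b))) \<le> conv_const TYPE('i) * M * N * wt a" for a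
        using nn[of a] conv_summable(2)[OF f g, of a] by (simp add: F_def norm_mult \<phi>(1))
    qed simp
  qed
  then have "F summable_on (UNIV \<times> UNIV)" by (rule abs_summable_summable)
  then have "(\<Sum>\<^sub>\<infinity>a. \<Sum>\<^sub>\<infinity>b. F (a, b)) = (\<Sum>\<^sub>\<infinity>b. \<Sum>\<^sub>\<infinity>a. F (a, b))"
    using infsum_swap_banach[of "\<lambda>b c. F (b, c)" UNIV UNIV] by simp
  moreover have "(\<Sum>\<^sub>\<infinity>b. F (a, b)) = conv f g a * \<phi> a" for a
    unfolding F_def conv_def by (simp add: infsum_cmult_left')
  moreover have "(\<Sum>\<^sub>\<infinity>a. F (a, b)) = f b * \<phi> b * (\<Sum>\<^sub>\<infinity>a. g a * \<phi> a)" for b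
  proof -
    have "(\<Sum>\<^sub>\<infinity>a. F (a, b)) = (\<Sum>\<^sub>\<infinity>a. (f b * \<phi> b) * (g (a - b) * \<phi> (a - b)))"
      unfolding F_def
    proof (intro infsum_cong)
      fix a show "(case (a, b) of (a, b) \<Rightarrow> f b * g (a - b) * \<phi> a) = f b * \<phi> b * (g (a - b) * \<phi> (a - b))"
        unfolding prod.case by (subst \<phi>'[of a b]) (simp only: mult_ac)
    qed
    then show ?thesis by (simp only: infsum_cmult_right' sh)
  qed
  ultimately show ?thesis by (simp add: infsum_cmult_left')
qed

section \<open>The bifurcation equation\<close>

text \<open>Banach's fixed point theorem for the distance sup |f i - g i| / \<rho> i, which is never
  formed: the estimates are carried index by index, and completeness of S is replaced by closure
  under pointwise limits. \<open>bounded\<close> supplies the finite diameter M that is halved at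
  each iteration.\<close>

lemma weighted_contraction:
  fixes T :: "('i \<Rightarrow> complex) \<Rightarrow> 'i \<Rightarrow> complex" and \<rho> :: "'i \<Rightarrow> real"
  assumes ne: "start \<in> S"
    and closed: "\<And>F f. (\<And>n. F n \<in> S) \<Longrightarrow> (\<And>i. (\<lambda>n::nat. F n i) \<longlonglongrightarrow> f i) \<Longrightarrow> f \<in> S"
    and maps: "\<And>f. f \<in> S \<Longrightarrow> T f \<in> S"
    and bounded: "\<And>f g i. f \<in> S \<Longrightarrow> g \<in> S \<Longrightarrow> norm (f i - g i) \<le> M * \<rho> i"
    and contr: "\<And>f g d i. f \<in> S \<Longrightarrow> g \<in> S \<Longrightarrow> (\<And>i. norm (f i - g i) \<le> d * \<rho> i) \<Longrightarrow>
                  norm (T f i - T g i) \<le> d / 2 * \<rho> i"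
  shows "\<exists>f\<in>S. T f = f"
proof -
  define F where "F n = (T ^^ n) start" for n
  have FS: "F n \<in> S" for n unfolding F_def by (induction n) (auto intro: ne maps)
  have iter: "norm ((T ^^ n) f i - (T ^^ n) g i) \<le> M / 2 ^ n * \<rho> i \<and> (T ^^ n) f \<in> S \<and> (T ^^ n) g \<in> S"
    if "f \<in> S" "g \<in> S" for f g n i
  proof (induction n arbitrary: i)
    case 0 then show ?case using that bounded by simp
  next
    case (Suc n)
    then have "norm (T ((T ^^ n) f) i - T ((T ^^ n) g) i) \<le> (M / 2 ^ n) / 2 * \<rho> i"
      by (intro contr) auto
    then show ?case using Suc maps by (simp add: field_simps)
  qed
  have dist: "norm (F (n + k) i - F n i) \<le> M / 2 ^ n * \<rho> i" for n k i
    using iter[OF FS[of k] ne, of n i] unfolding F_def by (simp add: funpow_add)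
  have lim0: "(\<lambda>n. M / 2 ^ n * \<rho> i) \<longlonglongrightarrow> 0" for i
  proof -
    have "(\<lambda>n. (M * \<rho> i) * (1 / 2) ^ n) \<longlonglongrightarrow> (M * \<rho> i) * 0"
      by (intro tendsto_mult_left LIMSEQ_power_zero) simp
    then show ?thesis by (simp add: power_divide)
  qed
  have "Cauchy (\<lambda>n. F n i)" for i
  proof (rule metric_CauchyI)
    fix \<epsilon> :: real assume "\<epsilon> > 0"
    then have "\<forall>\<^sub>F n in sequentially. M / 2 ^ n * \<rho> i < \<epsilon> / 2"
      by (intro order_tendstoD(2)[OF lim0]) simp
    then obtain N where N: "M / 2 ^ N * \<rho> i < \<epsilon> / 2" by (auto simp: eventually_sequentially)
    have near: "dist (F n i) (F N i) < \<epsilon> / 2" if "n \<ge> N" for n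
    proof -
      have "norm (F n i - F N i) \<le> M / 2 ^ N * \<rho> i" using dist[of N "n - N" i] that by simp
      then show ?thesis using N unfolding dist_norm by linarith
    qed
    show "\<exists>M. \<forall>m\<ge>M. \<forall>n\<ge>M. dist (F m i) (F n i) < \<epsilon>"
      using near by (meson dist_triangle_half_l)
  qed
  then have "convergent (\<lambda>n. F n i)" for i by (rule Cauchy_convergent)
  then obtain f where lim: "(\<lambda>n. F n i) \<longlonglongrightarrow> f i" for i
    unfolding convergent_def by metis
  have fS: "f \<in> S" by (rule closed[OF FS lim])
  have near: "norm (f i - F n i) \<le> M / 2 ^ n * \<rho> i" for i n
  proof (rule LIMSEQ_le_const2)
    show "(\<lambda>k. norm (F (n + k) i - F n i)) \<longlonglongrightarrow> norm (f i - F n i)"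
      using LIMSEQ_ignore_initial_segment[OF lim[of i], of n]
      by (intro tendsto_intros) (simp add: add.commute)
  qed (use dist in auto)
  have "T f i = f i" for i
  proof (rule LIMSEQ_unique)
    have "norm (T f i - F (Suc n) i) \<le> M / 2 ^ Suc n * \<rho> i" for n
      using contr[OF fS FS near, of i n] by (simp add: F_def)
    then have "norm (F (Suc n) i - T f i) \<le> M / 2 ^ Suc n * \<rho> i" for n by (simp add: norm_minus_commute)
    then show "(\<lambda>n. F (Suc n) i) \<longlonglongrightarrow> T f i"
      using Lim_null_comparison[OF _ LIMSEQ_Suc[OF lim0[of i]], of "\<lambda>n. F (Suc n) i - T f i"]
      by (simp add: LIM_zero_iff)
    show "(\<lambda>n. F (Suc n) i) \<longlonglongrightarrow> f i" by (rule LIMSEQ_Suc[OF lim])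
  qed
  with fS show ?thesis by (intro bexI[of _ f]) auto
qed

section \<open>Abstract Hopf problem on coefficient families\<close>

lemma exp_lipschitz:
  fixes u v :: complex
  assumes "Re u \<le> 1" "Re v \<le> 1"
  shows "norm (exp u - exp v) \<le> 3 * norm (u - v)"
proof (rule field_differentiable_bound[where S = "{z. Re z \<le> 1}" and f' = exp])
  fix z :: complex assume "z \<in> {z. Re z \<le> 1}"
  then show "norm (exp z) \<le> 3" using exp_le order_trans[of "exp (Re z)" "exp 1" 3] by simp
qed (use assms in \<open>auto intro!: derivative_eq_intros convex_halfspace_Re_le\<close>)

lemma Ln_lipschitz:
  assumes "norm x \<le> 1 / 2" "norm y \<le> 1 / 2"
  shows "norm (Ln (1 - x) - Ln (1 - y)) \<le> 2 * norm (x - y)"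
proof -
  have half: "norm z \<ge> 1 / 2" "z \<notin> \<real>\<^sub>\<le>\<^sub>0" if "z \<in> cball 1 (1 / 2)" for z :: complex
  proof -
    have "norm (1 - z) \<le> 1 / 2" using that by (simp add: dist_norm)
    moreover have "1 \<le> norm (1 - z) + norm z" using norm_triangle_ineq[of "1 - z" z] by simp
    ultimately show "norm z \<ge> 1 / 2" by linarith
    have "\<bar>Re (1 - z)\<bar> \<le> 1 / 2" using \<open>norm (1 - z) \<le> 1 / 2\<close> abs_Re_le_cmod order_trans by blast
    then show "z \<notin> \<real>\<^sub>\<le>\<^sub>0" by (auto simp: complex_nonpos_Reals_iff)
  qed
  have "norm (Ln (1 - x) - Ln (1 - y)) \<le> 2 * norm ((1 - x) - (1 - y))"
  proof (rule field_differentiable_bound[where S = "cball 1 (1 / 2)" and f' = inverse])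
    fix z :: complex assume z: "z \<in> cball 1 (1 / 2)"
    show "(Ln has_field_derivative inverse z) (at z within cball 1 (1 / 2))"
      using has_field_derivative_Ln[OF half(2)[OF z]] by (rule has_field_derivative_at_within)
    show "norm (inverse z) \<le> 2" using half(1)[OF z] le_imp_inverse_le[of "1 / 2" "norm z"]
      by (simp add: norm_inverse)
  qed (use assms in \<open>auto simp: dist_norm\<close>)
  then show ?thesis by (simp add: norm_minus_commute)
qed

lemma decays_finite_support:
  assumes "finite {a. f a \<noteq> 0}"
  shows "\<exists>E. decays E f"
proof -
  let ?E = "\<Sum>a | f a \<noteq> 0. norm (f a) / wt a"
  have "norm (f a) \<le> ?E * wt a" for a
  proof (cases "f a = 0")
    case True
    have "0 \<le> ?E" by (intro sum_nonneg divide_nonneg_nonneg) (auto intro: less_imp_le[OF wt_pos])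
    with True show ?thesis using wt_pos[of a] by simp
  next
    case False
    have "norm (f a) / wt a \<le> ?E"
      using False divide_nonneg_nonneg[OF norm_ge_zero less_imp_le[OF wt_pos]]
      by (intro member_le_sum[OF _ _ assms]) auto
    then show ?thesis using wt_pos[of a] by (simp add: divide_le_eq)
  qed
  then show ?thesis unfolding decays_def by blast
qed

text \<open>\<open>g\<close> is the symbol of the linear part without the delayed feedback b exp(-ik
  tau). \<open>Y\<close> is the real-linear space of admissible families; \<open>Y_crit\<close> says
  that its critical part is one complex line spanned by \<open>e\<close>, with the coordinate read
  off at \<open>a0\<close> and conjugated at negative frequencies because the families represent
  real functions.\<close>

locale hopf =
  fixes g :: "'i::{finite,ab_group_add} \<times> int \<Rightarrow> complex" and G bs \<tau>s \<beta> :: real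
    and Y :: "('i \<times> int \<Rightarrow> complex) \<Rightarrow> bool" and e :: "'i \<times> int \<Rightarrow> complex"
    and a0 :: "'i \<times> int" and m :: int
  assumes g_bound: "\<And>a. norm (g a + (of_int (snd a))\<^sup>2) \<le> G * (1 + \<bar>of_int (snd a)\<bar>)"
    and bs: "0 < bs" and m: "0 < m" and \<beta>: "0 < \<beta>"
    and Y_zero: "Y (\<lambda>_. 0)"
    and Y_add: "\<And>y z. Y y \<Longrightarrow> Y z \<Longrightarrow> Y (\<lambda>a. y a + z a)"
    and Y_scale: "\<And>y r. Y y \<Longrightarrow> Y (\<lambda>a. of_real r * y a)"
    and Y_cube: "\<And>y M. Y y \<Longrightarrow> decays M y \<Longrightarrow> Y (cube y)"
    and Y_limit: "\<And>F f. (\<And>n::nat. Y (F n)) \<Longrightarrow> (\<And>a. (\<lambda>n. F n a) \<longlonglongrightarrow> f a) \<Longrightarrow> Y f"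
    and Y_real: "\<And>y a. Y y \<Longrightarrow> y (- a) = cnj (y a)"
    and Y_divide: "\<And>y b \<tau>. Y y \<Longrightarrow>
       Y (\<lambda>a. if g a + of_real bs * cis (- (of_int (snd a) * \<tau>s)) = 0 then 0
              else y a / (g a + of_real b * cis (- (of_int (snd a) * \<tau>))))"
    and e_Y: "Y e" and e_a0: "e a0 = 1"
    and e_finite: "finite {a. e a \<noteq> 0}"
    and e_support: "\<And>a. e a \<noteq> 0 \<Longrightarrow> \<bar>snd a\<bar> = m \<and> g a + of_real bs * cis (- (of_int (snd a) * \<tau>s)) = 0"
    and Y_crit: "\<And>y a. Y y \<Longrightarrow> g a + of_real bs * cis (- (of_int (snd a) * \<tau>s)) = 0 \<Longrightarrow>
       y a = (if snd a > 0 then y a0 else cnj (y a0)) * e a"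
begin

definition D :: "real \<Rightarrow> real \<Rightarrow> 'i \<times> int \<Rightarrow> complex" where
  "D b \<tau> a = g a + of_real b * cis (- (of_int (snd a) * \<tau>))"

definition crit :: "'i \<times> int \<Rightarrow> bool" where "crit a \<longleftrightarrow> D bs \<tau>s a = 0"

text \<open>Logarithmic coordinates on the parameter plane: b exp(-im tau) equals its critical value
  times exp \<zeta>. The real part of \<zeta> moves b, the imaginary part moves the delay.\<close>

definition bz :: "complex \<Rightarrow> real" where "bz \<zeta> = bs * exp (Re \<zeta>)"
definition tz :: "complex \<Rightarrow> real" where "tz \<zeta> = \<tau>s - Im \<zeta> / of_int m"
definition DZ :: "complex \<Rightarrow> 'i \<times> int \<Rightarrow> complex" where "DZ \<zeta> = D (bz \<zeta>) (tz \<zeta>)"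

lemma DZ_zero: "DZ 0 = D bs \<tau>s" by (simp add: DZ_def bz_def tz_def)

lemma DZ_eq: "DZ \<zeta> a = g a + of_real bs * cis (- (of_int (snd a) * \<tau>s)) *
   exp (Complex (Re \<zeta>) (of_int (snd a) / of_int m * Im \<zeta>))"
proof -
  have "cis (- (of_int (snd a) * tz \<zeta>)) = cis (- (of_int (snd a) * \<tau>s)) * cis (of_int (snd a) / of_int m * Im \<zeta>)"
    unfolding cis_mult tz_def by (simp add: algebra_simps)
  moreover have "exp (Complex (Re \<zeta>) (of_int (snd a) / of_int m * Im \<zeta>)) =
      of_real (exp (Re \<zeta>)) * cis (of_int (snd a) / of_int m * Im \<zeta>)"
    by (simp add: exp_eq_polar)
  ultimately show ?thesis unfolding DZ_def D_def bz_def by simp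
qed

lemma G_nonneg: "0 \<le> G"
  using order_trans[OF norm_ge_zero g_bound[of "(undefined, 0)"]] by simp

lemma abs_le_square: "1 + \<bar>of_int k\<bar> \<le> 2 * (1 + (of_int k :: real)\<^sup>2)"
proof -
  have "0 \<le> (\<bar>of_int k\<bar> - 1 / 2 :: real)\<^sup>2" by simp
  then show ?thesis by (simp add: power2_eq_square algebra_simps abs_mult_self_eq)
qed

text \<open>Varying the delay in exp(-ik tau) costs a factor of size k; the bound spends 1 + k^2,
  which is exactly what the lower bound on the symbol can absorb. The 6 is the 3 of
  \<open>exp_lipschitz\<close> times the 2 of \<open>abs_le_square\<close>.\<close>

lemma DZ_lipschitz:
  assumes "norm \<zeta> \<le> 1" "norm \<xi> \<le> 1"
  shows "norm (DZ \<zeta> a - DZ \<xi> a) \<le> 6 * bs * (1 + (of_int (snd a))\<^sup>2) * norm (\<zeta> - \<xi>)"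
proof -
  let ?k = "of_int (snd a) :: real"
  let ?u = "\<lambda>\<zeta>. Complex (Re \<zeta>) (?k / of_int m * Im \<zeta>)"
  have "\<bar>?k / of_int m\<bar> \<le> \<bar>?k\<bar>"
    using m by (simp add: abs_divide divide_le_eq mult_right_mono[of 1 "of_int m" "\<bar>?k\<bar>"] mult_ac)
      (metis abs_ge_zero mult.commute mult_left_mono mult.right_neutral int_one_le_iff_zero_less of_int_1_le_iff)
  then have km: "\<bar>?k / of_int m\<bar> * norm (\<zeta> - \<xi>) \<le> \<bar>?k\<bar> * norm (\<zeta> - \<xi>)"
    by (rule mult_right_mono) simp
  have "norm (?u \<zeta> - ?u \<xi>) \<le> \<bar>Re (\<zeta> - \<xi>)\<bar> + \<bar>?k / of_int m * Im (\<zeta> - \<xi>)\<bar>"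
    using cmod_le[of "?u \<zeta> - ?u \<xi>"] by (simp add: right_diff_distrib)
  also have "\<dots> \<le> norm (\<zeta> - \<xi>) + \<bar>?k / of_int m\<bar> * norm (\<zeta> - \<xi>)"
    unfolding abs_mult by (intro add_mono mult_left_mono abs_Re_le_cmod abs_Im_le_cmod) auto
  also have "\<dots> \<le> (1 + \<bar>?k\<bar>) * norm (\<zeta> - \<xi>)" using km by (simp add: distrib_right)
  also have "\<dots> \<le> (2 * (1 + ?k\<^sup>2)) * norm (\<zeta> - \<xi>)" by (intro mult_right_mono abs_le_square) simp
  finally have u: "norm (?u \<zeta> - ?u \<xi>) \<le> (2 * (1 + ?k\<^sup>2)) * norm (\<zeta> - \<xi>)" .
  have "Re \<zeta> \<le> 1" "Re \<xi> \<le> 1" using assms complex_Re_le_cmod order_trans by blast+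
  then have "norm (exp (?u \<zeta>) - exp (?u \<xi>)) \<le> 3 * norm (?u \<zeta> - ?u \<xi>)"
    by (intro exp_lipschitz) auto
  also have "\<dots> \<le> 3 * ((2 * (1 + ?k\<^sup>2)) * norm (\<zeta> - \<xi>))" using u by simp
  finally have "bs * norm (exp (?u \<zeta>) - exp (?u \<xi>)) \<le> bs * (3 * ((2 * (1 + ?k\<^sup>2)) * norm (\<zeta> - \<xi>)))"
    using bs by (intro mult_left_mono) auto
  moreover have "DZ \<zeta> a - DZ \<xi> a = of_real bs * cis (- (?k * \<tau>s)) * (exp (?u \<zeta>) - exp (?u \<xi>))"
    by (simp add: DZ_eq right_diff_distrib)
  ultimately have "norm (DZ \<zeta> a - DZ \<xi> a) \<le> bs * (3 * ((2 * (1 + ?k\<^sup>2)) * norm (\<zeta> - \<xi>)))"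
    using bs by (simp only: norm_mult norm_cis norm_of_real)
  then show ?thesis by (simp add: algebra_simps)
qed

lemma D_lower_bound: "\<exists>c>0. \<forall>a. \<not> crit a \<longrightarrow> c * (1 + (of_int (snd a))\<^sup>2) \<le> norm (D bs \<tau>s a)"
proof -
  \<comment> \<open>For k >= N one has 2G(1 + k) + 2bs + 1 <= k^2, which leaves half of 1 + k^2
    after the lower order terms and the feedback are subtracted from k^2.\<close>
  define N where "N = \<lceil>4 * G + 2 * bs + 1\<rceil>"
  have large: "1 / 2 * (1 + (of_int (snd a))\<^sup>2) \<le> norm (D bs \<tau>s a)" if "N \<le> \<bar>snd a\<bar>" for a
  proof -
    define k :: real where "k = \<bar>of_int (snd a)\<bar>"
    have k: "4 * G + 2 * bs + 1 \<le> k" using that unfolding N_def k_def by linarith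
    then have k1: "1 \<le> k" using G_nonneg bs by linarith
    have "4 * G * 1 \<le> 4 * G * k" "(2 * bs + 1) * 1 \<le> (2 * bs + 1) * k"
      using k1 G_nonneg bs by (intro mult_left_mono; simp)+
    moreover have "(4 * G + 2 * bs + 1) * k \<le> k * k" using k k1 by (intro mult_right_mono) auto
    moreover have "2 * G * 1 \<le> 2 * G * k" using k1 G_nonneg by (intro mult_left_mono) auto
    ultimately have main: "2 * G * (1 + k) + 2 * bs + 1 \<le> k * k" by (simp add: algebra_simps)
    have "norm ((of_int (snd a))\<^sup>2 :: complex) \<le> norm (D bs \<tau>s a) + norm (g a + (of_int (snd a))\<^sup>2) + bs"
    proof -
      have "(of_int (snd a))\<^sup>2 = (g a + (of_int (snd a))\<^sup>2) + of_real bs * cis (- (of_int (snd a) * \<tau>s)) - D bs \<tau>s a"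
        by (simp add: D_def)
      then have "norm ((of_int (snd a))\<^sup>2 :: complex) \<le>
          norm ((g a + (of_int (snd a))\<^sup>2) + of_real bs * cis (- (of_int (snd a) * \<tau>s))) + norm (D bs \<tau>s a)"
        by (metis norm_triangle_ineq4)
      also have "norm ((g a + (of_int (snd a))\<^sup>2) + of_real bs * cis (- (of_int (snd a) * \<tau>s))) \<le>
          norm (g a + (of_int (snd a))\<^sup>2) + norm (of_real bs * cis (- (of_int (snd a) * \<tau>s)))"
        by (rule norm_triangle_ineq)
      finally show ?thesis using bs by (simp add: norm_mult)
    qed
    moreover have "norm ((of_int (snd a))\<^sup>2 :: complex) = k * k"
      unfolding norm_power k_def by (simp add: power2_eq_square)
    ultimately show ?thesis using g_bound[of a] main by (simp add: k_def power2_eq_square)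
  qed
  \<comment> \<open>Below N only finitely many indices are left, because the class index ranges over
    a finite type, so a minimum takes care of them.\<close>
  define X where "X = {a :: 'i \<times> int. \<bar>snd a\<bar> < N \<and> \<not> crit a}"
  have "X \<subseteq> UNIV \<times> {-N..N}" unfolding X_def by auto
  then have fin: "finite X" by (rule finite_subset) simp
  define c where "c = Min (insert (1 / 2) ((\<lambda>a. norm (D bs \<tau>s a) / (1 + (of_int (snd a))\<^sup>2)) ` X))"
  have pos: "0 < 1 + (of_int (snd a) :: real)\<^sup>2" for a :: "'i \<times> int" by (simp add: add_pos_nonneg)
  have "c > 0"
    unfolding c_def using fin pos by (subst Min_gr_iff) (auto simp: X_def crit_def)
  moreover have "c * (1 + (of_int (snd a))\<^sup>2) \<le> norm (D bs \<tau>s a)" if "\<not> crit a" for a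
  proof (cases "a \<in> X")
    case True
    then have "c \<le> norm (D bs \<tau>s a) / (1 + (of_int (snd a))\<^sup>2)" unfolding c_def using fin by (intro Min_le) auto
    then show ?thesis using pos[of a] by (simp add: le_divide_eq)
  next
    case False
    have "c \<le> 1 / 2" unfolding c_def using fin by (intro Min_le) auto
    then have "c * (1 + (of_int (snd a))\<^sup>2) \<le> 1 / 2 * (1 + (of_int (snd a))\<^sup>2)" using pos[of a] by (intro mult_right_mono) auto
    then show ?thesis using large[of a] False that by (auto simp: X_def)
  qed
  ultimately show ?thesis by blast
qed

lemma DZ_lower_bound:
  "\<exists>c r. 0 < c \<and> 0 < r \<and> r \<le> 1 \<and> (\<forall>\<zeta> a. norm \<zeta> \<le> r \<longrightarrow> \<not> crit a \<longrightarrow> c * (1 + (of_int (snd a))\<^sup>2) \<le> norm (DZ \<zeta> a))"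
proof -
  obtain c where c: "c > 0" "\<And>a. \<not> crit a \<Longrightarrow> c * (1 + (of_int (snd a))\<^sup>2) \<le> norm (D bs \<tau>s a)"
    using D_lower_bound by blast
  \<comment> \<open>By \<open>DZ_lipschitz\<close> the symbol moves by at most 6 bs r (1 + k^2), and
    this r makes that at most half of the lower bound at \<zeta> = 0.\<close>
  define r where "r = min 1 (c / (12 * bs))"
  have r: "0 < r" "r \<le> 1" "6 * bs * r \<le> c / 2"
    using c bs by (auto simp: r_def min_def field_simps)
  have "c / 2 * (1 + (of_int (snd a))\<^sup>2) \<le> norm (DZ \<zeta> a)" if "norm \<zeta> \<le> r" "\<not> crit a" for \<zeta> a
  proof -
    let ?w = "1 + (of_int (snd a) :: real)\<^sup>2"
    have "norm (DZ \<zeta> a - DZ 0 a) \<le> 6 * bs * ?w * norm \<zeta>"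
      using DZ_lipschitz[of \<zeta> 0 a] that r by simp
    also have "\<dots> \<le> 6 * bs * ?w * r" using that bs by (intro mult_left_mono) auto
    also have "\<dots> = (6 * bs * r) * ?w" by simp
    also have "\<dots> \<le> c / 2 * ?w" using r by (intro mult_right_mono) auto
    finally have "norm (DZ \<zeta> a - DZ 0 a) \<le> c / 2 * ?w" .
    moreover have "norm (DZ 0 a) \<le> norm (DZ \<zeta> a) + norm (DZ \<zeta> a - DZ 0 a)"
      using norm_triangle_sub[of "DZ 0 a" "DZ \<zeta> a"] by (simp add: norm_minus_commute)
    ultimately show ?thesis using c(2)[OF that(2)] unfolding DZ_zero by linarith
  qed
  then show ?thesis using c r by (intro exI[of _ "c / 2"] exI[of _ r]) auto
qed

end

context hopf begin

lemma e_crit: "e a \<noteq> 0 \<Longrightarrow> crit a"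
  using e_support by (simp add: crit_def D_def)

lemma crit_a0: "crit a0"
  using e_crit[of a0] e_a0 by simp

lemma Y_crit': "Y y \<Longrightarrow> crit a \<Longrightarrow> y a = (if snd a > 0 then y a0 else cnj (y a0)) * e a"
  using Y_crit by (simp add: crit_def D_def)

lemma Y_divide': "Y y \<Longrightarrow> Y (\<lambda>a. if crit a then 0 else y a / DZ \<zeta> a)"
  using Y_divide[of y "bz \<zeta>" "tz \<zeta>"] unfolding crit_def D_def DZ_def by simp

definition qs :: complex where "qs = of_real bs * cis (- (of_int m * \<tau>s))"

lemma norm_qs: "norm qs = bs"
  using bs by (simp add: qs_def norm_mult)

text \<open>Lyapunov-Schmidt reduction in one contraction. With z = s (e + w) and w = 0 at critical
  indices, amplitude and phase are fixed, and the unknowns are w and \<zeta>. Both are collected in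
  one function on \<open>option\<close>: \<open>Some a\<close> holds w a and \<open>None\<close>
  holds \<zeta>. The small parameter is s^2.\<close>

lemma fixed_point:
  assumes E: "decays E e" and c: "0 < c" and r: "0 < r" "r \<le> 1"
    and lower: "\<And>\<zeta> a. norm \<zeta> \<le> r \<Longrightarrow> \<not> crit a \<Longrightarrow> c * (1 + (of_int (snd a))\<^sup>2) \<le> norm (DZ \<zeta> a)"
    and C: "C = (conv_const TYPE('i))\<^sup>2 * (E + 1) ^ 3" and L: "L = 3 * (conv_const TYPE('i))\<^sup>2 * (E + 1)\<^sup>2"
    and B: "B = \<beta> * (C / c + L / c + C * (6 * bs) / c\<^sup>2 + 2 * C / bs + 2 * L / bs)"
    and s: "s\<^sup>2 * B \<le> r / 2"
  shows "\<exists>w \<zeta>. Y w \<and> (\<forall>a. crit a \<longrightarrow> w a = 0) \<and> norm \<zeta> \<le> s\<^sup>2 * B \<and>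
     (\<forall>a. norm (w a) \<le> s\<^sup>2 * B * wt a / (1 + (of_int (snd a))\<^sup>2)) \<and>
     (\<forall>a. \<not> crit a \<longrightarrow> DZ \<zeta> a * w a = - (of_real (\<beta> * s\<^sup>2) * cube (\<lambda>a. e a + w a) a)) \<and>
     qs * (exp \<zeta> - 1) = - (of_real (\<beta> * s\<^sup>2) * cube (\<lambda>a. e a + w a) a0)"
proof -
  define \<epsilon> where "\<epsilon> = \<beta> * s\<^sup>2"
  define N where "N f = cube (\<lambda>a. e a + f (Some a))" for f
  define x where "x f = of_real \<epsilon> * N f a0 / qs" for f
  \<comment> \<open>Off the critical set w is found by dividing by the symbol; the equation qs (exp
    \<zeta> - 1) = - \<epsilon> N(a0) becomes \<zeta> = Ln (1 - x).\<close>
  define T where "T f i = (case i of None \<Rightarrow> Ln (1 - x f)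
      | Some a \<Rightarrow> if crit a then 0 else - (of_real \<epsilon> * N f a / DZ (f None) a))" for f i
  define \<rho> :: "('i \<times> int) option \<Rightarrow> real" where "\<rho> i = (case i of None \<Rightarrow> 1 | Some a \<Rightarrow> wt a)" for i
  define S where "S = {f. Y (\<lambda>a. f (Some a)) \<and> (\<forall>a. crit a \<longrightarrow> f (Some a) = 0) \<and>
      decays 1 (\<lambda>a. f (Some a)) \<and> norm (f None) \<le> r}"
  have S_zero: "f (Some a) = 0" if "f \<in> S" "crit a" for f a
    using that unfolding S_def by blast
  have S_le: "norm (f (Some a)) \<le> wt a" if "f \<in> S" for f a
    using that unfolding S_def decays_def mult_1 by blast
  have E0: "0 \<le> E" by (rule decays_nonneg[OF E])
  have C0: "0 \<le> C" and L0: "0 \<le> L" using E0 by (simp_all add: C L)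
  have eps0: "0 \<le> \<epsilon>" using \<beta> by (simp add: \<epsilon>_def)
  \<comment> \<open>\<open>B1\<close> and \<open>B3\<close> control the size of T at
    \<open>Some\<close> and \<open>None\<close>, \<open>B2\<close> and \<open>B4\<close> its
    Lipschitz constants there. Since B is \<beta> times their sum, the single condition s^2 B <= r /
    2 makes T a self-map of S that contracts by 1/2.\<close>
  define B1 where "B1 = C / c"
  define B2 where "B2 = L / c + C * (6 * bs) / c\<^sup>2"
  define B3 where "B3 = 2 * C / bs"
  define B4 where "B4 = 2 * L / bs"
  have Bs: "0 \<le> B1" "0 \<le> B2" "0 \<le> B3" "0 \<le> B4"
    unfolding B1_def B2_def B3_def B4_def using C0 L0 c bs by auto
  have sB: "s\<^sup>2 * B = \<epsilon> * B1 + \<epsilon> * B2 + \<epsilon> * B3 + \<epsilon> * B4"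
    unfolding B \<epsilon>_def B1_def B2_def B3_def B4_def by (simp add: algebra_simps)
  have Bi: "0 \<le> \<epsilon> * B1" "0 \<le> \<epsilon> * B2" "0 \<le> \<epsilon> * B3" "0 \<le> \<epsilon> * B4"
    using eps0 Bs by simp_all
  have wsum: "decays (E + 1) (\<lambda>a. e a + f (Some a))" if "f \<in> S" for f
    using that by (intro decays_add E) (auto simp: S_def)
  have N_bound: "decays C (N f)" if "f \<in> S" for f
    unfolding N_def C by (rule decays_cube[OF wsum[OF that]])
  have N_le: "norm (N f a) \<le> C * wt a" if "f \<in> S" for f a
    using N_bound[OF that] unfolding decays_def by blast
  have N_diff: "norm (N f a - N h a) \<le> L * d * wt a"
    if "f \<in> S" "h \<in> S" "\<And>i. norm (f i - h i) \<le> d * \<rho> i" for f h d a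
  proof -
    have "decays d (\<lambda>a. (e a + f (Some a)) - (e a + h (Some a)))"
      using that(3)[of "Some _"] by (simp add: decays_def \<rho>_def)
    from decays_cube_diff[OF wsum[OF that(1)] wsum[OF that(2)] this]
    show ?thesis unfolding decays_def N_def L by blast
  qed
  have w2: "1 \<le> 1 + (of_int (snd a) :: real)\<^sup>2" for a :: "'i \<times> int" by simp
  have DZ_pos: "0 < c * (1 + (of_int (snd a))\<^sup>2)" for a :: "'i \<times> int"
    using c w2[of a] by (intro mult_pos_pos) linarith+
  have x_le: "norm (x f) \<le> \<epsilon> * B3 / 2" if "f \<in> S" for f
  proof -
    have "norm (N f a0) \<le> C" using N_le[OF that, of a0] mult_left_mono[OF wt_le_1 C0, of a0] by linarith
    then have "\<epsilon> * norm (N f a0) / bs \<le> \<epsilon> * C / bs" using eps0 bs by (intro divide_right_mono mult_left_mono) auto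
    moreover have "norm (x f) = \<epsilon> * norm (N f a0) / bs"
      using eps0 by (simp add: x_def norm_divide norm_mult norm_qs)
    ultimately show ?thesis by (simp add: B3_def)
  qed
  have x_half: "norm (x f) \<le> 1 / 2" if "f \<in> S" for f
    using x_le[OF that] Bi s r unfolding sB by linarith
  have T_some: "norm (T f (Some a)) \<le> s\<^sup>2 * B * wt a / (1 + (of_int (snd a))\<^sup>2)" if "f \<in> S" for f a
  proof (cases "crit a")
    case True
    then show ?thesis
      using Bi wt_pos[of a] w2[of a] unfolding sB by (simp add: T_def)
  next
    case False
    have low: "c * (1 + (of_int (snd a))\<^sup>2) \<le> norm (DZ (f None) a)"
      using that False by (intro lower) (auto simp: S_def)
    have "norm (T f (Some a)) = \<epsilon> * norm (N f a) / norm (DZ (f None) a)"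
      using False eps0 by (simp add: T_def norm_divide norm_mult)
    also have "\<dots> \<le> \<epsilon> * (C * wt a) / (c * (1 + (of_int (snd a))\<^sup>2))"
      using eps0 N_le[OF that, of a] low DZ_pos[of a] C0 wt_pos[of a]
      by (intro frac_le mult_left_mono) (auto intro!: mult_nonneg_nonneg)
    also have "\<dots> = (\<epsilon> * B1) * (wt a / (1 + (of_int (snd a))\<^sup>2))"
      by (simp add: B1_def)
    also have "\<dots> \<le> (s\<^sup>2 * B) * (wt a / (1 + (of_int (snd a))\<^sup>2))"
      using Bi wt_pos[of a] w2[of a] unfolding sB
      by (intro mult_right_mono divide_nonneg_nonneg) auto
    finally show ?thesis by simp
  qed
  have T_none: "norm (T f None) \<le> s\<^sup>2 * B" if "f \<in> S" for f
  proof -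
    have "norm (Ln (1 - x f) - Ln (1 - 0)) \<le> 2 * norm (x f - 0)"
      using x_half[OF that] by (intro Ln_lipschitz) auto
    then have "norm (T f None) \<le> 2 * norm (x f)" by (simp add: T_def)
    also have "\<dots> \<le> \<epsilon> * B3" using x_le[OF that] by simp
    finally show ?thesis using Bi unfolding sB by linarith
  qed
  have sB0: "0 \<le> s\<^sup>2 * B" using Bi unfolding sB by simp
  have "\<exists>f\<in>S. T f = f"
  proof (rule weighted_contraction[where start = "\<lambda>_. 0" and M = 2 and \<rho> = \<rho>])
    show "(\<lambda>_. 0) \<in> S" using r Y_zero by (simp add: S_def decays_zero)
  next
    fix F f assume F: "\<And>n. F n \<in> S" and lim: "\<And>i. (\<lambda>n::nat. F n i) \<longlonglongrightarrow> f i"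
    have "Y (\<lambda>a. f (Some a))"
      by (rule Y_limit[of "\<lambda>n a. F n (Some a)"]) (use F lim in \<open>auto simp: S_def\<close>)
    moreover have "f (Some a) = 0" if "crit a" for a
    proof -
      have "(\<lambda>n. F n (Some a)) = (\<lambda>n. 0)" using S_zero[OF F that] by simp
      then show ?thesis using lim[of "Some a"] by (simp add: LIMSEQ_const_iff)
    qed
    moreover have "decays 1 (\<lambda>a. f (Some a))" unfolding decays_def
    proof
      fix a show "norm (f (Some a)) \<le> 1 * wt a"
        by (rule LIMSEQ_le_const2[OF tendsto_norm[OF lim]]) (use S_le[OF F] in auto)
    qed
    moreover have "norm (f None) \<le> r"
      by (rule LIMSEQ_le_const2[OF tendsto_norm[OF lim]]) (use F in \<open>auto simp: S_def\<close>)
    ultimately show "f \<in> S" by (simp add: S_def)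
  next
    fix f assume f: "f \<in> S"
    have "Y (N f)" unfolding N_def
      by (rule Y_cube[OF _ wsum[OF f]]) (use f e_Y Y_add in \<open>auto simp: S_def\<close>)
    then have "Y (\<lambda>a. of_real (- \<epsilon>) * (if crit a then 0 else N f a / DZ (f None) a))"
      by (intro Y_scale Y_divide')
    also have "(\<lambda>a. of_real (- \<epsilon>) * (if crit a then 0 else N f a / DZ (f None) a)) = (\<lambda>a. T f (Some a))"
      by (auto simp: T_def)
    finally have Yw: "Y (\<lambda>a. T f (Some a))" .
    have "norm (T f (Some a)) \<le> 1 * wt a" for a
    proof -
      have "s\<^sup>2 * B * wt a / (1 + (of_int (snd a))\<^sup>2) \<le> s\<^sup>2 * B * wt a / 1"
        using w2[of a] mult_nonneg_nonneg[OF sB0 less_imp_le[OF wt_pos[of a]]]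
        by (intro divide_left_mono mult_pos_pos) linarith+
      also have "\<dots> \<le> 1 * wt a / 1" using s r wt_pos[of a] by (intro divide_right_mono mult_right_mono) auto
      finally show ?thesis using T_some[OF f, of a] by simp
    qed
    moreover have "norm (T f None) \<le> r" using T_none[OF f] s r by linarith
    ultimately show "T f \<in> S" using Yw by (simp add: S_def decays_def T_def)
  next
    fix f h i assume f: "f \<in> S" and h: "h \<in> S"
    have n2: "norm (f (Some a) - h (Some a)) \<le> 2 * wt a" for a
    proof -
      show ?thesis using S_le[OF f, of a] S_le[OF h, of a] norm_triangle_ineq4[of "f (Some a)" "h (Some a)"] by simp
    qed
    have "norm (f None) \<le> r" "norm (h None) \<le> r" using f h by (auto simp: S_def)
    then have "norm (f None - h None) \<le> 2" using r norm_triangle_ineq4[of "f None" "h None"] by simp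
    with n2 show "norm (f i - h i) \<le> 2 * \<rho> i" by (cases i) (auto simp: \<rho>_def)
  next
    fix f h d i assume f: "f \<in> S" and h: "h \<in> S" and d: "\<And>i. norm (f i - h i) \<le> d * \<rho> i"
    have d0: "0 \<le> d" using order_trans[OF norm_ge_zero d[of None]] by (simp add: \<rho>_def)
    show "norm (T f i - T h i) \<le> d / 2 * \<rho> i"
    proof (cases i)
      case None
      have "norm (N f a0 - N h a0) \<le> L * d"
        using N_diff[OF f h d, of a0] mult_left_mono[OF wt_le_1, of "L * d" a0] L0 d0 by simp
      then have "\<epsilon> * norm (N f a0 - N h a0) / bs \<le> \<epsilon> * (L * d) / bs"
        using eps0 bs by (intro divide_right_mono mult_left_mono) auto
      moreover have "x f - x h = of_real \<epsilon> * (N f a0 - N h a0) / qs"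
        by (simp add: x_def diff_divide_distrib right_diff_distrib)
      ultimately have xd: "norm (x f - x h) \<le> \<epsilon> * (L * d) / bs"
        using eps0 by (simp add: norm_divide norm_mult norm_qs)
      have "norm (T f None - T h None) \<le> 2 * norm (x f - x h)"
        unfolding T_def using Ln_lipschitz[OF x_half[OF f] x_half[OF h]] by simp
      also have "\<dots> \<le> 2 * (\<epsilon> * (L * d) / bs)" using xd by simp
      also have "\<dots> = (\<epsilon> * B4) * d" by (simp add: B4_def)
      also have "\<dots> \<le> 1 / 2 * d" using Bi s r d0 unfolding sB by (intro mult_right_mono) auto
      finally show ?thesis using None by (simp add: \<rho>_def)
    next
      case (Some a)
      show ?thesis
      proof (cases "crit a")
        case True
        then show ?thesis using Some d0 wt_pos[of a] by (simp add: T_def \<rho>_def)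
      next
        case False
        let ?F = "DZ (f None) a" and ?H = "DZ (h None) a"
        define k where "k = 1 + (of_int (snd a) :: real)\<^sup>2"
        have k: "1 \<le> k" using w2[of a] by (simp add: k_def)
        have lowF: "c * k \<le> norm ?F" and lowH: "c * k \<le> norm ?H"
          using f h False unfolding k_def by (auto intro!: lower simp: S_def)
        have nz: "?F \<noteq> 0" "?H \<noteq> 0" using lowF lowH DZ_pos[of a] unfolding k_def by auto
        have cF: "c \<le> norm ?F"
          using lowF mult_left_mono[OF k, of c] c by linarith
        have Dd: "norm (?H - ?F) \<le> 6 * bs * k * d"
        proof -
          have "norm (f None) \<le> 1" "norm (h None) \<le> 1" using f h r by (auto simp: S_def)
          then have "norm (?H - ?F) \<le> 6 * bs * k * norm (h None - f None)" unfolding k_def by (intro DZ_lipschitz)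
          also have "\<dots> \<le> 6 * bs * k * d"
            using d[of None] bs k by (intro mult_left_mono) (auto simp: \<rho>_def norm_minus_commute)
          finally show ?thesis .
        qed
        \<comment> \<open>Both quotients are compared through N h / F. In the second summand the
          growth k of H - F cancels against the bound c * k for H, while for F the bound c is
          enough.\<close>
        have "T f i - T h i = - of_real \<epsilon> * ((N f a - N h a) / ?F + N h a * (?H - ?F) / (?F * ?H))"
          using nz False Some by (simp add: T_def field_simps)
        then have "norm (T f i - T h i) = \<epsilon> * norm ((N f a - N h a) / ?F + N h a * (?H - ?F) / (?F * ?H))"
          using eps0 by (simp add: norm_mult)
        also have "\<dots> \<le> \<epsilon> * (L * d * wt a / c + C * wt a * (6 * bs * k * d) / (c * (c * k)))"
        proof (intro mult_left_mono eps0 norm_triangle_le add_mono)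
          show "norm ((N f a - N h a) / ?F) \<le> L * d * wt a / c"
            unfolding norm_divide using N_diff[OF f h d, of a] cF c L0 d0 wt_pos[of a]
            by (intro frac_le) (auto intro!: mult_nonneg_nonneg)
          show "norm (N h a * (?H - ?F) / (?F * ?H)) \<le> C * wt a * (6 * bs * k * d) / (c * (c * k))"
            unfolding norm_divide norm_mult
            using N_le[OF h, of a] Dd cF lowH c C0 d0 wt_pos[of a] k bs
            by (intro frac_le mult_mono mult_pos_pos) (auto intro!: mult_nonneg_nonneg)
        qed
        also have "\<dots> = (\<epsilon> * B2) * d * wt a"
          using c k unfolding B2_def power2_eq_square by (simp add: field_simps)
        also have "\<dots> \<le> (1 / 2) * d * wt a"
          using Bi s r d0 wt_pos[of a] unfolding sB by (intro mult_right_mono) auto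
        finally show ?thesis using Some by (simp add: \<rho>_def)
      qed
    qed
  qed
  then obtain f where f: "f \<in> S" "T f = f" by blast
  define w where "w = (\<lambda>a. f (Some a))"
  have Nf: "N f = cube (\<lambda>a. e a + w a)" by (simp add: N_def w_def)
  have "\<not> crit a \<Longrightarrow> DZ (f None) a * w a = - (of_real (\<beta> * s\<^sup>2) * cube (\<lambda>a. e a + w a) a)" for a
  proof -
    assume nc: "\<not> crit a"
    have "c * (1 + (of_int (snd a))\<^sup>2) \<le> norm (DZ (f None) a)"
      using f(1) nc by (intro lower) (auto simp: S_def)
    then have "DZ (f None) a \<noteq> 0" using DZ_pos[of a] by auto
    moreover have "w a = - (of_real \<epsilon> * N f a / DZ (f None) a)"
      using fun_cong[OF f(2), of "Some a"] nc by (simp add: T_def w_def)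
    ultimately show ?thesis by (simp add: Nf \<epsilon>_def)
  qed
  moreover have "qs * (exp (f None) - 1) = - (of_real (\<beta> * s\<^sup>2) * cube (\<lambda>a. e a + w a) a0)"
  proof -
    have "f None = Ln (1 - x f)" using fun_cong[OF f(2), of None] by (simp add: T_def)
    moreover have "1 - x f \<noteq> 0" using x_half[OF f(1)] by auto
    ultimately have "exp (f None) = 1 - x f" by simp
    moreover have "qs \<noteq> 0" using norm_qs bs by auto
    ultimately show ?thesis by (simp add: x_def Nf \<epsilon>_def)
  qed
  moreover have "norm (w a) \<le> s\<^sup>2 * B * wt a / (1 + (of_int (snd a))\<^sup>2)" for a
    using T_some[OF f(1), of a] f(2) by (simp add: w_def)
  moreover have "norm (f None) \<le> s\<^sup>2 * B" using T_none[OF f(1)] f(2) by simp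
  ultimately show ?thesis using f(1) by (intro exI[of _ w] exI[of _ "f None"]) (auto simp: S_def w_def)
qed

end

section \<open>Leibniz rule and energy balance on coefficients\<close>

lemma momentum_conv:
  fixes f g :: "'i::{finite,ab_group_add} \<times> int \<Rightarrow> complex"
  assumes f: "decays M f" and g: "decays N g"
    and f': "decays M' (\<lambda>a. of_int (snd a) * f a)" and g': "decays N' (\<lambda>a. of_int (snd a) * g a)"
  shows "of_int (snd a) * conv f g a =
    conv (\<lambda>a. of_int (snd a) * f a) g a + conv f (\<lambda>a. of_int (snd a) * g a) a"
proof -
  have "of_int (snd a) * conv f g a = (\<Sum>\<^sub>\<infinity>b. of_int (snd a) * (f b * g (a - b)))"
    unfolding conv_def by (rule infsum_cmult_right'[symmetric])
  also have "\<dots> = (\<Sum>\<^sub>\<infinity>b. (of_int (snd b) * f b) * g (a - b) + f b * (of_int (snd (a - b)) * g (a - b)))"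
    by (intro infsum_cong) (simp add: algebra_simps)
  also have "\<dots> = conv (\<lambda>a. of_int (snd a) * f a) g a + conv f (\<lambda>a. of_int (snd a) * g a) a"
    unfolding conv_def by (intro infsum_add conv_summable'[OF f' g] conv_summable'[OF f g'])
  finally show ?thesis .
qed

text \<open>In function terms: \<open>\<integral> u\<^sup>3 u' = 0\<close> for periodic \<open>u\<close>.\<close>

lemma conv_momentum_cube_zero:
  fixes y :: "'i::{finite,ab_group_add} \<times> int \<Rightarrow> complex"
  assumes y: "decays M y" and y': "decays M' (\<lambda>a. of_int (snd a) * y a)"
  shows "conv (\<lambda>a. of_int (snd a) * y a) (cube y) 0 = 0"
proof -
  define P where "P = (\<lambda>a. of_int (snd a) * y a)"
  have P: "decays M' P" using y' by (simp add: P_def)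
  note yy = decays_conv[OF y y] and Py = decays_conv[OF P y]
  note yyy = decays_conv[OF y yy] and PPyy = decays_conv[OF P yy]
  have m2: "(\<lambda>a. of_int (snd a) * conv y y a) = (\<lambda>a. 2 * conv P y a)"
    using momentum_conv[OF y y y' y'] unfolding P_def[symmetric] by (simp add: conv_commute[of y P])
  have swap: "conv y (conv P z) = conv P (conv y z)" if "decays K z" for K z
    using conv_assoc[OF y P that] conv_assoc[OF P y that] by (simp only: conv_commute[of y P])
  have m2d: "decays (norm (2::complex) * (conv_const TYPE('i) * M' * M)) (\<lambda>a. of_int (snd a) * conv y y a)"
    unfolding m2 by (intro decays_cmult Py)
  have m3: "(\<lambda>a. of_int (snd a) * cube y a) = (\<lambda>a. 3 * conv P (conv y y) a)"
    using momentum_conv[OF y yy y' m2d] unfolding P_def[symmetric] m2 conv_cmult_right cube_def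
    by (simp add: swap[OF y])
  have m3d: "decays (norm (3::complex) * (conv_const TYPE('i) * M' * (conv_const TYPE('i) * M * M))) (\<lambda>a. of_int (snd a) * cube y a)"
    unfolding m3 by (intro decays_cmult PPyy)
  \<comment> \<open>This is the Leibniz rule for y times y^3 at the index 0, where the derivative of
    y^4 has coefficient 0. As (y^3)' = 3 y^2 y', the two terms add up to four times the wanted
    one.\<close>
  have "0 = conv P (cube y) 0 + conv y (\<lambda>a. 3 * conv P (conv y y) a) 0"
    using momentum_conv[OF y yyy[folded cube_def] y' m3d, of 0] unfolding P_def[symmetric] m3 by simp
  then have "4 * conv P (cube y) 0 = 0"
    unfolding conv_cmult_right swap[OF yy] cube_def by simp
  then show ?thesis by (simp add: P_def)
qed

lemma finite_support_conv:
  fixes f g :: "'i::ab_group_add \<times> int \<Rightarrow> complex"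
  assumes "finite {a. f a \<noteq> 0}" "finite {a. g a \<noteq> 0}"
  shows "finite {a. conv f g a \<noteq> 0}"
proof (rule finite_subset)
  show "{a. conv f g a \<noteq> 0} \<subseteq> (\<lambda>(b, c). b + c) ` ({a. f a \<noteq> 0} \<times> {a. g a \<noteq> 0})"
  proof
    fix a assume a: "a \<in> {a. conv f g a \<noteq> 0}"
    have "\<exists>b. f b * g (a - b) \<noteq> 0"
    proof (rule ccontr)
      assume "\<nexists>b. f b * g (a - b) \<noteq> 0"
      then have "conv f g a = 0" unfolding conv_def by (intro infsum_0) blast
      with a show False by simp
    qed
    then obtain b where "f b \<noteq> 0" "g (a - b) \<noteq> 0" by auto
    then show "a \<in> (\<lambda>(b, c). b + c) ` ({a. f a \<noteq> 0} \<times> {a. g a \<noteq> 0})"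
      by (intro image_eqI[of _ _ "(b, a - b)"]) auto
  qed
qed (use assms in auto)

text \<open>The equation is multiplied by k times the conjugate of y a and summed, that is, paired
  with y'. The cubic side vanishes by \<open>conv_momentum_cube_zero\<close>, and the imaginary part
  of the other side remains.\<close>

lemma energy_identity:
  fixes y L :: "'i::{finite,ab_group_add} \<times> int \<Rightarrow> complex"
  assumes real: "\<And>a. y (- a) = cnj (y a)" and y: "\<And>a. norm (y a) \<le> B * wt a / (1 + (of_int (snd a))\<^sup>2)"
    and eq: "\<And>a. L a * y a = - (of_real \<epsilon> * cube y a)" and B: "0 \<le> B"
  shows "((\<lambda>a. of_int (snd a) * Im (L a) * (norm (y a))\<^sup>2) has_sum 0) UNIV"
proof -
  have k: "1 \<le> 1 + (of_int k :: real)\<^sup>2" "\<bar>of_int k\<bar> \<le> 1 + (of_int k :: real)\<^sup>2" for k :: int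
    using zero_le_power2[of "\<bar>of_int k\<bar> - 1 / 2 :: real"] by (simp_all add: power2_eq_square algebra_simps)
  have Bw: "0 \<le> B * wt a" for a :: "'i \<times> int" using B wt_pos[of a] by simp
  have yd: "decays B y" unfolding decays_def
  proof
    fix a :: "'i \<times> int"
    have "B * wt a / (1 + (of_int (snd a))\<^sup>2) \<le> B * wt a / 1"
      using k[of "snd a"] Bw[of a] by (intro divide_left_mono mult_pos_pos) linarith+
    then show "norm (y a) \<le> B * wt a" using y[of a] by simp
  qed
  define P where "P = (\<lambda>a. of_int (snd a) * y a)"
  have Pd: "decays B P" unfolding decays_def P_def
  proof
    fix a :: "'i \<times> int"
    have "norm (of_int (snd a) * y a) \<le> \<bar>of_int (snd a)\<bar> * (B * wt a / (1 + (of_int (snd a))\<^sup>2))"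
      unfolding norm_mult norm_of_int by (intro mult_left_mono y) simp
    also have "\<dots> \<le> (1 + (of_int (snd a))\<^sup>2) * (B * wt a / (1 + (of_int (snd a))\<^sup>2))"
      using k[of "snd a"] Bw[of a] by (intro mult_right_mono divide_nonneg_nonneg) linarith+
    also have "\<dots> = B * wt a"
    proof -
      have "1 + (of_int (snd a))\<^sup>2 \<noteq> (0::real)" using k(1)[of "snd a"] by linarith
      then show ?thesis by simp
    qed
    finally show "norm (of_int (snd a) * y a) \<le> B * wt a" .
  qed
  have "((\<lambda>b. P b * cube y (0 - b)) has_sum conv P (cube y) 0) UNIV"
    unfolding conv_def by (intro has_sum_infsum conv_summable'[OF Pd decays_cube[OF yd]])
  moreover have "conv P (cube y) 0 = 0"
    unfolding P_def by (rule conv_momentum_cube_zero[OF yd Pd[unfolded P_def]])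
  ultimately have "((\<lambda>b. P b * cube y (0 - b)) has_sum 0) UNIV" by simp
  then have "((\<lambda>a. P (0 - a) * cube y (0 - (0 - a))) has_sum 0) UNIV"
    by (subst has_sum_reindex_bij_betw[OF bij_minus_left, of "\<lambda>b. P b * cube y (0 - b)"])
  then have "((\<lambda>a. of_real \<epsilon> * (P (- a) * cube y a)) has_sum of_real \<epsilon> * 0) UNIV"
    by (intro has_sum_cmult_right) simp
  moreover have "of_real \<epsilon> * (P (- a) * cube y a) = of_real (of_int (snd a) * (norm (y a))\<^sup>2) * L a" for a
  proof -
    have "of_real ((norm (y a))\<^sup>2) = y a * cnj (y a)" by (rule complex_norm_square)
    then have "of_real (of_int (snd a) * (norm (y a))\<^sup>2) * L a = of_int (snd a) * cnj (y a) * (L a * y a)"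
      by (simp add: mult_ac)
    then show ?thesis unfolding eq P_def using real[of a] by simp
  qed
  ultimately have "((\<lambda>a. of_real (of_int (snd a) * (norm (y a))\<^sup>2) * L a) has_sum 0) UNIV" by simp
  from has_sum_Im[OF this] show ?thesis by (simp add: mult_ac)
qed

section \<open>Solutions of the full equation, and the sign of the delay at the boundary\<close>

context hopf begin

lemma DZ_critical:
  assumes "e a \<noteq> 0"
  shows "DZ \<zeta> a = (if snd a > 0 then qs * (exp \<zeta> - 1) else cnj (qs * (exp \<zeta> - 1)))"
proof -
  have k: "snd a = m \<or> snd a = - m" using e_support[OF assms] m by linarith
  have D0: "g a + of_real bs * cis (- (of_int (snd a) * \<tau>s)) = 0" using e_support[OF assms] by simp
  from k show ?thesis
  proof
    assume k: "snd a = m"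
    have "g a = - qs" using D0 by (simp add: k qs_def eq_neg_iff_add_eq_0)
    moreover have "DZ \<zeta> a = g a + qs * exp \<zeta>" using m by (simp add: DZ_eq k qs_def)
    ultimately show ?thesis using k m by (simp add: algebra_simps)
  next
    assume k: "snd a = - m"
    have q: "of_real bs * cis (- (of_int (snd a) * \<tau>s)) = cnj qs" by (simp add: qs_def k cis_cnj)
    have "g a = - cnj qs" using D0 unfolding q by (simp add: eq_neg_iff_add_eq_0)
    moreover have "DZ \<zeta> a = g a + cnj qs * exp (cnj \<zeta>)"
      unfolding DZ_eq q using m by (simp add: k complex_cnj[symmetric])
    ultimately show ?thesis using k m by (simp add: algebra_simps exp_cnj)
  qed
qed

text \<open>At critical indices w vanishes, and \<open>cube y\<close> lies again in
  \<open>Y\<close>, so \<open>Y_crit\<close> makes it a multiple of e there. All critical equations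
  thus reduce to the one at \<open>a0\<close> or to its conjugate.\<close>

lemma solves:
  assumes w: "Y w" "\<And>a. crit a \<Longrightarrow> w a = 0" and y: "y = (\<lambda>a. e a + w a)" "decays M y"
    and noncrit: "\<And>a. \<not> crit a \<Longrightarrow> DZ \<zeta> a * w a = - (of_real \<epsilon> * cube y a)"
    and bif: "qs * (exp \<zeta> - 1) = - (of_real \<epsilon> * cube y a0)"
  shows "DZ \<zeta> a * y a = - (of_real \<epsilon> * cube y a)"
proof (cases "crit a")
  case False
  then have "e a = 0" using e_crit[of a] by auto
  then show ?thesis using noncrit[OF False] by (simp add: y(1))
next
  case True
  have "Y y" unfolding y by (rule Y_add[OF e_Y w(1)])
  then have "Y (cube y)" using y(2) by (rule Y_cube)
  then have c: "cube y a = (if snd a > 0 then cube y a0 else cnj (cube y a0)) * e a"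
    using True by (rule Y_crit')
  show ?thesis
  proof (cases "e a = 0")
    case True
    then show ?thesis using c w(2)[OF \<open>crit a\<close>] by (simp add: y)
  next
    case False
    then show ?thesis
      using c w(2)[OF True] DZ_critical[OF False, of \<zeta>] unfolding bif by (simp add: y(1))
  qed
qed

text \<open>If the delay were not positive, then Im \<zeta> >= 0 and the critical indices would
  contribute nonnegative terms to the energy identity. To leading order w is - \<beta> s^2 cube e
  divided by the symbol, so noncritical indices in the support of \<open>cube e\<close> contribute
  nonnegative terms, at \<open>a3\<close> a positive one of order s^4. At all other indices w is of
  order s^4 and contributes at least -O(s^8). For small s the sum would be positive, but it is
  0.\<close>

lemma delay_positive:
  assumes \<tau>s: "\<tau>s = 0"
    and sign: "\<And>a. \<not> crit a \<Longrightarrow> cube e a \<noteq> 0 \<Longrightarrow> 0 < of_int (snd a) * Im (D bs 0 a)"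
    and a3: "\<not> crit a3" "cube e a3 \<noteq> 0"
    and growth: "\<And>a. \<eta> * (of_int (snd a))\<^sup>2 - H * \<bar>of_int (snd a)\<bar> \<le> of_int (snd a) * Im (g a)" and \<eta>: "0 < \<eta>"
    and E: "decays E e" and B: "0 \<le> B" and c: "0 < c" and r: "0 < r"
    and lower: "\<And>\<zeta> a. norm \<zeta> \<le> r \<Longrightarrow> \<not> crit a \<Longrightarrow> c * (1 + (of_int (snd a))\<^sup>2) \<le> norm (DZ \<zeta> a)"
  shows "\<exists>s0>0. \<forall>s w \<zeta>. 0 < s \<and> s < s0 \<and> Y w \<and> (\<forall>a. crit a \<longrightarrow> w a = 0) \<and> norm \<zeta> \<le> s\<^sup>2 * B \<and>
     (\<forall>a. norm (w a) \<le> s\<^sup>2 * B * wt a) \<and>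
     (\<forall>a. \<not> crit a \<longrightarrow> DZ \<zeta> a * w a = - (of_real (\<beta> * s\<^sup>2) * cube (\<lambda>a. e a + w a) a)) \<and>
     ((\<lambda>a. of_int (snd a) * Im (DZ \<zeta> a) * (norm (e a + w a))\<^sup>2) has_sum 0) UNIV
     \<longrightarrow> 0 < tz \<zeta>"
proof -
  \<comment> \<open>The noncritical indices that the cubic of e excites at order s^2. There are
    finitely many, so one radius \<rho> preserves all their signs.\<close>
  define F where "F = {a. \<not> crit a \<and> cube e a \<noteq> 0}"
  have finF: "finite F"
    by (rule finite_subset[of _ "{a. cube e a \<noteq> 0}"])
      (auto simp: F_def cube_def intro!: finite_support_conv e_finite)
  have DZ0: "DZ 0 a = D bs 0 a" for a using fun_cong[OF DZ_zero, of a] by (simp only: \<tau>s)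
  define v where "v a = of_int (snd a) * Im (D bs 0 a)" for a
  have cont: "((\<lambda>\<zeta>. of_int (snd a) * Im (DZ \<zeta> a)) \<longlongrightarrow> v a) (nhds 0)" for a
  proof -
    have "isCont Re 0" "isCont Im 0"
      by (simp_all add: linear_continuous_at bounded_linear_Re bounded_linear_Im)
    then have "isCont (\<lambda>\<zeta>. DZ \<zeta> a) 0" unfolding DZ_eq Complex_eq by (intro continuous_intros)
    then have "((\<lambda>\<zeta>. DZ \<zeta> a) \<longlongrightarrow> DZ 0 a) (nhds 0)"
      unfolding isCont_def by (rule tendsto_at_iff_tendsto_nhds[THEN iffD1])
    then have "((\<lambda>\<zeta>. of_int (snd a) * Im (DZ \<zeta> a)) \<longlongrightarrow> of_int (snd a) * Im (DZ 0 a)) (nhds 0)"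
      by (intro tendsto_intros)
    then show ?thesis unfolding v_def DZ0 .
  qed
  have "\<forall>\<^sub>F \<zeta> in nhds 0. \<forall>a\<in>F. v a / 2 < of_int (snd a) * Im (DZ \<zeta> a)"
    using sign by (intro eventually_ball_finite[OF finF] ballI order_tendstoD(1)[OF cont]) (auto simp: F_def v_def)
  then obtain \<rho> where \<rho>: "0 < \<rho>" "\<And>\<zeta> a. norm \<zeta> < \<rho> \<Longrightarrow> a \<in> F \<Longrightarrow> v a / 2 < of_int (snd a) * Im (DZ \<zeta> a)"
    unfolding eventually_nhds_metric dist_norm by auto
  have v: "0 < v a" if "a \<in> F" for a using sign that by (simp add: F_def v_def)
  have a3F: "a3 \<in> F" using a3 by (simp add: F_def)
  \<comment> \<open>\<open>- \<Gamma>\<close> is the least value of \<eta> x^2 - (H + 3 bs) x over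
    real x; 3 bs bounds the feedback term, because exp (Re \<zeta>) <= 3.\<close>
  define \<Gamma> where "\<Gamma> = (H + 3 * bs)\<^sup>2 / (4 * \<eta>)"
  have \<Gamma>0: "0 \<le> \<Gamma>" using \<eta> by (simp add: \<Gamma>_def)
  have low: "- \<Gamma> \<le> of_int (snd a) * Im (DZ \<zeta> a)" if "norm \<zeta> \<le> 1" for \<zeta> a
  proof -
    let ?k = "of_int (snd a) :: real"
    have "exp (Re \<zeta>) \<le> 3"
      using order_trans[OF complex_Re_le_cmod that] exp_le order_trans[of "exp (Re \<zeta>)" "exp 1" 3] by simp
    then have "norm (DZ \<zeta> a - g a) \<le> 3 * bs"
      using bs by (simp add: DZ_def D_def bz_def norm_mult)
    then have "\<bar>Im (DZ \<zeta> a - g a)\<bar> \<le> 3 * bs" using abs_Im_le_cmod order_trans by blast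
    then have "\<bar>?k\<bar> * \<bar>Im (DZ \<zeta> a - g a)\<bar> \<le> \<bar>?k\<bar> * (3 * bs)" by (intro mult_left_mono) auto
    then have "- (\<bar>?k\<bar> * (3 * bs)) \<le> ?k * Im (DZ \<zeta> a - g a)" unfolding abs_mult[symmetric] by linarith
    then have "\<eta> * ?k\<^sup>2 - (H + 3 * bs) * \<bar>?k\<bar> \<le> ?k * Im (DZ \<zeta> a)" using growth[of a] by (simp add: algebra_simps)
    moreover have "\<eta> * ?k\<^sup>2 - (H + 3 * bs) * \<bar>?k\<bar> + \<Gamma> = \<eta> * (\<bar>?k\<bar> - (H + 3 * bs) / (2 * \<eta>))\<^sup>2"
      using \<eta> unfolding \<Gamma>_def by (simp add: power2_eq_square field_simps)
    moreover have "0 \<le> \<eta> * (\<bar>?k\<bar> - (H + 3 * bs) / (2 * \<eta>))\<^sup>2" using \<eta> by simp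
    ultimately show ?thesis by linarith
  qed
  define L where "L = 3 * (conv_const TYPE('i))\<^sup>2 * (E + 1)\<^sup>2"
  have E0: "0 \<le> E" by (rule decays_nonneg[OF E])
  have L0: "0 \<le> L" using E0 by (simp add: L_def)
  define B' where "B' = \<beta> * (L * B) / c"
  have B'0: "0 \<le> B'" using \<beta> L0 B c by (simp add: B'_def)
  define U where "U = norm (D bs 0 a3) + 6 * bs * (1 + (of_int (snd a3))\<^sup>2) + 1"
  have U: "0 < U" unfolding U_def using bs by (intro add_nonneg_pos add_nonneg_nonneg mult_nonneg_nonneg) auto
  \<comment> \<open>U bounds the symbol at \<open>a3\<close> from above, so s^2 \<kappa> bounds the
    leading part of w there from below; half of it survives the remainder of order s^4.\<close>
  define \<kappa> where "\<kappa> = \<beta> * norm (cube e a3) / U"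
  have \<kappa>: "0 < \<kappa>" using \<beta> U a3 by (simp add: \<kappa>_def)
  define W where "W = (\<Sum>\<^sub>\<infinity>a::'i \<times> int. wt a)"
  have W0: "0 \<le> W" unfolding W_def by (intro infsum_nonneg less_imp_le[OF wt_pos])
  define A1 where "A1 = v a3 / 2 * (\<kappa> / 2)\<^sup>2"
  have A1: "0 < A1" using v[OF a3F] \<kappa> by (simp add: A1_def)
  define A2 where "A2 = \<Gamma> * B'\<^sup>2 * W"
  have A2: "0 \<le> A2" using \<Gamma>0 W0 by (simp add: A2_def)
  define s0 where "s0 = min (1 / (B + 1)) (min (\<rho> / (B + 1)) (min (r / (B + 1)) (min (\<kappa> / (2 * B' + 1)) (min 1 (A1 / (A2 + 1))))))"
  have s0: "0 < s0" unfolding s0_def using B \<rho>(1) r \<kappa> B'0 A1 A2 by simp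
  have "0 < tz \<zeta>"
    if s: "0 < s" "s < s0" and w: "Y w" "\<And>a. crit a \<Longrightarrow> w a = 0" and \<zeta>: "norm \<zeta> \<le> s\<^sup>2 * B"
      and wle: "\<And>a. norm (w a) \<le> s\<^sup>2 * B * wt a"
      and eq: "\<And>a. \<not> crit a \<Longrightarrow> DZ \<zeta> a * w a = - (of_real (\<beta> * s\<^sup>2) * cube (\<lambda>a. e a + w a) a)"
      and energy: "((\<lambda>a. of_int (snd a) * Im (DZ \<zeta> a) * (norm (e a + w a))\<^sup>2) has_sum 0) UNIV"
    for s w \<zeta>
  proof (rule ccontr)
    assume "\<not> 0 < tz \<zeta>"
    moreover have "tz \<zeta> = 0 - Im \<zeta> / of_int m" using tz_def[of \<zeta>] by (simp only: \<tau>s)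
    ultimately have Im0: "0 \<le> Im \<zeta>" using m by (auto simp: divide_less_0_iff not_less)
    have ss: "s \<le> 1" "s * (B + 1) < 1" "s * (B + 1) < \<rho>" "s * (B + 1) < r" "s * (2 * B' + 1) < \<kappa>" "s * (A2 + 1) < A1"
    proof -
      have p: "0 < B + 1" "0 < 2 * B' + 1" "0 < A2 + 1" using B B'0 A2 by simp_all
      have "s < 1 / (B + 1)" "s < \<rho> / (B + 1)" "s < r / (B + 1)" "s < \<kappa> / (2 * B' + 1)" "s < 1" "s < A1 / (A2 + 1)"
        using s(2) unfolding s0_def by simp_all
      then show "s \<le> 1" "s * (B + 1) < 1" "s * (B + 1) < \<rho>" "s * (B + 1) < r" "s * (2 * B' + 1) < \<kappa>" "s * (A2 + 1) < A1"
        using p by (simp_all only: pos_less_divide_eq less_imp_le)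
    qed
    have s2: "s\<^sup>2 \<le> s" using s ss(1) by (simp add: power2_eq_square mult_left_le)
    have sx: "s\<^sup>2 * X \<le> s * (X + 1)" if "0 \<le> X" for X
    proof -
      have "s\<^sup>2 * X \<le> s * X" using s2 that by (rule mult_right_mono)
      also have "\<dots> \<le> s * (X + 1)" using s by (intro mult_left_mono) auto
      finally show ?thesis .
    qed
    have n\<zeta>: "norm \<zeta> \<le> 1" "norm \<zeta> < \<rho>" "norm \<zeta> \<le> r" and sB1: "s\<^sup>2 * B \<le> 1"
      using \<zeta> sx[OF B] ss by linarith+
    have yd: "decays (E + 1) (\<lambda>a. e a + w a)"
    proof (intro decays_add E)
      show "decays 1 w" unfolding decays_def
        using wle sB1 mult_right_mono[OF sB1 less_imp_le[OF wt_pos]] order_trans by blast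
    qed
    have ed: "decays (E + 1) e" using E by (rule decays_mono) simp
    have "decays (s\<^sup>2 * B) (\<lambda>a. (e a + w a) - e a)" using wle by (simp add: decays_def)
    from decays_cube_diff[OF yd ed this]
    have cd: "norm (cube (\<lambda>a. e a + w a) a - cube e a) \<le> L * (s\<^sup>2 * B) * wt a" for a
      unfolding decays_def L_def by blast
    have \<beta>s: "norm (of_real (\<beta> * s\<^sup>2) :: complex) = \<beta> * s\<^sup>2"
      using \<beta> by (simp only: norm_of_real abs_of_nonneg mult_nonneg_nonneg zero_le_power2 less_imp_le)
    have cD: "c \<le> norm (DZ \<zeta> a)" if "\<not> crit a" for a
    proof -
      have "c * 1 \<le> c * (1 + (of_int (snd a))\<^sup>2)" using c by (intro mult_left_mono) auto
      then show ?thesis using lower[OF n\<zeta>(3) that] by linarith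
    qed
    \<comment> \<open>Replacing cube (e + w) by cube e costs L times the size s^2 B of w; with the
      prefactor s^2 this is of order s^4.\<close>
    have second: "norm (w a + of_real (\<beta> * s\<^sup>2) * cube e a / DZ \<zeta> a) \<le> s ^ 4 * B' * wt a" if nc: "\<not> crit a" for a
    proof -
      have nz: "DZ \<zeta> a \<noteq> 0" using cD[OF nc] c by auto
      have "w a = - (of_real (\<beta> * s\<^sup>2) * cube (\<lambda>a. e a + w a) a) / DZ \<zeta> a"
        unfolding eq[OF nc, symmetric] using nz by simp
      then have "w a + of_real (\<beta> * s\<^sup>2) * cube e a / DZ \<zeta> a =
          - (of_real (\<beta> * s\<^sup>2) * (cube (\<lambda>a. e a + w a) a - cube e a)) / DZ \<zeta> a"
        using nz by (simp add: field_simps)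
      then have "norm (w a + of_real (\<beta> * s\<^sup>2) * cube e a / DZ \<zeta> a) =
          \<beta> * s\<^sup>2 * norm (cube (\<lambda>a. e a + w a) a - cube e a) / norm (DZ \<zeta> a)"
        by (simp only: norm_divide norm_mult norm_minus_cancel \<beta>s)
      also have "\<dots> \<le> \<beta> * s\<^sup>2 * (L * (s\<^sup>2 * B) * wt a) / c"
        using cd[of a] cD[OF nc] c \<beta> L0 B wt_pos[of a] by (intro frac_le mult_left_mono) (auto intro!: mult_nonneg_nonneg)
      also have "\<dots> = s ^ 4 * B' * wt a" unfolding B'_def by (simp add: power4_eq_xxxx power2_eq_square)
      finally show ?thesis .
    qed
    have w3: "s\<^sup>2 * (\<kappa> / 2) \<le> norm (w a3)"
    proof -
      have nz: "0 < norm (DZ \<zeta> a3)" using cD[OF a3(1)] c by linarith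
      have "norm (DZ \<zeta> a3) \<le> norm (DZ 0 a3) + norm (DZ \<zeta> a3 - DZ 0 a3)" by (rule norm_triangle_sub)
      also have "\<dots> \<le> U"
      proof -
        have "norm (DZ \<zeta> a3 - DZ 0 a3) \<le> 6 * bs * (1 + (of_int (snd a3))\<^sup>2) * norm (\<zeta> - 0)"
          using n\<zeta> by (intro DZ_lipschitz) auto
        also have "\<dots> \<le> 6 * bs * (1 + (of_int (snd a3))\<^sup>2) * 1"
          using n\<zeta> bs by (intro mult_left_mono mult_nonneg_nonneg) auto
        finally show ?thesis unfolding U_def DZ0 by linarith
      qed
      finally have DU: "norm (DZ \<zeta> a3) \<le> U" .
      have "s\<^sup>2 * \<kappa> = \<beta> * s\<^sup>2 * norm (cube e a3) / U" by (simp add: \<kappa>_def)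
      also have "\<dots> \<le> \<beta> * s\<^sup>2 * norm (cube e a3) / norm (DZ \<zeta> a3)"
        using DU nz U \<beta> by (intro divide_left_mono) (auto intro!: mult_nonneg_nonneg mult_pos_pos)
      also have "\<dots> = norm (of_real (\<beta> * s\<^sup>2) * cube e a3 / DZ \<zeta> a3)"
        by (simp only: norm_divide norm_mult norm_minus_cancel \<beta>s)
      also have "\<dots> \<le> norm (w a3) + norm (w a3 + of_real (\<beta> * s\<^sup>2) * cube e a3 / DZ \<zeta> a3)"
        by (metis add_diff_cancel_left' norm_triangle_ineq4 add.commute)
      also have "\<dots> \<le> norm (w a3) + s ^ 4 * B' * wt a3" using second[OF a3(1)] by simp
      also have "s ^ 4 * B' * wt a3 \<le> s ^ 4 * B' * 1" using B'0 by (intro mult_left_mono wt_le_1) simp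
      also have "\<dots> = s\<^sup>2 * (s\<^sup>2 * B')" by (simp add: power4_eq_xxxx power2_eq_square)
      also have "\<dots> \<le> s\<^sup>2 * (\<kappa> / 2)"
      proof (intro mult_left_mono)
        have "s\<^sup>2 * (2 * B') \<le> s * (2 * B' + 1)" using B'0 by (intro sx) simp
        then show "s\<^sup>2 * B' \<le> \<kappa> / 2" using ss(5) by simp
      qed simp
      finally show ?thesis by (simp add: algebra_simps)
    qed
    define t where "t a = of_int (snd a) * Im (DZ \<zeta> a) * (norm (e a + w a))\<^sup>2" for a
    \<comment> \<open>A summable minorant of the terms t: the gain at \<open>a3\<close> minus the
      worst loss possible at any index.\<close>
    define u where "u a = (if a = a3 then s ^ 4 * A1 else 0) - s ^ 8 * (\<Gamma> * B'\<^sup>2) * wt a" for a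
    have A2': "0 \<le> s ^ 8 * (\<Gamma> * B'\<^sup>2) * wt a" for a :: "'i \<times> int" using \<Gamma>0 wt_pos[of a] by simp
    have ut: "u a \<le> t a" for a
    proof (cases "crit a")
      case True
      then have na3: "a \<noteq> a3" using a3 by auto
      have "0 \<le> t a"
      proof (cases "e a = 0")
        case True then show ?thesis using w(2)[OF \<open>crit a\<close>] by (simp add: t_def)
      next
        case False
        have "qs = of_real bs * cis (- (of_int m * 0))" using qs_def by (simp only: \<tau>s)
        then have "qs = of_real bs" by simp
        \<comment> \<open>0 <= Im \<zeta> <= 1 < pi makes the sine in Im (exp \<zeta>) nonnegative;
          at \<tau>s = 0 the factor \<open>qs\<close> is the positive number
          \<open>bs\<close>.\<close>
        moreover have "0 \<le> Im (exp \<zeta>)"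
        proof -
          have "Im \<zeta> \<le> pi" using n\<zeta>(1) abs_Im_le_cmod[of \<zeta>] pi_gt3 by linarith
          then show ?thesis using Im0 by (simp add: Im_exp sin_ge_zero)
        qed
        ultimately have "0 \<le> of_int (snd a) * Im (DZ \<zeta> a)"
          unfolding DZ_critical[OF False] using bs
          by (auto simp: zero_le_mult_iff mult_le_0_iff)
        then show ?thesis unfolding t_def by simp
      qed
      then show ?thesis using na3 A2'[of a] unfolding u_def by simp
    next
      case False
      note nc = this
      then have e0: "e a = 0" using e_crit[of a] by auto
      show ?thesis
      proof (cases "a \<in> F")
        case True
        have "v a / 2 < of_int (snd a) * Im (DZ \<zeta> a)" by (rule \<rho>(2)[OF n\<zeta>(2) True])
        then have t0: "v a / 2 * (norm (w a))\<^sup>2 \<le> t a" unfolding t_def e0 add_0 by (intro mult_right_mono) auto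
        have "0 \<le> v a / 2 * (norm (w a))\<^sup>2" using v[OF True] by simp
        show ?thesis
        proof (cases "a = a3")
          case True
          have "(s\<^sup>2 * (\<kappa> / 2))\<^sup>2 \<le> (norm (w a))\<^sup>2" unfolding True using w3 \<kappa> by (intro power_mono) auto
          then have "v a / 2 * (s\<^sup>2 * (\<kappa> / 2))\<^sup>2 \<le> v a / 2 * (norm (w a))\<^sup>2"
            using v[OF \<open>a \<in> F\<close>] by (intro mult_left_mono) auto
          moreover have "(s\<^sup>2)\<^sup>2 = s ^ 4" by (simp flip: power_mult)
          then have "v a / 2 * (s\<^sup>2 * (\<kappa> / 2))\<^sup>2 = s ^ 4 * A1"
            unfolding True A1_def by (simp only: power_mult_distrib mult_ac)
          ultimately show ?thesis using t0 A2'[of a] True unfolding u_def by simp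
        next
          case False
          then show ?thesis using t0 \<open>0 \<le> v a / 2 * (norm (w a))\<^sup>2\<close> A2'[of a] unfolding u_def by simp
        qed
      next
        case False
        then have c0: "cube e a = 0" and na3: "a \<noteq> a3" using nc a3F by (auto simp: F_def)
        have "norm (w a) \<le> s ^ 4 * B' * wt a" using second[OF nc] by (simp add: c0)
        then have "(norm (w a))\<^sup>2 \<le> (s ^ 4 * B' * wt a)\<^sup>2" by (intro power_mono) auto
        also have "\<dots> = s ^ 8 * B'\<^sup>2 * (wt a * wt a)" by (simp add: power_mult_distrib power2_eq_square[of "wt a"])
        also have "\<dots> \<le> s ^ 8 * B'\<^sup>2 * (wt a * 1)"
          using wt_pos[of a] by (intro mult_left_mono wt_le_1) auto
        finally have "\<Gamma> * (norm (w a))\<^sup>2 \<le> \<Gamma> * (s ^ 8 * B'\<^sup>2 * (wt a * 1))" using \<Gamma>0 by (rule mult_left_mono)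
        moreover have "- \<Gamma> * (norm (w a))\<^sup>2 \<le> t a"
          unfolding t_def e0 using low[OF n\<zeta>(1), of a] by (simp only: add_0) (intro mult_right_mono; simp)
        ultimately show ?thesis using na3 unfolding u_def by (simp add: mult_ac)
      qed
    qed
    have "((\<lambda>a. if a = a3 then s ^ 4 * A1 else 0) has_sum s ^ 4 * A1) UNIV"
      using has_sum_finite_neutralI[of "{a3}" UNIV "\<lambda>a. if a = a3 then s ^ 4 * A1 else 0"] by simp
    moreover have "((\<lambda>a::'i \<times> int. s ^ 8 * (\<Gamma> * B'\<^sup>2) * wt a) has_sum s ^ 8 * (\<Gamma> * B'\<^sup>2) * W) UNIV"
      unfolding W_def by (intro has_sum_cmult_right has_sum_infsum wt_summable)
    then have "((\<lambda>a::'i \<times> int. - (s ^ 8 * (\<Gamma> * B'\<^sup>2) * wt a)) has_sum - (s ^ 8 * (\<Gamma> * B'\<^sup>2) * W)) UNIV"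
      by (simp only: has_sum_uminus minus_minus)
    ultimately have "((\<lambda>a. (if a = a3 then s ^ 4 * A1 else 0) + - (s ^ 8 * (\<Gamma> * B'\<^sup>2) * wt a)) has_sum
        (s ^ 4 * A1 + - (s ^ 8 * (\<Gamma> * B'\<^sup>2) * W))) UNIV"
      by (rule has_sum_add)
    then have "(u has_sum (s ^ 4 * A1 - s ^ 8 * A2)) UNIV"
      by (simp add: u_def[abs_def] A2_def mult_ac)
    from has_sum_mono[OF this energy[folded t_def] ut]
    have "s ^ 4 * A1 - s ^ 8 * A2 \<le> 0" by simp
    moreover have "s ^ 8 * A2 < s ^ 4 * A1"
    proof -
      have "s ^ 8 = s ^ 4 * s ^ 4" by (simp flip: power_add)
      moreover have "s ^ 4 \<le> s" using s ss(1) power_decreasing[of 1 4 s] by simp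
      then have "s ^ 4 * A2 \<le> s * A2" using A2 by (rule mult_right_mono)
      then have "s ^ 4 * A2 < A1" using ss(6) s by (simp add: distrib_left)
      then have "s ^ 4 * (s ^ 4 * A2) < s ^ 4 * A1" using s by (intro mult_strict_left_mono) auto
      ultimately show ?thesis by (simp add: mult.assoc)
    qed
    ultimately show False by simp
  qed
  then show ?thesis using s0 by (intro exI[of _ s0]) blast
qed

end

context hopf begin

theorem bifurcating_solutions:
  assumes \<tau>s: "0 \<le> \<tau>s"
    and boundary: "\<tau>s = 0 \<Longrightarrow> \<exists>a3 \<eta> H. D bs 0 a3 \<noteq> 0 \<and> cube e a3 \<noteq> 0 \<and> 0 < \<eta> \<and>
       (\<forall>a. D bs 0 a \<noteq> 0 \<longrightarrow> cube e a \<noteq> 0 \<longrightarrow> 0 < of_int (snd a) * Im (D bs 0 a)) \<and>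
       (\<forall>a. \<eta> * (of_int (snd a))\<^sup>2 - H * \<bar>of_int (snd a)\<bar> \<le> of_int (snd a) * Im (g a))"
  shows "\<exists>B>0. \<forall>\<epsilon>>0. \<exists>s y b \<tau>. 0 < s \<and> s < \<epsilon> \<and> Y y \<and> y a0 = 1 \<and>
     (\<forall>a. norm (y a) \<le> B * wt a / (1 + (of_int (snd a))\<^sup>2)) \<and> (\<forall>a. norm (y a - e a) \<le> \<epsilon> * wt a) \<and>
     \<bar>b - bs\<bar> < \<epsilon> \<and> \<bar>\<tau> - \<tau>s\<bar> < \<epsilon> \<and> 0 < b \<and> 0 \<le> \<tau> \<and>
     (\<forall>a. D b \<tau> a * y a = - (of_real (\<beta> * s\<^sup>2) * cube y a))"
proof -
  obtain E where E: "decays E e" using decays_finite_support[OF e_finite] by blast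
  \<comment> \<open>Having finite support, e also obeys the stronger bound with the factor 1 / (1 +
    k^2) that w gets from division by the symbol.\<close>
  have "finite {a. e a * (1 + (of_int (snd a))\<^sup>2) \<noteq> 0}"
    by (rule finite_subset[OF _ e_finite]) auto
  then obtain E' where E': "decays E' (\<lambda>a. e a * (1 + (of_int (snd a))\<^sup>2))"
    using decays_finite_support[of "\<lambda>a. e a * (1 + (of_int (snd a))\<^sup>2)"] by blast
  have one: "1 \<le> 1 + (of_int (snd a) :: real)\<^sup>2" for a :: "'i \<times> int" by simp
  have e_le: "norm (e a) \<le> E' * wt a / (1 + (of_int (snd a))\<^sup>2)" for a
  proof -
    have "norm (e a * (1 + (of_int (snd a))\<^sup>2)) = norm (e a) * (1 + (of_int (snd a))\<^sup>2)"
    proof -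
      have "(1 + (of_int (snd a))\<^sup>2 :: complex) = of_real (1 + (of_int (snd a))\<^sup>2)" by simp
      then show ?thesis using one[of a] by (simp only: norm_mult norm_of_real)
    qed
    moreover have "norm (e a * (1 + (of_int (snd a))\<^sup>2)) \<le> E' * wt a" using E' unfolding decays_def by blast
    moreover have "0 < 1 + (of_int (snd a) :: real)\<^sup>2" using one[of a] by linarith
    ultimately show ?thesis by (simp add: pos_le_divide_eq)
  qed
  obtain c r where cr: "0 < c" "0 < r" "r \<le> 1"
    and lower: "\<And>\<zeta> a. norm \<zeta> \<le> r \<Longrightarrow> \<not> crit a \<Longrightarrow> c * (1 + (of_int (snd a))\<^sup>2) \<le> norm (DZ \<zeta> a)"
    using DZ_lower_bound by blast
  define C where "C = (conv_const TYPE('i))\<^sup>2 * (E + 1) ^ 3"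
  define L where "L = 3 * (conv_const TYPE('i))\<^sup>2 * (E + 1)\<^sup>2"
  define B where "B = \<beta> * (C / c + L / c + C * (6 * bs) / c\<^sup>2 + 2 * C / bs + 2 * L / bs)"
  have E0: "0 \<le> E" "0 \<le> E'" using decays_nonneg E E' by auto
  have B0: "0 \<le> B" unfolding B_def C_def L_def using E0 \<beta> cr bs by (intro mult_nonneg_nonneg add_nonneg_nonneg) auto
  define Good where "Good s w \<zeta> \<longleftrightarrow> Y w \<and> (\<forall>a. crit a \<longrightarrow> w a = 0) \<and> norm \<zeta> \<le> s\<^sup>2 * B \<and>
     (\<forall>a. norm (w a) \<le> s\<^sup>2 * B * wt a / (1 + (of_int (snd a))\<^sup>2)) \<and>
     (\<forall>a. \<not> crit a \<longrightarrow> DZ \<zeta> a * w a = - (of_real (\<beta> * s\<^sup>2) * cube (\<lambda>a. e a + w a) a)) \<and>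
     qs * (exp \<zeta> - 1) = - (of_real (\<beta> * s\<^sup>2) * cube (\<lambda>a. e a + w a) a0)" for s :: real and w \<zeta>
  have ex: "\<exists>w \<zeta>. Good s w \<zeta>" if "s\<^sup>2 * B \<le> r / 2" for s
    unfolding Good_def by (rule fixed_point[OF E cr lower C_def L_def B_def that])
  have y_le: "norm (e a + w a) \<le> (E' + 1) * wt a / (1 + (of_int (snd a))\<^sup>2)"
    if "Good s w \<zeta>" "s\<^sup>2 * B \<le> 1" for s w \<zeta> a
  proof -
    have "norm (w a) \<le> s\<^sup>2 * B * wt a / (1 + (of_int (snd a))\<^sup>2)" using that(1) unfolding Good_def by blast
    also have "\<dots> \<le> 1 * wt a / (1 + (of_int (snd a))\<^sup>2)"
      using that(2) wt_pos[of a] one[of a] by (intro divide_right_mono mult_right_mono) auto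
    finally show ?thesis using e_le[of a] norm_triangle_ineq[of "e a" "w a"]
      by (simp add: distrib_right add_divide_distrib)
  qed
  have wt_le: "X * wt a / (1 + (of_int (snd a))\<^sup>2) \<le> X * wt a" if "0 \<le> X" for X and a :: "'i \<times> int"
  proof -
    have "X * wt a / (1 + (of_int (snd a))\<^sup>2) \<le> X * wt a / 1"
      using one[of a] mult_nonneg_nonneg[OF that less_imp_le[OF wt_pos[of a]]]
      by (intro divide_left_mono mult_pos_pos) linarith+
    then show ?thesis by simp
  qed
  have sol: "DZ \<zeta> a * (e a + w a) = - (of_real (\<beta> * s\<^sup>2) * cube (\<lambda>a. e a + w a) a)"
    if good: "Good s w \<zeta>" "s\<^sup>2 * B \<le> 1" for s w \<zeta> a
  proof (rule solves[OF _ _ refl])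
    show "decays (E' + 1) (\<lambda>a. e a + w a)"
      unfolding decays_def using order_trans[OF y_le[OF good] wt_le] E0 by auto
  qed (use good in \<open>auto simp: Good_def\<close>)
  have pos: "\<exists>s0>0. \<forall>s w \<zeta>. 0 < s \<and> s < s0 \<and> Good s w \<zeta> \<and> s\<^sup>2 * B \<le> 1 \<longrightarrow> 0 < tz \<zeta>" if \<tau>0: "\<tau>s = 0"
  proof -
    obtain a3 \<eta> H where h: "D bs 0 a3 \<noteq> 0" "cube e a3 \<noteq> 0" "0 < \<eta>"
      "\<And>a. D bs 0 a \<noteq> 0 \<Longrightarrow> cube e a \<noteq> 0 \<Longrightarrow> 0 < of_int (snd a) * Im (D bs 0 a)"
      "\<And>a. \<eta> * (of_int (snd a))\<^sup>2 - H * \<bar>of_int (snd a)\<bar> \<le> of_int (snd a) * Im (g a)"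
      using boundary[OF \<tau>0] by blast
    have crit0: "crit a \<longleftrightarrow> D bs 0 a = 0" for a using crit_def[of a] by (simp only: \<tau>0)
    have sign: "\<And>a. \<not> crit a \<Longrightarrow> cube e a \<noteq> 0 \<Longrightarrow> 0 < of_int (snd a) * Im (D bs 0 a)"
      and a3: "\<not> crit a3" using h crit0 by simp_all
    obtain s0 where s0: "0 < s0" and
      s: "\<And>s w \<zeta>. 0 < s \<and> s < s0 \<and> Y w \<and> (\<forall>a. crit a \<longrightarrow> w a = 0) \<and> norm \<zeta> \<le> s\<^sup>2 * B \<and>
     (\<forall>a. norm (w a) \<le> s\<^sup>2 * B * wt a) \<and>
     (\<forall>a. \<not> crit a \<longrightarrow> DZ \<zeta> a * w a = - (of_real (\<beta> * s\<^sup>2) * cube (\<lambda>a. e a + w a) a)) \<and>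
     ((\<lambda>a. of_int (snd a) * Im (DZ \<zeta> a) * (norm (e a + w a))\<^sup>2) has_sum 0) UNIV
     \<Longrightarrow> 0 < tz \<zeta>"
      using delay_positive[OF \<tau>0 sign a3 h(2,5,3) E B0 cr(1,2) lower] by blast
    have "0 < tz \<zeta>" if good: "0 < s" "s < s0" "Good s w \<zeta>" "s\<^sup>2 * B \<le> 1" for s w \<zeta>
    proof (rule s, intro conjI)
      have "Y (\<lambda>a. e a + w a)" using good e_Y Y_add by (simp add: Good_def)
      then show "((\<lambda>a. of_int (snd a) * Im (DZ \<zeta> a) * (norm (e a + w a))\<^sup>2) has_sum 0) UNIV"
        using E0 by (intro energy_identity[OF Y_real y_le[OF good(3,4)] sol[OF good(3,4)]]) auto
      have "norm (w a) \<le> s\<^sup>2 * B * wt a / (1 + (of_int (snd a))\<^sup>2)" for a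
        using good(3) unfolding Good_def by blast
      then show "\<forall>a. norm (w a) \<le> s\<^sup>2 * B * wt a"
        using wt_le[of "s\<^sup>2 * B"] B0 order_trans by (metis mult_nonneg_nonneg zero_le_power2)
    qed (use good in \<open>auto simp: Good_def\<close>)
    then show ?thesis using s0 by blast
  qed
  have "\<exists>s y b \<tau>. 0 < s \<and> s < \<epsilon> \<and> Y y \<and> y a0 = 1 \<and>
     (\<forall>a. norm (y a) \<le> (E' + 1) * wt a / (1 + (of_int (snd a))\<^sup>2)) \<and> (\<forall>a. norm (y a - e a) \<le> \<epsilon> * wt a) \<and>
     \<bar>b - bs\<bar> < \<epsilon> \<and> \<bar>\<tau> - \<tau>s\<bar> < \<epsilon> \<and> 0 < b \<and> 0 \<le> \<tau> \<and>
     (\<forall>a. D b \<tau> a * y a = - (of_real (\<beta> * s\<^sup>2) * cube y a))" if \<epsilon>: "0 < \<epsilon>" for \<epsilon>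
  proof -
    obtain s0 where s0: "0 < s0" and s0': "\<tau>s = 0 \<Longrightarrow> \<forall>s w \<zeta>. 0 < s \<and> s < s0 \<and> Good s w \<zeta> \<and> s\<^sup>2 * B \<le> 1 \<longrightarrow> 0 < tz \<zeta>"
      using pos by (cases "\<tau>s = 0") (blast, use zero_less_one in blast)
    \<comment> \<open>For \<tau>s > 0 the bound \<delta> <= \<tau>s on the distance keeps the delay
      nonnegative; for \<tau>s = 0 this is the task of \<open>pos\<close>.\<close>
    define \<delta> where "\<delta> = (if \<tau>s = 0 then \<epsilon> else min \<epsilon> \<tau>s)"
    have \<delta>: "0 < \<delta>" "\<delta> \<le> \<epsilon>" "\<tau>s \<noteq> 0 \<Longrightarrow> \<delta> \<le> \<tau>s" using \<epsilon> \<tau>s by (auto simp: \<delta>_def)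
    \<comment> \<open>The three bounds serve, in this order, the hypothesis of
      \<open>fixed_point\<close>, the delay, and b, which moves by at most 3 bs |\<zeta>|.\<close>
    define K where "K = min (r / 2) (min \<delta> (\<delta> / (3 * bs)))"
    have K: "0 < K" "K \<le> r / 2" "K \<le> \<delta>" "3 * bs * K \<le> \<delta>"
    proof -
      have "K \<le> \<delta> / (3 * bs)" unfolding K_def by simp
      then show "3 * bs * K \<le> \<delta>" using bs by (simp add: pos_le_divide_eq mult_ac)
    qed (use cr \<delta> bs in \<open>auto simp: K_def\<close>)
    define s where "s = min (\<epsilon> / 2) (min (s0 / 2) (min 1 (K / (2 * (B + 1)))))"
    have s: "0 < s" "s < \<epsilon>" "s < s0" "s \<le> 1" "s \<le> K / (2 * (B + 1))"
      using \<epsilon> s0 K B0 by (auto simp: s_def)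
    have "s\<^sup>2 * B \<le> s * (B + 1)"
    proof -
      have "s\<^sup>2 \<le> s" using s by (simp add: power2_eq_square mult_left_le)
      then show ?thesis using s B0 by (intro mult_mono) auto
    qed
    also have "\<dots> \<le> K / 2" 
    proof -
      have "0 < 2 * (B + 1)" using B0 by simp
      then have "s * (2 * (B + 1)) \<le> K" using s(5) by (simp only: pos_le_divide_eq)
      then show ?thesis by (simp add: algebra_simps)
    qed
    finally have sB: "s\<^sup>2 * B < K" using K by simp
    then obtain w \<zeta> where good: "Good s w \<zeta>" using ex[of s] K by auto
    have sB1: "s\<^sup>2 * B \<le> 1" using sB K cr by linarith
    have \<zeta>: "norm \<zeta> < K" using good sB unfolding Good_def by linarith
    have "\<bar>bz \<zeta> - bs\<bar> < \<epsilon>"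
    proof -
      have "norm (of_real (exp (Re \<zeta>)) - 1 :: complex) \<le> 3 * norm (of_real (Re \<zeta>) - 0 :: complex)"
        using exp_lipschitz[of "of_real (Re \<zeta>)" 0] complex_Re_le_cmod[of \<zeta>] \<zeta> K cr
        by (simp flip: exp_of_real)
      then have "\<bar>exp (Re \<zeta>) - 1\<bar> \<le> 3 * \<bar>Re \<zeta>\<bar>"
        by (metis diff_zero norm_of_real of_real_1 of_real_diff)
      also have "\<dots> \<le> 3 * norm \<zeta>" using abs_Re_le_cmod[of \<zeta>] by simp
      finally have "bs * \<bar>exp (Re \<zeta>) - 1\<bar> \<le> bs * (3 * norm \<zeta>)" using bs by (intro mult_left_mono) auto
      moreover have "bs * (3 * norm \<zeta>) < bs * (3 * K)" using \<zeta> bs by simp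
      moreover have "bz \<zeta> - bs = bs * (exp (Re \<zeta>) - 1)" by (simp add: bz_def algebra_simps)
      moreover have "\<bar>bz \<zeta> - bs\<bar> = bs * \<bar>exp (Re \<zeta>) - 1\<bar>" unfolding calculation(3) using bs by (simp add: abs_mult)
      ultimately show ?thesis using K \<delta> by linarith
    qed
    moreover have \<tau>d: "\<bar>tz \<zeta> - \<tau>s\<bar> < \<delta>"
    proof -
      have "1 \<le> (of_int m :: real)" using m by simp
      then have "\<bar>Im \<zeta>\<bar> / of_int m \<le> \<bar>Im \<zeta>\<bar> / 1" by (intro divide_left_mono) auto
      then show ?thesis using abs_Im_le_cmod[of \<zeta>] \<zeta> K m by (simp add: tz_def abs_divide)
    qed
    moreover have "0 \<le> tz \<zeta>"
    proof (cases "\<tau>s = 0")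
      case True then show ?thesis using s0'[OF True] s good sB1 by (simp add: less_imp_le)
    next
      case False then show ?thesis using \<tau>d \<delta> by linarith
    qed
    moreover have "Y (\<lambda>a. e a + w a)" "e a0 + w a0 = 1"
    proof -
      have "Y w" "crit a0 \<longrightarrow> w a0 = 0" using good unfolding Good_def by blast+
      then show "Y (\<lambda>a. e a + w a)" "e a0 + w a0 = 1" using e_Y Y_add crit_a0 e_a0 by simp_all
    qed
    moreover have "0 < bz \<zeta>" using bs by (simp add: bz_def)
    moreover have "norm (w a) \<le> \<epsilon> * wt a" for a
    proof -
      have "norm (w a) \<le> s\<^sup>2 * B * wt a / (1 + (of_int (snd a))\<^sup>2)" using good unfolding Good_def by blast
      also have "\<dots> \<le> s\<^sup>2 * B * wt a" using B0 by (intro wt_le) simp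
      also have "\<dots> \<le> \<epsilon> * wt a" using sB K \<delta> wt_pos[of a] by (intro mult_right_mono) auto
      finally show ?thesis .
    qed
    ultimately show ?thesis
      using s \<delta> y_le[OF good sB1] sol[OF good sB1] unfolding DZ_def
      by (intro exI[of _ s] exI[of _ "\<lambda>a. e a + w a"] exI[of _ "bz \<zeta>"] exI[of _ "tz \<zeta>"]) auto
  qed
  then show ?thesis using E0 by (intro exI[of _ "E' + 1"]) auto
qed

end

section \<open>Periodic solutions from Fourier coefficients\<close>

lemma has_vector_derivative_at_shift:
  assumes "(f has_vector_derivative D) (at (t + c))"
  shows "((\<lambda>t. f (t + c)) has_vector_derivative D) (at (t::real))"
proof -
  have "((\<lambda>t. t + c) has_vector_derivative 1) (at t)" by (auto intro!: derivative_eq_intros)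
  from vector_diff_chain_at[OF this assms] show ?thesis by (simp add: o_def)
qed

text \<open>\<open>A_inv\<close> is a definite description, so uniqueness is the content. The
  difference w of two solutions satisfies w'' = w almost everywhere; integrating the derivative
  |w|^2 + |w'|^2 of w . w' over a period gives 0, hence w = 0.\<close>

lemma A_inv_eqI:
  fixes x :: "'e::euclidean_space h2per"
  assumes y: "weak_d2 (h2fun x) y" and r: "\<And>t. r t = y t - h2fun x t"
  shows "A_inv r = x"
proof -
  have ae: "(AE t in lebesgue_on {0..2 * pi}. P t)"
    if "negligible N" "\<And>t. t \<in> {0..2 * pi} - N \<Longrightarrow> P t" for N P
  proof (rule AE_I')
    show "N \<inter> {0..2 * pi} \<in> null_sets (lebesgue_on {0..2 * pi})"
      using that(1) by (simp add: null_sets_restrict_space negligible_iff_null_sets[symmetric] negligible_Int)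
    show "{t \<in> space (lebesgue_on {0..2 * pi}). \<not> P t} \<subseteq> N \<inter> {0..2 * pi}"
      using that(2) by auto
  qed
  have "AE t in lebesgue_on {0..2 * pi}. d2 x t - h2fun x t = r t"
  proof -
    obtain N where "negligible N" "\<forall>t \<in> {0..2 * pi} - N. d2 x t = y t" using d2_spike[OF y] by blast
    then show ?thesis by (intro ae) (auto simp: r)
  qed
  moreover have "z = x" if z: "AE t in lebesgue_on {0..2 * pi}. d2 z t - h2fun z t = r t" for z
  proof -
    define w where "w = z - x"
    have h2w: "h2fun w t = h2fun z t - h2fun x t" for t
    proof -
      have "w = z + (-1) *\<^sub>R x" by (simp add: w_def)
      then have "h2fun w t = h2fun z t + (-1) *\<^sub>R h2fun x t" by (simp only: plus_h2per.rep_eq scaleR_h2per.rep_eq)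
      then show ?thesis by simp
    qed
    have ww: "weak_d2 (h2fun w) (\<lambda>t. d2 z t - d2 x t)"
    proof -
      have "weak_d2 (\<lambda>t. h2fun z t + (-1) *\<^sub>R h2fun x t) (\<lambda>t. d2 z t + (-1) *\<^sub>R d2 x t)"
        by (intro weak_d2_add weak_d2_scaleR weak_d2_d2)
      then show ?thesis by (simp add: h2w[abs_def])
    qed
    have "AE t in lebesgue_on {0..2 * pi}. d2 z t - d2 x t = h2fun w t"
      using z \<open>AE t in lebesgue_on {0..2 * pi}. d2 x t - h2fun x t = r t\<close>
      by eventually_elim (simp add: h2w algebra_simps)
    then obtain N where N: "negligible N" "\<And>t. t \<in> {0..2 * pi} - N \<Longrightarrow> d2 z t - d2 x t = h2fun w t"
    proof (rule AE_E)
      fix N assume "{t \<in> space (lebesgue_on {0..2 * pi}). d2 z t - d2 x t \<noteq> h2fun w t} \<subseteq> N"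
        "emeasure (lebesgue_on {0..2 * pi}) N = 0" "N \<in> sets (lebesgue_on {0..2 * pi})"
      then have "N \<in> null_sets (lebesgue_on {0..2 * pi})" by (intro null_setsI)
      then have "N \<in> null_sets lebesgue" by (simp add: null_sets_restrict_space)
      moreover have "d2 z t - d2 x t = h2fun w t" if "t \<in> {0..2 * pi} - N" for t
        using \<open>{t \<in> space _. _} \<subseteq> N\<close> that by (auto simp: subset_iff)
      ultimately show thesis using that by (simp add: negligible_iff_null_sets)
    qed
    have diff: "(h2fun w has_vector_derivative d1 w t) (at t)" for t
      using weak_d2_d2[of w] vector_derivative_works unfolding weak_d2_def d1_def by blast
    have int: "(h2fun w has_integral (d1 w t - d1 w s)) {s..t}" if "0 \<le> s" "s \<le> t" "t \<le> 2 * pi" for s t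
    proof (rule has_integral_spike[OF N(1)])
      show "((\<lambda>t. d2 z t - d2 x t) has_integral d1 w t - d1 w s) {s..t}"
        using ww that unfolding weak_d2_def d1_def by blast
    qed (use N(2) that in auto)
    \<comment> \<open>The weak second derivative agrees almost everywhere with the continuous
      function w, so w' is an indefinite integral of w and is differentiable in the classical
      sense.\<close>
    have d1': "(d1 w has_vector_derivative h2fun w t) (at t within {0..2 * pi})" if t: "t \<in> {0..2 * pi}" for t
    proof -
      have "((\<lambda>t. d1 w 0 + integral {0..t} (h2fun w)) has_vector_derivative h2fun w t) (at t within {0..2 * pi})"
        using integral_has_vector_derivative[OF h2per_continuous_fun t, of w] by (auto intro!: derivative_eq_intros)
      then show ?thesis
        using integral_unique[OF int[OF order_refl]]
        by (intro has_vector_derivative_transform[OF t, of "d1 w" "\<lambda>t. d1 w 0 + integral {0..t} (h2fun w)"]) auto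
    qed
    have per: "h2fun w (t + 2 * pi) = h2fun w t" for t using h2fun[of w] by (auto simp: H2per_def)
    have d1per: "d1 w (2 * pi) = d1 w 0"
    proof -
      have "((\<lambda>t. h2fun w (t + 2 * pi)) has_vector_derivative d1 w (0 + 2 * pi)) (at 0)"
        by (rule has_vector_derivative_at_shift[OF diff])
      from vector_derivative_unique_at[OF this[unfolded per] diff] show ?thesis by simp
    qed
    have "((\<lambda>t. h2fun w t \<bullet> h2fun w t + d1 w t \<bullet> d1 w t) has_integral
        h2fun w (2 * pi) \<bullet> d1 w (2 * pi) - h2fun w 0 \<bullet> d1 w 0) {0..2 * pi}"
    proof (rule fundamental_theorem_of_calculus)
      fix t assume t: "t \<in> {0..2 * pi}"
      from bounded_bilinear.has_vector_derivative[OF bounded_bilinear_inner has_vector_derivative_at_within[OF diff] d1'[OF t]]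
      show "((\<lambda>t. h2fun w t \<bullet> d1 w t) has_vector_derivative h2fun w t \<bullet> h2fun w t + d1 w t \<bullet> d1 w t)
          (at t within {0..2 * pi})" by simp
    qed simp
    moreover have "h2fun w (2 * pi) = h2fun w 0" using per[of 0] by simp
    ultimately have zero: "((\<lambda>t. h2fun w t \<bullet> h2fun w t + d1 w t \<bullet> d1 w t) has_integral 0) {0..2 * pi}"
      by (simp add: d1per)
    then have "integral {0..2 * pi} (\<lambda>t. h2fun w t \<bullet> h2fun w t + d1 w t \<bullet> d1 w t) = 0" by (rule integral_unique)
    moreover have "integral {0..2 * pi} (\<lambda>t. h2fun w t \<bullet> h2fun w t) \<le>
        integral {0..2 * pi} (\<lambda>t. h2fun w t \<bullet> h2fun w t + d1 w t \<bullet> d1 w t)"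
      by (intro integral_le h2_parts_integrable) (use zero in auto)
    moreover have "integral {0..2 * pi} (\<lambda>t. h2fun w t \<bullet> h2fun w t) \<ge> 0"
      by (intro integral_nonneg h2_parts_integrable) simp
    ultimately have w0: "integral {0..2 * pi} (\<lambda>t. h2fun w t \<bullet> h2fun w t) = 0"
      and wd0: "integral {0..2 * pi} (\<lambda>t. h2fun w t \<bullet> h2fun w t + d1 w t \<bullet> d1 w t) = 0" by linarith+
    have h0: "h2fun w t = 0" if "t \<in> {0..2 * pi}" for t
      using that w0 by (subst (asm) integral_eq_0_iff) (auto intro!: continuous_on_inner h2per_continuous_fun)
    have d0: "d1 w t = 0" if "t \<in> {0..2 * pi}" for t
      using that wd0 by (subst (asm) integral_eq_0_iff)
        (auto intro!: continuous_on_inner continuous_on_add h2per_continuous_fun h2per_continuous_d1 simp: add_nonneg_eq_0_iff)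
    \<comment> \<open>The norm also involves \<open>d2 w\<close>, which is known almost everywhere
      only: off the two null sets it equals w, which is 0.\<close>
    have "norm w = 0"
    proof -
      obtain M where M: "negligible M" "\<forall>t \<in> {0..2 * pi} - M. d2 w t = d2 z t - d2 x t" using d2_spike[OF ww] by blast
      have "inner w w = integral {0..2 * pi} (\<lambda>t. 0)" unfolding inner_h2per_def
        by (rule integral_spike[OF negligible_Un[OF M(1) N(1)]]) (use M(2) N(2) h0 d0 in auto)
      then show ?thesis by (simp add: norm_h2per_def)
    qed
    then show ?thesis by (simp add: w_def)
  qed
  ultimately show ?thesis unfolding A_inv_def by (rule the_equality)
qed

lemma classical_h2per:
  fixes X :: "real \<Rightarrow> 'e::euclidean_space"
  assumes d1: "\<And>t. (X has_vector_derivative X' t) (at t)"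
    and d2: "\<And>t. (X' has_vector_derivative X'' t) (at t)"
    and cont: "continuous_on UNIV X''" and per: "\<And>t. X (t + 2 * pi) = X t"
  shows "weak_d2 X X''" "X \<in> H2per" "h2fun (Abs_h2per X) = X" "d1 (Abs_h2per X) = X'"
proof -
  have per1: "X' (t + 2 * pi) = X' t" for t
  proof -
    have "((\<lambda>t. X (t + 2 * pi)) has_vector_derivative X' (t + 2 * pi)) (at t)"
      by (rule has_vector_derivative_at_shift[OF d1])
    from vector_derivative_unique_at[OF this[unfolded per] d1] show ?thesis .
  qed
  have per2: "X'' (t + 2 * pi) = X'' t" for t
  proof -
    have "((\<lambda>t. X' (t + 2 * pi)) has_vector_derivative X'' (t + 2 * pi)) (at t)"
      by (rule has_vector_derivative_at_shift[OF d2])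
    from vector_derivative_unique_at[OF this[unfolded per1] d2] show ?thesis .
  qed
  have vd: "vector_derivative X (at t) = X' t" for t by (rule vector_derivative_at[OF d1])
  have "X'' \<in> L2per"
    unfolding L2per_def
  proof (intro CollectI conjI allI per2)
    show "X'' \<in> borel_measurable lebesgue"
      using borel_measurable_continuous_onI[OF cont] by (simp add: measurable_completion)
    show "(\<lambda>t. (norm (X'' t))\<^sup>2) integrable_on {0..2 * pi}"
      by (intro integrable_continuous_real continuous_intros continuous_on_subset[OF cont]) auto
  qed
  moreover have "(X'' has_integral X' t - X' s) {s..t}" if "s \<le> t" for s t
    using that by (intro fundamental_theorem_of_calculus has_vector_derivative_at_within[OF d2])
  ultimately show w: "weak_d2 X X''"
    unfolding weak_d2_def vd using differentiableI_vector[OF d1] by blast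
  then show X: "X \<in> H2per" using per unfolding H2per_def by blast
  then show h: "h2fun (Abs_h2per X) = X" by (rule Abs_h2per_inverse)
  show "d1 (Abs_h2per X) = X'" unfolding d1_def[abs_def] h vd by simp
qed

text \<open>Three squares integrated over a period give at most 6 pi C^2 <= 25 C^2.\<close>

lemma norm_h2per_le:
  fixes x :: "'e::euclidean_space h2per"
  assumes w: "weak_d2 (h2fun x) y" and b: "\<And>t. norm (y t) \<le> C" "\<And>t. norm (d1 x t) \<le> C" "\<And>t. norm (h2fun x t) \<le> C"
  shows "norm x \<le> 5 * C"
proof -
  have C: "0 \<le> C" using b(3)[of 0] norm_ge_zero order_trans by blast
  obtain N where N: "negligible N" "\<forall>t \<in> {0..2 * pi} - N. d2 x t = y t" using d2_spike[OF w] by blast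
  have "inner x x = integral {0..2 * pi} (h2_inner_integrand x x)"
    by (simp add: inner_h2per_def h2_inner_integrand_def[abs_def])
  also have "\<dots> = integral {0..2 * pi} (\<lambda>t. if t \<in> N then 0 else h2_inner_integrand x x t)"
    by (rule integral_spike[OF N(1)]) auto
  also have "\<dots> \<le> integral {0..2 * pi} (\<lambda>t. 3 * C\<^sup>2)"
  proof (rule integral_le)
    show "(\<lambda>t. if t \<in> N then 0 else h2_inner_integrand x x t) integrable_on {0..2 * pi}"
      by (rule integrable_spike[OF h2_integrable N(1)]) auto
    fix t assume "t \<in> {0..2 * pi}"
    have "(norm (y t))\<^sup>2 \<le> C\<^sup>2" "(norm (d1 x t))\<^sup>2 \<le> C\<^sup>2" "(norm (h2fun x t))\<^sup>2 \<le> C\<^sup>2"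
      using b by (auto intro!: power_mono)
    then show "(if t \<in> N then 0 else h2_inner_integrand x x t) \<le> 3 * C\<^sup>2"
      using N(2) \<open>t \<in> _\<close> by (auto simp: h2_inner_integrand_def dot_square_norm)
  qed auto
  also have "\<dots> = 6 * pi * C\<^sup>2" by simp
  also have "\<dots> \<le> (5 * C)\<^sup>2" using pi_less_4 mult_right_mono[of "6 * pi" 25 "C\<^sup>2"] by (simp add: power_mult_distrib)
  finally show ?thesis using C by (simp add: norm_h2per_def real_le_lsqrt)
qed

section \<open>Characters of the index ring and Fourier synthesis\<close>

definition chi :: "'n::finite mod_ring \<Rightarrow> 'n mod_ring \<Rightarrow> complex" where
  "chi j \<kappa> = cis (2 * pi * of_int (to_int_mod_ring j * to_int_mod_ring \<kappa>) / real CARD('n))"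

lemma cis_cong_mod:
  fixes x y n :: int
  assumes "x mod n = y mod n" "0 < n"
  shows "cis (2 * pi * of_int x / of_int n) = cis (2 * pi * of_int y / of_int n)"
proof -
  obtain k where k: "x = y + n * k" using assms(1) by (metis mod_eqE)
  have "2 * pi * of_int x / of_int n = 2 * pi * of_int y / of_int n + 2 * pi * of_int k"
    using assms(2) by (simp add: k field_simps)
  then show ?thesis by (simp add: cis_multiple_2pi flip: cis_mult)
qed

lemma to_int_mod_ring_plus:
  "to_int_mod_ring (i + j) = (to_int_mod_ring i + to_int_mod_ring j) mod int CARD('n)" for i j :: "'n::finite mod_ring"
  by transfer simp

lemma to_int_mod_ring_of_int:
  "to_int_mod_ring (of_int_mod_ring x :: 'n::finite mod_ring) = x mod int CARD('n)"
  by transfer simp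

lemma chi_commute: "chi j \<kappa> = chi \<kappa> j" by (simp add: chi_def mult.commute)

lemma chi_of_int: "chi (of_int_mod_ring x) (\<kappa> :: 'n::finite mod_ring) = cis (2 * pi * of_int (x * to_int_mod_ring \<kappa>) / real CARD('n))"
proof -
  have "(x mod int CARD('n) * to_int_mod_ring \<kappa>) mod int CARD('n) = (x * to_int_mod_ring \<kappa>) mod int CARD('n)"
    by (rule mod_mult_left_eq)
  from cis_cong_mod[OF this] show ?thesis unfolding chi_def to_int_mod_ring_of_int by simp
qed

lemma chi_add: "chi (i + j) (\<kappa> :: 'n::finite mod_ring) = chi i \<kappa> * chi j \<kappa>"
proof -
  have "((to_int_mod_ring i + to_int_mod_ring j) mod int CARD('n) * to_int_mod_ring \<kappa>) mod int CARD('n) =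
      (to_int_mod_ring i * to_int_mod_ring \<kappa> + to_int_mod_ring j * to_int_mod_ring \<kappa>) mod int CARD('n)"
    unfolding mod_mult_left_eq by (simp add: distrib_right)
  from cis_cong_mod[OF this] show ?thesis unfolding chi_def to_int_mod_ring_plus
    by (simp add: cis_mult add_divide_distrib distrib_left)
qed

lemma chi_add_right: "chi j (\<kappa> + \<mu>) = chi j \<kappa> * chi j \<mu>"
  using chi_add[of \<kappa> \<mu> j] by (simp add: chi_commute)

lemma norm_chi [simp]: "norm (chi j \<kappa>) = 1" by (simp add: chi_def)

lemma chi_nonzero [simp]: "chi j \<kappa> \<noteq> 0" by (simp add: chi_def)

lemma chi_0 [simp]: "chi 0 \<kappa> = 1"
  using chi_add[of 0 0 \<kappa>] by simp

lemma chi_0_right [simp]: "chi j 0 = 1"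
  using chi_0[of j] by (simp add: chi_commute)

lemma chi_minus: "chi (- j) \<kappa> = cnj (chi j \<kappa>)"
proof -
  have "chi (- j) \<kappa> * chi j \<kappa> = 1" using chi_add[of "- j" j \<kappa>] by simp
  moreover have "cnj (chi j \<kappa>) * chi j \<kappa> = 1"
    using complex_norm_square[of "chi j \<kappa>"] by (simp add: mult.commute)
  ultimately show ?thesis by (metis chi_nonzero mult_right_cancel)
qed

lemma chi_minus_right: "chi j (- \<kappa>) = cnj (chi j \<kappa>)"
  using chi_minus[of \<kappa> j] by (simp add: chi_commute)

text \<open>For fixed \<kappa> and t this is a character of the index group in its last argument, so
  that synthesis turns \<open>conv\<close> into pointwise products.\<close>

definition chr :: "'n::finite mod_ring \<Rightarrow> real \<Rightarrow> 'n mod_ring \<times> int \<Rightarrow> complex" where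
  "chr \<kappa> t a = chi (fst a) \<kappa> * cis (of_int (snd a) * t)"

lemma norm_chr [simp]: "norm (chr \<kappa> t a) = 1" by (simp add: chr_def norm_mult)

lemma chr_add: "chr \<kappa> t (a + b) = chr \<kappa> t a * chr \<kappa> t b"
  by (simp add: chr_def chi_add cis_mult[symmetric] distrib_right)

lemma chr_minus: "chr \<kappa> t (- a) = cnj (chr \<kappa> t a)"
  by (simp add: chr_def chi_minus cis_cnj)

definition synth :: "('n::finite mod_ring \<times> int \<Rightarrow> complex) \<Rightarrow> 'n mod_ring \<Rightarrow> real \<Rightarrow> complex" where
  "synth z \<kappa> t = (\<Sum>\<^sub>\<infinity>a. z a * chr \<kappa> t a)"

lemma synth_has_sum:
  fixes z :: "'n::finite mod_ring \<times> int \<Rightarrow> complex"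
  assumes "(\<lambda>a. norm (z a)) summable_on UNIV"
  shows "((\<lambda>a. z a * chr \<kappa> t a) has_sum synth z \<kappa> t) UNIV"
  unfolding synth_def
proof (rule has_sum_infsum, rule abs_summable_summable)
  show "(\<lambda>a. norm (z a * chr \<kappa> t a)) summable_on UNIV" using assms by (simp add: norm_mult)
qed

lemma norm_synth_le:
  fixes z :: "'n::finite mod_ring \<times> int \<Rightarrow> complex"
  assumes "\<And>a. norm (z a) \<le> h a" "h summable_on UNIV"
  shows "norm (synth z \<kappa> t) \<le> (\<Sum>\<^sub>\<infinity>a. h a)"
proof -
  have s: "(\<lambda>a. norm (z a)) summable_on UNIV"
    by (rule summable_on_comparison_test[OF assms(2,1)]) simp
  have "norm (synth z \<kappa> t) \<le> (\<Sum>\<^sub>\<infinity>a. norm (z a * chr \<kappa> t a))"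
    unfolding synth_def by (rule norm_infsum_bound) (use s in \<open>simp add: norm_mult\<close>)
  also have "\<dots> \<le> (\<Sum>\<^sub>\<infinity>a. h a)"
    by (rule infsum_mono) (use assms s in \<open>auto simp: norm_mult\<close>)
  finally show ?thesis .
qed

text \<open>Mean value inequality along the segment from 0 to ix, on which the derivative exp z - 1
  is at most 3 |x|.\<close>

lemma norm_cis_remainder: "norm (cis x - 1 - \<i> * of_real x) \<le> 3 * x\<^sup>2"
proof -
  have "norm ((exp (\<i> * of_real x) - 1 - \<i> * of_real x) - (exp 0 - 1 - 0)) \<le> (3 * \<bar>x\<bar>) * norm (\<i> * of_real x - 0)"
  proof (rule field_differentiable_bound[where S = "closed_segment 0 (\<i> * of_real x)" and f' = "\<lambda>z. exp z - 1"])
    fix z assume "z \<in> closed_segment 0 (\<i> * of_real x)"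
    then obtain u where u: "0 \<le> u" "u \<le> 1" "z = of_real u * (\<i> * of_real x)"
      by (auto simp: closed_segment_def scaleR_conv_of_real)
    have "norm z \<le> \<bar>x\<bar>" using u by (simp add: norm_mult mult_left_le_one_le)
    moreover have "norm (exp z - exp 0) \<le> 3 * norm (z - 0)" using u by (intro exp_lipschitz) auto
    ultimately show "norm (exp z - 1) \<le> 3 * \<bar>x\<bar>" by simp
  qed (auto intro!: derivative_eq_intros)
  then show ?thesis by (simp add: cis_conv_exp norm_mult power2_eq_square mult.commute)
qed

text \<open>Termwise differentiation through the quadratic remainder of \<open>cis\<close>: summed
  over all indices, it bounds the error of the linear approximation by C (u - t)^2, with C finite by
  the assumption.\<close>

lemma synth_has_vector_derivative:
  fixes z :: "'n::finite mod_ring \<times> int \<Rightarrow> complex"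
  assumes s: "(\<lambda>a. norm (z a) * (1 + (of_int (snd a))\<^sup>2)) summable_on UNIV"
  shows "(synth z \<kappa> has_vector_derivative synth (\<lambda>a. \<i> * of_int (snd a) * z a) \<kappa> t) (at t)"
proof -
  let ?z' = "\<lambda>a. \<i> * of_int (snd a) * z a" and ?C = "\<Sum>\<^sub>\<infinity>a. 3 * (norm (z a) * (1 + (of_int (snd a))\<^sup>2))"
  have k: "\<bar>of_int k\<bar> \<le> 1 + (of_int k :: real)\<^sup>2" "1 \<le> 1 + (of_int k :: real)\<^sup>2" for k :: int
    using zero_le_power2[of "\<bar>of_int k\<bar> - 1 / 2 :: real"] by (simp_all add: power2_eq_square algebra_simps)
  have s0: "(\<lambda>a. norm (z a)) summable_on UNIV"
    by (rule summable_on_comparison_test[OF s]) (use mult_left_mono[OF k(2) norm_ge_zero] in auto)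
  have s1: "(\<lambda>a. norm (?z' a)) summable_on UNIV"
  proof (rule summable_on_comparison_test[OF s])
    fix a :: "'n mod_ring \<times> int"
    show "norm (?z' a) \<le> norm (z a) * (1 + (of_int (snd a))\<^sup>2)"
      using mult_left_mono[OF k(1)[of "snd a"] norm_ge_zero[of "z a"]] by (simp add: norm_mult mult.commute)
  qed simp
  have bound: "norm (synth z \<kappa> u - synth z \<kappa> t - (u - t) *\<^sub>R synth ?z' \<kappa> t) \<le> ?C * (u - t)\<^sup>2" for u
  proof -
    let ?r = "\<lambda>a. z a * chr \<kappa> u a + - (z a * chr \<kappa> t a) + - (of_real (u - t) * (?z' a * chr \<kappa> t a))"
    have "(?r has_sum (synth z \<kappa> u + - synth z \<kappa> t + - (of_real (u - t) * synth ?z' \<kappa> t))) UNIV"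
    proof (intro has_sum_add synth_has_sum[OF s0])
      show "((\<lambda>a. - (z a * chr \<kappa> t a)) has_sum - synth z \<kappa> t) UNIV"
        using synth_has_sum[OF s0] by (simp only: has_sum_uminus minus_minus)
      show "((\<lambda>a. - (of_real (u - t) * (?z' a * chr \<kappa> t a))) has_sum - (of_real (u - t) * synth ?z' \<kappa> t)) UNIV"
        using has_sum_cmult_right[OF synth_has_sum[OF s1]] by (simp only: has_sum_uminus minus_minus)
    qed
    moreover have r: "norm (?r a) \<le> 3 * (norm (z a) * (1 + (of_int (snd a))\<^sup>2)) * (u - t)\<^sup>2" for a
    proof -
      let ?k = "of_int (snd a) :: real"
      have "chr \<kappa> u a = chr \<kappa> t a * cis (?k * (u - t))"
        by (simp add: chr_def cis_mult right_diff_distrib)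
      then have "?r a = z a * chr \<kappa> t a * (cis (?k * (u - t)) - 1 - \<i> * of_real (?k * (u - t)))"
        by (simp add: algebra_simps)
      then have "norm (?r a) = norm (z a) * norm (cis (?k * (u - t)) - 1 - \<i> * of_real (?k * (u - t)))"
        by (simp only: norm_mult norm_chr mult_1_right)
      also have "\<dots> \<le> norm (z a) * (3 * (?k * (u - t))\<^sup>2)"
        by (rule mult_left_mono[OF norm_cis_remainder norm_ge_zero])
      also have "\<dots> = 3 * (norm (z a) * ?k\<^sup>2) * (u - t)\<^sup>2" by (simp add: power_mult_distrib)
      also have "\<dots> \<le> 3 * (norm (z a) * (1 + ?k\<^sup>2)) * (u - t)\<^sup>2" by (intro mult_right_mono mult_left_mono) auto
      finally show ?thesis .
    qed
    have sr: "(\<lambda>a. 3 * (norm (z a) * (1 + (of_int (snd a))\<^sup>2)) * (u - t)\<^sup>2) summable_on UNIV"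
      by (intro summable_on_cmult_left summable_on_cmult_right s)
    have "norm (synth z \<kappa> u + - synth z \<kappa> t + - (of_real (u - t) * synth ?z' \<kappa> t)) \<le>
        (\<Sum>\<^sub>\<infinity>a. 3 * (norm (z a) * (1 + (of_int (snd a))\<^sup>2)) * (u - t)\<^sup>2)"
      by (rule norm_infsum_le[OF calculation has_sum_infsum[OF sr] r])
    then show ?thesis
      by (simp add: scaleR_conv_of_real infsum_cmult_left')
  qed
  show ?thesis
    unfolding has_vector_derivative_def has_derivative_iff_norm
  proof (intro conjI bounded_linear_scaleR_left)
    show "((\<lambda>u. norm (synth z \<kappa> u - synth z \<kappa> t - (u - t) *\<^sub>R synth ?z' \<kappa> t) / norm (u - t)) \<longlongrightarrow> 0) (at t)"
    proof (rule Lim_null_comparison)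
      show "\<forall>\<^sub>F u in at t. norm (norm (synth z \<kappa> u - synth z \<kappa> t - (u - t) *\<^sub>R synth ?z' \<kappa> t) / norm (u - t)) \<le> ?C * \<bar>u - t\<bar>"
      proof (rule eventually_at_topological[THEN iffD2], intro exI[of _ UNIV] conjI ballI impI)
        fix u assume "u \<noteq> t"
        then show "norm (norm (synth z \<kappa> u - synth z \<kappa> t - (u - t) *\<^sub>R synth ?z' \<kappa> t) / norm (u - t)) \<le> ?C * \<bar>u - t\<bar>"
          using bound[of u] by (simp add: divide_le_eq power2_eq_square mult.assoc abs_mult_self_eq)
      qed auto
      have "((\<lambda>u. ?C * \<bar>u - t\<bar>) \<longlongrightarrow> ?C * \<bar>t - t\<bar>) (at t)" by (intro tendsto_intros)
      then show "((\<lambda>u. ?C * \<bar>u - t\<bar>) \<longlongrightarrow> 0) (at t)" by simp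
    qed
  qed
qed

lemma synth_real:
  fixes z :: "'n::finite mod_ring \<times> int \<Rightarrow> complex"
  assumes "\<And>a. z (- a) = cnj (z a)"
  shows "synth z \<kappa> t = of_real (Re (synth z \<kappa> t))"
proof -
  have "cnj (synth z \<kappa> t) = (\<Sum>\<^sub>\<infinity>a. z (0 - a) * chr \<kappa> t (0 - a))"
    unfolding synth_def infsum_cnj[symmetric] using assms by (simp add: chr_minus)
  also have "\<dots> = synth z \<kappa> t"
    unfolding synth_def by (rule infsum_minus_left[where f = "\<lambda>a. z a * chr \<kappa> t a"])
  finally show ?thesis by (simp add: complex_eq_iff)
qed

lemma synth_cube:
  fixes z :: "'n::finite mod_ring \<times> int \<Rightarrow> complex"
  assumes "decays M z"
  shows "synth (cube z) \<kappa> t = (synth z \<kappa> t) ^ 3"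
  unfolding synth_def cube_def
  by (subst infsum_conv_char[OF assms decays_conv[OF assms assms] norm_chr chr_add],
      subst infsum_conv_char[OF assms assms norm_chr chr_add])
    (simp add: power3_eq_cube)

lemma synth_periodic: "synth z \<kappa> (t + 2 * pi) = synth z \<kappa> t"
proof -
  have "cis (of_int k * (t + 2 * pi)) = cis (of_int k * t)" for k
    using cis_multiple_2pi[of "of_int k"] by (simp add: distrib_left mult.commute flip: cis_mult)
  then show ?thesis by (simp add: synth_def chr_def)
qed

lemma has_vector_derivative_vec_lambda:
  fixes f :: "'k::finite \<Rightarrow> real \<Rightarrow> real"
  assumes "\<And>\<kappa>. (f \<kappa> has_vector_derivative f' \<kappa>) (at t)"
  shows "((\<lambda>t. \<chi> \<kappa>. f \<kappa> t) has_vector_derivative (\<chi> \<kappa>. f' \<kappa>)) (at t)"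
proof -
  have eq: "(\<chi> \<kappa>. h \<kappa>) = (\<Sum>\<kappa>\<in>UNIV. h \<kappa> *\<^sub>R axis \<kappa> 1)" for h :: "'k \<Rightarrow> real"
    by (simp add: vec_eq_iff axis_def if_distrib[of "\<lambda>x. _ * x"] cong: if_cong)
  have "((\<lambda>t. \<Sum>\<kappa>\<in>UNIV. f \<kappa> t *\<^sub>R (axis \<kappa> 1 :: real ^ 'k)) has_vector_derivative (\<Sum>\<kappa>\<in>UNIV. f' \<kappa> *\<^sub>R axis \<kappa> 1)) (at t)"
  proof (intro has_vector_derivative_sum)
    fix \<kappa>
    show "((\<lambda>t. f \<kappa> t *\<^sub>R (axis \<kappa> 1 :: real ^ 'k)) has_vector_derivative f' \<kappa> *\<^sub>R axis \<kappa> 1) (at t)"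
      using bounded_linear.has_vector_derivative[OF bounded_linear_scaleR_left assms] .
  qed
  then show ?thesis unfolding eq .
qed

lemma dde_solution:
  fixes x x' x'' :: "'n::finite mod_ring \<Rightarrow> real \<Rightarrow> real"
  assumes d1: "\<And>\<kappa> t. (x \<kappa> has_vector_derivative x' \<kappa> t) (at t)"
    and d2: "\<And>\<kappa> t. (x' \<kappa> has_vector_derivative x'' \<kappa> t) (at t)"
    and per: "\<And>\<kappa> t. x \<kappa> (t + 2 * pi) = x \<kappa> t"
    and eq: "\<And>\<kappa> t. x'' \<kappa> t = - (a + \<delta>) * x' \<kappa> t - a * \<delta> * x \<kappa> t - b * x \<kappa> (t - \<tau>)
       + c * (x (\<kappa> + of_int_mod_ring 1) (t - \<tau>\<^sub>c) - 2 * x \<kappa> t + x (\<kappa> - of_int_mod_ring 1) (t - \<tau>\<^sub>c)) - \<beta> * x \<kappa> t ^ 3"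
    and bound: "\<And>\<kappa> t. \<bar>x \<kappa> t\<bar> \<le> C" "\<And>\<kappa> t. \<bar>x' \<kappa> t\<bar> \<le> C" "\<And>\<kappa> t. \<bar>x'' \<kappa> t\<bar> \<le> C"
  defines "X \<equiv> Abs_h2per (\<lambda>t. \<chi> \<kappa>. x \<kappa> t)"
  shows "h2fun X = (\<lambda>t. \<chi> \<kappa>. x \<kappa> t)" "Psi a \<delta> c \<beta> \<tau>\<^sub>c (b, \<tau>) X = 0" "norm X \<le> 5 * (real CARD('n) * C)"
proof -
  \<comment> \<open>The equation itself expresses x'' by continuous functions.\<close>
  have cont: "continuous_on UNIV (x'' \<kappa>)" for \<kappa>
  proof -
    have cx: "continuous_on UNIV (x \<kappa>)" for \<kappa>
      using d1 differentiable_imp_continuous_on differentiableI_vector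
      by (metis differentiable_at_imp_differentiable_on)
    have cx': "continuous_on UNIV (x' \<kappa>)" for \<kappa>
      using d2 differentiable_imp_continuous_on differentiableI_vector
      by (metis differentiable_at_imp_differentiable_on)
    have sh: "continuous_on UNIV (\<lambda>t. x \<kappa> (t - h))" for h \<kappa>
      by (rule continuous_on_compose2[OF cx]) (auto intro!: continuous_intros)
    show ?thesis unfolding eq by (intro continuous_intros cx cx' sh)
  qed
  note D1 = has_vector_derivative_vec_lambda[OF d1] and D2 = has_vector_derivative_vec_lambda[OF d2]
  have C: "continuous_on UNIV (\<lambda>t. \<chi> \<kappa>. x'' \<kappa> t)" by (intro continuous_on_vec_lambda cont)
  have P: "(\<chi> \<kappa>. x \<kappa> (t + 2 * pi)) = (\<chi> \<kappa>. x \<kappa> t)" for t by (simp add: per)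
  note cl = classical_h2per[of "\<lambda>t. \<chi> \<kappa>. x \<kappa> t", OF D1 D2 C P, folded X_def]
  show h: "h2fun X = (\<lambda>t. \<chi> \<kappa>. x \<kappa> t)" by (rule cl(3))
  have "A_inv (\<lambda>t. F_rhs a \<delta> c \<beta> \<tau>\<^sub>c (b, \<tau>) X t - h2fun X t) = X"
  proof (rule A_inv_eqI)
    show "weak_d2 (h2fun X) (\<lambda>t. \<chi> \<kappa>. x'' \<kappa> t)" unfolding h by (rule cl(1))
    show "F_rhs a \<delta> c \<beta> \<tau>\<^sub>c (b, \<tau>) X t - h2fun X t = (\<chi> \<kappa>. x'' \<kappa> t) - h2fun X t" for t
      unfolding F_rhs_def prod.case cl(3,4) eq by simp
  qed
  then show "Psi a \<delta> c \<beta> \<tau>\<^sub>c (b, \<tau>) X = 0" by (simp add: Psi_def)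
  have nv: "norm (\<chi> \<kappa>::'n mod_ring. f \<kappa>) \<le> real CARD('n) * C" if "\<And>\<kappa>. \<bar>f \<kappa>\<bar> \<le> C" for f :: "'n mod_ring \<Rightarrow> real"
    using norm_le_l1_cart[of "\<chi> \<kappa>. f \<kappa>"] sum_mono[of UNIV "\<lambda>\<kappa>. \<bar>f \<kappa>\<bar>" "\<lambda>_. C"] that by simp
  show "norm X \<le> 5 * (real CARD('n) * C)"
  proof (rule norm_h2per_le)
    show "weak_d2 (h2fun X) (\<lambda>t. \<chi> \<kappa>. x'' \<kappa> t)" unfolding h by (rule cl(1))
  qed (simp_all only: cl(3,4) nv bound)
qed

lemma inverse_square_summable: "(\<lambda>a :: 'i::finite \<times> int. 1 / (1 + (of_int (snd a))\<^sup>2) :: real) summable_on UNIV"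
proof -
  have "summable (\<lambda>n::nat. 1 / (1 + (real n)\<^sup>2))"
  proof (rule summable_comparison_test_ev)
    show "summable (\<lambda>n. inverse ((real n)\<^sup>2))"
      using inverse_power_summable[of 2, where 'a = real] by simp
    show "\<forall>\<^sub>F n in sequentially. norm (1 / (1 + (real n)\<^sup>2)) \<le> inverse ((real n)\<^sup>2)"
      unfolding eventually_sequentially
      by (intro exI[of _ 1]) (simp add: inverse_eq_divide frac_le)
  qed
  then have "(\<lambda>n::nat. 1 / (1 + (real n)\<^sup>2)) summable_on UNIV"
    by (intro summable_nonneg_imp_summable_on) auto
  then have int: "(\<lambda>k::int. 1 / (1 + (of_int k)\<^sup>2) :: real) summable_on UNIV"
    by (intro summable_on_int_iff_nat) auto
  have "(\<lambda>a :: 'i \<times> int. 1 / (1 + (of_int (snd a))\<^sup>2) :: real) summable_on (UNIV \<times> UNIV)"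
  proof (rule summable_on_SigmaI)
    fix x :: 'i
    show "((\<lambda>y. 1 / (1 + (of_int (snd (x, y)))\<^sup>2)) has_sum (\<Sum>\<^sub>\<infinity>k::int. 1 / (1 + (of_int k)\<^sup>2) :: real)) UNIV"
      unfolding snd_conv by (rule has_sum_infsum[OF int])
  qed auto
  then show ?thesis by simp
qed

text \<open>Delta at \<nu> = ik without the feedback term. The angle enters through the real part of
  a character, so the formula makes sense for every class j and every sign of k, and it takes the
  same value at j and -j.\<close>

definition gcoef :: "real \<Rightarrow> real \<Rightarrow> real \<Rightarrow> real \<Rightarrow> 'n::finite mod_ring \<times> int \<Rightarrow> complex" where
  "gcoef a \<delta> c \<tau>\<^sub>c q = - (of_int (snd q))\<^sup>2 + \<i> * of_real (a + \<delta>) * of_int (snd q) + of_real (a * \<delta>) + 2 * of_real c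
     - 2 * of_real c * of_real (Re (chi (fst q) (of_int_mod_ring 1))) * cis (- (of_int (snd q) * \<tau>\<^sub>c))"

text \<open>Division by the symbol has gained two powers of k, so the coefficients decay like k^-6
  and the series may be differentiated twice term by term. The delay equation is then the
  coefficient equation summed against \<open>chr\<close>.\<close>

lemma realization:
  fixes z :: "'n::finite mod_ring \<times> int \<Rightarrow> complex"
  assumes real: "\<And>q. z (- q) = cnj (z q)"
    and bound: "\<And>q. norm (z q) \<le> M * wt q / (1 + (of_int (snd q))\<^sup>2)" and M: "0 \<le> M"
    and eq: "\<And>q. (gcoef a \<delta> c \<tau>\<^sub>c q + of_real b * cis (- (of_int (snd q) * \<tau>))) * z q = - (of_real \<beta> * cube z q)"
  defines "x \<equiv> \<lambda>\<kappa> t. Re (synth z \<kappa> t)"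
  shows "\<exists>x' x''. (\<forall>\<kappa> t. (x \<kappa> has_vector_derivative x' \<kappa> t) (at t)) \<and> (\<forall>\<kappa> t. (x' \<kappa> has_vector_derivative x'' \<kappa> t) (at t)) \<and>
     (\<forall>\<kappa> t. x \<kappa> (t + 2 * pi) = x \<kappa> t) \<and>
     (\<forall>\<kappa> t. x'' \<kappa> t = - (a + \<delta>) * x' \<kappa> t - a * \<delta> * x \<kappa> t - b * x \<kappa> (t - \<tau>)
       + c * (x (\<kappa> + of_int_mod_ring 1) (t - \<tau>\<^sub>c) - 2 * x \<kappa> t + x (\<kappa> - of_int_mod_ring 1) (t - \<tau>\<^sub>c)) - \<beta> * x \<kappa> t ^ 3) \<and>
     (\<forall>\<kappa> t. \<bar>x \<kappa> t\<bar> \<le> M * (\<Sum>\<^sub>\<infinity>q::'n mod_ring \<times> int. wt q) \<and> \<bar>x' \<kappa> t\<bar> \<le> M * (\<Sum>\<^sub>\<infinity>q::'n mod_ring \<times> int. wt q) \<and> \<bar>x'' \<kappa> t\<bar> \<le> M * (\<Sum>\<^sub>\<infinity>q::'n mod_ring \<times> int. wt q))"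
proof -
  let ?W = "\<Sum>\<^sub>\<infinity>q::'n mod_ring \<times> int. wt q"
  define z1 where "z1 q = \<i> * of_int (snd q) * z q" for q
  define z2 where "z2 q = \<i> * of_int (snd q) * z1 q" for q
  have k: "\<bar>of_int k\<bar> \<le> 1 + (of_int k :: real)\<^sup>2" "1 \<le> 1 + (of_int k :: real)\<^sup>2" for k :: int
    using zero_le_power2[of "\<bar>of_int k\<bar> - 1 / 2 :: real"] by (simp_all add: power2_eq_square algebra_simps)
  have pull: "norm (z q) * X \<le> M * wt q" if "X \<le> 1 + (of_int (snd q))\<^sup>2" for X q
  proof -
    have "norm (z q) * X \<le> norm (z q) * (1 + (of_int (snd q))\<^sup>2)" using that by (rule mult_left_mono) simp
    also have "\<dots> \<le> M * wt q" using bound[of q] k(2)[of "snd q"] by (simp add: pos_le_divide_eq)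
    finally show ?thesis .
  qed
  have b0: "norm (z q) \<le> M * wt q" for q using pull[OF k(2)] by simp
  have b1: "norm (z1 q) \<le> M * wt q" for q using pull[OF k(1), of q] by (simp add: z1_def norm_mult mult.commute)
  have b2: "norm (z2 q) \<le> M * wt q" for q
    using pull[of "(of_int (snd q))\<^sup>2" q] by (simp add: z2_def z1_def norm_mult power2_eq_square mult_ac)
  have dz: "decays M z" unfolding decays_def using b0 by blast
  have Mws: "(\<lambda>q::'n mod_ring \<times> int. M * wt q) summable_on UNIV" by (intro summable_on_cmult_right wt_summable)
  have Mwsum: "(\<Sum>\<^sub>\<infinity>q::'n mod_ring \<times> int. M * wt q) = M * ?W" by (rule infsum_cmult_right') 
  have sz: "(\<lambda>q. norm (y q)) summable_on UNIV" if "\<And>q. norm (y q) \<le> M * wt q" for y :: "'n mod_ring \<times> int \<Rightarrow> complex"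
    by (rule summable_on_comparison_test[OF Mws that]) simp
  have D0: "(synth z \<kappa> has_vector_derivative synth z1 \<kappa> t) (at t)" for \<kappa> t
    unfolding z1_def
    by (rule synth_has_vector_derivative, rule summable_on_comparison_test[OF Mws]) (use pull[OF order_refl] in auto)
  have D1: "(synth z1 \<kappa> has_vector_derivative synth z2 \<kappa> t) (at t)" for \<kappa> t
    unfolding z2_def
  proof (rule synth_has_vector_derivative, rule summable_on_comparison_test)
    show "(\<lambda>q::'n mod_ring \<times> int. M * (1 / (1 + (of_int (snd q))\<^sup>2))) summable_on UNIV"
      by (intro summable_on_cmult_right inverse_square_summable)
    fix q :: "'n mod_ring \<times> int"
    define K where "K = 1 + (of_int (snd q) :: real)\<^sup>2"
    have K: "1 \<le> K" "\<bar>of_int (snd q)\<bar> \<le> K" unfolding K_def using k by blast+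
    have "norm (z1 q) * K = \<bar>of_int (snd q)\<bar> * (norm (z q) * K)" by (simp add: z1_def norm_mult mult_ac)
    also have "\<dots> \<le> K * (M * wt q)" using K pull[of K q] unfolding K_def[symmetric] by (intro mult_mono[OF K(2)]) auto
    also have "\<dots> = M * (1 / K)" using K unfolding wt_def K_def[symmetric] by (simp add: power2_eq_square)
    finally show "norm (z1 q) * (1 + (of_int (snd q))\<^sup>2) \<le> M * (1 / (1 + (of_int (snd q))\<^sup>2))" unfolding K_def .
  qed simp
  have r1: "z1 (- q) = cnj (z1 q)" for q by (simp add: z1_def real)
  have r2: "z2 (- q) = cnj (z2 q)" for q by (simp add: z2_def r1)
  have main: "synth z2 \<kappa> t = - of_real (a + \<delta>) * synth z1 \<kappa> t + - of_real (a * \<delta>) * synth z \<kappa> t + - of_real b * synth z \<kappa> (t - \<tau>)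
      + of_real c * synth z (\<kappa> + of_int_mod_ring 1) (t - \<tau>\<^sub>c) + - (2 * of_real c) * synth z \<kappa> t
      + of_real c * synth z (\<kappa> + - of_int_mod_ring 1) (t - \<tau>\<^sub>c) + - of_real \<beta> * synth (cube z) \<kappa> t" for \<kappa> t
  proof (rule has_sum_unique[OF synth_has_sum[OF sz[OF b2]]])
    let ?r = "\<lambda>q. - of_real (a + \<delta>) * (z1 q * chr \<kappa> t q) + - of_real (a * \<delta>) * (z q * chr \<kappa> t q) + - of_real b * (z q * chr \<kappa> (t - \<tau>) q)
      + of_real c * (z q * chr (\<kappa> + of_int_mod_ring 1) (t - \<tau>\<^sub>c) q) + - (2 * of_real c) * (z q * chr \<kappa> t q)
      + of_real c * (z q * chr (\<kappa> + - of_int_mod_ring 1) (t - \<tau>\<^sub>c) q) + - of_real \<beta> * (cube z q * chr \<kappa> t q)"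
    have "(?r has_sum (- of_real (a + \<delta>) * synth z1 \<kappa> t + - of_real (a * \<delta>) * synth z \<kappa> t + - of_real b * synth z \<kappa> (t - \<tau>)
      + of_real c * synth z (\<kappa> + of_int_mod_ring 1) (t - \<tau>\<^sub>c) + - (2 * of_real c) * synth z \<kappa> t
      + of_real c * synth z (\<kappa> + - of_int_mod_ring 1) (t - \<tau>\<^sub>c) + - of_real \<beta> * synth (cube z) \<kappa> t)) UNIV"
      by (intro has_sum_add has_sum_cmult_right synth_has_sum sz[OF b0] sz[OF b1] decays_summable[OF decays_cube[OF dz]])
    moreover have "?r q = z2 q * chr \<kappa> t q" for q
    proof -
      have sh: "chr \<mu> (t - h) q = chr \<mu> t q * cis (- (of_int (snd q) * h))" for h \<mu>
        by (simp add: chr_def right_diff_distrib cis_mult)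
      have up: "chr (\<kappa> + \<mu>) t q = chr \<kappa> t q * chi (fst q) \<mu>" for \<mu>
        by (simp add: chr_def chi_add_right)
      have cc: "chi (fst q) (- of_int_mod_ring 1) = 2 * of_real (Re (chi (fst q) (of_int_mod_ring 1))) - chi (fst q) (of_int_mod_ring 1)"
        using complex_add_cnj[of "chi (fst q) (of_int_mod_ring 1)"] by (simp add: chi_minus_right algebra_simps)
      have "- (of_real \<beta> * cube z q) = (gcoef a \<delta> c \<tau>\<^sub>c q + of_real b * cis (- (of_int (snd q) * \<tau>))) * z q" using eq[of q] by simp
      then have "- of_real \<beta> * (cube z q * chr \<kappa> t q) = (gcoef a \<delta> c \<tau>\<^sub>c q + of_real b * cis (- (of_int (snd q) * \<tau>))) * z q * chr \<kappa> t q"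
        by (metis mult.assoc mult_minus_left)
      then show ?thesis
        unfolding sh up cc z2_def z1_def gcoef_def by (simp add: algebra_simps power2_eq_square)
    qed
    ultimately show "((\<lambda>q. z2 q * chr \<kappa> t q) has_sum (- of_real (a + \<delta>) * synth z1 \<kappa> t + - of_real (a * \<delta>) * synth z \<kappa> t + - of_real b * synth z \<kappa> (t - \<tau>)
      + of_real c * synth z (\<kappa> + of_int_mod_ring 1) (t - \<tau>\<^sub>c) + - (2 * of_real c) * synth z \<kappa> t
      + of_real c * synth z (\<kappa> + - of_int_mod_ring 1) (t - \<tau>\<^sub>c) + - of_real \<beta> * synth (cube z) \<kappa> t)) UNIV"
      by simp
  qed
  define x' where "x' = (\<lambda>\<kappa> t. Re (synth z1 \<kappa> t))"
  define x'' where "x'' = (\<lambda>\<kappa> t. Re (synth z2 \<kappa> t))"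
  have e0: "synth z \<kappa> t = of_real (x \<kappa> t)" for \<kappa> t unfolding x_def by (rule synth_real[of z, OF real])
  have e1: "synth z1 \<kappa> t = of_real (x' \<kappa> t)" for \<kappa> t unfolding x'_def by (rule synth_real[of z1, OF r1])
  have e2: "synth z2 \<kappa> t = of_real (x'' \<kappa> t)" for \<kappa> t unfolding x''_def by (rule synth_real[of z2, OF r2])
  have "x'' \<kappa> t = - (a + \<delta>) * x' \<kappa> t - a * \<delta> * x \<kappa> t - b * x \<kappa> (t - \<tau>)
       + c * (x (\<kappa> + of_int_mod_ring 1) (t - \<tau>\<^sub>c) - 2 * x \<kappa> t + x (\<kappa> - of_int_mod_ring 1) (t - \<tau>\<^sub>c)) - \<beta> * x \<kappa> t ^ 3" for \<kappa> t
    using arg_cong[OF main[of \<kappa> t, unfolded synth_cube[OF dz] e0 e1 e2], of Re]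
    by (simp add: algebra_simps flip: of_real_power)
  moreover have "(x \<kappa> has_vector_derivative x' \<kappa> t) (at t)" "(x' \<kappa> has_vector_derivative x'' \<kappa> t) (at t)" for \<kappa> t
    unfolding x_def x'_def x''_def
    using bounded_linear.has_vector_derivative[OF bounded_linear_Re D0] bounded_linear.has_vector_derivative[OF bounded_linear_Re D1] by blast+
  moreover have "\<bar>x \<kappa> t\<bar> \<le> M * ?W \<and> \<bar>x' \<kappa> t\<bar> \<le> M * ?W \<and> \<bar>x'' \<kappa> t\<bar> \<le> M * ?W" for \<kappa> t
    unfolding x_def x'_def x''_def Mwsum[symmetric]
    using order_trans[OF abs_Re_le_cmod norm_synth_le[OF b0 Mws]] order_trans[OF abs_Re_le_cmod norm_synth_le[OF b1 Mws]]
      order_trans[OF abs_Re_le_cmod norm_synth_le[OF b2 Mws]] by blast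
  moreover have "x \<kappa> (t + 2 * pi) = x \<kappa> t" for \<kappa> t by (simp add: x_def synth_periodic)
  ultimately show ?thesis by blast
qed

section \<open>The group action on coefficients\<close>

definition cact :: "'n::finite gelem \<Rightarrow> ('n mod_ring \<times> int \<Rightarrow> complex) \<Rightarrow> 'n mod_ring \<times> int \<Rightarrow> complex" where
  "cact g z q = of_int (fst (snd g)) * cis (of_int (snd q) * Arg (snd (snd g))) * chi (fst q) (- fst (fst g)) *
     z (if snd (fst g) = 1 then fst q else - fst q, snd q)"

text \<open>Synthesis intertwines \<open>cact\<close> with \<open>act\<close>: a time shift and a
  rotation multiply a coefficient by a character value, and a reflection sends class j to -j.
  Frequencies are never mixed.\<close>

lemma synth_cact:
  "synth (cact g z) \<kappa> t = of_int (fst (snd g)) *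
     synth z (if snd (fst g) = 1 then \<kappa> - fst (fst g) else fst (fst g) - \<kappa>) (t + Arg (snd (snd g)))"
proof -
  obtain r s \<iota> w where g: "g = ((r, s), (\<iota>, w))" by (cases g, cases "fst g", cases "snd g") auto
  have trm: "cact g z q * chr \<kappa> t q = of_int \<iota> * (z (if s = 1 then fst q else - fst q, snd q) *
      chr (if s = 1 then \<kappa> - r else r - \<kappa>) (t + Arg w) (if s = 1 then fst q else - fst q, snd q))" for q
  proof -
    have "chi (- fst q) (r - \<kappa>) = chi (fst q) (- r) * chi (fst q) \<kappa>"
      using chi_add_right[of "fst q" "\<kappa>" "- r"] chi_minus[of "fst q" "r - \<kappa>"] chi_minus_right[of "fst q" "r - \<kappa>"]
      by (simp add: mult.commute)
    moreover have "chi (fst q) (\<kappa> - r) = chi (fst q) (- r) * chi (fst q) \<kappa>"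
      using chi_add_right[of "fst q" "\<kappa>" "- r"] by simp
    moreover have "cis (of_int (snd q) * (t + Arg w)) = cis (of_int (snd q) * Arg w) * cis (of_int (snd q) * t)"
      by (simp add: cis_mult distrib_left add.commute)
    ultimately show ?thesis by (simp add: g cact_def chr_def)
  qed
  have bij: "bij (\<lambda>q :: 'a mod_ring \<times> int. (if s = 1 then fst q else - fst q, snd q))"
    by (rule bij_betwI[where g = "\<lambda>q. (if s = 1 then fst q else - fst q, snd q)"]) auto
  have "synth (cact g z) \<kappa> t = of_int \<iota> * (\<Sum>\<^sub>\<infinity>q. z (if s = 1 then fst q else - fst q, snd q) *
      chr (if s = 1 then \<kappa> - r else r - \<kappa>) (t + Arg w) (if s = 1 then fst q else - fst q, snd q))"
    unfolding synth_def trm infsum_cmult_right' ..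
  also have "\<dots> = of_int \<iota> * synth z (if s = 1 then \<kappa> - r else r - \<kappa>) (t + Arg w)"
    unfolding synth_def
    using infsum_reindex_bij_betw[OF bij, of "\<lambda>q. z q * chr (if s = 1 then \<kappa> - r else r - \<kappa>) (t + Arg w) q"]
    by (simp only:)
  finally show ?thesis by (simp add: g)
qed

lemma act_eqI:
  assumes "\<And>t \<kappa>. h2fun X t $ \<kappa> = of_int (fst (snd g)) *
     h2fun X (t + Arg (snd (snd g))) $ (if snd (fst g) = 1 then \<kappa> - fst (fst g) else fst (fst g) - \<kappa>)"
  shows "act g X = X"
proof -
  have "(\<lambda>t. of_int (fst (snd g)) *\<^sub>R (\<chi> k. h2fun X (t + Arg (snd (snd g))) $
      (if snd (fst g) = 1 then k - fst (fst g) else fst (fst g) - k))) = h2fun X"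
    unfolding fun_eq_iff vec_eq_iff vector_scaleR_component vec_lambda_beta real_scaleR_def
    by (intro allI assms[symmetric])
  then show ?thesis by (simp add: act_def case_prod_unfold h2fun_inverse)
qed

lemma act_eq_if_cact_eq:
  assumes "\<And>t \<kappa>. h2fun X t $ \<kappa> = Re (synth z \<kappa> t)" "cact g z = z"
  shows "act g X = X"
proof (rule act_eqI)
  fix t \<kappa>
  show "h2fun X t $ \<kappa> = of_int (fst (snd g)) *
     h2fun X (t + Arg (snd (snd g))) $ (if snd (fst g) = 1 then \<kappa> - fst (fst g) else fst (fst g) - \<kappa>)"
    unfolding assms(1) using synth_cact[of g z \<kappa> t] unfolding assms(2) by simp
qed

lemma conv_twist:
  fixes f h :: "'i::ab_group_add \<times> int \<Rightarrow> complex"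
  assumes bij: "bij \<sigma>" and \<sigma>: "\<And>a b. \<sigma> (a - b) = \<sigma> a - \<sigma> b" and \<phi>: "\<And>a b. \<phi> (a + b) = \<phi> a * \<phi> b"
  shows "conv (\<lambda>a. \<phi> a * f (\<sigma> a)) (\<lambda>a. \<phi> a * h (\<sigma> a)) = (\<lambda>a. \<phi> a * conv f h (\<sigma> a))"
proof
  fix a
  have "conv (\<lambda>a. \<phi> a * f (\<sigma> a)) (\<lambda>a. \<phi> a * h (\<sigma> a)) a = (\<Sum>\<^sub>\<infinity>b. \<phi> a * (f (\<sigma> b) * h (\<sigma> a - \<sigma> b)))"
    unfolding conv_def
  proof (rule infsum_cong)
    fix b
    have "\<phi> a = \<phi> b * \<phi> (a - b)" using \<phi>[of b "a - b"] by simp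
    then show "\<phi> b * f (\<sigma> b) * (\<phi> (a - b) * h (\<sigma> (a - b))) = \<phi> a * (f (\<sigma> b) * h (\<sigma> a - \<sigma> b))" by (simp add: \<sigma>)
  qed
  then show "conv (\<lambda>a. \<phi> a * f (\<sigma> a)) (\<lambda>a. \<phi> a * h (\<sigma> a)) a = \<phi> a * conv f h (\<sigma> a)"
    unfolding infsum_cmult_right' conv_def
    using infsum_reindex_bij_betw[OF bij, of "\<lambda>b. f b * h (\<sigma> a - b)"] by simp
qed

text \<open>A twist by a character and an automorphism of the index group both pass through
  convolution; the sign passes because \<iota>^3 = \<iota>.\<close>

lemma cube_cact:
  fixes z :: "'n::finite mod_ring \<times> int \<Rightarrow> complex"
  assumes "fst (snd g) \<in> {1, -1}"
  shows "cube (cact g z) = cact g (cube z)"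
proof -
  define \<sigma> where "\<sigma> = (\<lambda>q :: 'n mod_ring \<times> int. (if snd (fst g) = 1 then fst q else - fst q, snd q))"
  define \<phi> where "\<phi> = (\<lambda>q :: 'n mod_ring \<times> int. cis (of_int (snd q) * Arg (snd (snd g))) * chi (fst q) (- fst (fst g)))"
  have bij: "bij \<sigma>" unfolding \<sigma>_def
    by (rule bij_betwI[where g = "\<lambda>q. (if snd (fst g) = 1 then fst q else - fst q, snd q)"]) auto
  have \<sigma>: "\<sigma> (a - b) = \<sigma> a - \<sigma> b" for a b by (simp add: \<sigma>_def)
  have \<phi>: "\<phi> (a + b) = \<phi> a * \<phi> b" for a b
    by (simp add: \<phi>_def chi_add distrib_right flip: cis_mult)
  note tw = conv_twist[where \<sigma> = \<sigma> and \<phi> = \<phi>, OF bij \<sigma> \<phi>]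
  have ca: "cact g y = (\<lambda>q. of_int (fst (snd g)) * (\<phi> q * y (\<sigma> q)))" for y
    by (simp add: cact_def \<phi>_def \<sigma>_def fun_eq_iff)
  have "cube (\<lambda>q. \<phi> q * z (\<sigma> q)) = (\<lambda>q. \<phi> q * cube z (\<sigma> q))"
    unfolding cube_def tw ..
  then show ?thesis unfolding ca cube_cmult using assms by auto
qed

lemma cube_real:
  fixes z :: "'i::ab_group_add \<times> int \<Rightarrow> complex"
  assumes "\<And>a. z (- a) = cnj (z a)"
  shows "cube z (- a) = cnj (cube z a)"
proof -
  have conv_real: "conv f h (- a) = cnj (conv f h a)" if "\<And>a. f (- a) = cnj (f a)" "\<And>a. h (- a) = cnj (h a)"
    for f h :: "'i \<times> int \<Rightarrow> complex" and a
  proof -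
    have "conv f h (- a) = (\<Sum>\<^sub>\<infinity>b. f (0 - b) * h (- a - (0 - b)))"
      unfolding conv_def by (rule infsum_minus_left[symmetric])
    also have "\<dots> = (\<Sum>\<^sub>\<infinity>b. cnj (f b * h (a - b)))"
    proof (rule infsum_cong)
      fix b
      have "- a - (- b) = - (a - b)" by simp
      then show "f (0 - b) * h (- a - (0 - b)) = cnj (f b * h (a - b))"
        by (simp only: diff_0 that complex_cnj_mult)
    qed
    finally show ?thesis by (simp only: conv_def infsum_cnj)
  qed
  show ?thesis unfolding cube_def by (intro conv_real assms)
qed

section \<open>Harmonics of a critical mode\<close>

text \<open>K fixes the solution itself, not only up to conjugacy. With K empty this is plain
  bifurcation of nonconstant solutions.\<close>

definition bifurcates :: "real \<Rightarrow> real \<Rightarrow> real \<Rightarrow> real \<Rightarrow> real \<Rightarrow> real \<times> real \<Rightarrow> 'n::finite gelem set \<Rightarrow> bool" where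
  "bifurcates a \<delta> c \<beta> \<tau>\<^sub>c p K \<longleftrightarrow> (\<forall>U :: ((real \<times> real) \<times> 'n osc) set. open U \<and> (p, 0) \<in> U \<longrightarrow>
     (\<exists>q x. (q, x) \<in> U \<and> q \<in> param_space \<and> Psi a \<delta> c \<beta> \<tau>\<^sub>c q x = 0 \<and> x \<notin> const_space \<and> (\<forall>g\<in>K. act g x = x)))"

lemma bifurcatesI:
  fixes K :: "'n::finite gelem set"
  assumes "\<And>\<epsilon>. 0 < \<epsilon> \<Longrightarrow> \<exists>b \<tau> (x :: 'n osc). \<bar>b - bs\<bar> < \<epsilon> \<and> \<bar>\<tau> - \<tau>s\<bar> < \<epsilon> \<and> norm x < \<epsilon> \<and> 0 < b \<and> 0 \<le> \<tau> \<and>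
     Psi a \<delta> c \<beta> \<tau>\<^sub>c (b, \<tau>) x = 0 \<and> x \<notin> const_space \<and> (\<forall>g\<in>K. act g x = x)"
  shows "bifurcates a \<delta> c \<beta> \<tau>\<^sub>c (bs, \<tau>s) K"
  unfolding bifurcates_def
proof (intro allI impI, elim conjE)
  fix U :: "((real \<times> real) \<times> 'n osc) set" assume "open U" "((bs, \<tau>s), 0) \<in> U"
  then obtain \<epsilon> where \<epsilon>: "0 < \<epsilon>" "ball ((bs, \<tau>s), 0) \<epsilon> \<subseteq> U" by (meson open_contains_ball)
  then obtain b \<tau> and x :: "'n osc" where x: "\<bar>b - bs\<bar> < \<epsilon> / 3" "\<bar>\<tau> - \<tau>s\<bar> < \<epsilon> / 3" "norm x < \<epsilon> / 3" "0 < b" "0 \<le> \<tau>"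
     "Psi a \<delta> c \<beta> \<tau>\<^sub>c (b, \<tau>) x = 0" "x \<notin> const_space" "\<forall>g\<in>K. act g x = x"
    using assms[of "\<epsilon> / 3"] by (metis zero_less_divide_iff zero_less_numeral)
  have "dist ((bs, \<tau>s), 0) ((b, \<tau>), x) \<le> dist (bs, \<tau>s) (b, \<tau>) + dist 0 x"
    unfolding dist_Pair_Pair by (rule sqrt_sum_squares_le_sum) auto
  also have "dist (bs, \<tau>s) (b, \<tau>) \<le> dist bs b + dist \<tau>s \<tau>"
    unfolding dist_Pair_Pair by (rule sqrt_sum_squares_le_sum) auto
  finally have "dist ((bs, \<tau>s), 0) ((b, \<tau>), x) < \<epsilon>" using x(1-3) by (simp add: dist_norm abs_minus_commute)
  then have "((b, \<tau>), x) \<in> U" using \<epsilon>(2) by auto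
  then show "\<exists>q x. (q, x) \<in> U \<and> q \<in> param_space \<and> Psi a \<delta> c \<beta> \<tau>\<^sub>c q x = 0 \<and> x \<notin> const_space \<and> (\<forall>g\<in>K. act g x = x)"
    using x by (intro exI[of _ "(b, \<tau>)"] exI[of _ x]) (auto simp: param_space_def)
qed

definition cosj :: "'n::finite mod_ring \<Rightarrow> real" where "cosj j = Re (chi j (of_int_mod_ring 1))"

lemma cosj_minus [simp]: "cosj (- j) = cosj j" by (simp add: cosj_def chi_minus)

lemma abs_cosj_le: "\<bar>cosj j\<bar> \<le> 1"
  using abs_Re_le_cmod[of "chi j (of_int_mod_ring 1)"] by (simp add: cosj_def)

lemma cosj_triple: "cosj (j + j + j) = 4 * cosj j ^ 3 - 3 * cosj j"
proof -
  let ?z = "chi j (of_int_mod_ring 1)"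
  have "(Re ?z)\<^sup>2 + (Im ?z)\<^sup>2 = 1" using cmod_power2[of ?z] by simp
  then have im: "Im ?z * Im ?z = 1 - Re ?z * Re ?z" by (simp add: power2_eq_square)
  have "Re (?z * ?z * ?z) = Re ?z * Re ?z * Re ?z - 3 * Re ?z * (Im ?z * Im ?z)" by (simp add: algebra_simps)
  also have "\<dots> = 4 * Re ?z ^ 3 - 3 * Re ?z" unfolding im by (simp add: power3_eq_cube algebra_simps)
  finally show ?thesis by (simp add: cosj_def chi_add)
qed

definition Dc :: "real \<Rightarrow> real \<Rightarrow> real \<Rightarrow> real \<Rightarrow> real \<Rightarrow> real \<Rightarrow> 'n::finite mod_ring \<times> int \<Rightarrow> complex" where
  "Dc a \<delta> c \<tau>\<^sub>c b \<tau> q = gcoef a \<delta> c \<tau>\<^sub>c q + of_real b * cis (- (of_int (snd q) * \<tau>))"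

lemma gcoef_minus: "gcoef a \<delta> c \<tau>\<^sub>c (- q) = cnj (gcoef a \<delta> c \<tau>\<^sub>c q)"
  by (simp add: gcoef_def chi_minus cis_cnj)

lemma Dc_minus: "Dc a \<delta> c \<tau>\<^sub>c b \<tau> (- q) = cnj (Dc a \<delta> c \<tau>\<^sub>c b \<tau> q)"
  by (simp add: Dc_def gcoef_minus cis_cnj)

lemma Dc_cong: "cosj j = cosj i \<Longrightarrow> Dc a \<delta> c \<tau>\<^sub>c b \<tau> (j, k) = Dc a \<delta> c \<tau>\<^sub>c b \<tau> (i, k)"
  by (simp add: Dc_def gcoef_def cosj_def)

lemma Im_Dc_0: "Im (Dc a \<delta> c \<tau>\<^sub>c b 0 q) = (a + \<delta>) * of_int (snd q) + 2 * c * cosj (fst q) * sin (of_int (snd q) * \<tau>\<^sub>c)"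
  by (simp add: Dc_def gcoef_def cosj_def flip: of_int_power)

lemma sin_triple: "sin (3 * x) = 3 * sin x - 4 * sin x ^ 3" for x :: real
proof -
  have "sin (3 * x) = sin (2 * x + x)" by simp
  also have "\<dots> = 2 * sin x * (cos x)\<^sup>2 + (1 - 2 * (sin x)\<^sup>2) * sin x"
    unfolding sin_add sin_double cos_double_sin by (simp add: power2_eq_square)
  also have "\<dots> = 3 * sin x - 4 * sin x ^ 3"
    unfolding cos_squared_eq by (simp add: algebra_simps power2_eq_square power3_eq_cube)
  finally show ?thesis .
qed

text \<open>With \<open>x = cos\<^sup>2 \<theta>\<close> and \<open>y = sin\<^sup>2 (m\<tau>\<^sub>c)\<close>, the vanishing of the imaginary part at the critical mode gives
  \<open>Im \<Delta> = \<eta>m (12 (1 - x) (1 - y) + 4xy)\<close> at \<open>(3\<theta>, 3m)\<close>, \<open>4\<eta>my\<close> at \<open>(\<theta>, 3m)\<close> and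
  \<open>4\<eta>m (1 - x)\<close> at \<open>(3\<theta>, m)\<close>.\<close>

lemma Im_Dc_third_harmonic_pos:
  assumes \<eta>: "0 < a + \<delta>" and m: "0 < m" and crit: "Dc a \<delta> c \<tau>\<^sub>c b 0 (j, m) = 0"
    and q: "Dc a \<delta> c \<tau>\<^sub>c b 0 q \<noteq> 0" "\<bar>snd q\<bar> = m \<or> \<bar>snd q\<bar> = 3 * m"
      "cosj (fst q) = cosj j \<or> cosj (fst q) = 4 * cosj j ^ 3 - 3 * cosj j"
  shows "0 < of_int (snd q) * Im (Dc a \<delta> c \<tau>\<^sub>c b 0 q)"
proof -
  define S where "S = sin (of_int m * \<tau>\<^sub>c)"
  define C where "C = cosj j"
  define h where "h = (a + \<delta>) * of_int m"
  have h: "0 < h" using \<eta> m by (simp add: h_def)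
  have h_eq: "h = - (2 * c * C * S)"
    using arg_cong[OF crit, of Im] by (simp add: Im_Dc_0 h_def S_def C_def)
  have C1: "C\<^sup>2 \<le> 1" using abs_cosj_le[of j] by (simp add: C_def abs_square_le_1)
  have S1: "S\<^sup>2 \<le> 1" by (simp add: S_def abs_square_le_1)
  have "C \<noteq> 0" "S \<noteq> 0" using h h_eq by auto
  then have CS: "0 < C\<^sup>2" "0 < S\<^sup>2" by simp_all
  have sin3: "sin (of_int (3 * m) * \<tau>\<^sub>c) = 3 * S - 4 * S ^ 3"
    using sin_triple[of "of_int m * \<tau>\<^sub>c"] by (simp add: S_def mult.assoc)
  \<comment> \<open>Im Dc is odd in the frequency k, so k Im Dc is even and k may be taken
    positive.\<close>
  have reduce: "of_int (snd q) * Im (Dc a \<delta> c \<tau>\<^sub>c b 0 q) = of_int \<bar>snd q\<bar> * Im (Dc a \<delta> c \<tau>\<^sub>c b 0 (fst q, \<bar>snd q\<bar>))"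
    by (cases "0 \<le> snd q") (simp_all add: Im_Dc_0 algebra_simps)
  have "0 < Im (Dc a \<delta> c \<tau>\<^sub>c b 0 (fst q, \<bar>snd q\<bar>))"
    using q(2)
  proof
    assume k: "\<bar>snd q\<bar> = m"
    have "cosj (fst q) \<noteq> C"
    proof
      assume "cosj (fst q) = C"
      then have "Dc a \<delta> c \<tau>\<^sub>c b 0 (fst q, m) = 0" using crit Dc_cong[of "fst q" j] by (simp add: C_def)
      moreover have "q = (fst q, m) \<or> q = - (- fst q, m)" using k m by (cases q) auto
      ultimately show False using q(1) Dc_minus[of a \<delta> c \<tau>\<^sub>c b 0 "(- fst q, m)"] Dc_cong[of "- fst q" "fst q"]
        by (metis complex_cnj_zero cosj_minus)
    qed
    then have c3: "cosj (fst q) = 4 * C ^ 3 - 3 * C" using q(3) by (simp add: C_def)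
    \<comment> \<open>For C^2 = 1 the triple angle formula would return C, the cosine already
      excluded.\<close>
    have "C\<^sup>2 \<noteq> 1"
    proof
      assume "C\<^sup>2 = 1"
      then have "4 * C ^ 3 - 3 * C = C" by (simp add: power3_eq_cube power2_eq_square)
      with c3 \<open>cosj (fst q) \<noteq> C\<close> show False by simp
    qed
    then have "0 < 4 * h * (1 - C\<^sup>2)" using C1 h by simp
    also have "\<dots> = h + 2 * c * (4 * C ^ 3 - 3 * C) * S"
      unfolding h_eq by (simp add: algebra_simps power2_eq_square power3_eq_cube)
    finally show ?thesis by (simp add: Im_Dc_0 k c3 h_def S_def)
  next
    assume k: "\<bar>snd q\<bar> = 3 * m"
    have val: "Im (Dc a \<delta> c \<tau>\<^sub>c b 0 (fst q, \<bar>snd q\<bar>)) = 3 * h + 2 * c * cosj (fst q) * (3 * S - 4 * S ^ 3)"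
      unfolding k Im_Dc_0 fst_conv snd_conv sin3 by (simp add: h_def)
    from q(3) show ?thesis
    proof
      assume "cosj (fst q) = cosj j"
      then have "Im (Dc a \<delta> c \<tau>\<^sub>c b 0 (fst q, \<bar>snd q\<bar>)) = 4 * h * S\<^sup>2"
        unfolding val C_def[symmetric] h_eq by (simp add: C_def algebra_simps power2_eq_square power3_eq_cube)
      then show ?thesis using h CS by simp
    next
      assume c3: "cosj (fst q) = 4 * cosj j ^ 3 - 3 * cosj j"
      then have "Im (Dc a \<delta> c \<tau>\<^sub>c b 0 (fst q, \<bar>snd q\<bar>)) = h * (12 * (1 - C\<^sup>2) * (1 - S\<^sup>2) + 4 * C\<^sup>2 * S\<^sup>2)"
        unfolding val c3 C_def[symmetric] h_eq by (simp add: algebra_simps power2_eq_square power3_eq_cube)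
      moreover have "0 < 12 * (1 - C\<^sup>2) * (1 - S\<^sup>2) + 4 * C\<^sup>2 * S\<^sup>2"
        using C1 S1 CS by (intro add_nonneg_pos mult_nonneg_nonneg mult_pos_pos) auto
      ultimately show ?thesis using h by simp
    qed
  qed
  moreover have "0 < \<bar>snd q\<bar>" using q(2) m by auto
  ultimately show ?thesis unfolding reduce by (intro mult_pos_pos) auto
qed

lemma conv_support:
  assumes "conv f h q \<noteq> 0" shows "\<exists>b c. q = b + c \<and> f b \<noteq> 0 \<and> h c \<noteq> 0"
proof -
  have "\<exists>b. f b * h (q - b) \<noteq> 0"
  proof (rule ccontr)
    assume "\<nexists>b. f b * h (q - b) \<noteq> 0"
    then have "conv f h q = 0" unfolding conv_def by (intro infsum_0) blast
    with assms show False by simp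
  qed
  then obtain b where "f b * h (q - b) \<noteq> 0" by blast
  then show ?thesis by (intro exI[of _ b] exI[of _ "q - b"]) auto
qed

lemma cube_support:
  assumes "cube f q \<noteq> 0" shows "\<exists>b c d. q = b + (c + d) \<and> f b \<noteq> 0 \<and> f c \<noteq> 0 \<and> f d \<noteq> 0"
  using conv_support assms unfolding cube_def by metis

lemma norm_gcoef_le:
  assumes "0 \<le> c" "0 < a" "0 < \<delta>"
  shows "norm (gcoef a \<delta> c \<tau>\<^sub>c q + (of_int (snd q))\<^sup>2) \<le> (a + \<delta> + a * \<delta> + 4 * c) * (1 + \<bar>of_int (snd q)\<bar>)"
proof -
  let ?k = "\<bar>of_int (snd q)\<bar> :: real"
  have "norm (gcoef a \<delta> c \<tau>\<^sub>c q + (of_int (snd q))\<^sup>2) =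
      norm (\<i> * of_real (a + \<delta>) * of_int (snd q) + of_real (a * \<delta>) + 2 * of_real c
     - 2 * of_real c * of_real (cosj (fst q)) * cis (- (of_int (snd q) * \<tau>\<^sub>c)))"
    by (simp add: gcoef_def cosj_def algebra_simps)
  also have "\<dots> \<le> (a + \<delta>) * ?k + a * \<delta> + 2 * c + 2 * c * 1"
  proof (intro norm_triangle_le_diff norm_triangle_le add_mono)
    show "norm (2 * of_real c * of_real (cosj (fst q)) * cis (- (of_int (snd q) * \<tau>\<^sub>c))) \<le> 2 * c * 1"
      using abs_cosj_le[of "fst q"] assms by (simp add: norm_mult mult_left_le)
  qed (use assms in \<open>simp_all add: norm_mult del: of_real_add of_real_mult\<close>)
  also have "\<dots> \<le> (a + \<delta> + a * \<delta> + 4 * c) * (1 + ?k)"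
    using assms by (simp add: algebra_simps)
  finally show ?thesis .
qed

definition fixed_family :: "'n::finite gelem set \<Rightarrow> ('n mod_ring \<times> int \<Rightarrow> complex) \<Rightarrow> bool" where
  "fixed_family K z \<longleftrightarrow> (\<forall>q. z (- q) = cnj (z q)) \<and> (\<forall>g\<in>K. cact g z = z)"

lemma gcoef_reflect: "gcoef a \<delta> c \<tau>\<^sub>c (- j, k) = gcoef a \<delta> c \<tau>\<^sub>c (j, k)"
  by (simp add: gcoef_def chi_minus)

lemma norm_cact_coefficient:
  "fst (snd g) \<in> {1, -1} \<Longrightarrow> norm (of_int (fst (snd g)) * cis x * chi i r :: complex) = 1"
  by (auto simp: norm_mult)

text \<open>An instance of \<open>hopf\<close>: \<open>Y\<close> consists of the real K-fixed
  families supported on odd multiples of m, which the cubic preserves because a sum of three odd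
  numbers is odd. Nonconstancy is recorded as two different values at the same cell.\<close>

lemma mode_solutions:
  fixes K :: "'n::finite gelem set" and e :: "'n mod_ring \<times> int \<Rightarrow> complex"
  assumes par: "0 < a" "0 < \<delta>" "0 \<le> c" "0 < \<beta>" and bs: "0 < bs" and \<tau>s: "0 \<le> \<tau>s"
    and K: "\<And>g. g \<in> K \<Longrightarrow> fst (snd g) \<in> {1, -1}"
    and m: "0 < m" and crit0: "Dc a \<delta> c \<tau>\<^sub>c bs \<tau>s (j, m) = 0"
    and e: "fixed_family K e" "e (j, m) = 1"
      "\<And>q. e q \<noteq> 0 \<Longrightarrow> (fst q = j \<or> fst q = - j) \<and> \<bar>snd q\<bar> = m"
    and crit: "\<And>y q k. fixed_family K y \<Longrightarrow> (\<And>q. y q \<noteq> 0 \<Longrightarrow> \<exists>k. odd k \<and> snd q = k * m) \<Longrightarrow>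
       Dc a \<delta> c \<tau>\<^sub>c bs \<tau>s q = 0 \<Longrightarrow> y q = (if snd q > 0 then y (j, m) else cnj (y (j, m))) * e q"
    and nonvanishing: "Re (synth e \<kappa>0 t0) \<noteq> 0"
    and third: "\<exists>q. snd q = 3 * m \<and> cube e q \<noteq> 0"
    and \<epsilon>: "0 < \<epsilon>"
  shows "\<exists>b \<tau> z. \<bar>b - bs\<bar> < \<epsilon> \<and> \<bar>\<tau> - \<tau>s\<bar> < \<epsilon> \<and> 0 < b \<and> 0 \<le> \<tau> \<and> fixed_family K z \<and>
     (\<forall>q. norm (z q) \<le> \<epsilon> * wt q / (1 + (of_int (snd q))\<^sup>2)) \<and>
     (\<forall>q. Dc a \<delta> c \<tau>\<^sub>c b \<tau> q * z q = - (of_real \<beta> * cube z q)) \<and>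
     Re (synth z \<kappa>0 t0) \<noteq> Re (synth z \<kappa>0 (t0 + pi / of_int m))"
proof -
  define Odd where "Odd = {q :: 'n mod_ring \<times> int. \<exists>k. odd k \<and> snd q = k * m}"
  define Y where "Y y \<longleftrightarrow> fixed_family K y \<and> (\<forall>q. y q \<noteq> 0 \<longrightarrow> q \<in> Odd)" for y
  have Y_r: "y (- q) = cnj (y q)" and Y_o: "y q \<noteq> 0 \<Longrightarrow> q \<in> Odd" if "Y y" for y q
    using that unfolding Y_def fixed_family_def by blast+
  have Y_k: "cact g y = y" if "Y y" "g \<in> K" for y g
    using that unfolding Y_def fixed_family_def by blast
  have Y_I: "Y y" if "\<And>q. y (- q) = cnj (y q)" "\<And>g. g \<in> K \<Longrightarrow> cact g y = y" "\<And>q. y q \<noteq> 0 \<Longrightarrow> q \<in> Odd" for y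
    using that unfolding Y_def fixed_family_def by blast
  have Odd_sum: "b + (c + d) \<in> Odd" if bcd: "b \<in> Odd" "c \<in> Odd" "d \<in> Odd" for b c d
  proof -
    obtain k1 k2 k3 where k: "odd k1" "odd k2" "odd k3" "snd b = k1 * m" "snd c = k2 * m" "snd d = k3 * m"
      using bcd unfolding Odd_def by auto
    then show ?thesis unfolding Odd_def
      by (auto simp: distrib_right intro!: exI[of _ "k1 + (k2 + k3)"])
  qed
  have e_Odd: "q \<in> Odd" if "e q \<noteq> 0" for q
    using e(3)[OF that] unfolding Odd_def by (auto simp: abs_if split: if_splits intro: exI[of _ 1] exI[of _ "-1"])
  have Ye: "Y e" using e(1) e_Odd by (simp add: Y_def)
  have supp_e: "{q. e q \<noteq> 0} \<subseteq> {j, - j} \<times> {m, - m}"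
  proof
    fix q assume "q \<in> {q. e q \<noteq> 0}"
    then have "fst q = j \<or> fst q = - j" "\<bar>snd q\<bar> = m" using e(3) by auto
    then show "q \<in> {j, - j} \<times> {m, - m}" by (cases q) (auto simp: abs_if split: if_splits)
  qed
  have e_crit: "Dc a \<delta> c \<tau>\<^sub>c bs \<tau>s q = 0" if "e q \<noteq> 0" for q
  proof -
    have "q \<in> {j, - j} \<times> {m, - m}" using supp_e that by blast
    then consider "q = (j, m)" | "q = (- j, m)" | "q = - (- j, m)" | "q = - (j, m)" by fastforce
    then show ?thesis
      by cases (simp_all add: crit0 Dc_minus Dc_cong[of "- j" j] del: uminus_Pair)
  qed
  interpret hopf "gcoef a \<delta> c \<tau>\<^sub>c" "a + \<delta> + a * \<delta> + 4 * c" bs \<tau>s \<beta> Y e "(j, m)" m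
  proof
    show "norm (gcoef a \<delta> c \<tau>\<^sub>c q + (of_int (snd q))\<^sup>2) \<le> (a + \<delta> + a * \<delta> + 4 * c) * (1 + \<bar>of_int (snd q)\<bar>)" for q :: "'n mod_ring \<times> int"
      using par by (intro norm_gcoef_le)
    show "Y (\<lambda>_. 0)" by (simp add: Y_def fixed_family_def cact_def fun_eq_iff)
  next
    fix y z :: "'n mod_ring \<times> int \<Rightarrow> complex" assume yz: "Y y" "Y z"
    have "cact g (\<lambda>a. y a + z a) = (\<lambda>a. cact g y a + cact g z a)" for g
      by (simp add: cact_def fun_eq_iff distrib_left)
    then show "Y (\<lambda>a. y a + z a)"
      using Y_o[OF yz(1)] Y_o[OF yz(2)]
      by (intro Y_I) (simp add: Y_r[OF yz(1)] Y_r[OF yz(2)], simp add: Y_k[OF yz(1)] Y_k[OF yz(2)], metis add.right_neutral)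
  next
    fix y :: "'n mod_ring \<times> int \<Rightarrow> complex" and r assume y: "Y y"
    have "cact g (\<lambda>a. of_real r * y a) = (\<lambda>a. of_real r * cact g y a)" for g
      by (simp add: cact_def fun_eq_iff)
    then show "Y (\<lambda>a. of_real r * y a)"
      by (intro Y_I) (simp_all add: Y_r[OF y] Y_k[OF y] Y_o[OF y])
  next
    fix y :: "'n mod_ring \<times> int \<Rightarrow> complex" and M assume y: "Y y" "decays M y"
    show "Y (cube y)"
    proof (rule Y_I)
      show "cube y (- q) = cnj (cube y q)" for q by (rule cube_real[of y, OF Y_r[OF y(1)]])
      show "cact g (cube y) = cube y" if "g \<in> K" for g
        using cube_cact[OF K[OF that], of y] Y_k[OF y(1) that] by simp
      show "q \<in> Odd" if "cube y q \<noteq> 0" for q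
        using cube_support[OF that] Y_o[OF y(1)] Odd_sum by blast
    qed
  next
    fix F f assume F: "\<And>n::nat. Y (F n)" and lim: "\<And>a. (\<lambda>n. F n a) \<longlonglongrightarrow> f a"
    have "f (- q) = cnj (f q)" for q
      using tendsto_cnj[OF lim[of q]] by (intro LIMSEQ_unique[OF lim]) (simp add: Y_r[OF F])
    moreover have "cact g f = f" if "g \<in> K" for g
    proof
      fix q
      have "(\<lambda>n. cact g (F n) q) \<longlonglongrightarrow> cact g f q" unfolding cact_def by (intro tendsto_intros lim)
      moreover have "cact g (F n) = F n" for n by (rule Y_k[OF F that])
      ultimately show "cact g f q = f q" using LIMSEQ_unique[OF _ lim] by simp
    qed
    moreover have "q \<in> Odd" if "f q \<noteq> 0" for q
    proof (rule ccontr)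
      assume "q \<notin> Odd"
      then have "F n q = 0" for n using Y_o[OF F] by blast
      then have "(\<lambda>n. F n q) = (\<lambda>n. 0)" by blast
      then show False using lim[of q] that by (simp add: LIMSEQ_const_iff)
    qed
    ultimately show "Y f" by (intro Y_I)
  next
    fix y :: "'n mod_ring \<times> int \<Rightarrow> complex" and b \<tau> assume y: "Y y"
    have "Y (\<lambda>q. if Dc a \<delta> c \<tau>\<^sub>c bs \<tau>s q = 0 then 0 else y q / Dc a \<delta> c \<tau>\<^sub>c b \<tau> q)" (is "Y ?f")
    proof (rule Y_I)
      show "?f (- q) = cnj (?f q)" for q by (simp add: Dc_minus Y_r[OF y])
      show "cact g ?f = ?f" if "g \<in> K" for g
      proof
        fix q :: "'n mod_ring \<times> int"
        have refl: "Dc a \<delta> c \<tau>\<^sub>c b \<tau> (if P then fst q else - fst q, snd q) = Dc a \<delta> c \<tau>\<^sub>c b \<tau> q" for b \<tau> P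
          by (cases q) (simp add: Dc_def gcoef_reflect)
        have "cact g y q = y q" by (simp add: Y_k[OF y that])
        then show "cact g ?f q = ?f q" unfolding cact_def refl by simp
      qed
      show "q \<in> Odd" if "?f q \<noteq> 0" for q using that Y_o[OF y, of q] by (auto split: if_splits)
    qed
    then show "Y (\<lambda>q. if gcoef a \<delta> c \<tau>\<^sub>c q + of_real bs * cis (- (of_int (snd q) * \<tau>s)) = 0 then 0
              else y q / (gcoef a \<delta> c \<tau>\<^sub>c q + of_real b * cis (- (of_int (snd q) * \<tau>))))"
      by (simp only: Dc_def)
  next
    fix y :: "'n mod_ring \<times> int \<Rightarrow> complex" and q :: "'n mod_ring \<times> int"
    assume y: "Y y" and D: "gcoef a \<delta> c \<tau>\<^sub>c q + of_real bs * cis (- (of_int (snd q) * \<tau>s)) = 0"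
    show "y q = (if snd q > 0 then y (j, m) else cnj (y (j, m))) * e q"
    proof (rule crit)
      show "fixed_family K y" using y by (simp add: Y_def)
      show "\<exists>k. odd k \<and> snd q = k * m" if "y q \<noteq> 0" for q using Y_o[OF y that] by (simp add: Odd_def)
      show "Dc a \<delta> c \<tau>\<^sub>c bs \<tau>s q = 0" using D by (simp only: Dc_def)
    qed
  next
    show "finite {q. e q \<noteq> 0}" by (rule finite_subset[OF supp_e]) simp
  next
    fix q assume "e q \<noteq> 0"
    then show "\<bar>snd q\<bar> = m \<and> gcoef a \<delta> c \<tau>\<^sub>c q + of_real bs * cis (- (of_int (snd q) * \<tau>s)) = 0"
      using e(3) e_crit unfolding Dc_def by blast
  qed (use bs m par Ye e(2) Y_r in auto)
  have D_eq: "D b \<tau> q = Dc a \<delta> c \<tau>\<^sub>c b \<tau> q" for b \<tau> q by (simp add: D_def Dc_def)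
  have boundary: "\<exists>a3 \<eta> H. D bs 0 a3 \<noteq> 0 \<and> cube e a3 \<noteq> 0 \<and> 0 < \<eta> \<and>
       (\<forall>q. D bs 0 q \<noteq> 0 \<longrightarrow> cube e q \<noteq> 0 \<longrightarrow> 0 < of_int (snd q) * Im (D bs 0 q)) \<and>
       (\<forall>q::'n mod_ring \<times> int. \<eta> * (of_int (snd q))\<^sup>2 - H * \<bar>of_int (snd q)\<bar> \<le> of_int (snd q) * Im (gcoef a \<delta> c \<tau>\<^sub>c q))"
    if \<tau>0: "\<tau>s = 0"
  proof -
    have c0: "Dc a \<delta> c \<tau>\<^sub>c bs 0 (j, m) = 0" using crit0 \<tau>0 by simp
    have \<eta>: "0 < a + \<delta>" using par by simp
    \<comment> \<open>Sums of three indices from the support of e have class j, -j, 3j or -3j and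
      frequency m, -m, 3m or -3m, which are the cases settled by
      \<open>Im_Dc_third_harmonic_pos\<close>.\<close>
    have pos: "0 < of_int (snd q) * Im (D bs 0 q)" if "D bs 0 q \<noteq> 0" "cube e q \<noteq> 0" for q
    proof -
      obtain u v w where q: "q = u + (v + w)" "e u \<noteq> 0" "e v \<noteq> 0" "e w \<noteq> 0" using cube_support[OF \<open>cube e q \<noteq> 0\<close>] by blast
      have f: "fst q = fst u + (fst v + fst w)" "snd q = snd u + (snd v + snd w)" by (simp_all add: q(1))
      have s: "\<bar>snd q\<bar> = m \<or> \<bar>snd q\<bar> = 3 * m"
        using e(3)[OF q(2)] e(3)[OF q(3)] e(3)[OF q(4)] unfolding f by linarith
      have "fst q \<in> {j, - j, j + j + j, - (j + j + j)}"
        using e(3)[OF q(2)] e(3)[OF q(3)] e(3)[OF q(4)] unfolding f by (elim conjE disjE) simp_all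
      then have "cosj (fst q) = cosj j \<or> cosj (fst q) = 4 * cosj j ^ 3 - 3 * cosj j"
        using cosj_triple[of j] cosj_minus by (auto simp del: minus_add_distrib)
      then show ?thesis
        using Im_Dc_third_harmonic_pos[OF \<eta> m c0 _ s] \<open>D bs 0 q \<noteq> 0\<close> unfolding D_eq by blast
    qed
    obtain a3 where a3: "snd a3 = 3 * m" "cube e a3 \<noteq> 0" using third by blast
    \<comment> \<open>If a3 were critical, \<open>Y_crit\<close> would give e a nonzero coefficient
      there; but e lives at frequencies m and -m, and a3 has frequency 3m.\<close>
    have "D bs 0 a3 \<noteq> 0"
    proof
      assume "D bs 0 a3 = 0"
      then have "D bs \<tau>s a3 = 0" using \<tau>0 by simp
      moreover have "Y (cube e)" using decays_finite_support[OF e_finite] Y_cube[OF Ye] by blast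
      ultimately have "cube e a3 = (if snd a3 > 0 then cube e (j, m) else cnj (cube e (j, m))) * e a3"
        by (intro Y_crit) (simp_all add: D_def)
      then have "e a3 \<noteq> 0" using a3 by auto
      then show False using e(3) a3 m by fastforce
    qed
    moreover have "(a + \<delta>) * (of_int (snd q))\<^sup>2 - (2 * c) * \<bar>of_int (snd q)\<bar> \<le> of_int (snd q) * Im (gcoef a \<delta> c \<tau>\<^sub>c q)" for q :: "'n mod_ring \<times> int"
    proof -
      let ?x = "cosj (fst q) * sin (of_int (snd q) * \<tau>\<^sub>c)"
      have "\<bar>?x\<bar> \<le> 1 * 1" unfolding abs_mult by (intro mult_mono abs_cosj_le) auto
      then have "2 * c * \<bar>of_int (snd q)\<bar> * \<bar>?x\<bar> \<le> 2 * c * \<bar>of_int (snd q)\<bar> * 1" using par by (intro mult_left_mono) auto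
      moreover have "- (2 * c * \<bar>of_int (snd q)\<bar> * \<bar>?x\<bar>) \<le> 2 * c * of_int (snd q) * ?x"
      proof -
        have "\<bar>2 * c * of_int (snd q) * ?x\<bar> = 2 * c * \<bar>of_int (snd q)\<bar> * \<bar>?x\<bar>" using par by (simp add: abs_mult)
        then show ?thesis by linarith
      qed
      moreover have "of_int (snd q) * Im (gcoef a \<delta> c \<tau>\<^sub>c q) = (a + \<delta>) * (of_int (snd q))\<^sup>2 + 2 * c * of_int (snd q) * ?x"
        by (simp add: gcoef_def cosj_def power2_eq_square algebra_simps flip: of_int_mult)
      ultimately show ?thesis by linarith
    qed
    ultimately show ?thesis using a3 pos \<eta>
      by (intro exI[of _ a3] exI[of _ "a + \<delta>"] exI[of _ "2 * c"]) blast
  qed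
  obtain B where B: "0 < B" and sols: "\<And>\<epsilon>. 0 < \<epsilon> \<Longrightarrow> \<exists>s y b \<tau>. 0 < s \<and> s < \<epsilon> \<and> Y y \<and> y (j, m) = 1 \<and>
     (\<forall>a. norm (y a) \<le> B * wt a / (1 + (of_int (snd a))\<^sup>2)) \<and> (\<forall>a. norm (y a - e a) \<le> \<epsilon> * wt a) \<and>
     \<bar>b - bs\<bar> < \<epsilon> \<and> \<bar>\<tau> - \<tau>s\<bar> < \<epsilon> \<and> 0 < b \<and> 0 \<le> \<tau> \<and>
     (\<forall>a. D b \<tau> a * y a = - (of_real (\<beta> * s\<^sup>2) * cube y a))"
    using bifurcating_solutions[OF \<tau>s boundary] by blast
  define W where "W = (\<Sum>\<^sub>\<infinity>q::'n mod_ring \<times> int. wt q)"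
  have W0: "0 \<le> W" unfolding W_def by (intro infsum_nonneg less_imp_le[OF wt_pos])
  define E where "E = \<bar>Re (synth e \<kappa>0 t0)\<bar>"
  have E: "0 < E" using nonvanishing by (simp add: E_def)
  \<comment> \<open>\<epsilon> / B makes the scaled solution small; E / (W + 1) keeps y closer to e
    than E, uniformly in time.\<close>
  define \<epsilon>' where "\<epsilon>' = min \<epsilon> (min (\<epsilon> / B) (E / (W + 1)))"
  have \<epsilon>': "0 < \<epsilon>'" "\<epsilon>' \<le> \<epsilon>" "\<epsilon>' \<le> \<epsilon> / B" "\<epsilon>' \<le> E / (W + 1)" using \<epsilon> B E W0 by (auto simp: \<epsilon>'_def)
  obtain s y b \<tau> where s: "0 < s" "s < \<epsilon>'" and y: "Y y" "\<And>q. norm (y q) \<le> B * wt q / (1 + (of_int (snd q))\<^sup>2)"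
      "\<And>q. norm (y q - e q) \<le> \<epsilon>' * wt q"
    and near: "\<bar>b - bs\<bar> < \<epsilon>'" "\<bar>\<tau> - \<tau>s\<bar> < \<epsilon>'" "0 < b" "0 \<le> \<tau>"
    and eq: "\<And>q. D b \<tau> q * y q = - (of_real (\<beta> * s\<^sup>2) * cube y q)"
    using sols[OF \<epsilon>'(1)] by blast
  define z where "z = (\<lambda>q. of_real s * y q)"
  have one: "1 \<le> 1 + (of_int (snd q) :: real)\<^sup>2" for q :: "'n mod_ring \<times> int" by simp
  have "fixed_family K z" using Y_scale[OF y(1), of s] by (simp add: Y_def z_def)
  moreover have "norm (z q) \<le> \<epsilon> * wt q / (1 + (of_int (snd q))\<^sup>2)" for q
  proof -
    have "s * B \<le> \<epsilon>" using s \<epsilon>'(3) B by (simp add: pos_le_divide_eq) (meson less_imp_le mult_right_mono order_trans)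
    then have "s * B * (wt q / (1 + (of_int (snd q))\<^sup>2)) \<le> \<epsilon> * (wt q / (1 + (of_int (snd q))\<^sup>2))"
      using wt_pos[of q] one[of q] by (intro mult_right_mono divide_nonneg_nonneg) auto
    moreover have "norm (z q) \<le> s * (B * wt q / (1 + (of_int (snd q))\<^sup>2))"
      using mult_left_mono[OF y(2)[of q], of s] s by (simp add: z_def norm_mult)
    ultimately show ?thesis by simp
  qed
  moreover have "Dc a \<delta> c \<tau>\<^sub>c b \<tau> q * z q = - (of_real \<beta> * cube z q)" for q
    using eq[of q] unfolding D_eq z_def cube_cmult
    by (simp add: power3_eq_cube power2_eq_square mult_ac)
  moreover have "Re (synth z \<kappa>0 t0) \<noteq> Re (synth z \<kappa>0 (t0 + pi / of_int m))"
  proof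
    assume eqz: "Re (synth z \<kappa>0 t0) = Re (synth z \<kappa>0 (t0 + pi / of_int m))"
    have sz: "synth z \<kappa>0 t = of_real s * synth y \<kappa>0 t" for t
      unfolding synth_def z_def mult.assoc by (rule infsum_cmult_right')
    have se: "(\<lambda>q. norm (e q)) summable_on UNIV"
      using decays_finite_support[OF e_finite] decays_summable by blast
    have sw: "(\<lambda>q::'n mod_ring \<times> int. \<epsilon>' * wt q) summable_on UNIV" by (intro summable_on_cmult_right wt_summable)
    have sd: "(\<lambda>q. norm (y q - e q)) summable_on UNIV"
      by (rule summable_on_comparison_test[OF sw y(3)]) simp
    have close: "\<bar>Re (synth y \<kappa>0 t) - Re (synth e \<kappa>0 t)\<bar> \<le> \<epsilon>' * W" for t
    proof -
      have "((\<lambda>q. (y q - e q) * chr \<kappa>0 t q + e q * chr \<kappa>0 t q) has_sum (synth (\<lambda>q. y q - e q) \<kappa>0 t + synth e \<kappa>0 t)) UNIV"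
        by (intro has_sum_add synth_has_sum sd se)
      then have "synth y \<kappa>0 t = synth (\<lambda>q. y q - e q) \<kappa>0 t + synth e \<kappa>0 t"
        unfolding synth_def[of y] by (intro infsumI) (simp add: algebra_simps)
      moreover have "norm (synth (\<lambda>q. y q - e q) \<kappa>0 t) \<le> (\<Sum>\<^sub>\<infinity>q::'n mod_ring \<times> int. \<epsilon>' * wt q)"
        by (rule norm_synth_le[OF y(3) sw])
      ultimately show ?thesis
        using abs_Re_le_cmod[of "synth (\<lambda>q. y q - e q) \<kappa>0 t"] by (simp add: W_def infsum_cmult_right')
    qed
    \<comment> \<open>Half a period changes the sign of e. At the two times y is therefore closer
      than E to opposite values of modulus E, and its two values differ.\<close>
    have flip: "synth e \<kappa>0 (t + pi / of_int m) = - synth e \<kappa>0 t" for t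
    proof -
      have "e q * chr \<kappa>0 (t + pi / of_int m) q = - (e q * chr \<kappa>0 t q)" for q
      proof (cases "e q = 0")
        case False
        then have "snd q = m \<or> snd q = - m" using e(3) by fastforce
        then have "cis (of_int (snd q) * (t + pi / of_int m)) = - cis (of_int (snd q) * t)"
        proof
          assume "snd q = m"
          then have "of_int (snd q) * (t + pi / of_int m) = of_int (snd q) * t + pi" using m by (simp add: distrib_left)
          then show ?thesis by (simp flip: cis_mult)
        next
          assume "snd q = - m"
          then have "of_int (snd q) * (t + pi / of_int m) = of_int (snd q) * t + - pi" using m by (simp add: distrib_left)
          then show ?thesis by (simp add: complex_eq_iff)
        qed
        then show ?thesis by (simp add: chr_def)
      qed simp
      then show ?thesis unfolding synth_def by (simp add: infsum_uminus)
    qed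
    have "s * Re (synth y \<kappa>0 t0) = s * Re (synth y \<kappa>0 (t0 + pi / of_int m))" using eqz unfolding sz by simp
    then have "Re (synth y \<kappa>0 t0) = Re (synth y \<kappa>0 (t0 + pi / of_int m))" using s by simp
    then have "E \<le> \<epsilon>' * W"
      using close[of t0] close[of "t0 + pi / of_int m"] unfolding flip E_def by simp
    moreover have "\<epsilon>' * (W + 1) \<le> E" using \<epsilon>'(4) W0 by (simp add: pos_le_divide_eq)
    ultimately show False using \<epsilon>'(1) by (simp add: distrib_left)
  qed
  ultimately show ?thesis using near \<epsilon>'(2) by (intro exI[of _ b] exI[of _ \<tau>] exI[of _ z]) auto
qed

section \<open>Resonances inside a fixed space\<close>

lemma chi_inj:
  assumes "chi i (of_int_mod_ring 1) = chi (j :: 'n::finite mod_ring) (of_int_mod_ring 1)" shows "i = j"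
proof -
  let ?x = "to_int_mod_ring (i - j)" and ?n = "real CARD('n)"
  have "chi (i - j) (of_int_mod_ring 1) = chi i (of_int_mod_ring 1) * chi (- j) (of_int_mod_ring 1)"
    using chi_add[of i "- j"] by simp
  also have "\<dots> = chi j (of_int_mod_ring 1) * chi (- j) (of_int_mod_ring 1)" by (simp add: assms)
  also have "\<dots> = 1" using chi_add[of j "- j" "of_int_mod_ring 1"] by simp
  finally have "cis (2 * pi * of_int ?x / ?n) = 1"
    using chi_of_int[of 1 "i - j"] by (simp add: chi_commute)
  then have "cos (2 * pi * of_int ?x / ?n) = 1" by (simp add: complex_eq_iff)
  then obtain k :: int where k: "2 * pi * of_int ?x / ?n = of_int k * 2 * pi" unfolding cos_one_2pi_int by blast
  then have "of_int ?x = of_int k * ?n" by (simp add: field_simps)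
  then have x: "?x = k * int CARD('n)" by (metis of_int_eq_iff of_int_mult of_int_of_nat_eq)
  have "?x \<in> {0..<int CARD('n)}" using range_to_int_mod_ring by blast
  then have "k = 0" unfolding x by (auto simp: zero_le_mult_iff mult_less_cancel_right1)
  then have "of_int_mod_ring ?x = (0 :: 'n mod_ring)" by (simp add: x)
  then show ?thesis by simp
qed

lemma cosj_inj: "cosj i = cosj j \<Longrightarrow> i = j \<or> i = - j"
proof -
  assume eq: "cosj i = cosj j"
  let ?u = "chi i (of_int_mod_ring 1)" and ?v = "chi j (of_int_mod_ring 1)"
  have "(Re ?u)\<^sup>2 + (Im ?u)\<^sup>2 = 1" "(Re ?v)\<^sup>2 + (Im ?v)\<^sup>2 = 1" using cmod_power2[of ?u] cmod_power2[of ?v] by simp_all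
  moreover have re: "Re ?u = Re ?v" using eq by (simp add: cosj_def)
  ultimately have "(Im ?u)\<^sup>2 = (Im ?v)\<^sup>2" by simp
  then have "Im ?u = Im ?v \<or> Im ?u = - Im ?v" by (simp add: power2_eq_iff)
  then have "?u = ?v \<or> ?u = chi (- j) (of_int_mod_ring 1)" using re by (auto simp: complex_eq_iff chi_minus)
  then show ?thesis using chi_inj by blast
qed

lemma fixed_family_uminus: "fixed_family K y \<Longrightarrow> y (- q) = cnj (y q)"
  unfolding fixed_family_def by blast

lemma fixed_family_cact: "fixed_family K y \<Longrightarrow> g \<in> K \<Longrightarrow> cact g y = y"
  unfolding fixed_family_def by blast

text \<open>The action keeps the frequency and sends a class only to itself or its negative, so
  cutting a family down to one such block preserves invariance.\<close>

lemma fixed_family_restrict: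
  assumes "fixed_family K y"
  shows "fixed_family K (\<lambda>q. if (fst q = j \<or> fst q = - j) \<and> \<bar>snd q\<bar> = m then y q else 0)" (is "fixed_family K ?f")
  unfolding fixed_family_def
proof (intro conjI allI ballI)
  have m: "- i = j \<longleftrightarrow> i = - j" for i j :: "'a mod_ring" by (metis minus_minus)
  show "?f (- q) = cnj (?f q)" for q
  proof -
    have "y (- q) = cnj (y q)" by (rule fixed_family_uminus[OF assms])
    then show ?thesis by (simp add: m)
  qed
  fix g assume "g \<in> K"
  then have g: "cact g y q = y q" for q using assms by (simp add: fixed_family_def)
  show "cact g ?f = ?f"
  proof
    fix q show "cact g ?f q = ?f q"
      using g[of q] by (auto simp: cact_def m)
  qed
qed

text \<open>At the top frequency l + m only the part of e at frequency exactly m can meet f. The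
  case distinction avoids counting one index twice when j = -j.\<close>

lemma conv_leading:
  fixes e f :: "'n::finite mod_ring \<times> int \<Rightarrow> complex"
  assumes e: "\<And>q. e q \<noteq> 0 \<Longrightarrow> (fst q = j \<or> fst q = - j) \<and> \<bar>snd q\<bar> = m"
    and f: "\<And>q. f q \<noteq> 0 \<Longrightarrow> snd q \<le> l" and q: "snd q = l + m"
  shows "conv e f q = e (j, m) * f (q - (j, m)) + (if j = - j then 0 else e (- j, m) * f (q - (- j, m)))"
proof -
  have "conv e f q = (\<Sum>\<^sub>\<infinity>b\<in>{(j, m), (- j, m)}. e b * f (q - b))"
    unfolding conv_def
  proof (rule infsum_cong_neutral)
    fix b assume b: "b \<in> UNIV - {(j, m), (- j, m)}"
    show "e b * f (q - b) = 0"
    proof (rule ccontr)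
      assume nz: "e b * f (q - b) \<noteq> 0"
      then have "(fst b = j \<or> fst b = - j) \<and> \<bar>snd b\<bar> = m" "snd (q - b) \<le> l" using e[of b] f[of "q - b"] by auto
      moreover have "snd b = m" using calculation q by auto
      ultimately show False using b by (cases b) auto
    qed
  qed auto
  also have "\<dots> = (\<Sum>b\<in>{(j, m), (- j, m)}. e b * f (q - b))" by (rule infsum_finite) simp
  finally show ?thesis by (cases "j = - j") auto
qed

lemma conv_snd_le:
  assumes "\<And>q. f q \<noteq> 0 \<Longrightarrow> snd q \<le> l" "\<And>q. h q \<noteq> 0 \<Longrightarrow> snd q \<le> l'" "conv f h q \<noteq> 0"
  shows "snd q \<le> l + l'"
  using conv_support[OF assms(3)] assms(1,2) by fastforce

lemma cube_leading:
  fixes e :: "'n::finite mod_ring \<times> int \<Rightarrow> complex"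
  assumes e: "\<And>q. e q \<noteq> 0 \<Longrightarrow> (fst q = j \<or> fst q = - j) \<and> \<bar>snd q\<bar> = m" and q: "snd q = 3 * m"
  defines "u \<equiv> e (j, m)" and "v \<equiv> (if j = - j then 0 else e (- j, m))"
  shows "cube e q = u\<^sup>2 * e (q - (j, m) - (j, m)) + u * v * e (q - (j, m) - (- j, m))
     + (v * u * e (q - (- j, m) - (j, m)) + v\<^sup>2 * e (q - (- j, m) - (- j, m)))"
proof -
  have e1: "snd q \<le> m" if "e q \<noteq> 0" for q using e[OF that] by auto
  have e2: "snd q \<le> 2 * m" if "conv e e q \<noteq> 0" for q using conv_snd_le[OF e1 e1 that] by simp
  have c2: "conv e e p = u * e (p - (j, m)) + v * e (p - (- j, m))" if "snd p = 2 * m" for p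
    using conv_leading[of e j m e m p, OF e e1] that by (simp add: u_def v_def)
  have "cube e q = u * conv e e (q - (j, m)) + v * conv e e (q - (- j, m))"
    unfolding cube_def using conv_leading[of e j m "conv e e" "2 * m" q, OF e e2] q by (simp add: u_def v_def)
  then show ?thesis using q by (simp add: c2 power2_eq_square distrib_left mult.assoc)
qed

lemma synth_finite:
  assumes "\<And>q. e q \<noteq> 0 \<Longrightarrow> q \<in> S" "finite S"
  shows "synth e \<kappa> t = (\<Sum>q\<in>S. e q * chr \<kappa> t q)"
proof -
  have "synth e \<kappa> t = (\<Sum>\<^sub>\<infinity>q\<in>S. e q * chr \<kappa> t q)"
    unfolding synth_def by (rule infsum_cong_neutral) (use assms in auto)
  then show ?thesis using assms(2) by simp
qed

lemma cis_mult_Arg: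
  assumes "norm w = 1" shows "cis (of_int k * Arg w) = w powi k"
proof -
  have "w \<noteq> 0" using assms by auto
  then have "cis (Arg w) = w" using cis_Arg[of w] assms by (simp add: sgn_div_norm)
  then show ?thesis using cis_power_int[of "Arg w" k] by simp
qed

text \<open>The bifurcating frequency may be a larger one than m0 and the symmetry group imposed may
  be larger than K; both are harmless, because only invariance under K and nonconstancy are
  claimed.\<close>

lemma fixed_mode_solutions:
  fixes K :: "'n::finite gelem set"
  assumes par: "0 < a" "0 < \<delta>" "0 \<le> c" "0 < \<beta>" and bs: "0 < bs" and \<tau>s: "0 \<le> \<tau>s"
    and K: "\<And>g. g \<in> K \<Longrightarrow> fst (snd g) \<in> {1, -1}"
    and m0: "0 < m0" and crit0: "Dc a \<delta> c \<tau>\<^sub>c bs \<tau>s (j0, m0) = 0"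
    and z0: "fixed_family K z0" "\<And>q. z0 q \<noteq> 0 \<Longrightarrow> (fst q = j0 \<or> fst q = - j0) \<and> \<bar>snd q\<bar> = m0" "z0 q0 \<noteq> 0"
    and coupled: "0 < c \<or> (\<forall>g\<in>K. snd (fst g) = 1)"
  shows "\<exists>\<kappa>0 t0 t1. \<forall>\<epsilon>>0. \<exists>b \<tau> z. \<bar>b - bs\<bar> < \<epsilon> \<and> \<bar>\<tau> - \<tau>s\<bar> < \<epsilon> \<and> 0 < b \<and> 0 \<le> \<tau> \<and> fixed_family K z \<and>
     (\<forall>q. norm (z q) \<le> \<epsilon> * wt q / (1 + (of_int (snd q))\<^sup>2)) \<and>
     (\<forall>q. Dc a \<delta> c \<tau>\<^sub>c b \<tau> q * z q = - (of_real \<beta> * cube z q)) \<and>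
     Re (synth z \<kappa>0 t0) \<noteq> Re (synth z \<kappa>0 t1)"
proof -
  let ?\<Delta> = "Dc a \<delta> c \<tau>\<^sub>c bs \<tau>s :: 'n mod_ring \<times> int \<Rightarrow> complex"
  define mode where "mode j m \<longleftrightarrow> 0 < m \<and> ?\<Delta> (j, m) = 0 \<and>
      (\<exists>z. fixed_family K z \<and> (\<forall>q. z q \<noteq> 0 \<longrightarrow> (fst q = j \<or> fst q = - j) \<and> \<bar>snd q\<bar> = m) \<and> z (j, m) \<noteq> 0)" for j m
  have \<Delta>_minus: "?\<Delta> (- q) = cnj (?\<Delta> q)" for q by (rule Dc_minus)
  \<comment> \<open>A nonzero coefficient of any K-fixed family at a critical index of positive
    frequency suffices: its block can be cut out.\<close>
  have modeI: "mode (fst q) (snd q)" if y: "fixed_family K y" "y q \<noteq> 0" "0 < snd q" "?\<Delta> q = 0" for y q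
    unfolding mode_def using fixed_family_restrict[OF y(1), of "fst q" "snd q"] y
    by (intro conjI exI[of _ "\<lambda>p. if (fst p = fst q \<or> fst p = - fst q) \<and> \<bar>snd p\<bar> = snd q then y p else 0"]) auto
  have ex: "\<exists>j m. mode j m"
  proof -
    have q0: "fst q0 = j0 \<or> fst q0 = - j0" "\<bar>snd q0\<bar> = m0" using z0(2,3) by blast+
    have z0m: "z0 (- q0) \<noteq> 0" using z0(3) by (simp add: fixed_family_uminus[OF z0(1)])
    have D: "?\<Delta> (i, m0) = 0" if "i = j0 \<or> i = - j0" for i using that crit0 Dc_cong[of "- j0" j0] by auto
    show ?thesis
    proof (cases "0 < snd q0")
      case True
      then show ?thesis using modeI[OF z0(1,3) True] D q0 by (cases q0) auto
    next
      case False
      then have s: "snd (- q0) = m0" using q0 m0 by auto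
      moreover have "?\<Delta> (- q0) = 0"
      proof -
        have "- q0 = (- fst q0, m0)" using s by (cases q0) auto
        moreover have "- fst q0 = j0 \<or> - fst q0 = - j0" using q0(1) by auto
        ultimately show ?thesis using D by presburger
      qed
      ultimately show ?thesis using modeI[OF z0(1) z0m] m0 by auto
    qed
  qed
  \<comment> \<open>A critical m satisfies m^2 <= G (1 + m) + bs, so there are only finitely many
    and a largest one exists.\<close>
  have bound: "of_int m \<le> 2 * (a + \<delta> + a * \<delta> + 4 * c) + bs" if "mode j m" for j m
  proof -
    let ?G = "a + \<delta> + a * \<delta> + 4 * c"
    have m: "1 \<le> (of_int m :: real)" using that by (simp add: mode_def)
    have "?\<Delta> (j, m) = 0" using that by (simp add: mode_def)
    then have "(of_int m)\<^sup>2 = (gcoef a \<delta> c \<tau>\<^sub>c (j, m) + (of_int m)\<^sup>2) + of_real bs * cis (- (of_int m * \<tau>s))"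
      by (simp add: Dc_def algebra_simps)
    then have "norm ((of_int m)\<^sup>2 :: complex) \<le> norm (gcoef a \<delta> c \<tau>\<^sub>c (j, m) + (of_int m)\<^sup>2) + norm (of_real bs * cis (- (of_int m * \<tau>s)))"
      by (metis norm_triangle_ineq)
    also have "\<dots> \<le> ?G * (1 + of_int m) + bs"
      using norm_gcoef_le[of c a \<delta> \<tau>\<^sub>c "(j, m)"] par bs m by (simp add: norm_mult)
    also have "norm ((of_int m)\<^sup>2 :: complex) = of_int m * of_int m"
      unfolding norm_power norm_of_int by (simp add: power2_eq_square)
    finally have "of_int m * of_int m \<le> ?G * (1 + of_int m) + bs" .
    also have "\<dots> \<le> ?G * (of_int m + of_int m) + bs * of_int m"
      using m par bs by (intro add_mono mult_left_mono) auto
    also have "\<dots> = (2 * ?G + bs) * of_int m" by (simp add: algebra_simps)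
    finally show ?thesis using m by simp
  qed
  have fin: "finite {m. \<exists>j. mode j m}"
  proof (rule finite_subset)
    show "{m. \<exists>j. mode j m} \<subseteq> {0..\<lceil>2 * (a + \<delta> + a * \<delta> + 4 * c) + bs\<rceil>}"
    proof clarify
      fix m j assume "mode j m"
      then have "0 < m" "of_int m \<le> 2 * (a + \<delta> + a * \<delta> + 4 * c) + bs" using bound by (auto simp: mode_def)
      then show "m \<in> {0..\<lceil>2 * (a + \<delta> + a * \<delta> + 4 * c) + bs\<rceil>}"
        using le_of_int_ceiling[of "2 * (a + \<delta> + a * \<delta> + 4 * c) + bs"] by (simp add: le_ceiling_iff)
    qed
  qed simp
  define m where "m = Max {m. \<exists>j. mode j m}"
  have "m \<in> {m. \<exists>j. mode j m}" unfolding m_def using ex by (intro Max_in[OF fin]) auto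
  then obtain j where jm: "mode j m" by blast
  have max: "m' \<le> m" if "mode j' m'" for j' m' unfolding m_def using that by (intro Max_ge[OF fin]) auto
  obtain z where z: "fixed_family K z" "\<And>q. z q \<noteq> 0 \<Longrightarrow> (fst q = j \<or> fst q = - j) \<and> \<bar>snd q\<bar> = m" "z (j, m) \<noteq> 0"
    and m: "0 < m" and crit: "?\<Delta> (j, m) = 0"
    using jm unfolding mode_def by blast
  \<comment> \<open>An odd multiple of m has modulus at least m, and a critical one has modulus at
    most m by maximality.\<close>
  have snd_crit: "\<bar>snd q\<bar> = m" if y: "fixed_family K y" "\<And>q. y q \<noteq> 0 \<Longrightarrow> \<exists>k. odd k \<and> snd q = k * m" "?\<Delta> q = 0" "y q \<noteq> 0" for y q
  proof -
    obtain k where k: "odd k" "snd q = k * m" using y(2,4) by blast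
    have "k \<noteq> 0" using k by auto
    have y': "y (- q) \<noteq> 0" using y(4) by (simp add: fixed_family_uminus[OF y(1)])
    have "?\<Delta> (- q) = 0" using y(3) by (simp add: \<Delta>_minus)
    then have "\<bar>snd q\<bar> \<le> m"
      using max[OF modeI[OF y(1,4) _ y(3)]] max[OF modeI[OF y(1) y']] m k
      by (cases "0 < snd q") (auto simp: abs_if mult_less_0_iff zero_less_mult_iff not_less)
    moreover have "1 * m \<le> \<bar>k\<bar> * m" using \<open>k \<noteq> 0\<close> m by (intro mult_right_mono) auto
    ultimately show ?thesis using k m by (simp add: abs_mult)
  qed
  define a0 where "a0 = (j, m)"
  have a0_ne: "a0 \<noteq> - a0" using m by (auto simp: a0_def)
  consider (T) "j = - j \<or> (\<forall>g\<in>K. snd (fst g) = 1)" | (S) g0 where "0 < c" "j \<noteq> - j" "g0 \<in> K" "snd (fst g0) \<noteq> 1"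
    using coupled by blast
  then show ?thesis
  proof cases
    case T
    \<comment> \<open>The time shift \<alpha> compensates the rotation by one cell on class j: m
      \<alpha> is the angle of the character of j at 1.\<close>
    define \<alpha> where "\<alpha> = 2 * pi * of_int (to_int_mod_ring j) / (real CARD('n) * of_int m)"
    define g1 :: "'n gelem" where "g1 = ((of_int_mod_ring 1, 1), (1, cis \<alpha>))"
    have "cis (of_int m * Arg (cis \<alpha>)) = cis (of_int m * \<alpha>)"
      using cis_mult_Arg[of "cis \<alpha>" m] cis_power_int[of \<alpha> m] by simp
    also have "of_int m * \<alpha> = 2 * pi * of_int (1 * to_int_mod_ring j) / real CARD('n)" using m by (simp add: \<alpha>_def)
    finally have g1: "cis (of_int m * Arg (cis \<alpha>)) = chi j (of_int_mod_ring 1)"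
      using chi_of_int[of 1 j] by (simp add: chi_commute)
    define e where "e q = (if q = a0 \<or> q = - a0 then 1 else 0 :: complex)" for q
    have coef: "of_int (fst (snd g)) * cis (of_int m * Arg (snd (snd g))) * chi j (- fst (fst g)) = 1 \<and>
        (snd (fst g) = 1 \<or> j = - j)" if "g \<in> insert g1 K" for g
    proof (cases "g = g1")
      case True
      have "chi j (of_int_mod_ring 1) * chi j (- of_int_mod_ring 1) = 1"
        using chi_add_right[of j "of_int_mod_ring 1" "- of_int_mod_ring 1"] by simp
      then show ?thesis using g1 by (simp add: True g1_def)
    next
      case False
      then have g: "g \<in> K" using that by simp
      then have s: "snd (fst g) = 1 \<or> j = - j" using T by blast
      have "cact g z (j, m) = z (j, m)" by (simp only: fixed_family_cact[OF z(1) g])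
      moreover have "(if snd (fst g) = 1 then j else - j) = j" using s by auto
      ultimately show ?thesis using z(3) s unfolding cact_def fst_conv snd_conv by simp
    qed
    have e_fixed: "fixed_family (insert g1 K) e"
      unfolding fixed_family_def
    proof (intro conjI allI ballI)
      show "e (- q) = cnj (e q)" for q
      proof -
        have "- q = a0 \<longleftrightarrow> q = - a0" by (metis minus_minus)
        moreover have "- q = - a0 \<longleftrightarrow> q = a0" by (rule neg_equal_iff_equal)
        ultimately show ?thesis unfolding e_def by auto
      qed
      fix g assume g: "g \<in> insert g1 K"
      let ?\<psi> = "\<lambda>q :: 'n mod_ring \<times> int. of_int (fst (snd g)) * cis (of_int (snd q) * Arg (snd (snd g))) * chi (fst q) (- fst (fst g))"
      show "cact g e = e"
      proof
        fix q :: "'n mod_ring \<times> int"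
        have c: "?\<psi> a0 = 1" using coef[OF g] by (simp add: a0_def)
        have c': "?\<psi> (- a0) = 1"
          using arg_cong[OF c, of cnj] by (simp add: a0_def chi_minus cis_cnj)
        have eq: "e (if snd (fst g) = 1 then fst q else - fst q, snd q) = e q"
        proof -
          have mi: "- fst q = i \<longleftrightarrow> fst q = - i" for i by (metis minus_minus)
          show ?thesis using coef[OF g] by (cases q) (auto simp: e_def a0_def mi[of _, simplified])
        qed
        have "?\<psi> q * e q = e q" using c c' by (auto simp: e_def)
        then show "cact g e q = e q" unfolding cact_def eq .
      qed
    qed
    have e_supp: "(fst q = j \<or> fst q = - j) \<and> \<bar>snd q\<bar> = m" if "e q \<noteq> 0" for q
      using that m by (auto simp: e_def a0_def split: if_splits)
    have e_crit: "y q = (if snd q > 0 then y (j, m) else cnj (y (j, m))) * e q"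
      if y: "fixed_family (insert g1 K) y" "\<And>q. y q \<noteq> 0 \<Longrightarrow> \<exists>k. odd k \<and> snd q = k * m" "?\<Delta> q = 0" for y q
    proof -
      have yK: "fixed_family K y" using y(1) by (simp add: fixed_family_def)
      have real: "y (- q) = cnj (y q)" for q by (rule fixed_family_uminus[OF y(1)])
      \<comment> \<open>Invariance under \<open>g1\<close> equates the characters of the class of q
        and of j at 1, and a class is determined by that value.\<close>
      have pos: "q = a0" if "y q \<noteq> 0" "snd q = m" for q
      proof -
        have "cact g1 y q = y q" using fixed_family_cact[OF y(1), of g1] by simp
        then have "chi j (of_int_mod_ring 1) * chi (fst q) (- of_int_mod_ring 1) = 1"
          using that g1 by (cases q) (simp add: cact_def g1_def)
        moreover have "chi (fst q) (of_int_mod_ring 1) * chi (fst q) (- of_int_mod_ring 1) = 1"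
          using chi_add_right[of "fst q" "of_int_mod_ring 1" "- of_int_mod_ring 1"] by simp
        ultimately have "chi (fst q) (of_int_mod_ring 1) = chi j (of_int_mod_ring 1)"
          by (metis chi_nonzero mult_right_cancel)
        then show ?thesis using chi_inj that(2) by (cases q) (auto simp: a0_def)
      qed
      show ?thesis
      proof (cases "y q = 0")
        case True
        then show ?thesis using real[of a0] m by (auto simp: e_def a0_def)
      next
        case False
        from snd_crit[OF yK y(2,3) False] have "snd q = m \<or> snd q = - m" by linarith
        then show ?thesis
        proof
          assume "snd q = m"
          then show ?thesis using pos[OF False] m by (simp add: e_def a0_def)
        next
          assume "snd q = - m"
          then have "- q = a0" using pos[of "- q"] False by (simp add: real)
          then have "q = - a0" by (metis minus_minus)
          then show ?thesis using m real[of a0] by (simp add: e_def) (simp add: a0_def)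
        qed
      qed
    qed
    \<comment> \<open>A single travelling wave has only one cubic coefficient at frequency 3m; it
      sits at (3j, 3m) and equals 1.\<close>
    have third: "cube e (j + j + j, 3 * m) \<noteq> 0"
    proof -
      have "(if j = - j then 0 else e (- j, m)) = 0" using m by (auto simp: e_def a0_def)
      then show ?thesis
        using cube_leading[of e j m "(j + j + j, 3 * m)", OF e_supp] by (simp add: e_def a0_def)
    qed
    have "synth e 0 0 = (\<Sum>q\<in>{a0, - a0}. e q * chr 0 0 q)"
      by (rule synth_finite) (auto simp: e_def split: if_splits)
    then have "synth e 0 0 = 2" using a0_ne by (simp add: e_def chr_def)
    then have nv: "Re (synth e 0 0) \<noteq> 0" by simp
    have K1: "fst (snd g) \<in> {1, -1}" if "g \<in> insert g1 K" for g using K[of g] that by (cases "g = g1") (simp_all add: g1_def)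
    have sub: "fixed_family (insert g1 K) y \<Longrightarrow> fixed_family K y" for y by (simp add: fixed_family_def)
    have e1: "e (j, m) = 1" by (simp add: e_def a0_def)
    have third': "\<exists>q. snd q = 3 * m \<and> cube e q \<noteq> 0" using third by (intro exI[of _ "(j + j + j, 3 * m)"]) simp
    show ?thesis
    proof (rule exI[of _ 0], rule exI[of _ 0], rule exI[of _ "0 + pi / of_int m"], intro allI impI)
      fix \<epsilon> :: real assume \<epsilon>: "0 < \<epsilon>"
      from mode_solutions[OF par bs \<tau>s K1 m crit e_fixed e1 e_supp e_crit nv third' \<epsilon>] sub
      show "\<exists>b \<tau> z. \<bar>b - bs\<bar> < \<epsilon> \<and> \<bar>\<tau> - \<tau>s\<bar> < \<epsilon> \<and> 0 < b \<and> 0 \<le> \<tau> \<and> fixed_family K z \<and>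
         (\<forall>q. norm (z q) \<le> \<epsilon> * wt q / (1 + (of_int (snd q))\<^sup>2)) \<and>
         (\<forall>q. Dc a \<delta> c \<tau>\<^sub>c b \<tau> q * z q = - (of_real \<beta> * cube z q)) \<and>
         Re (synth z 0 0) \<noteq> Re (synth z 0 (0 + pi / of_int m))" by blast
    qed
  next
    case S
    \<comment> \<open>Dividing by \<open>z a0\<close> at positive and by its conjugate at negative
      frequencies normalises the coefficient at (j, m) and keeps the family real. It commutes with
      \<open>cact\<close>, which preserves frequencies.\<close>
    define e where "e q = (if snd q > 0 then z q / z a0 else z q / cnj (z a0))" for q
    have za0: "z a0 \<noteq> 0" using z(3) by (simp add: a0_def)
    have e_supp: "(fst q = j \<or> fst q = - j) \<and> \<bar>snd q\<bar> = m" if "e q \<noteq> 0" for q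
      using z(2)[of q] that by (auto simp: e_def split: if_splits)
    have e_real: "e (- q) = cnj (e q)" for q
    proof (cases "z q = 0")
      case True
      moreover have "z (- q) = cnj (z q)" by (rule fixed_family_uminus[OF z(1)])
      ultimately show ?thesis by (simp add: e_def)
    next
      case False
      then have "snd q \<noteq> 0" using z(2)[OF False] m by auto
      moreover have "z (- q) = cnj (z q)" by (rule fixed_family_uminus[OF z(1)])
      ultimately show ?thesis by (auto simp: e_def)
    qed
    have e_fixed: "fixed_family K e"
      unfolding fixed_family_def
    proof (intro conjI allI ballI e_real)
      fix g assume "g \<in> K"
      then have "cact g z q = z q" for q by (simp only: fixed_family_cact[OF z(1)])
      moreover have "cact g e q = (if snd q > 0 then cact g z q / z a0 else cact g z q / cnj (z a0))" for q
        by (simp add: cact_def e_def)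
      ultimately show "cact g e = e" by (simp add: e_def fun_eq_iff)
    qed
    have e1: "e (j, m) = 1" using za0 m by (simp add: e_def a0_def)
    define \<gamma> where "\<gamma> = of_int (fst (snd g0)) * cis (of_int m * Arg (snd (snd g0))) * chi j (- fst (fst g0))"
    have \<gamma>: "norm \<gamma> = 1" unfolding \<gamma>_def by (rule norm_cact_coefficient[OF K[OF S(3)]])
    have swap: "y (j, m) = \<gamma> * y (- j, m)" if "fixed_family K y" for y
    proof -
      have "cact g0 y (j, m) = y (j, m)" by (simp only: fixed_family_cact[OF that S(3)])
      then show ?thesis using S(4) unfolding cact_def fst_conv snd_conv by (simp add: \<gamma>_def)
    qed
    define \<psi> where "\<psi> = e (- j, m)"
    have \<gamma>\<psi>: "\<gamma> * \<psi> = 1" using swap[OF e_fixed] e1 by (simp add: \<psi>_def)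
    then have \<psi>: "norm \<psi> = 1" using \<gamma> by (metis mult_1 norm_mult norm_one)
    have e_crit: "y q = (if snd q > 0 then y (j, m) else cnj (y (j, m))) * e q"
      if y: "fixed_family K y" "\<And>q. y q \<noteq> 0 \<Longrightarrow> \<exists>k. odd k \<and> snd q = k * m" "?\<Delta> q = 0" for y q
    proof -
      have real: "y (- q) = cnj (y q)" for q by (rule fixed_family_uminus[OF y(1)])
      have main: "y q = y (j, m) * e q" if "snd q = m" "?\<Delta> q = 0" for q
      proof -
        \<comment> \<open>Symbols of equal frequency differ only in the coupling term; if both
          vanish and c > 0, the cosines agree.\<close>
        have "?\<Delta> q - ?\<Delta> (j, m) = - (2 * of_real c * of_real (cosj (fst q) - cosj j) * cis (- (of_int m * \<tau>\<^sub>c)))"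
          using that(1) by (simp add: Dc_def gcoef_def cosj_def algebra_simps)
        then have "cosj (fst q) = cosj j" using that(2) crit S(1) by simp
        then have "fst q = j \<or> fst q = - j" by (rule cosj_inj)
        then have "q = (j, m) \<or> q = (- j, m)" using that(1) by (cases q) auto
        then show ?thesis
        proof
          assume "q = (- j, m)"
          moreover have "y (- j, m) = y (j, m) * \<psi>"
            using swap[OF y(1)] \<gamma>\<psi> by (simp add: mult_ac)
          ultimately show ?thesis by (simp add: \<psi>_def)
        qed (simp add: e1)
      qed
      show ?thesis
      proof (cases "snd q = m \<or> snd q = - m")
        case True
        then show ?thesis
        proof
          assume "snd q = m"
          then show ?thesis using main y(3) m by simp
        next
          assume s: "snd q = - m"
          then have "y (- q) = y (j, m) * e (- q)" using y(3) by (intro main) (simp_all add: \<Delta>_minus)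
          then have "cnj (y q) = y (j, m) * cnj (e q)" by (simp add: real e_real)
          then have "y q = cnj (y (j, m)) * e q" by (metis complex_cnj_cnj complex_cnj_mult)
          then show ?thesis using s m by simp
        qed
      next
        case False
        then have "y q = 0" using snd_crit[OF y(1,2,3)] by (metis abs_eq_iff' abs_of_pos m)
        moreover have "e q = 0" using e_supp[of q] False by (metis abs_eq_iff' abs_of_pos m)
        ultimately show ?thesis by simp
      qed
    qed
    have jj: "j + j \<noteq> 0" using S(2) by (metis add_eq_0_iff2)
    \<comment> \<open>Three of the four products contribute \<psi> each and the fourth has modulus
      at most 1, so they cannot cancel: |3 \<psi>| = 3.\<close>
    have third: "cube e (j, 3 * m) \<noteq> 0"
    proof -
      have c: "cube e (j, 3 * m) = \<psi> + \<psi> + (\<psi> + \<psi>\<^sup>2 * e (j + j + j, m))"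
      proof -
        have "(j, 3 * m) - (j, m) - (j, m) = (- j, m)" "(j, 3 * m) - (j, m) - (- j, m) = (j, m)"
          "(j, 3 * m) - (- j, m) - (j, m) = (j, m)" "(j, 3 * m) - (- j, m) - (- j, m) = (j + j + j, m)" by simp_all
        then show ?thesis
          using cube_leading[of e j m "(j, 3 * m)", OF e_supp] S(2) by (simp add: e1 \<psi>_def)
      qed
      have "norm (\<psi>\<^sup>2 * e (j + j + j, m)) \<le> 1"
      proof (cases "e (j + j + j, m) = 0")
        case False
        then have "j + j + j = j \<or> j + j + j = - j" using e_supp by fastforce
        then have "j + j + j = - j" using jj by (metis add.right_neutral add.assoc add_left_cancel)
        then show ?thesis using \<psi> by (simp add: \<psi>_def[symmetric] norm_mult norm_power)
      qed simp
      moreover have "norm (3 * \<psi>) = 3" using \<psi> by (simp add: norm_mult)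
      ultimately have "3 * \<psi> + \<psi>\<^sup>2 * e (j + j + j, m) \<noteq> 0" by (metis add_eq_0_iff norm_minus_cancel one_less_numeral_iff linorder_not_le semiring_norm(77))
      then show ?thesis unfolding c by (simp add: algebra_simps)
    qed
    have syn: "Re (synth e \<kappa> t) = 2 * Re (cis (of_int m * t) * (chi j \<kappa> + \<psi> * chi (- j) \<kappa>))" for \<kappa> t
    proof -
      let ?b = "(- j, m)"
      have ne: "(j, m) \<noteq> ?b" "(j, m) \<noteq> - (j, m)" "(j, m) \<noteq> - ?b" "?b \<noteq> - (j, m)" "?b \<noteq> - ?b" "- (j, m) \<noteq> - ?b"
        using S(2) m by auto
      have "synth e \<kappa> t = (\<Sum>q\<in>{(j, m), ?b, - (j, m), - ?b}. e q * chr \<kappa> t q)"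
      proof (rule synth_finite)
        fix q assume "e q \<noteq> 0"
        then have "fst q = j \<or> fst q = - j" "snd q = m \<or> snd q = - m" using e_supp by fastforce+
        then show "q \<in> {(j, m), ?b, - (j, m), - ?b}" by (cases q) auto
      qed simp
      also have "\<dots> = e (j, m) * chr \<kappa> t (j, m) + (e ?b * chr \<kappa> t ?b + (e (- (j, m)) * chr \<kappa> t (- (j, m)) + e (- ?b) * chr \<kappa> t (- ?b)))"
        using ne by (simp del: uminus_Pair)
      also have "\<dots> = (e (j, m) * chr \<kappa> t (j, m) + e ?b * chr \<kappa> t ?b) + cnj (e (j, m) * chr \<kappa> t (j, m) + e ?b * chr \<kappa> t ?b)"
        unfolding e_real chr_minus by simp
      finally have "Re (synth e \<kappa> t) = 2 * Re (e (j, m) * chr \<kappa> t (j, m) + e ?b * chr \<kappa> t ?b)" by simp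
      also have "e (j, m) * chr \<kappa> t (j, m) + e ?b * chr \<kappa> t ?b = cis (of_int m * t) * (chi j \<kappa> + \<psi> * chi (- j) \<kappa>)"
        by (simp add: e1 chr_def \<psi>_def algebra_simps)
      finally show ?thesis .
    qed
    \<comment> \<open>If the amplitude vanished in every cell, cell 0 would give \<psi> = -1, and
      cell 1 would then identify the characters of j and -j.\<close>
    have "\<exists>\<kappa>. chi j \<kappa> + \<psi> * chi (- j) \<kappa> \<noteq> 0"
    proof (rule ccontr)
      assume neg: "\<nexists>\<kappa>. chi j \<kappa> + \<psi> * chi (- j) \<kappa> \<noteq> 0"
      then have "chi j 0 + \<psi> * chi (- j) 0 = 0" by blast
      then have "1 + \<psi> = 0" by simp
      then have "\<psi> = - 1" unfolding add_eq_0_iff .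
      moreover have "chi j (of_int_mod_ring 1) + \<psi> * chi (- j) (of_int_mod_ring 1) = 0" using neg by blast
      ultimately have "chi j (of_int_mod_ring 1) = chi (- j) (of_int_mod_ring 1)" by simp
      then show False using chi_inj S(2) by blast
    qed
    then obtain \<kappa> where \<kappa>: "chi j \<kappa> + \<psi> * chi (- j) \<kappa> \<noteq> 0" by blast
    define v where "v = chi j \<kappa> + \<psi> * chi (- j) \<kappa>"
    have "\<exists>t. Re (cis (of_int m * t) * v) \<noteq> 0"
    proof (cases "Re v = 0")
      case False then show ?thesis by (intro exI[of _ 0]) simp
    next
      case True
      then have "Im v \<noteq> 0" using \<kappa> by (auto simp: v_def[symmetric] complex_eq_iff)
      moreover have "of_int m * (pi / 2 / of_int m) = pi / 2" using m by simp
      ultimately show ?thesis using m by (intro exI[of _ "pi / 2 / of_int m"]) simp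
    qed
    then obtain t where nv: "Re (synth e \<kappa> t) \<noteq> 0" unfolding syn v_def by auto
    have third': "\<exists>q. snd q = 3 * m \<and> cube e q \<noteq> 0" using third by (intro exI[of _ "(j, 3 * m)"]) simp
    show ?thesis
      by (rule exI[of _ \<kappa>], rule exI[of _ t], rule exI[of _ "t + pi / of_int m"])
        (intro allI impI mode_solutions[OF par bs \<tau>s K m crit e_fixed e1 e_supp e_crit nv third'])
  qed
qed

section \<open>Travelling and standing waves\<close>

text \<open>Complex coordinates on a mode space: cell \<kappa> carries the real part of exp(imt)
  times \<open>amp l A B \<kappa>\<close>. The waves with B = 0 and with A = 0 travel around the
  ring in opposite directions.\<close>

definition amp :: "nat \<Rightarrow> complex \<Rightarrow> complex \<Rightarrow> 'n::finite mod_ring \<Rightarrow> complex" where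
  "amp l A B \<kappa> = A * chi (of_int_mod_ring (int l)) \<kappa> + B * cnj (chi (of_int_mod_ring (int l)) \<kappa>)"

definition wave :: "nat \<Rightarrow> nat \<Rightarrow> complex \<Rightarrow> complex \<Rightarrow> 'n::finite osc" where
  "wave l m A B = Abs_h2per (\<lambda>t. \<chi> \<kappa>. Re (cis (real m * t) * amp l A B \<kappa>))"

lemma cis_mult_has_vector_derivative:
  "((\<lambda>t. Re (cis (r * t) * P)) has_vector_derivative Re (cis (r * t) * (\<i> * of_real r * P))) (at t)"
  unfolding has_real_derivative_iff_has_vector_derivative[symmetric]
  by (auto intro!: derivative_eq_intros simp: algebra_simps)

lemma h2fun_wave:
  fixes \<kappa> :: "'n::finite mod_ring"
  shows "h2fun (wave l m A B) t $ \<kappa> = Re (cis (real m * t) * amp l A B \<kappa>)"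
proof -
  let ?r = "real m"
  have "h2fun (wave l m A B) = (\<lambda>t. \<chi> \<kappa> :: 'n mod_ring. Re (cis (?r * t) * amp l A B \<kappa>))"
    unfolding wave_def
  proof (rule classical_h2per(3))
    show "((\<lambda>t. \<chi> \<kappa>. Re (cis (?r * t) * amp l A B \<kappa>)) has_vector_derivative (\<chi> \<kappa>. Re (cis (?r * t) * (\<i> * of_real ?r * amp l A B \<kappa>)))) (at t)" for t
      by (intro has_vector_derivative_vec_lambda cis_mult_has_vector_derivative)
    show "((\<lambda>t. \<chi> \<kappa>. Re (cis (?r * t) * (\<i> * of_real ?r * amp l A B \<kappa>))) has_vector_derivative
        (\<chi> \<kappa>. Re (cis (?r * t) * (\<i> * of_real ?r * (\<i> * of_real ?r * amp l A B \<kappa>))))) (at t)" for t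
      by (intro has_vector_derivative_vec_lambda cis_mult_has_vector_derivative)
    show "continuous_on UNIV (\<lambda>t. \<chi> \<kappa>. Re (cis (?r * t) * (\<i> * of_real ?r * (\<i> * of_real ?r * amp l A B \<kappa>))))"
      by (intro continuous_on_vec_lambda continuous_intros)
    have "cis (?r * (t + 2 * pi)) = cis (?r * t)" for t
      using cis_multiple_2pi[of ?r] by (simp add: distrib_left mult.commute flip: cis_mult)
    then show "(\<chi> \<kappa>. Re (cis (?r * (t + 2 * pi)) * amp l A B \<kappa>)) = (\<chi> \<kappa>. Re (cis (?r * t) * amp l A B \<kappa>))" for t
      by simp
  qed
  then show ?thesis by simp
qed

lemma h2per_eqI: "(\<And>t \<kappa>. h2fun x t $ \<kappa> = h2fun y t $ \<kappa>) \<Longrightarrow> x = y"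
  for x y :: "'n::finite osc"
  by (simp add: h2fun_inject[symmetric] fun_eq_iff vec_eq_iff)

lemma cis_theta: "cis (theta CARD('n) l * of_int (to_int_mod_ring \<kappa>)) = chi (of_int_mod_ring (int l)) (\<kappa> :: 'n::finite mod_ring)"
  unfolding chi_of_int theta_def by (simp add: mult_ac)

lemma V_mode_eq: "(V_mode l m :: 'n::finite osc set) = {wave l m A B | A B. True}"
proof (intro equalityI subsetI)
  fix x :: "'n osc" assume "x \<in> V_mode l m"
  let ?c = "\<chi> k :: 'n mod_ring. cos (theta CARD('n) l * of_int (to_int_mod_ring k))"
  let ?s = "\<chi> k :: 'n mod_ring. sin (theta CARD('n) l * of_int (to_int_mod_ring k))"
  obtain u v where uv: "u \<in> span {?c, ?s}" "v \<in> span {?c, ?s}"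
    and x: "\<And>t. h2fun x t = cos (real m * t) *\<^sub>R u + sin (real m * t) *\<^sub>R v"
    using \<open>x \<in> V_mode l m\<close> unfolding V_mode_def V_space_def by blast
  obtain a1 a2 where u: "u = a1 *\<^sub>R ?c + a2 *\<^sub>R ?s"
    using uv(1) unfolding span_insert span_empty by (auto simp: algebra_simps)
  obtain b1 b2 where v: "v = b1 *\<^sub>R ?c + b2 *\<^sub>R ?s"
    using uv(2) unfolding span_insert span_empty by (auto simp: algebra_simps)
  \<comment> \<open>A and B solve the four real equations that compare the products of cosines and
    sines in t and \<kappa>.\<close>
  define A where "A = Complex ((a1 - b2) / 2) (- (a2 + b1) / 2)"
  define B where "B = Complex ((a1 + b2) / 2) ((a2 - b1) / 2)"
  have "x = wave l m A B"
  proof (rule h2per_eqI)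
    fix t \<kappa>
    show "h2fun x t $ \<kappa> = h2fun (wave l m A B) t $ \<kappa>"
      unfolding h2fun_wave amp_def cis_theta[symmetric] x u v A_def B_def
      by (simp add: field_simps)
  qed
  then show "x \<in> {wave l m A B | A B. True}" by blast
next
  fix x :: "'n osc" assume "x \<in> {wave l m A B | A B. True}"
  then obtain A B where x: "x = wave l m A B" by blast
  let ?c = "\<chi> k :: 'n mod_ring. cos (theta CARD('n) l * of_int (to_int_mod_ring k))"
  let ?s = "\<chi> k :: 'n mod_ring. sin (theta CARD('n) l * of_int (to_int_mod_ring k))"
  let ?u = "(Re A + Re B) *\<^sub>R ?c + (Im B - Im A) *\<^sub>R ?s" and ?v = "(- (Im A + Im B)) *\<^sub>R ?c + (Re B - Re A) *\<^sub>R ?s"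
  have "?u \<in> V_space l" "?v \<in> V_space l"
    unfolding V_space_def by (intro span_add span_scale span_base; simp)+
  moreover have "h2fun x t = cos (real m * t) *\<^sub>R ?u + sin (real m * t) *\<^sub>R ?v" for t
    unfolding vec_eq_iff x h2fun_wave amp_def cis_theta[symmetric]
    by (simp add: field_simps)
  ultimately show "x \<in> V_mode l m" unfolding V_mode_def by blast
qed

text \<open>In the coordinates (A, B) a reflection swaps the two entries, a rotation multiplies them
  by \<open>rot\<close> and its conjugate, and the sign and time shift multiply both by
  \<open>lam\<close>; see \<open>act_wave\<close>.\<close>

definition lam :: "nat \<Rightarrow> 'n::finite gelem \<Rightarrow> complex" where
  "lam m g = of_int (fst (snd g)) * cis (real m * Arg (snd (snd g)))"

definition rot :: "nat \<Rightarrow> 'n::finite gelem \<Rightarrow> complex" where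
  "rot l g = chi (of_int_mod_ring (int l)) (- fst (fst g))"

lemma wave_swap: "h2fun (wave l m A B) t $ (if s = 1 then \<kappa> - r else r - \<kappa>) =
  Re (cis (real m * t) * amp l
     (chi (of_int_mod_ring (int l)) (- r) * (if s = 1 then A else B)) (cnj (chi (of_int_mod_ring (int l)) (- r)) * (if s = 1 then B else A)) \<kappa>)"
proof -
  let ?j = "of_int_mod_ring (int l)"
  have "chi ?j (\<kappa> - r) = chi ?j \<kappa> * chi ?j (- r)" using chi_add_right[of ?j \<kappa> "- r"] by simp
  moreover have "chi ?j (r - \<kappa>) = cnj (chi ?j \<kappa>) * cnj (chi ?j (- r))"
    using chi_minus_right[of ?j "\<kappa> - r"] chi_add_right[of ?j \<kappa> "- r"] by simp
  ultimately have "amp l A B (if s = 1 then \<kappa> - r else r - \<kappa>) =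
      amp l (chi ?j (- r) * (if s = 1 then A else B)) (cnj (chi ?j (- r)) * (if s = 1 then B else A)) \<kappa>"
    unfolding amp_def by (auto simp: mult_ac add.commute)
  then show ?thesis unfolding h2fun_wave by (rule arg_cong)
qed

lemma act_wave:
  fixes g :: "'n::finite gelem"
  shows "act g (wave l m A B) = wave l m (lam m g * rot l g * (if snd (fst g) = 1 then A else B))
     (lam m g * cnj (rot l g) * (if snd (fst g) = 1 then B else A))"
proof (rule h2per_eqI)
  fix t and \<kappa> :: "'n mod_ring"
  obtain r s \<iota> w where g: "g = ((r, s), (\<iota>, w))" by (cases g, cases "fst g", cases "snd g") auto
  let ?W = "wave l m (lam m g * rot l g * (if snd (fst g) = 1 then A else B))
     (lam m g * cnj (rot l g) * (if snd (fst g) = 1 then B else A)) :: 'n osc"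
  have "of_int \<iota> * h2fun (wave l m A B) (t + Arg w) $ (if s = 1 then \<kappa> - r else r - \<kappa>) = h2fun ?W t $ \<kappa>" for t \<kappa>
  proof -
    have cis: "cis (real m * (t + Arg w)) = cis (real m * t) * cis (real m * Arg w)"
      by (simp add: cis_mult distrib_left)
    have re: "of_int \<iota> * Re X = Re (of_int \<iota> * X)" for X by simp
    have "of_int \<iota> * (cis (real m * (t + Arg w)) * amp l
        (chi (of_int_mod_ring (int l)) (- r) * (if s = 1 then A else B)) (cnj (chi (of_int_mod_ring (int l)) (- r)) * (if s = 1 then B else A)) \<kappa>) =
      cis (real m * t) * amp l (lam m g * rot l g * (if snd (fst g) = 1 then A else B))
        (lam m g * cnj (rot l g) * (if snd (fst g) = 1 then B else A)) \<kappa>"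
      unfolding amp_def lam_def rot_def cis g fst_conv snd_conv by (simp only: distrib_left mult_ac)
    then show ?thesis unfolding wave_swap unfolding re unfolding h2fun_wave by (rule arg_cong)
  qed
  then have "act g (wave l m A B) = Abs_h2per (h2fun ?W)"
    unfolding act_def g prod.case
    by (intro arg_cong[of _ _ Abs_h2per] ext) (simp add: vec_eq_iff)
  then show "h2fun (act g (wave l m A B)) t $ \<kappa> = h2fun ?W t $ \<kappa>" by (simp add: h2fun_inverse)
qed

lemma wave_eq_iff_amp:
  assumes "0 < m"
  shows "wave l m A B = (wave l m A' B' :: 'n::finite osc) \<longleftrightarrow> (\<forall>\<kappa> :: 'n mod_ring. amp l A B \<kappa> = amp l A' B' \<kappa>)"
proof
  assume eq: "wave l m A B = (wave l m A' B' :: 'n osc)"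
  show "\<forall>\<kappa> :: 'n mod_ring. amp l A B \<kappa> = amp l A' B' \<kappa>"
  proof
    fix \<kappa> :: "'n mod_ring"
    have h: "Re (cis (real m * t) * amp l A B \<kappa>) = Re (cis (real m * t) * amp l A' B' \<kappa>)" for t
      using eq h2fun_wave by metis
    have "real m * (pi / 2 / real m) = pi / 2" using assms by simp
    then have "Im (amp l A B \<kappa>) = Im (amp l A' B' \<kappa>)" using h[of "pi / 2 / real m"] assms by simp
    moreover have "Re (amp l A B \<kappa>) = Re (amp l A' B' \<kappa>)" using h[of 0] by simp
    ultimately show "amp l A B \<kappa> = amp l A' B' \<kappa>" by (simp add: complex_eq_iff)
  qed
next
  assume "\<forall>\<kappa> :: 'n mod_ring. amp l A B \<kappa> = amp l A' B' \<kappa>"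
  then show "wave l m A B = (wave l m A' B' :: 'n osc)" using assms by (intro h2per_eqI) (simp add: h2fun_wave)
qed

lemma wave_inject:
  assumes "0 < m" and j: "(of_int_mod_ring (int l) :: 'n::finite mod_ring) \<noteq> - of_int_mod_ring (int l)"
  shows "wave l m A B = (wave l m A' B' :: 'n osc) \<longleftrightarrow> A = A' \<and> B = B'"
proof
  let ?j = "of_int_mod_ring (int l) :: 'n mod_ring" and ?one = "of_int_mod_ring 1 :: 'n mod_ring"
  assume "wave l m A B = (wave l m A' B' :: 'n osc)"
  then have eq: "amp l A B \<kappa> = amp l A' B' \<kappa>" for \<kappa> :: "'n mod_ring" using wave_eq_iff_amp[OF assms(1)] by blast
  define z where "z = chi ?j ?one"
  have "z \<noteq> cnj z"
    using chi_inj[of ?j "- ?j"] j by (auto simp: z_def chi_minus)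
  have e0: "A + B = A' + B'" using eq[of 0] by (simp add: amp_def)
  have e1: "A * z + B * cnj z = A' * z + B' * cnj z" using eq[of ?one] by (simp add: amp_def z_def)
  have "(A - A') * (z - cnj z) = (A * z + B * cnj z) - (A' * z + B' * cnj z) - (A + B - (A' + B')) * cnj z"
    by (simp add: algebra_simps)
  then have "(A - A') * (z - cnj z) = 0" using e0 e1 by simp
  then have "A = A'" using \<open>z \<noteq> cnj z\<close> by simp
  with e0 show "A = A' \<and> B = B'" by simp
qed simp

lemma chi_self_conjugate: "j = - j \<Longrightarrow> cnj (chi j \<kappa>) = chi j \<kappa>"
  by (metis chi_minus)

lemma wave_self_conjugate:
  assumes "0 < m" and j: "(of_int_mod_ring (int l) :: 'n::finite mod_ring) = - of_int_mod_ring (int l)"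
  shows "wave l m A B = (wave l m A' B' :: 'n osc) \<longleftrightarrow> A + B = A' + B'"
proof -
  have amp: "amp l A B \<kappa> = (A + B) * chi (of_int_mod_ring (int l)) \<kappa>" for A B and \<kappa> :: "'n mod_ring"
    unfolding amp_def chi_self_conjugate[OF j] by (simp add: distrib_right)
  show ?thesis unfolding wave_eq_iff_amp[OF assms(1)] amp by simp
qed

lemma wave_zero: "wave l m 0 0 = 0"
  by (rule h2per_eqI) (simp add: h2fun_wave amp_def zero_h2per.rep_eq)

lemma amp_act_coefficients:
  fixes g :: "'n::finite gelem"
  shows "amp l (lam m g * rot l g * (if snd (fst g) = 1 then A else B)) (lam m g * cnj (rot l g) * (if snd (fst g) = 1 then B else A)) \<kappa>
    = lam m g * amp l A B (if snd (fst g) = 1 then \<kappa> - fst (fst g) else fst (fst g) - \<kappa>)"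
proof -
  let ?j = "of_int_mod_ring (int l) :: 'n mod_ring" and ?r = "fst (fst g)"
  have "chi ?j (\<kappa> - ?r) = chi ?j \<kappa> * rot l g" using chi_add_right[of ?j \<kappa> "- ?r"] by (simp add: rot_def)
  moreover have "chi ?j (?r - \<kappa>) = cnj (chi ?j \<kappa>) * cnj (rot l g)"
    using chi_minus_right[of ?j "\<kappa> - ?r"] chi_add_right[of ?j \<kappa> "- ?r"] by (simp add: rot_def)
  ultimately show ?thesis by (auto simp: amp_def algebra_simps)
qed

lemma amp_act:
  fixes g :: "'n::finite gelem"
  assumes "0 < m" "act g (wave l m A B) = wave l m A B"
  shows "amp l A B \<kappa> = lam m g * amp l A B (if snd (fst g) = 1 then \<kappa> - fst (fst g) else fst (fst g) - \<kappa>)"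
  unfolding amp_act_coefficients[symmetric] using assms(2)
  unfolding act_wave wave_eq_iff_amp[OF assms(1)] by metis

lemma carrier_GG: "g \<in> carrier GG \<longleftrightarrow> snd (fst g) \<in> {1, -1} \<and> fst (snd g) \<in> {1, -1} \<and> norm (snd (snd g)) = 1"
  by (cases g, cases "fst g", cases "snd g")
    (auto simp: GG_def DirProd_def dihedral_def sign_group_def circle_group_def)

text \<open>The witness is the coefficient family of twice the wave, supported on the indices with
  class j or -j and frequency m or -m. If j = -j, the coordinates A and B address the same index and
  are merged into A + B.\<close>

lemma wave_family:
  fixes K :: "'n::finite gelem set"
  assumes m: "0 < m" and nz: "wave l m A B \<noteq> (0 :: 'n osc)" and K: "K \<subseteq> carrier GG"
    and fixed: "\<And>g. g \<in> K \<Longrightarrow> act g (wave l m A B) = wave l m A B"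
  defines "j \<equiv> of_int_mod_ring (int l) :: 'n mod_ring"
  shows "\<exists>z q. fixed_family K z \<and> z q \<noteq> 0 \<and> (\<forall>q. z q \<noteq> 0 \<longrightarrow> (fst q = j \<or> fst q = - j) \<and> \<bar>snd q\<bar> = int m)"
proof -
  define u where "u = (if j = - j then A + B else A)"
  define v where "v = (if j = - j then 0 else B)"
  have w: "wave l m A B = (wave l m u v :: 'n osc)"
    using wave_self_conjugate[where ?'n = 'n, OF m] by (auto simp: u_def v_def j_def)
  define z :: "'n mod_ring \<times> int \<Rightarrow> complex" where "z q = (if snd q = int m then (if fst q = j then u else if fst q = - j then v else 0)
     else if snd q = - int m then (if - fst q = j then cnj u else if fst q = j then cnj v else 0) else 0)" for q
  have neg: "- i = j \<longleftrightarrow> i = - j" "- i = - j \<longleftrightarrow> i = j" for i :: "'n mod_ring" by (metis minus_minus)+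
  have real: "z (- q) = cnj (z q)" for q
    using m by (auto simp: z_def neg)
  have cact_pos: "cact g z q = z q" if g: "g \<in> K" and q: "snd q = int m" for g q
  proof -
    have fx: "act g (wave l m u v) = (wave l m u v :: 'n osc)" using fixed[OF g] w by metis
    have c: "cact g z q = lam m g * chi (fst q) (- fst (fst g)) * z (if snd (fst g) = 1 then fst q else - fst q, int m)"
      unfolding cact_def q lam_def by simp
    have r: "chi j (- fst (fst g)) = rot l g" by (simp add: rot_def j_def)
    show ?thesis
    proof (cases "j = - j")
      case True
      have rr: "cnj (rot l g) = rot l g" unfolding rot_def j_def[symmetric] by (rule chi_self_conjugate[OF True])
      have "lam m g * rot l g * u = u"
        using fx[unfolded act_wave wave_self_conjugate[where ?'n = 'n and l = l, OF m True[unfolded j_def]]] rr True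
        by (auto simp: v_def split: if_splits)
      moreover have "- fst q = j \<longleftrightarrow> fst q = j" using True neg(1)[of "fst q"] by simp
      ultimately show ?thesis unfolding c using True q m by (auto simp: z_def v_def r)
    next
      case False
      have e: "lam m g * rot l g * (if snd (fst g) = 1 then u else v) = u \<and> lam m g * cnj (rot l g) * (if snd (fst g) = 1 then v else u) = v"
        using fx[unfolded act_wave wave_inject[where ?'n = 'n and l = l, OF m False[unfolded j_def]]] .
      have r': "chi (- j) (- fst (fst g)) = cnj (rot l g)" by (simp add: chi_minus r)
      show ?thesis
      proof (cases "fst q = j")
        case True
        then show ?thesis unfolding c using e False q m by (auto simp: z_def r split: if_splits)
      next
        case nj: False
        show ?thesis
        proof (cases "fst q = - j")
          case True
          then show ?thesis unfolding c using e False q m nj by (auto simp: z_def r' split: if_splits)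
        next
          case False
          then have "- fst q \<noteq> j" "- fst q \<noteq> - j" using nj neg by auto
          then show ?thesis unfolding c using nj False q m by (auto simp: z_def)
        qed
      qed
    qed
  qed
  have "fixed_family K z"
    unfolding fixed_family_def
  proof (intro conjI allI ballI real)
    fix g assume g: "g \<in> K"
    have \<iota>: "fst (snd g) \<in> {1, -1}" using g K carrier_GG by blast
    show "cact g z = z"
    proof
      fix q :: "'n mod_ring \<times> int"
      consider "snd q = int m" | "snd q = - int m" | "snd q \<noteq> int m" "snd q \<noteq> - int m" by blast
      then show "cact g z q = z q"
      proof cases
        case 1 then show ?thesis by (rule cact_pos[OF g])
      next
        case 2
        have "cact g z (- q) = cnj (cact g z q)"
        proof -
          have "(if snd (fst g) = 1 then fst (- q) else - fst (- q), snd (- q)) = - (if snd (fst g) = 1 then fst q else - fst q, snd q)" by simp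
          then show ?thesis unfolding cact_def by (simp add: real chi_minus cis_cnj del: uminus_Pair)
        qed
        moreover have "cact g z (- q) = z (- q)" using 2 by (intro cact_pos[OF g]) simp
        ultimately show ?thesis unfolding real by (metis complex_cnj_cnj)
      next
        case 3 then show ?thesis by (simp add: cact_def z_def)
      qed
    qed
  qed
  moreover have "\<exists>q. z q \<noteq> 0"
  proof (rule ccontr)
    assume "\<nexists>q. z q \<noteq> 0"
    then have zz: "z (j, int m) = 0" "z (- j, int m) = 0" by blast+
    then have "u = 0" by (simp add: z_def)
    moreover have "v = 0" using zz(2) by (auto simp: z_def v_def split: if_splits)
    ultimately show False using nz w wave_zero by metis
  qed
  moreover have "(fst q = j \<or> fst q = - j) \<and> \<bar>snd q\<bar> = int m" if "z q \<noteq> 0" for q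
    using that by (auto simp: z_def neg split: if_splits)
  ultimately show ?thesis by blast
qed

lemma Dc_eq_Delta:
  "Dc a \<delta> c \<tau>\<^sub>c b \<tau> (of_int_mod_ring (int l) :: 'n::finite mod_ring, int m) = Delta a \<delta> c \<tau>\<^sub>c CARD('n) l (\<i> * of_nat m) (b, \<tau>)"
proof -
  have "chi (of_int_mod_ring (int l)) (of_int_mod_ring 1 :: 'n mod_ring) = cis (theta CARD('n) l)"
    using chi_of_int[of 1 "of_int_mod_ring (int l) :: 'n mod_ring"] cis_cong_mod[of "int l mod int CARD('n)" "int CARD('n)" "int l"]
    by (simp add: chi_commute to_int_mod_ring_of_int theta_def)
  moreover have "exp (- (\<i> * of_nat m * of_real x)) = cis (- (real m * x))" for x
    by (simp add: cis_conv_exp mult.assoc)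
  moreover have "(\<i> * of_nat m)\<^sup>2 = - (of_nat m)\<^sup>2" by (simp add: power_mult_distrib)
  ultimately show ?thesis by (simp add: Dc_def gcoef_def Delta_def algebra_simps)
qed

theorem fixed_wave_bifurcates:
  fixes K :: "'n::finite gelem set" and x0 :: "'n osc"
  assumes par: "0 < a" "0 < \<delta>" "0 \<le> c" "0 < \<beta>" and bs: "0 < bs" and \<tau>s: "0 \<le> \<tau>s"
    and m: "0 < m" and crit: "Delta a \<delta> c \<tau>\<^sub>c CARD('n) l (\<i> * of_nat m) (bs, \<tau>s) = 0"
    and x0: "x0 \<in> V_mode l m" "x0 \<noteq> 0" and K: "K \<subseteq> carrier GG" "\<And>g. g \<in> K \<Longrightarrow> act g x0 = x0"
  shows "bifurcates a \<delta> c \<beta> \<tau>\<^sub>c (bs, \<tau>s) K"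
proof -
  let ?n = "real CARD('n)"
  define W where "W = (\<Sum>\<^sub>\<infinity>q::'n mod_ring \<times> int. wt q)"
  have W0: "0 \<le> W" unfolding W_def by (intro infsum_nonneg less_imp_le[OF wt_pos])
  obtain A B where AB: "x0 = wave l m A B" using x0(1) unfolding V_mode_eq by blast
  have crit': "Dc a \<delta> c \<tau>\<^sub>c bs \<tau>s (of_int_mod_ring (int l) :: 'n mod_ring, int m) = 0"
    unfolding Dc_eq_Delta by (rule crit)
  \<comment> \<open>5 n \<epsilon>' W is the bound on the norm that \<open>dde_solution\<close> will
    give.\<close>
  have small: "\<exists>\<epsilon>'. 0 < \<epsilon>' \<and> \<epsilon>' \<le> \<epsilon> \<and> 5 * (?n * (\<epsilon>' * W)) < \<epsilon>" if "0 < \<epsilon>" for \<epsilon> :: real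
  proof -
    have pos: "0 < 5 * ?n * W + 1" using W0 by (intro add_nonneg_pos) auto
    define \<epsilon>' where "\<epsilon>' = \<epsilon> / (5 * ?n * W + 1)"
    have e: "0 < \<epsilon>'" "\<epsilon>' * (5 * ?n * W + 1) = \<epsilon>" using that pos by (simp_all add: \<epsilon>'_def)
    have "\<epsilon>' * 1 \<le> \<epsilon>' * (5 * ?n * W + 1)" using e(1) W0 by (intro mult_left_mono) auto
    then have "\<epsilon>' \<le> \<epsilon>" using e by simp
    moreover have "5 * (?n * (\<epsilon>' * W)) < \<epsilon>" using e by (simp add: algebra_simps)
    ultimately show ?thesis using e(1) by blast
  qed
  show ?thesis
  proof (cases "c = 0")
    case False
    obtain z0 q0 where z0: "fixed_family K z0" "z0 q0 \<noteq> 0"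
      "\<And>q. z0 q \<noteq> 0 \<Longrightarrow> (fst q = of_int_mod_ring (int l) \<or> fst q = - of_int_mod_ring (int l)) \<and> \<bar>snd q\<bar> = int m"
      using wave_family[OF m x0(2)[unfolded AB] K(1) K(2)[unfolded AB]] by blast
    have \<iota>: "fst (snd g) \<in> {1, -1}" if "g \<in> K" for g using that K(1) carrier_GG by blast
    have m': "0 < int m" using m by simp
    have c': "0 < c \<or> (\<forall>g\<in>K. snd (fst g) = 1)" using False par by simp
    obtain \<kappa>0 t0 t1 where sols: "\<And>\<epsilon>. 0 < \<epsilon> \<Longrightarrow> \<exists>b \<tau> z. \<bar>b - bs\<bar> < \<epsilon> \<and> \<bar>\<tau> - \<tau>s\<bar> < \<epsilon> \<and> 0 < b \<and> 0 \<le> \<tau> \<and> fixed_family K z \<and>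
       (\<forall>q. norm (z q) \<le> \<epsilon> * wt q / (1 + (of_int (snd q))\<^sup>2)) \<and>
       (\<forall>q. Dc a \<delta> c \<tau>\<^sub>c b \<tau> q * z q = - (of_real \<beta> * cube z q)) \<and>
       Re (synth z \<kappa>0 t0) \<noteq> Re (synth z \<kappa>0 t1)"
      using fixed_mode_solutions[OF par bs \<tau>s \<iota> m' crit' z0(1,3,2) c'] by blast
    show ?thesis
    proof (rule bifurcatesI)
      fix \<epsilon> :: real assume \<epsilon>: "0 < \<epsilon>"
      obtain \<epsilon>' where \<epsilon>': "0 < \<epsilon>'" "\<epsilon>' \<le> \<epsilon>" "5 * (?n * (\<epsilon>' * W)) < \<epsilon>" using small[OF \<epsilon>] by blast
      obtain b \<tau> z where near: "\<bar>b - bs\<bar> < \<epsilon>'" "\<bar>\<tau> - \<tau>s\<bar> < \<epsilon>'" "0 < b" "0 \<le> \<tau>" and z: "fixed_family K z"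
        "\<And>q. norm (z q) \<le> \<epsilon>' * wt q / (1 + (of_int (snd q))\<^sup>2)"
        "\<And>q. Dc a \<delta> c \<tau>\<^sub>c b \<tau> q * z q = - (of_real \<beta> * cube z q)"
        and nc: "Re (synth z \<kappa>0 t0) \<noteq> Re (synth z \<kappa>0 t1)"
        using sols[OF \<epsilon>'(1)] by blast
      define x where "x = (\<lambda>\<kappa> t. Re (synth z \<kappa> t))"
      obtain x' x'' where x: "\<And>\<kappa> t. (x \<kappa> has_vector_derivative x' \<kappa> t) (at t)" "\<And>\<kappa> t. (x' \<kappa> has_vector_derivative x'' \<kappa> t) (at t)"
        "\<And>\<kappa> t. x \<kappa> (t + 2 * pi) = x \<kappa> t"
        "\<And>\<kappa> t. x'' \<kappa> t = - (a + \<delta>) * x' \<kappa> t - a * \<delta> * x \<kappa> t - b * x \<kappa> (t - \<tau>)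
           + c * (x (\<kappa> + of_int_mod_ring 1) (t - \<tau>\<^sub>c) - 2 * x \<kappa> t + x (\<kappa> - of_int_mod_ring 1) (t - \<tau>\<^sub>c)) - \<beta> * x \<kappa> t ^ 3"
        "\<And>\<kappa> t. \<bar>x \<kappa> t\<bar> \<le> \<epsilon>' * W" "\<And>\<kappa> t. \<bar>x' \<kappa> t\<bar> \<le> \<epsilon>' * W" "\<And>\<kappa> t. \<bar>x'' \<kappa> t\<bar> \<le> \<epsilon>' * W"
        using realization[OF fixed_family_uminus[OF z(1)] z(2) less_imp_le[OF \<epsilon>'(1)] z(3)[unfolded Dc_def]]
        unfolding x_def W_def by blast
      define X where "X = Abs_h2per (\<lambda>t. \<chi> \<kappa>. x \<kappa> t)"
      note sol = dde_solution[OF x, folded X_def]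
      have h: "h2fun X t $ \<kappa> = Re (synth z \<kappa> t)" for t \<kappa> unfolding sol(1) by (simp add: x_def)
      have "X \<notin> const_space"
      proof
        assume "X \<in> const_space"
        then have "h2fun X t0 = h2fun X t1" unfolding const_space_def by auto
        then show False using nc h by metis
      qed
      moreover have "act g X = X" if "g \<in> K" for g
        by (rule act_eq_if_cact_eq[OF h fixed_family_cact[OF z(1) that]])
      ultimately show "\<exists>b \<tau> (x :: 'n osc). \<bar>b - bs\<bar> < \<epsilon> \<and> \<bar>\<tau> - \<tau>s\<bar> < \<epsilon> \<and> norm x < \<epsilon> \<and> 0 < b \<and> 0 \<le> \<tau> \<and>
         Psi a \<delta> c \<beta> \<tau>\<^sub>c (b, \<tau>) x = 0 \<and> x \<notin> const_space \<and> (\<forall>g\<in>K. act g x = x)"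
        using near \<epsilon>' sol(2,3) by (intro exI[of _ b] exI[of _ \<tau>] exI[of _ X]) auto
    qed
  next
    case c0: True
    \<comment> \<open>Without coupling the cells evolve independently: copies of a single oscillation, shifted by the
      phase of the mode in each cell, keep every symmetry of the mode.\<close>
    define K2 :: "'n gelem set" where "K2 = insert ((0, 1), (-1, cis (pi / real m))) {((r, 1), (1, 1)) | r. True}"
    define z0 where "z0 q = (if fst q = 0 \<and> \<bar>snd q\<bar> = int m then 1 else 0 :: complex)" for q :: "'n mod_ring \<times> int"
    have mpi: "real m * (pi / real m) = pi" using m by simp
    have "pi / real m \<le> pi / 1" using m by (intro divide_left_mono) auto
    moreover have "0 < pi / real m" using m by simp
    ultimately have arg: "Arg (cis (pi / real m)) = pi / real m" by (intro Arg_cis) auto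
    have z0_fixed: "fixed_family K2 z0"
      unfolding fixed_family_def
    proof (intro conjI allI ballI)
      show "z0 (- q) = cnj (z0 q)" for q by (simp add: z0_def)
      fix g assume "g \<in> K2"
      then show "cact g z0 = z0"
      proof (unfold K2_def, elim insertE CollectE exE conjE)
        assume g: "g = ((0, 1), (-1, cis (pi / real m)))"
        show "cact g z0 = z0"
        proof
          fix q :: "'n mod_ring \<times> int"
          have "cis (of_int (snd q) * (pi / real m)) = -1" if "\<bar>snd q\<bar> = int m"
          proof -
            have "snd q = int m \<or> snd q = - int m" using that by linarith
            then show ?thesis using mpi by (auto simp: complex_eq_iff)
          qed
          then show "cact g z0 q = z0 q" unfolding cact_def g fst_conv snd_conv arg by (simp add: z0_def)
        qed
      next
        fix r assume g: "g = ((r, 1), (1, 1))"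
        show "cact g z0 = z0" by (rule ext) (simp add: cact_def g z0_def)
      qed
    qed
    have \<iota>: "fst (snd g) \<in> {1, -1}" if "g \<in> K2" for g using that by (auto simp: K2_def)
    have c': "0 < c \<or> (\<forall>g\<in>K2. snd (fst g) = 1)" by (auto simp: K2_def)
    have m': "0 < int m" using m by simp
    \<comment> \<open>Without coupling the symbol does not depend on the class, so the synchronous
      class 0 is critical as well.\<close>
    have crit0: "Dc a \<delta> c \<tau>\<^sub>c bs \<tau>s (0 :: 'n mod_ring, int m) = 0"
      using crit' by (simp add: Dc_def gcoef_def c0)
    have z0_supp: "(fst q = 0 \<or> fst q = - 0) \<and> \<bar>snd q\<bar> = int m" if "z0 q \<noteq> 0" for q
      using that by (auto simp: z0_def split: if_splits)
    have z0_nz: "z0 (0, int m) \<noteq> 0" by (simp add: z0_def)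
    obtain \<kappa>0 t0 t1 where sols: "\<And>\<epsilon>. 0 < \<epsilon> \<Longrightarrow> \<exists>b \<tau> z. \<bar>b - bs\<bar> < \<epsilon> \<and> \<bar>\<tau> - \<tau>s\<bar> < \<epsilon> \<and> 0 < b \<and> 0 \<le> \<tau> \<and> fixed_family K2 z \<and>
       (\<forall>q. norm (z q) \<le> \<epsilon> * wt q / (1 + (of_int (snd q))\<^sup>2)) \<and>
       (\<forall>q. Dc a \<delta> c \<tau>\<^sub>c b \<tau> q * z q = - (of_real \<beta> * cube z q)) \<and>
       Re (synth z \<kappa>0 t0) \<noteq> Re (synth z \<kappa>0 t1)"
      using fixed_mode_solutions[OF par bs \<tau>s \<iota> m' crit0 z0_fixed z0_supp z0_nz c'] by blast
    define \<rho> where "\<rho> = (amp l A B :: 'n mod_ring \<Rightarrow> complex)"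
    have "\<exists>\<kappa>. \<rho> \<kappa> \<noteq> 0"
    proof (rule ccontr)
      assume "\<nexists>\<kappa>. \<rho> \<kappa> \<noteq> 0"
      then have "\<forall>\<kappa>. amp l A B \<kappa> = amp l 0 0 (\<kappa> :: 'n mod_ring)" by (simp add: \<rho>_def amp_def)
      then have "x0 = wave l m 0 0" unfolding AB wave_eq_iff_amp[OF m] .
      then show False using x0(2) wave_zero by metis
    qed
    then obtain \<kappa>1 where \<kappa>1: "\<rho> \<kappa>1 \<noteq> 0" by blast
    show ?thesis
    proof (rule bifurcatesI)
      fix \<epsilon> :: real assume \<epsilon>: "0 < \<epsilon>"
      obtain \<epsilon>' where \<epsilon>': "0 < \<epsilon>'" "\<epsilon>' \<le> \<epsilon>" "5 * (?n * (\<epsilon>' * W)) < \<epsilon>" using small[OF \<epsilon>] by blast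
      obtain b \<tau> z where near: "\<bar>b - bs\<bar> < \<epsilon>'" "\<bar>\<tau> - \<tau>s\<bar> < \<epsilon>'" "0 < b" "0 \<le> \<tau>" and z: "fixed_family K2 z"
        "\<And>q. norm (z q) \<le> \<epsilon>' * wt q / (1 + (of_int (snd q))\<^sup>2)"
        "\<And>q. Dc a \<delta> c \<tau>\<^sub>c b \<tau> q * z q = - (of_real \<beta> * cube z q)"
        and nc: "Re (synth z \<kappa>0 t0) \<noteq> Re (synth z \<kappa>0 t1)"
        using sols[OF \<epsilon>'(1)] by blast
      define y where "y = (\<lambda>\<kappa> t. Re (synth z \<kappa> t))"
      obtain y' y'' where y: "\<And>\<kappa> t. (y \<kappa> has_vector_derivative y' \<kappa> t) (at t)" "\<And>\<kappa> t. (y' \<kappa> has_vector_derivative y'' \<kappa> t) (at t)"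
        "\<And>\<kappa> t. y \<kappa> (t + 2 * pi) = y \<kappa> t"
        "\<And>\<kappa> t. y'' \<kappa> t = - (a + \<delta>) * y' \<kappa> t - a * \<delta> * y \<kappa> t - b * y \<kappa> (t - \<tau>)
           + c * (y (\<kappa> + of_int_mod_ring 1) (t - \<tau>\<^sub>c) - 2 * y \<kappa> t + y (\<kappa> - of_int_mod_ring 1) (t - \<tau>\<^sub>c)) - \<beta> * y \<kappa> t ^ 3"
        "\<And>\<kappa> t. \<bar>y \<kappa> t\<bar> \<le> \<epsilon>' * W" "\<And>\<kappa> t. \<bar>y' \<kappa> t\<bar> \<le> \<epsilon>' * W" "\<And>\<kappa> t. \<bar>y'' \<kappa> t\<bar> \<le> \<epsilon>' * W"
        using realization[OF fixed_family_uminus[OF z(1)] z(2) less_imp_le[OF \<epsilon>'(1)] z(3)[unfolded Dc_def]]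
        unfolding y_def W_def by blast
      define u where "u = y 0"
      have sync: "y \<kappa> t = u t" for \<kappa> t
      proof -
        have "cact ((\<kappa>, 1), (1, 1)) z = z" by (rule fixed_family_cact[OF z(1)]) (simp add: K2_def)
        then show ?thesis using synth_cact[of "((\<kappa>, 1), (1, 1))" z \<kappa> t] by (simp add: y_def u_def)
      qed
      \<comment> \<open>The element of \<open>K2\<close> with sign -1 makes u antisymmetric under a
        shift by pi / m, so that the sign in a symmetry of the mode can be traded for a time
        shift.\<close>
      have half: "u (t + pi / real m) = - u t" for t
      proof -
        have "cact ((0, 1), (-1, cis (pi / real m))) z = z" by (rule fixed_family_cact[OF z(1)]) (simp add: K2_def)
        then have "synth z 0 t = - synth z 0 (t + pi / real m)"
          using synth_cact[of "((0, 1), (-1, cis (pi / real m)))" z 0 t] unfolding fst_conv snd_conv arg by simp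
        then show ?thesis by (simp add: u_def y_def)
      qed
      have half_nat: "u (t + real k * (pi / real m)) = (-1) ^ k * u t" for t k
      proof (induction k)
        case (Suc k)
        have "t + real (Suc k) * (pi / real m) = t + real k * (pi / real m) + pi / real m" by (simp only: of_nat_Suc distrib_right)
        then show ?case by (simp only: half Suc) simp
      qed simp
      have full: "u (t + of_int k * (2 * pi / real m)) = u t" for t k
      proof (cases "0 \<le> k")
        case True
        then have k: "real_of_int k = real (nat k)" by simp
        have "of_int k * (2 * pi / real m) = real (2 * nat k) * (pi / real m)" unfolding k by simp
        then show ?thesis using half_nat[of t "2 * nat k"] by (simp only: power_mult) simp
      next
        case False
        define s where "s = t + of_int k * (2 * pi / real m)"
        have k: "real (nat (- k)) = - real_of_int k" using False by simp
        have "s + real (2 * nat (- k)) * (pi / real m) = t" unfolding of_nat_mult k s_def by simp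
        then have "u t = u s" using half_nat[of s "2 * nat (- k)"] by (simp only: power_mult) simp
        then show ?thesis by (simp add: s_def)
      qed
      \<comment> \<open>u has period 2 pi / m, so shifting it by \<alpha> / m depends on
        \<open>cis \<alpha>\<close> only.\<close>
      have phase: "u (t + \<alpha> / real m) = u (t + \<gamma> / real m)" if "cis \<alpha> = cis \<gamma>" for t \<alpha> \<gamma>
      proof -
        have "sin \<alpha> = sin \<gamma> \<and> cos \<alpha> = cos \<gamma>" using that by (simp add: complex_eq_iff)
        then obtain k :: int where "\<alpha> = \<gamma> + 2 * pi * of_int k" unfolding sin_cos_eq_iff by blast
        then have "t + \<alpha> / real m = t + \<gamma> / real m + of_int k * (2 * pi / real m)" by (simp add: add_divide_distrib mult_ac)
        then show ?thesis by (simp only: full)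
      qed
      \<comment> \<open>Each cell runs through u with the phase of its own amplitude. A cell of
        amplitude 0 has no phase and stays at rest, which also solves the uncoupled
        equation.\<close>
      define sh where "sh \<kappa> = Arg (\<rho> \<kappa>) / real m" for \<kappa>
      define x where "x = (\<lambda>\<kappa> t. if \<rho> \<kappa> = 0 then 0 else u (t + sh \<kappa>))"
      define x' where "x' = (\<lambda>\<kappa> t. if \<rho> \<kappa> = 0 then 0 else y' 0 (t + sh \<kappa>))"
      define x'' where "x'' = (\<lambda>\<kappa> t. if \<rho> \<kappa> = 0 then 0 else y'' 0 (t + sh \<kappa>))"
      have eW: "0 \<le> \<epsilon>' * W" using \<epsilon>'(1) W0 by simp
      have x1: "(x \<kappa> has_vector_derivative x' \<kappa> t) (at t)" for \<kappa> t
        unfolding x_def x'_def u_def using has_vector_derivative_at_shift[OF y(1)] by (cases "\<rho> \<kappa> = 0") auto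
      have x2: "(x' \<kappa> has_vector_derivative x'' \<kappa> t) (at t)" for \<kappa> t
        unfolding x'_def x''_def using has_vector_derivative_at_shift[OF y(2)] by (cases "\<rho> \<kappa> = 0") auto
      have x3: "x \<kappa> (t + 2 * pi) = x \<kappa> t" for \<kappa> t
        
      proof -
        have "t + 2 * pi + sh \<kappa> = t + sh \<kappa> + 2 * pi" by simp
        then show ?thesis unfolding x_def u_def by (simp only: y(3))
      qed
      have x4: "x'' \<kappa> t = - (a + \<delta>) * x' \<kappa> t - a * \<delta> * x \<kappa> t - b * x \<kappa> (t - \<tau>)
           + c * (x (\<kappa> + of_int_mod_ring 1) (t - \<tau>\<^sub>c) - 2 * x \<kappa> t + x (\<kappa> - of_int_mod_ring 1) (t - \<tau>\<^sub>c)) - \<beta> * x \<kappa> t ^ 3" for \<kappa> t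
      proof -
        have e: "t - \<tau> + sh \<kappa> = t + sh \<kappa> - \<tau>" by simp
        have d: "y 0 (t - \<tau> + sh \<kappa>) = y 0 (t + sh \<kappa> - \<tau>)" unfolding e ..
        show ?thesis using y(4)[of 0 "t + sh \<kappa>"] d by (simp add: x_def x'_def x''_def u_def c0)
      qed
      have x5: "\<bar>x \<kappa> t\<bar> \<le> \<epsilon>' * W" "\<bar>x' \<kappa> t\<bar> \<le> \<epsilon>' * W" "\<bar>x'' \<kappa> t\<bar> \<le> \<epsilon>' * W" for \<kappa> t
        using y(5,6,7)[of 0 "t + sh \<kappa>"] eW by (auto simp: x_def x'_def x''_def u_def)
      define X where "X = Abs_h2per (\<lambda>t. \<chi> \<kappa>. x \<kappa> t)"
      note sol = dde_solution[OF x1 x2 x3 x4 x5, folded X_def]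
      have h: "h2fun X t $ \<kappa> = x \<kappa> t" for t \<kappa> unfolding sol(1) by simp
      have "X \<notin> const_space"
      proof
        assume "X \<in> const_space"
        then have "h2fun X (t0 - sh \<kappa>1) = h2fun X (t1 - sh \<kappa>1)" unfolding const_space_def by auto
        then have "x \<kappa>1 (t0 - sh \<kappa>1) = x \<kappa>1 (t1 - sh \<kappa>1)" using h by metis
        then have "u t0 = u t1" using \<kappa>1 by (simp add: x_def)
        then show False using nc sync[of \<kappa>0] by (simp add: y_def)
      qed
      moreover have "act g X = X" if g: "g \<in> K" for g
      proof (rule act_eqI)
        fix t \<kappa>
        define \<mu> where "\<mu> = (if snd (fst g) = 1 then \<kappa> - fst (fst g) else fst (fst g) - \<kappa>)"
        have gc: "fst (snd g) \<in> {1, -1}" using g K(1) carrier_GG by blast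
        have "\<rho> \<kappa> = lam m g * \<rho> \<mu>" unfolding \<rho>_def \<mu>_def using amp_act[OF m K(2)[OF g, unfolded AB]] .
        then have rel: "\<rho> \<kappa> = of_int (fst (snd g)) * cis (real m * Arg (snd (snd g))) * \<rho> \<mu>" by (simp add: lam_def)
        have nl: "norm (of_int (fst (snd g)) * cis (real m * Arg (snd (snd g))) :: complex) = 1"
          using gc by (auto simp: norm_mult)
        have "x \<kappa> t = of_int (fst (snd g)) * x \<mu> (t + Arg (snd (snd g)))"
        proof (cases "\<rho> \<mu> = 0")
          case True
          then show ?thesis using rel by (simp add: x_def)
        next
          case False
          have \<kappa>0: "\<rho> \<kappa> \<noteq> 0" using rel nl False by auto
          have nr: "norm (\<rho> \<kappa>) = norm (\<rho> \<mu>)" unfolding rel norm_mult[of _ "\<rho> \<mu>"] nl by simp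
          have "cis (Arg (\<rho> \<kappa>)) = \<rho> \<kappa> / of_real (norm (\<rho> \<kappa>))" using cis_Arg[OF \<kappa>0] by (simp add: sgn_eq)
          also have "\<dots> = of_int (fst (snd g)) * cis (real m * Arg (snd (snd g))) * (\<rho> \<mu> / of_real (norm (\<rho> \<mu>)))"
            unfolding nr by (subst rel) simp
          also have "\<rho> \<mu> / of_real (norm (\<rho> \<mu>)) = cis (Arg (\<rho> \<mu>))" using cis_Arg[OF False] by (simp add: sgn_eq)
          finally have c: "cis (Arg (\<rho> \<kappa>)) = of_int (fst (snd g)) * cis (real m * Arg (snd (snd g)) + Arg (\<rho> \<mu>))"
            by (simp add: mult.assoc cis_mult)
          have arg_eq: "t + (real m * Arg (snd (snd g)) + Arg (\<rho> \<mu>)) / real m = t + Arg (snd (snd g)) + sh \<mu>"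
            using m by (simp add: sh_def add_divide_distrib)
          from gc consider "fst (snd g) = 1" | "fst (snd g) = -1" by blast
          then have "u (t + sh \<kappa>) = of_int (fst (snd g)) * u (t + Arg (snd (snd g)) + sh \<mu>)"
          proof cases
            case 1
            then have "cis (Arg (\<rho> \<kappa>)) = cis (real m * Arg (snd (snd g)) + Arg (\<rho> \<mu>))" using c by simp
            from phase[OF this, of t] show ?thesis using 1 unfolding arg_eq by (simp add: sh_def)
          next
            case 2
            then have "cis (Arg (\<rho> \<kappa>)) = cis (real m * Arg (snd (snd g)) + Arg (\<rho> \<mu>) + pi)"
              using c by (simp add: complex_eq_iff)
            from phase[OF this, of t]
            have "u (t + sh \<kappa>) = u (t + Arg (snd (snd g)) + sh \<mu> + pi / real m)"
              unfolding add_divide_distrib[of _ pi] add.assoc[symmetric, of t] arg_eq by (simp add: sh_def add.assoc)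
            then show ?thesis using 2 half by simp
          qed
          then show ?thesis using \<kappa>0 False by (simp add: x_def)
        qed
        then show "h2fun X t $ \<kappa> = of_int (fst (snd g)) *
            h2fun X (t + Arg (snd (snd g))) $ (if snd (fst g) = 1 then \<kappa> - fst (fst g) else fst (fst g) - \<kappa>)"
          unfolding h \<mu>_def .
      qed
      ultimately show "\<exists>b \<tau> (x :: 'n osc). \<bar>b - bs\<bar> < \<epsilon> \<and> \<bar>\<tau> - \<tau>s\<bar> < \<epsilon> \<and> norm x < \<epsilon> \<and> 0 < b \<and> 0 \<le> \<tau> \<and>
         Psi a \<delta> c \<beta> \<tau>\<^sub>c (b, \<tau>) x = 0 \<and> x \<notin> const_space \<and> (\<forall>g\<in>K. act g x = x)"
        using near \<epsilon>' sol(2,3) by (intro exI[of _ b] exI[of _ \<tau>] exI[of _ X]) auto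
    qed
  qed
qed

section \<open>The symmetry group\<close>

text \<open>f is a complete invariant of the classes R C g in the normalizer, so these classes
  correspond to its values. In the application R is an isotropy group and C the circle of time
  shifts.\<close>

lemma (in group) card_double_factor:
  assumes R: "subgroup R G" and C: "C \<subseteq> normalizer G R" "\<one> \<in> C"
    and f: "\<And>g h. g \<in> normalizer G R \<Longrightarrow> h \<in> normalizer G R \<Longrightarrow>
      f g = f h \<longleftrightarrow> (\<exists>k\<in>R. \<exists>c\<in>C. g = k \<otimes> (c \<otimes> h))"
  shows "card (carrier ((G\<lparr>carrier := normalizer G R\<rparr> Mod R) Mod ((\<lambda>c. R #> c) ` C))) = card (f ` normalizer G R)"
proof -
  let ?N = "normalizer G R" and ?I = "(\<lambda>c. R #> c) ` C"
  let ?GN = "G\<lparr>carrier := ?N\<rparr>"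
  have N: "subgroup ?N G" by (rule normalizer_imp_subgroup[OF subgroup.subset[OF R]])
  have NG: "?N \<subseteq> carrier G" and RG: "R \<subseteq> carrier G" using N R by (auto dest: subgroup.subset)
  have nR: "normal R ?GN" by (rule subgroup_in_normalizer[OF R])
  have rc: "R #>\<^bsub>?GN\<^esub> g = R #> g" for g by (simp add: r_coset_def)
  have prod: "(R #> c) <#> (R #> g) = R #> (c \<otimes> g)" if "c \<in> ?N" "g \<in> ?N" for c g
    using normal.rcos_sum[OF nR, of c g] that by (simp add: r_coset_def set_mult_def)
  \<comment> \<open>An element of the iterated quotient, unfolded as a set of R-cosets, is a fibre
    of f.\<close>
  have coset: "{(R #> c) <#> (R #> g) | c. c \<in> C} = {R #> h | h. h \<in> ?N \<and> f h = f g}" if g: "g \<in> ?N" for g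
  proof (intro equalityI subsetI)
    fix X assume "X \<in> {(R #> c) <#> (R #> g) | c. c \<in> C}"
    then obtain c where c: "c \<in> C" "X = R #> (c \<otimes> g)" using prod g C(1) by blast
    have cg: "c \<otimes> g \<in> ?N" using c C(1) g N by (auto intro: subgroup.m_closed)
    moreover have "c \<otimes> g = \<one> \<otimes> (c \<otimes> g)" using cg NG by auto
    then have "f (c \<otimes> g) = f g" using f[OF cg g] c(1) subgroup.one_closed[OF R] by blast
    ultimately show "X \<in> {R #> h | h. h \<in> ?N \<and> f h = f g}" using c by blast
  next
    fix X assume "X \<in> {R #> h | h. h \<in> ?N \<and> f h = f g}"
    then obtain h where h: "h \<in> ?N" "f h = f g" "X = R #> h" by blast
    then obtain k c where kc: "k \<in> R" "c \<in> C" "h = k \<otimes> (c \<otimes> g)" using f[OF h(1) g] by blast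
    have "X = (R #> k) #> (c \<otimes> g)"
      unfolding h(3) kc(3) using kc(1,2) C(1) g NG RG by (subst coset_mult_assoc) auto
    also have "R #> k = R" using kc(1) RG by (intro coset_join2 R) auto
    finally show "X \<in> {(R #> c) <#> (R #> g) | c. c \<in> C}" using prod kc(2) C(1) g by blast
  qed
  have "carrier ((?GN Mod R) Mod ?I) = (\<lambda>v. {R #> h | h. h \<in> ?N \<and> f h = v}) ` f ` ?N" (is "_ = ?F ` f ` ?N")
  proof -
    have "carrier ((?GN Mod R) Mod ?I) = (\<lambda>g. {(R #> c) <#> (R #> g) | c. c \<in> C}) ` ?N"
      unfolding FactGroup_def RCOSETS_def r_coset_def[of "FactGroup ?GN R" for GN] rc
      by (auto simp: r_coset_def set_mult_def)
    then show ?thesis using coset by (auto simp: image_iff)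
  qed
  moreover have "inj_on ?F (f ` ?N)"
  proof (rule inj_onI)
    fix v w assume "v \<in> f ` ?N" "w \<in> f ` ?N" and eq: "?F v = ?F w"
    then obtain g where g: "g \<in> ?N" "v = f g" by blast
    then have "R #> g \<in> ?F w" unfolding eq[symmetric] by blast
    then obtain h where h: "h \<in> ?N" "f h = w" "R #> g = R #> h" by blast
    have "g \<in> R #> h" unfolding h(3)[symmetric] using g(1) NG by (intro rcos_self R) auto
    then obtain k where "k \<in> R" "g = k \<otimes> h" by (auto simp: r_coset_def)
    then have "\<exists>k\<in>R. \<exists>c\<in>C. g = k \<otimes> (c \<otimes> h)" using C(2) h(1) NG by (intro bexI[of _ k] bexI[of _ \<one>]) auto
    then show "v = w" using f[OF g(1) h(1)] g(2) h(2) by blast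
  qed
  ultimately show ?thesis by (simp add: card_image)
qed

lemma group_dihedral: "group (dihedral :: ('n::finite mod_ring \<times> int) monoid)"
proof (rule groupI)
  fix x :: "'n mod_ring \<times> int" assume "x \<in> carrier dihedral"
  then have "(if snd x = 1 then - fst x else fst x, snd x) \<in> carrier dihedral \<and>
      (if snd x = 1 then - fst x else fst x, snd x) \<otimes>\<^bsub>dihedral\<^esub> x = \<one>\<^bsub>dihedral\<^esub>"
    by (cases x) (auto simp: dihedral_def)
  then show "\<exists>y\<in>carrier dihedral. y \<otimes>\<^bsub>dihedral\<^esub> x = \<one>\<^bsub>dihedral\<^esub>" by blast
qed (auto simp: dihedral_def)

lemma group_sign_group: "group sign_group"
  by (rule groupI) (auto simp: sign_group_def)

lemma group_circle_group: "group circle_group"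
proof (rule groupI)
  fix x assume "x \<in> carrier circle_group"
  then show "\<exists>y\<in>carrier circle_group. y \<otimes>\<^bsub>circle_group\<^esub> x = \<one>\<^bsub>circle_group\<^esub>"
    by (intro bexI[of _ "inverse x"]) (auto simp: circle_group_def norm_inverse intro!: left_inverse)
qed (auto simp: circle_group_def norm_mult)

lemma group_GG: "group (GG :: 'n::finite gelem monoid)"
  unfolding GG_def by (intro DirProd_group group_dihedral group_sign_group group_circle_group)

interpretation GG: group "GG :: 'n::finite gelem monoid" by (rule group_GG)

lemma GG_mult:
  "g \<otimes>\<^bsub>GG\<^esub> h = ((if snd (fst g) = 1 then fst (fst g) + fst (fst h) else fst (fst g) - fst (fst h),
     snd (fst g) * snd (fst h)), (fst (snd g) * fst (snd h), snd (snd g) * snd (snd h)))"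
proof -
  obtain r s \<iota> z where "g = ((r, s), (\<iota>, z))" by (cases g, cases "fst g", cases "snd g") auto
  moreover obtain r' s' \<iota>' z' where "h = ((r', s'), (\<iota>', z'))" by (cases h, cases "fst h", cases "snd h") auto
  ultimately show ?thesis by (simp add: GG_def dihedral_def sign_group_def circle_group_def)
qed

lemma GG_one: "\<one>\<^bsub>GG\<^esub> = ((0, 1), (1, 1))"
  by (simp add: GG_def dihedral_def sign_group_def circle_group_def)

lemma circle_elem_carrier: "norm z = 1 \<Longrightarrow> circle_elem z \<in> carrier GG"
  by (simp add: carrier_GG circle_elem_def)

lemma circle_elem_central: "circle_elem z \<otimes>\<^bsub>GG\<^esub> h = h \<otimes>\<^bsub>GG\<^esub> circle_elem z"
  by (cases h, cases "fst h") (simp add: GG_mult circle_elem_def mult_ac)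

lemma lam_carrier:
  assumes "g \<in> carrier GG"
  shows "lam m g = of_int (fst (snd g)) * snd (snd g) ^ m"
proof -
  have "cis (real m * Arg (snd (snd g))) = cis (Arg (snd (snd g))) ^ m" by (simp add: Complex.DeMoivre)
  also have "cis (Arg (snd (snd g))) = snd (snd g)"
    using assms cis_Arg[of "snd (snd g)"] by (cases "snd (snd g) = 0") (auto simp: carrier_GG sgn_eq)
  finally show ?thesis by (simp add: lam_def)
qed

lemma lam_mult: "g \<in> carrier GG \<Longrightarrow> h \<in> carrier GG \<Longrightarrow> lam m (g \<otimes>\<^bsub>GG\<^esub> h) = lam m g * lam m h"
  by (subst lam_carrier, rule GG.m_closed) (auto simp: lam_carrier GG_mult power_mult_distrib)

lemma rot_mult: "rot l (g \<otimes>\<^bsub>GG\<^esub> h) = rot l g * (if snd (fst g) = 1 then rot l h else cnj (rot l h))"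
proof -
  let ?j = "of_int_mod_ring (int l) :: 'a mod_ring"
  have 1: "chi ?j (- r - s) = chi ?j (- r) * chi ?j (- s)" for r s
    using chi_add_right[of ?j "- r" "- s"] by simp
  have 2: "chi ?j (s - r) = chi ?j (- r) * cnj (chi ?j (- s))" for r s
    using chi_add_right[of ?j "- r" s] chi_minus_right[of ?j s] by simp
  show ?thesis unfolding rot_def GG_mult using 1 2 by simp
qed

lemma norm_lam: "g \<in> carrier GG \<Longrightarrow> norm (lam m g) = 1"
  by (auto simp: lam_def carrier_GG norm_mult)

lemma lam_circle_elem: "norm z = 1 \<Longrightarrow> lam m (circle_elem z) = z ^ m"
  by (simp add: lam_carrier[OF circle_elem_carrier]) (simp add: circle_elem_def)

lemma rot_circle_elem: "rot l (circle_elem z) = 1"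
  by (simp add: rot_def circle_elem_def chi_0)

lemma act_mult_wave:
  assumes "g \<in> carrier GG" "h \<in> carrier GG"
  shows "act (g \<otimes>\<^bsub>GG\<^esub> h) (wave l m A B) = act g (act h (wave l m A B))"
proof -
  have "snd (fst g) = 1 \<or> snd (fst g) = -1" "snd (fst h) = 1 \<or> snd (fst h) = -1" using assms by (auto simp: carrier_GG)
  moreover have "snd (fst (g \<otimes>\<^bsub>GG\<^esub> h)) = snd (fst g) * snd (fst h)" by (simp add: GG_mult)
  ultimately show ?thesis unfolding act_wave lam_mult[OF assms] rot_mult by (auto simp: mult_ac)
qed

lemma act_one_wave: "act \<one>\<^bsub>GG\<^esub> (wave l m A B) = wave l m A B"
  unfolding act_wave by (simp add: GG_one lam_def rot_def chi_0)

section \<open>Isotropy groups of modes\<close>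

lemma amp_scale: "amp l (c * A) (c * B) \<kappa> = c * amp l A B \<kappa>"
  by (simp add: amp_def algebra_simps)

locale mode =
  fixes l m :: nat and j :: "'n::finite mod_ring"
  assumes m: "0 < m" and j_def: "j = of_int_mod_ring (int l)"
begin

abbreviation W :: "complex \<Rightarrow> complex \<Rightarrow> 'n osc" where "W \<equiv> wave l m"
abbreviation V :: "'n osc set" where "V \<equiv> V_mode l m"
abbreviation St :: "'n osc \<Rightarrow> 'n gelem set" where "St \<equiv> stabilizer GG act"

definition cline :: "'n osc \<Rightarrow> 'n osc set" where
  "cline x = {W (c * A) (c * B) | A B c. x = W A B}"

text \<open>The fixed space of the isotropy group of x is the complex line through x. By
  \<open>line_St_eq\<close> such isotropy groups are maximal among those of nonzero
  elements.\<close>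

definition is_line :: "'n osc \<Rightarrow> bool" where
  "is_line x \<longleftrightarrow> x \<in> V \<and> x \<noteq> 0 \<and> (\<forall>y\<in>V. St x \<subseteq> St y \<longrightarrow> y \<in> cline x)"

lemma W_in_V: "W A B \<in> V" unfolding V_mode_eq by blast

lemma V_cases: "x \<in> V \<Longrightarrow> (\<And>A B. x = W A B \<Longrightarrow> P) \<Longrightarrow> P" unfolding V_mode_eq by blast

lemma W_cong_scale: "W A B = W A' B' \<Longrightarrow> W (c * A) (c * B) = W (c * A') (c * B')"
  unfolding wave_eq_iff_amp[OF m] amp_scale by simp

lemma W_scale_cancel: "c \<noteq> 0 \<Longrightarrow> W (c * A) (c * B) = W (c * A') (c * B') \<longleftrightarrow> W A B = W A' B'"
  unfolding wave_eq_iff_amp[OF m] amp_scale by simp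

lemma cline_W: "cline (W A B) = {W (c * A) (c * B) | c. True}"
proof (intro equalityI subsetI)
  fix y assume "y \<in> cline (W A B)"
  then obtain A' B' c where y: "W A B = W A' B'" "y = W (c * A') (c * B')" unfolding cline_def by blast
  have "y = W (c * A) (c * B)" unfolding y(2) by (rule W_cong_scale[OF y(1), symmetric])
  then show "y \<in> {W (c * A) (c * B) | c. True}" by blast
qed (auto simp: cline_def)

lemma W_eq_0: "W A B = 0 \<longleftrightarrow> (\<forall>\<kappa> :: 'n mod_ring. amp l A B \<kappa> = 0)"
  unfolding wave_zero[of l m, symmetric] wave_eq_iff_amp[OF m] by (simp add: amp_def)

lemma W_scale_inject: "W A B \<noteq> 0 \<Longrightarrow> W (c * A) (c * B) = W (c' * A) (c' * B) \<longleftrightarrow> c = c'"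
  unfolding W_eq_0 wave_eq_iff_amp[OF m] amp_scale by auto

lemma act_V: "x \<in> V \<Longrightarrow> act g x \<in> V"
  by (metis V_cases act_wave W_in_V)

text \<open>Group elements act complex-linearly on the coordinates (A, B), so the action commutes
  with complex scalars.\<close>

lemma act_W_scale:
  assumes "act g (W A B) = W A' B'"
  shows "act g (W (c * A) (c * B)) = W (c * A') (c * B')"
proof -
  have "act g (W (c * A) (c * B)) = W (c * (lam m g * rot l g * (if snd (fst g) = 1 then A else B)))
     (c * (lam m g * cnj (rot l g) * (if snd (fst g) = 1 then B else A)))"
    unfolding act_wave by (auto simp: mult_ac)
  also have "\<dots> = W (c * A') (c * B')" by (rule W_cong_scale) (use assms in \<open>simp add: act_wave\<close>)
  finally show ?thesis .
qed

lemma St_scale: "c \<noteq> 0 \<Longrightarrow> St (W (c * A) (c * B)) = St (W A B)"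
  unfolding stabilizer_def using act_W_scale W_scale_cancel
  by (metis (no_types, lifting) act_wave)

lemma act_mult: "g \<in> carrier GG \<Longrightarrow> h \<in> carrier GG \<Longrightarrow> x \<in> V \<Longrightarrow> act (g \<otimes>\<^bsub>GG\<^esub> h) x = act g (act h x)"
  by (metis V_cases act_mult_wave)

lemma act_one: "x \<in> V \<Longrightarrow> act \<one>\<^bsub>GG\<^esub> x = x"
  by (metis V_cases act_one_wave)

lemma act_inv_act: "g \<in> carrier GG \<Longrightarrow> x \<in> V \<Longrightarrow> act (inv\<^bsub>GG\<^esub> g) (act g x) = x"
  by (metis GG.inv_closed GG.l_inv act_mult act_one)

lemma act_act_inv: "g \<in> carrier GG \<Longrightarrow> x \<in> V \<Longrightarrow> act g (act (inv\<^bsub>GG\<^esub> g) x) = x"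
  by (metis GG.inv_closed GG.r_inv act_mult act_one)

lemma act_zero: "act g 0 = (0 :: 'n osc)"
  unfolding wave_zero[of l m, symmetric] act_wave by simp

lemma zero_V: "0 \<in> V" using W_in_V[of 0 0] by (simp add: wave_zero)

lemma act_eq_0: "g \<in> carrier GG \<Longrightarrow> x \<in> V \<Longrightarrow> act g x = 0 \<longleftrightarrow> x = 0"
  by (metis act_zero act_inv_act)

lemma St_subset: "St x \<subseteq> carrier GG" by (auto simp: stabilizer_def)

lemma subgroup_St:
  assumes "x \<in> V" shows "subgroup (St x) GG"
proof (rule GG.subgroupI)
  show "St x \<noteq> {}" using act_one[OF assms] GG.one_closed unfolding stabilizer_def by blast
  show "inv\<^bsub>GG\<^esub> g \<in> St x" if "g \<in> St x" for g
    using that act_inv_act[of g x] assms GG.inv_closed unfolding stabilizer_def by (metis (mono_tags, lifting) mem_Collect_eq)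
  show "g \<otimes>\<^bsub>GG\<^esub> h \<in> St x" if "g \<in> St x" "h \<in> St x" for g h
    using that act_mult[of g h x] assms GG.m_closed unfolding stabilizer_def by (metis (mono_tags, lifting) mem_Collect_eq)
qed (rule St_subset)

lemma mem_conjugate: "h \<in> conjugate g H \<longleftrightarrow> (\<exists>k\<in>H. h = g \<otimes>\<^bsub>GG\<^esub> k \<otimes>\<^bsub>GG\<^esub> inv\<^bsub>GG\<^esub> g)"
  by (auto simp: conjugate_def l_coset_def r_coset_def)

lemma conjugate_St:
  assumes g: "g \<in> carrier GG" and x: "x \<in> V"
  shows "conjugate g (St x) = St (act g x)"
proof (intro equalityI subsetI)
  fix h assume "h \<in> conjugate g (St x)"
  then obtain k where k: "k \<in> carrier GG" "act k x = x" "h = g \<otimes>\<^bsub>GG\<^esub> k \<otimes>\<^bsub>GG\<^esub> inv\<^bsub>GG\<^esub> g"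
    unfolding mem_conjugate by (auto simp: stabilizer_def)
  have "act h (act g x) = act (g \<otimes>\<^bsub>GG\<^esub> k) (act (inv\<^bsub>GG\<^esub> g) (act g x))"
    unfolding k(3) using g k(1) x by (intro act_mult act_V) auto
  also have "\<dots> = act g x" using act_inv_act[OF g x] act_mult[OF g k(1) x] k(2) by simp
  finally show "h \<in> St (act g x)" using k g by (auto simp: stabilizer_def)
next
  fix h assume "h \<in> St (act g x)"
  then have h: "h \<in> carrier GG" "act h (act g x) = act g x" by (auto simp: stabilizer_def)
  let ?k = "inv\<^bsub>GG\<^esub> g \<otimes>\<^bsub>GG\<^esub> h \<otimes>\<^bsub>GG\<^esub> g"
  have "act ?k x = act (inv\<^bsub>GG\<^esub> g \<otimes>\<^bsub>GG\<^esub> h) (act g x)" using g h(1) x by (intro act_mult) auto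
  also have "\<dots> = act (inv\<^bsub>GG\<^esub> g) (act h (act g x))" using g h(1) x by (intro act_mult act_V) auto
  also have "\<dots> = x" using h(2) act_inv_act[OF g x] by simp
  finally have "?k \<in> St x" using g h(1) by (auto simp: stabilizer_def)
  moreover have "h = g \<otimes>\<^bsub>GG\<^esub> ?k \<otimes>\<^bsub>GG\<^esub> inv\<^bsub>GG\<^esub> g"
    using g h(1) by (simp add: GG.m_assoc) (simp add: GG.m_assoc[symmetric])
  ultimately show "h \<in> conjugate g (St x)" unfolding mem_conjugate by blast
qed

lemma orbit_type_St: "x \<in> V \<Longrightarrow> orbit_type (St x) = (\<lambda>g. St (act g x)) ` carrier GG"
  proof -
  assume x: "x \<in> V"
  have "orbit_type (St x) = (\<lambda>g. conjugate g (St x)) ` carrier GG" unfolding orbit_type_def by (simp only: Setcompr_eq_image Collect_mem_eq)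
  also have "\<dots> = (\<lambda>g. St (act g x)) ` carrier GG" by (rule image_cong) (simp_all only: conjugate_St x)
  finally show ?thesis .
qed

lemma orbit_type_St_act:
  assumes g: "g \<in> carrier GG" and x: "x \<in> V"
  shows "orbit_type (St (act g x)) = orbit_type (St x)"
proof -
  have 1: "orbit_type (St (act g x)) \<subseteq> orbit_type (St x)" if g: "g \<in> carrier GG" and x: "x \<in> V" for g x
  proof
    fix H assume "H \<in> orbit_type (St (act g x))"
    then obtain h where h: "h \<in> carrier GG" "H = St (act h (act g x))" unfolding orbit_type_St[OF act_V[OF x]] by blast
    have "H = St (act (h \<otimes>\<^bsub>GG\<^esub> g) x)" unfolding h(2) act_mult[OF h(1) g x] ..
    then show "H \<in> orbit_type (St x)" unfolding orbit_type_St[OF x] using GG.m_closed[OF h(1) g] by (intro image_eqI)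
  qed
  have "orbit_type (St (act (inv\<^bsub>GG\<^esub> g) (act g x))) \<subseteq> orbit_type (St (act g x))"
    by (rule 1[OF GG.inv_closed[OF g] act_V[OF x]])
  then show ?thesis using 1[OF g x] unfolding act_inv_act[OF g x] by blast
qed

lemma self_in_orbit_type:
  assumes "x \<in> V" shows "St x \<in> orbit_type (St x)"
proof -
  have "St x = St (act \<one>\<^bsub>GG\<^esub> x)" unfolding act_one[OF assms] ..
  then show ?thesis unfolding orbit_type_St[OF assms] by (rule image_eqI) (rule GG.one_closed)
qed

lemma rep_orbit_type:
  assumes "x \<in> V" obtains g where "g \<in> carrier GG" "rep (orbit_type (St x)) = St (act g x)"
proof -
  have "rep (orbit_type (St x)) \<in> orbit_type (St x)"
    unfolding rep_def using self_in_orbit_type[OF assms] by (rule someI[of "\<lambda>H. H \<in> _"])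
  then show ?thesis using that unfolding orbit_type_St[OF assms] by blast
qed

text \<open>The action permutes the cell amplitudes up to unit factors, so the sum of their moduli
  is invariant. It forces any scalar by which a group element acts on a line to have modulus
  1.\<close>

lemma sum_norm_amp_act:
  assumes g: "g \<in> carrier GG" and eq: "act g (W A B) = W A' B'"
  shows "(\<Sum>\<kappa>\<in>UNIV. norm (amp l A' B' (\<kappa> :: 'n mod_ring))) = (\<Sum>\<kappa>\<in>UNIV. norm (amp l A B (\<kappa> :: 'n mod_ring)))"
proof -
  let ?\<sigma> = "\<lambda>\<kappa>. if snd (fst g) = 1 then \<kappa> - fst (fst g) else fst (fst g) - \<kappa>"
  have "inj ?\<sigma>" by (rule injI) (auto split: if_splits)
  then have bij: "bij ?\<sigma>" by (simp add: bij_def finite_UNIV_inj_surj)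
  have "norm (amp l A' B' \<kappa>) = norm (amp l A B (?\<sigma> \<kappa>))" for \<kappa>
    using eq[symmetric] unfolding act_wave wave_eq_iff_amp[OF m] amp_act_coefficients
    by (simp add: norm_mult norm_lam[OF g])
  then have "(\<Sum>\<kappa>\<in>UNIV. norm (amp l A' B' (\<kappa> :: 'n mod_ring))) = (\<Sum>\<kappa>\<in>UNIV. norm (amp l A B (?\<sigma> \<kappa>)))" by (intro sum.cong refl)
  also have "\<dots> = (\<Sum>\<kappa>\<in>UNIV. norm (amp l A B (\<kappa> :: 'n mod_ring)))" by (rule sum.reindex_bij_betw[OF bij, of "\<lambda>\<kappa>. norm (amp l A B \<kappa>)"])
  finally show ?thesis .
qed

lemma norm_scalar:
  assumes g: "g \<in> carrier GG" and eq: "act g (W A B) = W (c * A) (c * B)" and nz: "W A B \<noteq> 0"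
  shows "norm c = 1"
proof -
  obtain \<kappa>0 :: "'n mod_ring" where "amp l A B \<kappa>0 \<noteq> 0" using nz unfolding W_eq_0 by blast
  then have "0 < (\<Sum>\<kappa>\<in>UNIV. norm (amp l A B (\<kappa> :: 'n mod_ring)))" by (intro sum_pos2[of _ \<kappa>0]) auto
  moreover have "norm c * (\<Sum>\<kappa>\<in>UNIV. norm (amp l A B (\<kappa> :: 'n mod_ring))) = (\<Sum>\<kappa>\<in>UNIV. norm (amp l A B (\<kappa> :: 'n mod_ring)))"
    using sum_norm_amp_act[OF g eq] unfolding amp_scale norm_mult sum_distrib_left[symmetric] .
  ultimately show ?thesis by simp
qed

lemma act_circle:
  "norm z = 1 \<Longrightarrow> act (circle_elem z) (W A B) = W (z ^ m * A) (z ^ m * B)"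
  unfolding act_wave lam_circle_elem rot_circle_elem by (simp add: circle_elem_def)

lemma root_of_unit: "norm c = 1 \<Longrightarrow> \<exists>z::complex. norm z = 1 \<and> z ^ m = c"
proof (intro exI conjI)
  assume c: "norm c = 1"
  then have "c \<noteq> 0" by auto
  have "cis (Arg c / real m) ^ m = cis (real m * (Arg c / real m))" by (simp add: Complex.DeMoivre)
  also have "\<dots> = c" using m cis_Arg[OF \<open>c \<noteq> 0\<close>] c by (simp add: sgn_eq)
  finally show "cis (Arg c / real m) ^ m = c" .
qed simp

lemma St_circle: "norm z = 1 \<Longrightarrow> x \<in> V \<Longrightarrow> St (act (circle_elem z) x) = St x"
  by (metis V_cases act_circle St_scale norm_zero power_not_zero zero_neq_one)

lemma normalizer_iff: "subgroup H GG \<Longrightarrow> g \<in> normalizer GG H \<longleftrightarrow> g \<in> carrier GG \<and> conjugate g H = H"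
  using subgroup.subset[of H GG] by (auto simp: normalizer_def stabilizer_def conjugate_def)

lemma circle_in_normalizer: "norm z = 1 \<Longrightarrow> x \<in> V \<Longrightarrow> circle_elem z \<in> normalizer GG (St x)"
  unfolding normalizer_iff[OF subgroup_St] by (simp add: circle_elem_carrier conjugate_St St_circle)

text \<open>At a cell of nonzero amplitude, invariance fixes the m-th power of the time shift up to
  the choice of a sign and of the cell that is mapped there, which leaves finitely many
  roots.\<close>

lemma finite_St:
  assumes x: "x \<in> V" "x \<noteq> 0" shows "finite (St x)"
proof -
  obtain A B where AB: "x = W A B" using x(1) V_cases by blast
  obtain \<kappa>0 :: "'n mod_ring" where \<kappa>0: "amp l A B \<kappa>0 \<noteq> 0" using x(2) unfolding AB W_eq_0 by blast
  define D where "D = (\<Union>\<iota>\<in>{1, -1::int}. \<Union>\<kappa>\<in>(UNIV :: 'n mod_ring set). {z::complex. z ^ m = of_int \<iota> * (amp l A B \<kappa>0 / amp l A B \<kappa>)})"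
  have "finite D" unfolding D_def using m by (intro finite_UN_I finite_nth_roots) auto
  moreover have "St x \<subseteq> (UNIV \<times> {1, -1}) \<times> ({1, -1} \<times> D)"
  proof
    fix g assume "g \<in> St x"
    then have g: "g \<in> carrier GG" "act g (W A B) = W A B" by (auto simp: stabilizer_def AB)
    let ?\<kappa> = "if snd (fst g) = 1 then \<kappa>0 - fst (fst g) else fst (fst g) - \<kappa>0"
    have e: "amp l A B \<kappa>0 = of_int (fst (snd g)) * snd (snd g) ^ m * amp l A B ?\<kappa>"
      using amp_act[OF m g(2), of \<kappa>0] unfolding lam_carrier[OF g(1)] .
    have \<iota>: "fst (snd g) \<in> {1, -1}" using g(1) carrier_GG by blast
    then have "of_int (fst (snd g)) * of_int (fst (snd g)) = (1 :: complex)" by auto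
    moreover have "amp l A B ?\<kappa> \<noteq> 0" using e \<kappa>0 by auto
    ultimately have "snd (snd g) ^ m = of_int (fst (snd g)) * (amp l A B \<kappa>0 / amp l A B ?\<kappa>)"
      by (subst e) (simp add: mult.assoc[symmetric])
    then have "snd (snd g) \<in> D" using \<iota> unfolding D_def by blast
    then show "g \<in> (UNIV \<times> {1, -1}) \<times> ({1, -1} \<times> D)"
      using g(1)[unfolded carrier_GG] by (simp add: mem_Times_iff)
  qed
  ultimately show ?thesis by (intro finite_subset[of "St x"]) auto
qed

lemma closed_subgroup_St:
  assumes x: "x \<in> V" "x \<noteq> 0" shows "closed_subgroup (St x)"
proof -
  have "Hausdorff_space (GG_topology :: 'n gelem topology)"
    unfolding GG_topology_def by (simp add: Hausdorff_space_prod_topology Hausdorff_space_subtopology)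
  then have "t1_space (GG_topology :: 'n gelem topology)" by (rule Hausdorff_imp_t1_space)
  moreover have "topspace (GG_topology :: 'n gelem topology) = carrier GG"
    by (simp add: GG_topology_def GG_def)
  ultimately have "closedin GG_topology (St x)"
    using finite_St[OF x] St_subset by (simp add: t1_space_closedin_finite)
  then show ?thesis using subgroup_St[OF x(1)] by (simp add: closed_subgroup_def)
qed

lemma lie_dim_full: "(\<And>z. norm z = 1 \<Longrightarrow> circle_elem z \<in> K) \<Longrightarrow> lie_dim K = 1"
  by (simp add: lie_dim_def)

text \<open>A one-parameter subgroup of the isotropy group would contain the shift by pi / m, which
  acts as -1 and fixes no nonzero wave. The circle does lie in the normalizer, so the dimensions are
  0 and 1.\<close>

lemma weyl_dim_St:
  assumes x: "x \<in> V" "x \<noteq> 0" shows "weyl_dim (St x) = 1"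
proof -
  obtain A B where AB: "x = W A B" using x(1) V_cases by blast
  have "v = 0" if v: "\<forall>s. circle_elem (cis (s * v)) \<in> St x" for v :: real
  proof (rule ccontr)
    assume "v \<noteq> 0"
    then have "circle_elem (cis (pi / real m)) \<in> St x" using v[rule_format, of "pi / real m / v"] by simp
    then have "act (circle_elem (cis (pi / real m))) (W A B) = W A B" by (simp add: stabilizer_def AB)
    moreover have "cis (pi / real m) ^ m = -1" using m by (simp add: Complex.DeMoivre)
    ultimately have "W (-1 * A) (-1 * B) = W (1 * A) (1 * B)" using act_circle[of "cis (pi / real m)" A B] by simp
    then have "(-1 :: complex) = 1" unfolding W_scale_inject[OF x(2)[unfolded AB]] .
    then show False by simp
  qed
  then have "{v::real. \<forall>s::real. circle_elem (cis (s * v)) \<in> St x} \<subseteq> {0}" by blast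
  then have "lie_dim (St x) = 0" unfolding lie_dim_def by (simp add: dim_eq_0)
  moreover have "lie_dim (normalizer GG (St x)) = 1"
    by (intro lie_dim_full circle_in_normalizer x(1))
  ultimately show ?thesis by (simp add: weyl_dim_def)
qed

lemma St_Phi: "x \<in> V \<Longrightarrow> x \<noteq> 0 \<Longrightarrow> orbit_type (St x) \<in> Phi 1"
  unfolding Phi_def using closed_subgroup_St weyl_dim_St by blast

text \<open>0 is fixed by all of G, and a group that contains the circle has a Weyl group of
  dimension 0. Thus the types in \<open>deg_mode\<close> are those of nonzero elements.\<close>

lemma St_zero_not_Phi: "orbit_type (St 0) \<notin> Phi 1"
proof
  assume "orbit_type (St 0) \<in> Phi 1"
  then obtain H where H: "orbit_type (St 0) = orbit_type H" "weyl_dim H = 1" unfolding Phi_def by auto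
  have c: "St 0 = carrier GG" by (auto simp: stabilizer_def act_zero)
  have "orbit_type (St 0) = {St 0}" unfolding orbit_type_St[OF zero_V] act_zero by (auto intro: GG.one_closed)
  moreover have "conjugate \<one>\<^bsub>GG\<^esub> H \<in> orbit_type H" unfolding orbit_type_def by blast
  ultimately have "conjugate \<one>\<^bsub>GG\<^esub> H = carrier GG" using H(1) c by blast
  have "circle_elem z \<in> H" if z: "norm z = 1" for z
  proof -
    have "circle_elem z \<in> conjugate \<one>\<^bsub>GG\<^esub> H" unfolding \<open>conjugate \<one>\<^bsub>GG\<^esub> H = carrier GG\<close> using z by (rule circle_elem_carrier)
    then obtain k where k: "k \<in> H" "circle_elem z = \<one>\<^bsub>GG\<^esub> \<otimes>\<^bsub>GG\<^esub> k \<otimes>\<^bsub>GG\<^esub> inv\<^bsub>GG\<^esub> \<one>\<^bsub>GG\<^esub>"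
      unfolding mem_conjugate by blast
    then have "circle_elem z = k" by (simp add: GG_mult GG_one[symmetric]) (simp add: GG_one prod_eq_iff)
    then show ?thesis using k(1) by simp
  qed
  then have "lie_dim H = 1" by (rule lie_dim_full)
  moreover have "lie_dim (normalizer GG H) \<le> 1" unfolding lie_dim_def using dim_subset_UNIV[where 'a = real] by simp
  ultimately show False using H(2) by (simp add: weyl_dim_def)
qed

end

section \<open>Degree recurrences\<close>

lemma dim_range_linear:
  fixes f :: "'a::euclidean_space \<Rightarrow> 'b::real_vector"
  assumes f: "linear f" and inj: "inj f"
  shows "dim (range f) = DIM('a)"
proof (rule dim_unique)
  show "independent (f ` Basis)"
    by (rule linear_independent_injective_image[OF f independent_Basis]) (rule inj_on_subset[OF inj], simp)
  show "range f \<subseteq> span (f ` Basis)" unfolding linear_span_image[OF f] by simp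
  show "card (f ` Basis) = DIM('a)" by (rule card_image) (rule inj_on_subset[OF inj], simp)
qed blast

text \<open>\<open>degree_of_recurrence\<close> is a definite description, about which nothing
  follows until the recurrence is known to have exactly one integer solution. T holds the maximal
  types, with coefficient 1; at most one further type E lies below all of them, with coefficient
  -1.\<close>

lemma keys_degree_of_recurrence:
  fixes E :: "'n::finite orbit_type"
  assumes fin: "finite S" and TS: "T \<subseteq> S" and E: "S - T \<subseteq> {E}"
    and top: "\<And>H. H \<in> T \<Longrightarrow> \<nu> H = 1 \<and> w H = 1 \<and> {K \<in> S. otype_less H K} = {}"
    and bot: "E \<in> S - T \<Longrightarrow> {K \<in> S. otype_less E K} = T \<and>
       (\<nu> E - (\<Sum>K\<in>T. real (num_containing E K) * real (w K))) / real (w E) = -1"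
  shows "Poly_Mapping.keys (degree_of_recurrence S \<nu> w) \<subseteq> S"
proof -
  let ?P = "\<lambda>d. Poly_Mapping.keys d \<subseteq> S \<and>
     (\<forall>\<H>\<in>S. real_of_int (Poly_Mapping.lookup d \<H>) =
        (\<nu> \<H> - (\<Sum>\<K> | \<K> \<in> S \<and> otype_less \<H> \<K>.
                   of_int (Poly_Mapping.lookup d \<K>) * real (num_containing \<H> \<K>) * real (w \<K>)))
        / real (w \<H>))"
  define f :: "'n orbit_type \<Rightarrow> int" where "f H = (if H \<in> T then 1 else if H \<in> S then -1 else 0)" for H
  have rec: "(\<nu> H - (\<Sum>K | K \<in> S \<and> otype_less H K. of_int (d K) * real (num_containing H K) * real (w K))) / real (w H) = of_int (f H)"
    if H: "H \<in> S" and d: "H \<notin> T \<Longrightarrow> \<forall>K\<in>T. d K = 1" for d :: "_ \<Rightarrow> int" and H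
  proof (cases "H \<in> T")
    case True
    then have t: "{K \<in> S. otype_less H K} = {}" "\<nu> H = 1" "w H = 1" using top by blast+
    show ?thesis unfolding t using True by (simp add: f_def)
  next
    case False
    then have "H = E" using H E by blast
    with False H have *: "{K \<in> S. otype_less H K} = T"
       "(\<nu> H - (\<Sum>K\<in>T. real (num_containing H K) * real (w K))) / real (w H) = -1" using bot by blast+
    have "(\<Sum>K\<in>T. of_int (d K) * real (num_containing H K) * real (w K)) = (\<Sum>K\<in>T. real (num_containing H K) * real (w K))"
      using d[OF False] by (intro sum.cong) auto
    then show ?thesis unfolding *(1) using *(2) False H by (simp add: f_def)
  qed
  have fin': "finite {H. f H \<noteq> 0}" by (rule finite_subset[OF _ fin]) (use TS in \<open>auto simp: f_def split: if_splits\<close>)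
  have look: "Poly_Mapping.lookup (Abs_poly_mapping f) = f" using fin' by simp
  have "?P (Abs_poly_mapping f)"
  proof (intro conjI ballI)
    show "Poly_Mapping.keys (Abs_poly_mapping f) \<subseteq> S"
      unfolding keys.rep_eq look using TS by (auto simp: f_def split: if_splits)
    fix H assume "H \<in> S"
    then show "real_of_int (Poly_Mapping.lookup (Abs_poly_mapping f) H) =
        (\<nu> H - (\<Sum>\<K> | \<K> \<in> S \<and> otype_less H \<K>.
                   of_int (Poly_Mapping.lookup (Abs_poly_mapping f) \<K>) * real (num_containing H \<K>) * real (w \<K>)))
        / real (w H)"
      unfolding look by (intro rec[symmetric]) (simp_all add: f_def)
  qed
  moreover have "d = Abs_poly_mapping f" if d: "?P d" for d
  proof (rule poly_mapping_eqI, unfold look)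
    have T: "Poly_Mapping.lookup d H = 1" if H: "H \<in> T" for H
    proof -
      have "real_of_int (Poly_Mapping.lookup d H) = of_int (f H)"
        using d H TS by (subst rec[of H "Poly_Mapping.lookup d", symmetric]) auto
      then show ?thesis using H by (simp add: f_def)
    qed
    fix H
    show "Poly_Mapping.lookup d H = f H"
    proof (cases "H \<in> S")
      case True
      have "real_of_int (Poly_Mapping.lookup d H) = of_int (f H)"
        using d True T by (subst rec[of H "Poly_Mapping.lookup d", symmetric]) auto
      then show ?thesis by simp
    next
      case False
      then have "H \<notin> Poly_Mapping.keys d" using d by blast
      then show ?thesis using False TS by (auto simp: f_def in_keys_iff)
    qed
  qed
  ultimately have "?P (degree_of_recurrence S \<nu> w)" unfolding degree_of_recurrence_def by (rule theI)
  then show ?thesis by blast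
qed

section \<open>Complex lines and their Weyl groups\<close>

context mode begin

lemma linear_W: "linear (\<lambda>q. W (fst q) (snd q))"
proof (rule linearI)
  show "W (fst (p + q)) (snd (p + q)) = W (fst p) (snd p) + W (fst q) (snd q)" for p q
    by (rule h2per_eqI) (simp add: h2fun_wave plus_h2per.rep_eq amp_def algebra_simps)
  show "W (fst (r *\<^sub>R q)) (snd (r *\<^sub>R q)) = r *\<^sub>R W (fst q) (snd q)" for r q
    by (rule h2per_eqI) (simp add: h2fun_wave scaleR_h2per.rep_eq amp_def algebra_simps)
qed

lemma dim_cline:
  assumes "W A B \<noteq> 0" shows "dim (cline (W A B)) = 2"
proof -
  have "linear (\<lambda>c. (c * A, c * B) :: complex \<times> complex)"
    by (rule linearI) (simp_all add: algebra_simps)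
  from linear_compose[OF this linear_W] have "linear (\<lambda>c. W (c * A) (c * B))" by (simp add: o_def)
  moreover have "inj (\<lambda>c. W (c * A) (c * B))" using W_scale_inject[OF assms] by (simp add: inj_def)
  moreover have "cline (W A B) = range (\<lambda>c. W (c * A) (c * B))" unfolding cline_W by auto
  ultimately show ?thesis using dim_range_linear by (metis DIM_complex)
qed

lemma is_line_V: "is_line x \<Longrightarrow> x \<in> V" and is_line_nonzero: "is_line x \<Longrightarrow> x \<noteq> 0"
  by (simp_all add: is_line_def)

text \<open>An element fixed by the whole isotropy group of x is a scalar multiple of x, and nonzero
  multiples have the same isotropy group.\<close>

lemma line_St_eq:
  assumes x: "is_line x" and y: "y \<in> V" "y \<noteq> 0" "St x \<subseteq> St y"
  shows "St x = St y"
proof -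
  obtain A B c where c: "x = W A B" "y = W (c * A) (c * B)" using x y unfolding is_line_def cline_def by blast
  then have "c \<noteq> 0" using y(2) by (auto simp: wave_zero)
  then show ?thesis unfolding c by (simp add: St_scale)
qed

lemma conjugate_mono: "H \<subseteq> K \<Longrightarrow> conjugate g H \<subseteq> conjugate g K"
  by (force simp: mem_conjugate)

lemma is_line_act:
  assumes g: "g \<in> carrier GG" and x: "is_line x"
  shows "is_line (act g x)"
  unfolding is_line_def
proof (intro conjI ballI impI)
  note xV = is_line_V[OF x]
  show "act g x \<in> V" "act g x \<noteq> 0" using act_V act_eq_0 g xV is_line_nonzero[OF x] by auto
  fix y assume y: "y \<in> V" "St (act g x) \<subseteq> St y"
  have "conjugate (inv\<^bsub>GG\<^esub> g) (St (act g x)) \<subseteq> conjugate (inv\<^bsub>GG\<^esub> g) (St y)" by (rule conjugate_mono[OF y(2)])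
  then have "St x \<subseteq> St (act (inv\<^bsub>GG\<^esub> g) y)"
    unfolding conjugate_St[OF GG.inv_closed[OF g] act_V[OF xV]] conjugate_St[OF GG.inv_closed[OF g] y(1)] act_inv_act[OF g xV] .
  then obtain A B c where c: "x = W A B" "act (inv\<^bsub>GG\<^esub> g) y = W (c * A) (c * B)"
    using x act_V[OF y(1)] unfolding is_line_def cline_def by blast
  obtain A' B' where A': "act g (W A B) = W A' B'" unfolding act_wave by blast
  have "y = W (c * A') (c * B')" using act_act_inv[OF g y(1)] unfolding c(2) act_W_scale[OF A'] by simp
  then show "y \<in> cline (act g x)" unfolding c(1) A' cline_W by blast
qed

lemma rep_line:
  assumes "is_line x" obtains y where "is_line y" "rep (orbit_type (St x)) = St y"
  using rep_orbit_type[OF is_line_V[OF assms]] is_line_act assms by metis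

lemma fixed_dim_line:
  assumes "is_line x" shows "fixed_dim V (orbit_type (St x)) = 2"
proof -
  obtain y where y: "is_line y" "rep (orbit_type (St x)) = St y" using rep_line[OF assms] .
  obtain A B where AB: "y = W A B" using is_line_V[OF y(1)] V_cases by blast
  have "{z \<in> V. \<forall>h \<in> St y. act h z = z} = cline y"
  proof (intro equalityI subsetI)
    fix z assume "z \<in> {z \<in> V. \<forall>h \<in> St y. act h z = z}"
    then have "z \<in> V" "St y \<subseteq> St z" using St_subset[of y] by (auto simp: stabilizer_def)
    then show "z \<in> cline y" using y(1) unfolding is_line_def by blast
  next
    fix z assume "z \<in> cline y"
    then obtain c where c: "z = W (c * A) (c * B)" unfolding AB cline_W by blast
    have "act h z = z" if "h \<in> St y" for h
      unfolding c by (rule act_W_scale) (use that in \<open>simp add: stabilizer_def AB\<close>)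
    then show "z \<in> {z \<in> V. \<forall>h \<in> St y. act h z = z}" using c W_in_V by simp
  qed
  then show ?thesis unfolding fixed_dim_def y(2) using dim_cline is_line_nonzero[OF y(1)] AB by simp
qed

lemma weyl_mod_circle_order_eq:
  assumes y: "y \<in> V" "rep H = St y"
    and f: "\<And>g h. g \<in> normalizer GG (St y) \<Longrightarrow> h \<in> normalizer GG (St y) \<Longrightarrow>
      f g = f h \<longleftrightarrow> (\<exists>k\<in>St y. \<exists>z. norm z = 1 \<and> g = k \<otimes>\<^bsub>GG\<^esub> (circle_elem z \<otimes>\<^bsub>GG\<^esub> h))"
  shows "weyl_mod_circle_order H = card (f ` normalizer GG (St y))"
proof -
  let ?C = "circle_elem ` carrier circle_group :: 'n gelem set"
  have c: "z \<in> carrier circle_group \<longleftrightarrow> norm z = 1" for z by (simp add: circle_group_def)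
  have "?C \<subseteq> normalizer GG (St y)" using circle_in_normalizer[OF _ y(1)] c by blast
  moreover have "\<one>\<^bsub>GG\<^esub> \<in> ?C" by (rule image_eqI[of _ _ 1]) (simp_all add: GG_one circle_elem_def circle_group_def)
  moreover have "f g = f h \<longleftrightarrow> (\<exists>k\<in>St y. \<exists>c\<in>?C. g = k \<otimes>\<^bsub>GG\<^esub> (c \<otimes>\<^bsub>GG\<^esub> h))"
    if "g \<in> normalizer GG (St y)" "h \<in> normalizer GG (St y)" for g h
    unfolding f[OF that] using c by blast
  ultimately show ?thesis unfolding weyl_mod_circle_order_def weyl_def y(2)
    using GG.card_double_factor[OF subgroup_St[OF y(1)], of ?C f] by (simp only: image_image)
qed

text \<open>The normalizer of an isotropy group preserves its fixed space, so it acts on the line by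
  unit scalars, and each of these is undone by a time shift. The normalizer is thus the product of
  the isotropy group and the circle.\<close>

lemma weyl_mod_circle_order_line:
  assumes "is_line x" shows "weyl_mod_circle_order (orbit_type (St x)) = 1"
proof -
  obtain y where y: "is_line y" "rep (orbit_type (St x)) = St y" using rep_line[OF assms] .
  note yV = is_line_V[OF y(1)]
  obtain A B where AB: "y = W A B" using yV V_cases by blast
  let ?N = "normalizer GG (St y)"
  have N: "subgroup ?N GG" by (rule GG.normalizer_imp_subgroup[OF St_subset])
  have "\<exists>k\<in>St y. \<exists>z. norm z = 1 \<and> g = k \<otimes>\<^bsub>GG\<^esub> (circle_elem z \<otimes>\<^bsub>GG\<^esub> h)" if gh: "g \<in> ?N" "h \<in> ?N" for g h
  proof -
    have car: "g \<in> carrier GG" "h \<in> carrier GG" using gh N by (auto dest: subgroup.mem_carrier)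
    define q where "q = g \<otimes>\<^bsub>GG\<^esub> inv\<^bsub>GG\<^esub> h"
    have qN: "q \<in> ?N" unfolding q_def using gh N by (auto intro: subgroup.m_closed subgroup.m_inv_closed)
    then have q: "q \<in> carrier GG" "conjugate q (St y) = St y" unfolding normalizer_iff[OF subgroup_St[OF yV]] by blast+
    then have q2: "St (act q y) = St y" unfolding conjugate_St[OF q(1) yV] by simp
    have "act q y \<in> cline y" using y(1) act_V[OF yV] q2 unfolding is_line_def by blast
    then obtain c where c: "act q (W A B) = W (c * A) (c * B)" unfolding AB cline_W by blast
    have "norm c = 1" using norm_scalar[OF q(1) c] is_line_nonzero[OF y(1)] AB by simp
    then have "norm (cnj c) = 1" by simp
    \<comment> \<open>The time shift z cancels the scalar c by which q acts, so that k below fixes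
      y.\<close>
    then obtain z where z: "norm z = 1" "z ^ m = cnj c" using root_of_unit by blast
    have z': "norm (cnj z) = 1" using z by simp
    have cz: "circle_elem z \<in> carrier (GG :: 'n gelem monoid)" "circle_elem (cnj z) \<in> carrier (GG :: 'n gelem monoid)"
      by (rule circle_elem_carrier[OF z(1)] circle_elem_carrier[OF z'])+
    define k where "k = circle_elem z \<otimes>\<^bsub>GG\<^esub> q"
    have "cnj c * c = 1" using \<open>norm c = 1\<close> complex_norm_square[of c] by (simp add: mult.commute)
    then have "act k y = y" unfolding k_def act_mult[OF circle_elem_carrier[OF z(1)] q(1) yV] unfolding AB c act_circle[OF z(1)] z(2)
      by (simp add: mult.assoc[symmetric])
    then have "k \<in> St y" using q(1) cz by (simp add: stabilizer_def k_def)
    moreover have "g = k \<otimes>\<^bsub>GG\<^esub> (circle_elem (cnj z) \<otimes>\<^bsub>GG\<^esub> h)"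
    proof -
      have zz: "circle_elem z \<otimes>\<^bsub>GG\<^esub> circle_elem (cnj z) = (\<one>\<^bsub>GG\<^esub> :: 'n gelem)"
        using complex_norm_square[of z] z(1) by (simp add: GG_mult GG_one circle_elem_def)
      have "k \<otimes>\<^bsub>GG\<^esub> (circle_elem (cnj z) \<otimes>\<^bsub>GG\<^esub> h) = (q \<otimes>\<^bsub>GG\<^esub> circle_elem z) \<otimes>\<^bsub>GG\<^esub> (circle_elem (cnj z) \<otimes>\<^bsub>GG\<^esub> h)"
        by (simp only: k_def circle_elem_central)
      also have "\<dots> = q \<otimes>\<^bsub>GG\<^esub> ((circle_elem z \<otimes>\<^bsub>GG\<^esub> circle_elem (cnj z)) \<otimes>\<^bsub>GG\<^esub> h)"
        using q(1) cz car by (simp add: GG.m_assoc)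
      also have "\<dots> = g" unfolding zz q_def using car by (simp add: GG.m_assoc)
      finally show ?thesis ..
    qed
    ultimately show ?thesis using z' by blast
  qed
  then have "weyl_mod_circle_order (orbit_type (St x)) = card ((\<lambda>_. ()) ` ?N)"
    by (intro weyl_mod_circle_order_eq[OF yV y(2)]) blast
  also have "(\<lambda>_. ()) ` ?N = {()}" using subgroup.one_closed[OF N] by auto
  finally show ?thesis by simp
qed

abbreviation (input) St_types :: "'n orbit_type set" where
  "St_types \<equiv> {orbit_type (St x) | x. x \<in> V \<and> x \<noteq> 0}"

lemma Phi_St_types: "Phi 1 \<inter> {orbit_type (St x) | x. x \<in> V} = St_types"
  using St_Phi St_zero_not_Phi by blast

lemma otype_less_St:
  assumes "otype_less (orbit_type (St x)) (orbit_type (St y))" "x \<in> V" "y \<in> V"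
  obtains g h where "g \<in> carrier GG" "h \<in> carrier GG" "St (act g x) \<subseteq> St (act h y)"
  using assms(1) unfolding otype_less_def otype_le_def orbit_type_St[OF assms(2)] orbit_type_St[OF assms(3)] by blast

lemma line_type_maximal:
  assumes x: "is_line x" shows "{K \<in> St_types. otype_less (orbit_type (St x)) K} = {}"
proof (rule ccontr)
  assume "{K \<in> St_types. otype_less (orbit_type (St x)) K} \<noteq> {}"
  then obtain y where y: "y \<in> V" "y \<noteq> 0" "otype_less (orbit_type (St x)) (orbit_type (St y))" by blast
  obtain g h where gh: "g \<in> carrier GG" "h \<in> carrier GG" "St (act g x) \<subseteq> St (act h y)"
    using otype_less_St[OF y(3) is_line_V[OF x] y(1)] .
  have "act h y \<noteq> 0" using y act_eq_0[OF gh(2)] by simp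
  then have "St (act g x) = St (act h y)"
    using line_St_eq[OF is_line_act[OF gh(1) x] act_V[OF y(1)]] gh(3) by blast
  then have "orbit_type (St x) = orbit_type (St y)"
    using orbit_type_St_act[OF gh(1) is_line_V[OF x]] orbit_type_St_act[OF gh(2) y(1)] by simp
  then show False using y(3) by (simp add: otype_less_def)
qed

text \<open>For j = -j the whole mode space is one complex line, so there is a single orbit type of
  nonzero elements and the recurrence consists of its top level only.\<close>

lemma keys_deg_mode_self_conjugate:
  assumes "j = - j"
  shows "Poly_Mapping.keys (deg_mode l m :: 'n orbit_type \<Rightarrow>\<^sub>0 int) \<subseteq> St_types"
proof -
  note eq = wave_self_conjugate[where ?'n = 'n and l = l, OF m assms[unfolded j_def]]
  have x10: "W A B = W ((A + B) * 1) ((A + B) * 0)" for A B unfolding eq by simp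
  have line: "is_line x" if x: "x \<in> V" "x \<noteq> 0" for x
    unfolding is_line_def
  proof (intro conjI x ballI impI)
    fix y assume "y \<in> V"
    then obtain A B A' B' where AB: "x = W A B" "y = W A' B'" using x(1) V_cases by metis
    have "A + B \<noteq> 0" using x(2) x10[of A B] AB(1) by (auto simp: wave_zero)
    then have "y = W ((A' + B') / (A + B) * A) ((A' + B') / (A + B) * B)"
      unfolding AB eq distrib_left[symmetric] by simp
    then show "y \<in> cline x" unfolding AB(1) cline_W by blast
  qed
  have St: "St x = St (W 1 0)" if x: "x \<in> V" "x \<noteq> 0" for x
  proof -
    obtain A B where AB: "x = W A B" using x(1) V_cases by blast
    have "A + B \<noteq> 0" using x(2) x10[of A B] AB by (auto simp: wave_zero)
    then show ?thesis unfolding AB x10[of A B] by (rule St_scale)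
  qed
  have "finite St_types" by (rule finite_subset[of _ "{orbit_type (St (W 1 0))}"]) (use St in auto)
  then show ?thesis unfolding deg_mode_def Phi_St_types
  proof (rule keys_degree_of_recurrence[where T = St_types and E = undefined])
    fix H assume "H \<in> St_types"
    then obtain x where x: "is_line x" "H = orbit_type (St x)" using line by blast
    show "real (fixed_dim V H) / 2 = 1 \<and> weyl_mod_circle_order H = 1 \<and> {K \<in> St_types. otype_less H K} = {}"
      unfolding x(2) using fixed_dim_line[OF x(1)] weyl_mod_circle_order_line[OF x(1)] line_type_maximal[OF x(1)] by simp
  qed auto
qed

end

section \<open>Modes with two independent travelling waves\<close>

lemma card_squares:
  fixes D :: "complex set"
  assumes "finite D" and "0 \<notin> D" and neg: "\<And>\<mu>. \<mu> \<in> D \<Longrightarrow> - \<mu> \<in> D"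
  shows "card D = 2 * card ((\<lambda>\<mu>. \<mu>\<^sup>2) ` D)"
proof -
  let ?sq = "\<lambda>\<mu>::complex. \<mu>\<^sup>2"
  have "card {\<mu> \<in> D. ?sq \<mu> = v} = 2" if v: "v \<in> ?sq ` D" for v
  proof -
    obtain \<mu> where \<mu>: "\<mu> \<in> D" "v = \<mu>\<^sup>2" using v by blast
    have "{\<mu> \<in> D. ?sq \<mu> = v} = {\<mu>, - \<mu>}" unfolding \<mu>(2) power2_eq_iff using \<mu>(1) neg by auto
    moreover have "\<mu> \<noteq> - \<mu>" using \<mu>(1) assms(2) by auto
    ultimately show ?thesis by simp
  qed
  moreover have "card D = (\<Sum>v\<in>?sq ` D. card {\<mu> \<in> D. ?sq \<mu> = v})"
    using sum.image_gen[OF assms(1), of "\<lambda>_. 1::nat" ?sq] by simp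
  ultimately show ?thesis by simp
qed

locale nonreal_mode = mode l m j for l m and j :: "'n::finite mod_ring" +
  assumes nonreal: "j \<noteq> - j"
begin

lemma W_inject: "W A B = W A' B' \<longleftrightarrow> A = A' \<and> B = B'"
  by (rule wave_inject[OF m nonreal[unfolded j_def]])

lemma W_nonzero: "W A B = 0 \<longleftrightarrow> A = 0 \<and> B = 0"
  unfolding wave_zero[of l m, symmetric] W_inject ..

lemma mem_St: "g \<in> St (W A B) \<longleftrightarrow> g \<in> carrier GG \<and>
    (if snd (fst g) = 1 then lam m g * rot l g * A = A \<and> lam m g * cnj (rot l g) * B = B
     else lam m g * rot l g * B = A \<and> lam m g * cnj (rot l g) * A = B)"
  unfolding stabilizer_def mem_Collect_eq act_wave W_inject by simp

definition ker :: "'n gelem set" where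
  "ker = {g \<in> carrier GG. snd (fst g) = 1 \<and> lam m g * rot l g = 1 \<and> lam m g * cnj (rot l g) = 1}"

text \<open>The ratios B / A at which some reflection fixes the wave, by
  \<open>reflection_iff\<close>; they are the standing waves.\<close>

definition D :: "complex set" where
  "D = (\<lambda>(\<epsilon>, r). \<epsilon> * chi j r) ` ({1, -1} \<times> UNIV)"

lemma kernel_subset: assumes x: "x \<in> V" shows "ker \<subseteq> St x"
  proof
  obtain A B where AB: "x = W A B" using x V_cases by blast
  fix g assume "g \<in> ker"
  then show "g \<in> St x" unfolding AB mem_St ker_def by simp
qed

lemma norm_rot: "norm (rot l (g :: 'n gelem)) = 1"
  by (simp add: rot_def)

lemma unit_mult_cnj: "norm z = 1 \<Longrightarrow> z * cnj z = 1" for z :: complex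
  using complex_norm_square[of z] by simp

definition spin :: "complex \<Rightarrow> 'n gelem" where
  "spin z = ((of_int_mod_ring 1, 1), (1, z))"

lemma spin:
  assumes "norm z = 1"
  shows "spin z \<in> carrier GG" "lam m (spin z) = z ^ m" "rot l (spin z) = cnj (chi j (of_int_mod_ring 1))"
proof -
  show c: "spin z \<in> carrier GG" using assms by (simp add: carrier_GG spin_def)
  show "lam m (spin z) = z ^ m" unfolding lam_carrier[OF c] by (simp add: spin_def)
  show "rot l (spin z) = cnj (chi j (of_int_mod_ring 1))"
    by (simp add: rot_def spin_def chi_minus_right j_def)
qed

lemma chi_square_not_1: "(chi j (of_int_mod_ring 1))\<^sup>2 \<noteq> 1"
proof
  let ?z = "chi j (of_int_mod_ring 1)"
  assume "?z\<^sup>2 = 1"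
  then have "?z * (?z - cnj ?z) = 0" using unit_mult_cnj[of ?z] by (simp add: right_diff_distrib power2_eq_square)
  then have "chi j (of_int_mod_ring 1) = chi (- j) (of_int_mod_ring 1)" by (simp add: chi_minus)
  then show False using chi_inj nonreal by blast
qed

lemma is_lineI:
  assumes "x = W A B" "A \<noteq> 0 \<or> B \<noteq> 0" "\<And>A' B'. St x \<subseteq> St (W A' B') \<Longrightarrow> \<exists>c. A' = c * A \<and> B' = c * B"
  shows "is_line x"
  unfolding is_line_def
proof (intro conjI ballI impI)
  show "x \<in> V" "x \<noteq> 0" using assms(1,2) W_in_V W_nonzero by auto
  fix y assume y: "y \<in> V" "St x \<subseteq> St y"
  then obtain A' B' where y': "y = W A' B'" using V_cases by blast
  then obtain c where "A' = c * A" "B' = c * B" using assms(3) y(2) by blast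
  then show "y \<in> cline x" unfolding assms(1) y' cline_W by blast
qed

text \<open>The rotation by one cell with the matching time shift fixes one coordinate and
  multiplies the other by the square of a character value or its conjugate, which is not 1 because j
  and -j differ.\<close>

lemma travelling_line:
  "is_line (W 1 0)" "is_line (W 0 1)"
proof -
  let ?z = "chi j (of_int_mod_ring 1)"
  obtain z where z: "norm z = 1" "z ^ m = ?z" using root_of_unit[of ?z] by auto
  have z': "norm (cnj z) = 1" "cnj z ^ m = cnj ?z" using z by (simp_all flip: complex_cnj_power)
  have s: "snd (fst (spin w)) = 1" for w by (simp add: spin_def)
  have sq: "cnj ?z * cnj ?z \<noteq> 1"
    using chi_square_not_1 by (metis complex_cnj_mult complex_cnj_one_iff power2_eq_square)
  show "is_line (W 1 0)"
  proof (rule is_lineI[OF refl])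
    fix A' B' assume sub: "St (W 1 0) \<subseteq> St (W A' B')"
    have "spin z \<in> St (W 1 0)" unfolding mem_St using spin[OF z(1)] z(2) s unit_mult_cnj[of ?z] by simp
    then have "spin z \<in> St (W A' B')" using sub by blast
    then have "?z * ?z * B' = B'" unfolding mem_St using spin[OF z(1)] z(2) s by simp
    then have "(?z\<^sup>2 - 1) * B' = 0" by (simp add: algebra_simps power2_eq_square)
    then have "B' = 0" using chi_square_not_1 by simp
    then show "\<exists>c. A' = c * 1 \<and> B' = c * 0" by simp
  qed simp
  show "is_line (W 0 1)"
  proof (rule is_lineI[OF refl])
    fix A' B' assume sub: "St (W 0 1) \<subseteq> St (W A' B')"
    have "spin (cnj z) \<in> St (W 0 1)"
      unfolding mem_St using spin[OF z'(1)] z'(2) s unit_mult_cnj[of ?z] by (simp add: mult.commute)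
    then have "spin (cnj z) \<in> St (W A' B')" using sub by blast
    then have "cnj ?z * cnj ?z * A' = A'" unfolding mem_St using spin[OF z'(1)] z'(2) s by simp
    then have "(cnj ?z * cnj ?z - 1) * A' = 0" by (simp add: algebra_simps)
    then have "A' = 0" using sq by simp
    then show "\<exists>c. A' = c * 0 \<and> B' = c * 1" by simp
  qed simp
qed

lemma reflection_line:
  assumes nz: "A \<noteq> 0" "B \<noteq> 0" and g: "g \<in> St (W A B)" "snd (fst g) \<noteq> 1"
  shows "is_line (W A B)"
proof (rule is_lineI[OF refl])
  fix A' B' assume "St (W A B) \<subseteq> St (W A' B')"
  then have "g \<in> St (W A' B')" using g(1) by blast
  then have e: "lam m g * rot l g * B' = A'" "lam m g * rot l g * B = A" using g unfolding mem_St by auto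
  show "\<exists>c. A' = c * A \<and> B' = c * B"
  proof (intro exI conjI)
    show "A' = B' / B * A" unfolding e(1)[symmetric] e(2)[symmetric] using nz by simp
    show "B' = B' / B * B" using nz by simp
  qed
qed (use nz in simp)

lemma St_generic:
  assumes nz: "A \<noteq> 0" "B \<noteq> 0" and r: "\<And>g. g \<in> St (W A B) \<Longrightarrow> snd (fst g) = 1"
  shows "St (W A B) = ker"
proof (intro equalityI kernel_subset W_in_V subsetI)
  fix g assume g: "g \<in> St (W A B)"
  then have "lam m g * rot l g * A = A" "lam m g * cnj (rot l g) * B = B" using r[OF g] unfolding mem_St by auto
  then show "g \<in> ker" using nz r[OF g] g unfolding ker_def mem_St by auto
qed

text \<open>A reflection in the isotropy group swaps A and B up to unit factors and would equate
  their moduli.\<close>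

lemma St_unequal:
  assumes "A \<noteq> 0" "B \<noteq> 0" "norm A \<noteq> norm B"
  shows "St (W A B) = ker"
proof (rule St_generic[OF assms(1,2)], rule ccontr)
  fix g assume g: "g \<in> St (W A B)" "snd (fst g) \<noteq> 1"
  then have "lam m g * rot l g * B = A" "g \<in> carrier GG" unfolding mem_St by auto
  then have "norm A = norm B" using norm_lam[of g m] norm_rot[of g] by (metis mult_1 norm_mult)
  then show False using assms(3) by blast
qed

text \<open>\<open>ker\<close> fixes both \<open>W 1 0\<close> and \<open>W 0 1\<close>, which are
  not multiples of one element.\<close>

lemma kernel_not_line: "St x = ker \<Longrightarrow> \<not> is_line x"
proof
  assume k: "St x = ker" and x: "is_line x"
  obtain A B where AB: "x = W A B" using is_line_V[OF x] V_cases by blast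
  have "W 1 0 \<in> cline x" "W 0 1 \<in> cline x"
    using x kernel_subset[OF W_in_V] k W_in_V unfolding is_line_def by blast+
  then show False unfolding AB cline_W W_inject mem_Collect_eq by auto
qed

text \<open>If a coordinate vanishes, x is a multiple of a travelling wave. Otherwise a reflection
  in the isotropy group ties A to B and leaves a line, and without one only \<open>ker\<close>
  remains.\<close>

lemma line_or_kernel:
  assumes "x \<in> V" "x \<noteq> 0" shows "is_line x \<or> St x = ker"
proof -
  obtain A B where AB: "x = W A B" using assms(1) V_cases by blast
  have t: "is_line (W (c * a) (c * b))" if "c \<noteq> 0" "is_line (W a b)" for a b c
  proof (rule is_lineI[OF refl])
    show "c * a \<noteq> 0 \<or> c * b \<noteq> 0" using that is_line_nonzero[OF that(2)] W_nonzero[of a b] by auto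
    fix A' B' assume "St (W (c * a) (c * b)) \<subseteq> St (W A' B')"
    then have "W A' B' \<in> cline (W a b)" using that(2) W_in_V unfolding St_scale[OF that(1)] is_line_def by blast
    then obtain d where "A' = d * a" "B' = d * b" unfolding cline_W W_inject mem_Collect_eq by blast
    then show "\<exists>k. A' = k * (c * a) \<and> B' = k * (c * b)" using that(1) by (intro exI[of _ "d / c"]) simp
  qed
  show ?thesis
  proof (cases "A = 0 \<or> B = 0")
    case True
    then show ?thesis
    proof
      assume "A = 0"
      then show ?thesis using t[OF _ travelling_line(2), of B] assms(2) unfolding AB W_nonzero by simp
    next
      assume "B = 0"
      then show ?thesis using t[OF _ travelling_line(1), of A] assms(2) unfolding AB W_nonzero by simp
    qed
  next
    case False
    then show ?thesis using St_generic[of A B] reflection_line[of A B] unfolding AB by blast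
  qed
qed

lemma reflection_iff:
  assumes "\<mu> \<noteq> 0"
  shows "(\<exists>g\<in>St (W 1 \<mu>). snd (fst g) \<noteq> 1) \<longleftrightarrow> \<mu> \<in> D"
proof
  assume "\<exists>g\<in>St (W 1 \<mu>). snd (fst g) \<noteq> 1"
  then obtain g where g': "g \<in> St (W 1 \<mu>)" "snd (fst g) \<noteq> 1" by blast
  then have g: "lam m g * rot l g * \<mu> = 1" "lam m g * cnj (rot l g) = \<mu>" unfolding mem_St by auto
  \<comment> \<open>Multiplying the two relations cancels \<open>rot\<close> against its conjugate
    and leaves the square of \<open>lam\<close> equal to 1; this is the sign in
    \<open>D\<close>.\<close>
  have "lam m g * lam m g * (rot l g * cnj (rot l g)) = 1"
    using g(1) unfolding g(2)[symmetric] by (simp only: mult_ac)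
  then have "(lam m g)\<^sup>2 = 1" unfolding unit_mult_cnj[OF norm_rot] by (simp add: power2_eq_square)
  then have "lam m g \<in> {1, -1}" by (simp add: power2_eq_1_iff)
  moreover have "cnj (rot l g) = chi j (fst (fst g))" by (simp add: rot_def chi_minus_right j_def)
  ultimately show "\<mu> \<in> D" using g(2) unfolding D_def by force
next
  assume "\<mu> \<in> D"
  then obtain \<epsilon> r where \<mu>: "\<epsilon> = 1 \<or> \<epsilon> = -1" "\<mu> = \<epsilon> * chi j r" unfolding D_def by auto
  define \<iota> :: int where "\<iota> = (if \<epsilon> = 1 then 1 else -1)"
  define g :: "'n gelem" where "g = ((r, -1), (\<iota>, 1))"
  have "g \<in> carrier GG" by (simp add: carrier_GG g_def \<iota>_def)
  moreover have "lam m g = \<epsilon>" using \<mu>(1) by (auto simp: lam_def g_def \<iota>_def)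
  moreover have "rot l g = cnj (chi j r)" by (simp add: rot_def g_def chi_minus_right j_def)
  moreover have "snd (fst g) = -1" by (simp add: g_def)
  moreover have "cnj (chi j r) * chi j r = 1" using unit_mult_cnj[of "chi j r"] by (simp add: mult.commute)
  ultimately have "g \<in> St (W 1 \<mu>)" unfolding mem_St \<mu>(2) using \<mu>(1) by (auto simp: mult.assoc)
  then show "\<exists>g\<in>St (W 1 \<mu>). snd (fst g) \<noteq> 1" using \<open>snd (fst g) = -1\<close> by (intro bexI[of _ g]) auto
qed

lemma D_facts: "finite D" "0 \<notin> D" "\<mu> \<in> D \<Longrightarrow> - \<mu> \<in> D"
  "(\<lambda>\<mu>. \<mu>\<^sup>2) ` D = range (\<lambda>r. (chi j r)\<^sup>2)"
proof -
  show "finite D" "0 \<notin> D" unfolding D_def by auto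
  show "\<mu> \<in> D \<Longrightarrow> - \<mu> \<in> D" unfolding D_def by force
  show "(\<lambda>\<mu>. \<mu>\<^sup>2) ` D = range (\<lambda>r. (chi j r)\<^sup>2)"
    unfolding D_def by (force simp: power_mult_distrib image_iff)
qed

definition line_groups :: "'n gelem set set" where
  "line_groups = {St x | x. is_line x}"

lemma is_line_D: "\<mu> \<in> D \<Longrightarrow> is_line (W 1 \<mu>)"
  using reflection_iff[of \<mu>] reflection_line[of 1 \<mu>] D_facts(2) by (metis zero_neq_one)

lemma line_groups_eq: "line_groups = {St (W 1 0), St (W 0 1)} \<union> (\<lambda>\<mu>. St (W 1 \<mu>)) ` D"
proof (intro equalityI subsetI)
  fix H assume "H \<in> line_groups"
  then obtain x where x: "is_line x" "H = St x" unfolding line_groups_def by blast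
  obtain A B where AB: "x = W A B" using is_line_V[OF x(1)] V_cases by blast
  consider "A = 0" "B \<noteq> 0" | "A \<noteq> 0" "B = 0" | "A \<noteq> 0" "B \<noteq> 0"
    using is_line_nonzero[OF x(1)] unfolding AB W_nonzero by blast
  then show "H \<in> {St (W 1 0), St (W 0 1)} \<union> (\<lambda>\<mu>. St (W 1 \<mu>)) ` D"
  proof cases
    case 1
    then have "H = St (W 0 1)" using St_scale[of B 0 1] unfolding x(2) AB by simp
    then show ?thesis by simp
  next
    case 2
    then have "H = St (W 1 0)" using St_scale[of A 1 0] unfolding x(2) AB by simp
    then show ?thesis by simp
  next
    case 3
    then have H: "H = St (W 1 (B / A))" using St_scale[of A 1 "B / A"] unfolding x(2) AB by simp
    have "\<exists>g\<in>St (W 1 (B / A)). snd (fst g) \<noteq> 1"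
      using St_generic[of 1 "B / A"] kernel_not_line x 3 H by (metis divide_eq_0_iff zero_neq_one)
    then have "B / A \<in> D" using reflection_iff[of "B / A"] 3 by simp
    then show ?thesis unfolding H by blast
  qed
next
  fix H assume "H \<in> {St (W 1 0), St (W 0 1)} \<union> (\<lambda>\<mu>. St (W 1 \<mu>)) ` D"
  then show "H \<in> line_groups" unfolding line_groups_def using travelling_line is_line_D by blast
qed

lemma line_St_proportional:
  assumes "is_line (W A B)" "St (W A B) = St (W A' B')"
  shows "\<exists>c. A' = c * A \<and> B' = c * B"
proof -
  have "W A' B' \<in> cline (W A B)" using assms W_in_V unfolding is_line_def by blast
  then show ?thesis unfolding cline_W W_inject mem_Collect_eq by blast
qed

text \<open>A line is the fixed space of its isotropy group, so the two travelling lines and the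
  lines of ratio in \<open>D\<close>, being distinct, have distinct groups.\<close>

lemma line_groups_card: "finite line_groups" "card line_groups = 2 + card D"
proof -
  show "finite line_groups" unfolding line_groups_eq using D_facts(1) by simp
  have "St (W 1 0) \<noteq> St (W 0 1)" using line_St_proportional[OF travelling_line(1), of 0 1] by auto
  moreover have "St (W 1 0) \<notin> (\<lambda>\<mu>. St (W 1 \<mu>)) ` D"
    using line_St_proportional[OF travelling_line(1), of 1] D_facts(2) by auto
  moreover have "St (W 0 1) \<notin> (\<lambda>\<mu>. St (W 1 \<mu>)) ` D"
    using line_St_proportional[OF travelling_line(2), of 1] by auto
  moreover have "inj_on (\<lambda>\<mu>. St (W 1 \<mu>)) D"
  proof (rule inj_onI)
    fix \<mu> \<nu> assume "\<mu> \<in> D" "St (W 1 \<mu>) = St (W 1 \<nu>)"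
    then show "\<mu> = \<nu>" using line_St_proportional[OF is_line_D, of \<mu> 1 \<nu>] by auto
  qed
  ultimately show "card line_groups = 2 + card D"
    unfolding line_groups_eq using D_facts(1) by (simp add: card_image)
qed

text \<open>The values 1 and 2 give a sample point of unequal moduli. Its translates have unequal
  moduli too, which shows that \<open>ker\<close> is an isotropy group and normal.\<close>

lemma St_12: "St (W 1 2) = ker"
  by (rule St_unequal) simp_all

lemma St_act_12: "g \<in> carrier GG \<Longrightarrow> St (act g (W 1 2)) = ker"
  unfolding act_wave using norm_lam[of g m] norm_rot[of g]
  by (intro St_unequal) (auto simp: norm_mult)

lemma orbit_type_kernel: "orbit_type ker = {ker}"
  using orbit_type_St[OF W_in_V, of 1 2] St_act_12 GG.one_closed unfolding St_12 by (auto simp: image_iff)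

lemma rep_kernel: "rep (orbit_type ker) = ker"
  unfolding orbit_type_kernel rep_def by simp

lemma normalizer_kernel: "normalizer GG ker = carrier GG"
  using normalizer_iff[OF subgroup_St[OF W_in_V], of _ 1 2] conjugate_St[OF _ W_in_V, of _ 1 2] St_act_12
  unfolding St_12 by blast

text \<open>A time shift adjusts \<open>lam\<close> freely, and on \<open>ker\<close> the factor
  \<open>rot\<close> is 1 or -1. The class of g is therefore given by its reflection sign and the
  square of \<open>rot\<close>. The number of such pairs is twice the number of squares of elements
  of \<open>D\<close>, which is the size of \<open>D\<close>.\<close>

lemma weyl_kernel: "weyl_mod_circle_order (orbit_type ker) = card D"
proof -
  define f where "f g = (snd (fst g), (rot l g)\<^sup>2)" for g :: "'n gelem"
  have "f g = f h \<longleftrightarrow> (\<exists>k\<in>ker. \<exists>z. norm z = 1 \<and> g = k \<otimes>\<^bsub>GG\<^esub> (circle_elem z \<otimes>\<^bsub>GG\<^esub> h))"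
    if g: "g \<in> carrier GG" and h: "h \<in> carrier GG" for g h
  proof
    assume eq: "f g = f h"
    define q where "q = g \<otimes>\<^bsub>GG\<^esub> inv\<^bsub>GG\<^esub> h"
    have q: "q \<in> carrier GG" "q \<otimes>\<^bsub>GG\<^esub> h = g" using g h by (simp_all add: q_def GG.m_assoc)
    have "snd (fst q) * snd (fst h) = snd (fst h)" using q(2) eq by (auto simp: GG_mult f_def)
    then have s: "snd (fst q) = 1" using h by (auto simp: carrier_GG)
    have "(rot l g)\<^sup>2 = (rot l q)\<^sup>2 * (rot l h)\<^sup>2" unfolding q(2)[symmetric] rot_mult s by (simp add: power_mult_distrib)
    moreover have "(rot l h)\<^sup>2 \<noteq> 0" using norm_rot[of h] by auto
    ultimately have sq: "(rot l q)\<^sup>2 = 1" using eq by (simp add: f_def)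
    then have r: "cnj (rot l q) = rot l q" using unit_mult_cnj[OF norm_rot[of q]] by (auto simp: power2_eq_1_iff)
    \<comment> \<open>w is the scalar by which q acts on the first coordinate, and since
      \<open>rot l q\<close> is real also on the second; the time shift z cancels it.\<close>
    define w where "w = lam m q * rot l q"
    have nw: "norm w = 1" using norm_lam[OF q(1), of m] norm_rot[of q] by (simp add: w_def norm_mult)
    then have "norm (cnj w) = 1" by simp
    then obtain z where z: "norm z = 1" "z ^ m = cnj w" using root_of_unit by blast
    have z': "norm (cnj z) = 1" using z by simp
    have cz: "circle_elem z \<in> carrier (GG :: 'n gelem monoid)" "circle_elem (cnj z) \<in> carrier (GG :: 'n gelem monoid)"
      by (rule circle_elem_carrier[OF z(1)] circle_elem_carrier[OF z'])+
    define k where "k = q \<otimes>\<^bsub>GG\<^esub> circle_elem z"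
    have "lam m k = lam m q * cnj w" unfolding k_def lam_mult[OF q(1) cz(1)] lam_circle_elem[OF z(1)] z(2) ..
    moreover have rk: "rot l k = rot l q" unfolding k_def rot_mult rot_circle_elem by simp
    ultimately have "lam m k * rot l k = 1" using unit_mult_cnj[OF nw] by (simp add: w_def mult_ac)
    moreover have "snd (fst k) = 1" using s by (simp add: k_def GG_mult circle_elem_def)
    ultimately have "k \<in> ker" using q(1) cz r rk by (simp add: ker_def k_def)
    moreover have "g = k \<otimes>\<^bsub>GG\<^esub> (circle_elem (cnj z) \<otimes>\<^bsub>GG\<^esub> h)"
    proof -
      have zz: "circle_elem z \<otimes>\<^bsub>GG\<^esub> circle_elem (cnj z) = (\<one>\<^bsub>GG\<^esub> :: 'n gelem)"
        using unit_mult_cnj[OF z(1)] by (simp add: GG_mult GG_one circle_elem_def)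
      have "k \<otimes>\<^bsub>GG\<^esub> (circle_elem (cnj z) \<otimes>\<^bsub>GG\<^esub> h) = q \<otimes>\<^bsub>GG\<^esub> ((circle_elem z \<otimes>\<^bsub>GG\<^esub> circle_elem (cnj z)) \<otimes>\<^bsub>GG\<^esub> h)"
        unfolding k_def using q(1) cz h by (simp add: GG.m_assoc)
      also have "\<dots> = g" unfolding zz using h q(2) by simp
      finally show ?thesis ..
    qed
    ultimately show "\<exists>k\<in>ker. \<exists>z. norm z = 1 \<and> g = k \<otimes>\<^bsub>GG\<^esub> (circle_elem z \<otimes>\<^bsub>GG\<^esub> h)" using z' by blast
  next
    assume "\<exists>k\<in>ker. \<exists>z. norm z = 1 \<and> g = k \<otimes>\<^bsub>GG\<^esub> (circle_elem z \<otimes>\<^bsub>GG\<^esub> h)"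
    then obtain k z where kz: "k \<in> ker" "g = k \<otimes>\<^bsub>GG\<^esub> (circle_elem z \<otimes>\<^bsub>GG\<^esub> h)" by blast
    have k: "snd (fst k) = 1" "lam m k * rot l k = 1" "lam m k * cnj (rot l k) = 1" using kz(1) by (auto simp: ker_def)
    have "lam m k * (rot l k - cnj (rot l k)) = 0" using k(2,3) by (simp add: right_diff_distrib)
    then have "rot l k = cnj (rot l k)" using k(2) by auto
    then have rk: "(rot l k)\<^sup>2 = 1" using unit_mult_cnj[OF norm_rot[of k]] by (simp add: power2_eq_square)
    have "rot l g = rot l k * rot l h"
      unfolding kz(2) rot_mult k(1) rot_circle_elem by (simp add: circle_elem_def)
    moreover have "snd (fst g) = snd (fst h)" unfolding kz(2) by (simp add: GG_mult circle_elem_def k(1))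
    ultimately show "f g = f h" using rk by (simp add: f_def power_mult_distrib)
  qed
  then have "weyl_mod_circle_order (orbit_type ker) = card (f ` normalizer GG (St (W 1 2)))"
    by (intro weyl_mod_circle_order_eq W_in_V) (simp_all add: St_12 rep_kernel normalizer_kernel)
  also have "\<dots> = card (f ` carrier GG)" by (simp add: St_12 normalizer_kernel)
  also have "f ` carrier GG = {1, -1} \<times> range (\<lambda>r. (chi j r)\<^sup>2)"
  proof (intro equalityI subsetI)
    fix q assume "q \<in> f ` carrier GG"
    then obtain g where g: "g \<in> carrier GG" "q = f g" by blast
    have "f g = (snd (fst g), (chi j (- fst (fst g)))\<^sup>2)" by (simp add: f_def rot_def j_def)
    then show "q \<in> {1, -1} \<times> range (\<lambda>r. (chi j r)\<^sup>2)" using g carrier_GG[of g] by simp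
  next
    fix q :: "int \<times> complex" assume "q \<in> {1, -1} \<times> range (\<lambda>r. (chi j r)\<^sup>2)"
    then obtain s r where sr: "s \<in> {1, -1}" "q = (s, (chi j r)\<^sup>2)" by blast
    have "((- r, s), (1, 1)) \<in> carrier GG" using sr(1) by (simp add: carrier_GG)
    moreover have "q = f ((- r, s), (1, 1))" unfolding sr(2) f_def by (simp add: rot_def j_def)
    ultimately show "q \<in> f ` carrier GG" by (intro image_eqI)
  qed
  also have "card ({1, -1 :: int} \<times> range (\<lambda>r. (chi j r)\<^sup>2)) = 2 * card (range (\<lambda>r. (chi j r)\<^sup>2))"
    by (simp add: card_cartesian_product)
  also have "\<dots> = card D" using card_squares[OF D_facts(1-3)] D_facts(4) by simp
  finally show ?thesis .
qed

lemma fixed_dim_kernel: "fixed_dim V (orbit_type ker) = 4"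
proof -
  have "act h z = z" if "z \<in> V" "h \<in> ker" for z h
    using kernel_subset[OF that(1)] that(2) by (auto simp: stabilizer_def)
  then have "{z \<in> V. \<forall>h \<in> ker. act h z = z} = V" by blast
  also have "V = range (\<lambda>q. W (fst q) (snd q))" unfolding V_mode_eq by (auto simp: image_iff) blast
  finally show ?thesis unfolding fixed_dim_def rep_kernel
    using dim_range_linear[OF linear_W] W_inject by (simp add: inj_def prod_eq_iff)
qed

text \<open>The coefficient of \<open>ker\<close> is (2 - (2 + d)) / d = -1 with d the size of
  \<open>D\<close>: half the real dimension 4, minus one for each of the 2 + d line groups, divided
  by the order of the Weyl group modulo the circle.\<close>

lemma keys_deg_mode_nonreal: "Poly_Mapping.keys (deg_mode l m :: 'n orbit_type \<Rightarrow>\<^sub>0 int) \<subseteq> St_types"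
proof -
  define T where "T = {orbit_type (St x) | x. is_line x}"
  have TS: "T \<subseteq> St_types" unfolding T_def is_line_def by blast
  have ST: "St_types - T \<subseteq> {orbit_type ker}"
  proof
    fix K assume K: "K \<in> St_types - T"
    then obtain x where x: "x \<in> V" "x \<noteq> 0" "K = orbit_type (St x)" by blast
    then have "\<not> is_line x" using K unfolding T_def by blast
    then show "K \<in> {orbit_type ker}" using line_or_kernel[OF x(1,2)] x(3) by simp
  qed
  \<comment> \<open>The maximal orbit types partition the line groups, so the sum over types below
    becomes a count of groups.\<close>
  have union: "\<Union> T = line_groups"
  proof (intro equalityI subsetI)
    fix H assume "H \<in> \<Union> T"
    then obtain x where x: "is_line x" "H \<in> orbit_type (St x)" unfolding T_def by blast
    then obtain g where "g \<in> carrier GG" "H = St (act g x)" unfolding orbit_type_St[OF is_line_V[OF x(1)]] by blast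
    then show "H \<in> line_groups" unfolding line_groups_def using is_line_act x(1) by blast
  next
    fix H assume "H \<in> line_groups"
    then obtain x where x: "is_line x" "H = St x" unfolding line_groups_def by blast
    then show "H \<in> \<Union> T" unfolding T_def using self_in_orbit_type[OF is_line_V[OF x(1)]] by blast
  qed
  have finT: "finite T" by (rule finite_UnionD) (simp add: union line_groups_card(1))
  have disj: "disjoint T"
  proof (rule disjointI)
    fix K L assume KL: "K \<in> T" "L \<in> T" "K \<noteq> L"
    then obtain x y where x: "is_line x" "K = orbit_type (St x)" and y: "is_line y" "L = orbit_type (St y)" unfolding T_def by blast
    show "K \<inter> L = {}"
    proof (rule ccontr)
      assume "K \<inter> L \<noteq> {}"
      then obtain g h where gh: "g \<in> carrier GG" "h \<in> carrier GG" "St (act g x) = St (act h y)"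
        unfolding x(2) y(2) orbit_type_St[OF is_line_V[OF x(1)]] orbit_type_St[OF is_line_V[OF y(1)]] by blast
      then have "K = L" unfolding x(2) y(2)
        using orbit_type_St_act[OF gh(1) is_line_V[OF x(1)]] orbit_type_St_act[OF gh(2) is_line_V[OF y(1)]] by simp
      then show False using KL(3) by blast
    qed
  qed
  have "finite St_types"
    by (rule finite_subset[of _ "insert (orbit_type ker) T"]) (use ST finT in blast)+
  then show ?thesis unfolding deg_mode_def Phi_St_types
  proof (rule keys_degree_of_recurrence[OF _ TS ST])
    fix H assume "H \<in> T"
    then obtain x where x: "is_line x" "H = orbit_type (St x)" unfolding T_def by blast
    show "real (fixed_dim V H) / 2 = 1 \<and> weyl_mod_circle_order H = 1 \<and> {K \<in> St_types. otype_less H K} = {}"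
      unfolding x(2) using fixed_dim_line[OF x(1)] weyl_mod_circle_order_line[OF x(1)] line_type_maximal[OF x(1)] by simp
  next
    assume E: "orbit_type ker \<in> St_types - T"
    have less: "{K \<in> St_types. otype_less (orbit_type ker) K} = T"
    proof (intro equalityI subsetI)
      fix K assume "K \<in> {K \<in> St_types. otype_less (orbit_type ker) K}"
      then show "K \<in> T" using ST by (auto simp: otype_less_def)
    next
      fix K assume K: "K \<in> T"
      then obtain x where x: "is_line x" "K = orbit_type (St x)" unfolding T_def by blast
      have "otype_le (orbit_type ker) K" unfolding otype_le_def orbit_type_kernel x(2)
        using self_in_orbit_type[OF is_line_V[OF x(1)]] kernel_subset[OF is_line_V[OF x(1)]] by blast
      then show "K \<in> {K \<in> St_types. otype_less (orbit_type ker) K}" using K TS E by (auto simp: otype_less_def)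
    qed
    \<comment> \<open>Every group in a maximal type contains \<open>ker\<close>, so n(ker, K) is the
      full size of that type.\<close>
    have "num_containing (orbit_type ker) K = card K" "weyl_mod_circle_order K = 1" if K: "K \<in> T" for K
    proof -
      obtain x where x: "is_line x" "K = orbit_type (St x)" using K unfolding T_def by blast
      show "weyl_mod_circle_order K = 1" unfolding x(2) by (rule weyl_mod_circle_order_line[OF x(1)])
      have "ker \<subseteq> H" if "H \<in> K" for H
        using that kernel_subset act_V is_line_V[OF x(1)] unfolding x(2) orbit_type_St[OF is_line_V[OF x(1)]] by blast
      then have "{H \<in> K. ker \<subseteq> H} = K" by blast
      then show "num_containing (orbit_type ker) K = card K" by (simp add: num_containing_def rep_kernel)
    qed
    then have "(\<Sum>K\<in>T. real (num_containing (orbit_type ker) K) * real (weyl_mod_circle_order K)) = real (\<Sum>K\<in>T. card K)"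
      by simp
    also have "(\<Sum>K\<in>T. card K) = card (\<Union> T)"
      by (rule card_Union_disjoint[symmetric, OF disj]) (use line_groups_card(1) union in \<open>auto intro: finite_subset\<close>)
    also have "\<dots> = 2 + card D" unfolding union by (rule line_groups_card(2))
    finally have sum: "(\<Sum>K\<in>T. real (num_containing (orbit_type ker) K) * real (weyl_mod_circle_order K)) = 2 + real (card D)"
      by simp
    have "1 \<in> D" unfolding D_def by (rule image_eqI[of _ _ "(1, 0)"]) auto
    then have "card D > 0" using D_facts(1) by (simp add: card_gt_0_iff) blast
    then show "{K \<in> St_types. otype_less (orbit_type ker) K} = T \<and>
       (real (fixed_dim V (orbit_type ker)) / 2 - (\<Sum>K\<in>T. real (num_containing (orbit_type ker) K) * real (weyl_mod_circle_order K)))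
       / real (weyl_mod_circle_order (orbit_type ker)) = -1"
      unfolding less sum fixed_dim_kernel weyl_kernel by (simp add: field_simps)
  qed
qed

end

section \<open>Orbit types in the invariant\<close>

lemma conjugate_one: "H \<subseteq> carrier GG \<Longrightarrow> conjugate \<one>\<^bsub>GG\<^esub> H = H"
  by (simp add: conjugate_def GG.lcos_mult_one GG.coset_mult_one)

text \<open>Only the support matters: whatever cancels, a type that survives in the product occurs
  in one of its terms.\<close>

lemma keys_burnside_mult:
  assumes "L \<in> Poly_Mapping.keys (burnside_mult k X Y)"
  obtains H K where "K \<in> Poly_Mapping.keys Y" "num_orbits H K L \<noteq> 0"
proof -
  obtain H where "L \<in> Poly_Mapping.keys (\<Sum>K\<in>Poly_Mapping.keys Y. \<Sum>L | L \<in> Phi k \<and> num_orbits H K L \<noteq> 0.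
       frag_cmul (Poly_Mapping.lookup X H * Poly_Mapping.lookup Y K * int (num_orbits H K L)) (frag_of L))"
    using subsetD[OF keys_sum assms[unfolded burnside_mult_def]] by blast
  from subsetD[OF keys_sum this] obtain K where K: "K \<in> Poly_Mapping.keys Y" 
    "L \<in> Poly_Mapping.keys (\<Sum>L | L \<in> Phi k \<and> num_orbits H K L \<noteq> 0.
       frag_cmul (Poly_Mapping.lookup X H * Poly_Mapping.lookup Y K * int (num_orbits H K L)) (frag_of L))" by blast
  from subsetD[OF keys_sum K(2)] obtain L' where "num_orbits H K L' \<noteq> 0"
    "L \<in> Poly_Mapping.keys (frag_cmul (Poly_Mapping.lookup X H * Poly_Mapping.lookup Y K * int (num_orbits H K L')) (frag_of L'))"
    by blast
  moreover from this(2) have "L = L'" by (auto simp: in_keys_iff lookup_frag_cmul lookup_frag_of split: if_splits)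
  ultimately show thesis using that K(1) by blast
qed

lemma (in group) coset_stabilizer_conjugate:
  assumes R: "subgroup R G" and b: "b \<in> carrier G" and k: "k \<in> carrier G" "k <# (b <# R) = b <# R"
  shows "\<exists>r\<in>R. k = b \<otimes> r \<otimes> inv b"
proof -
  have "b \<in> b <# R" using subgroup.one_closed[OF R] b by (force simp: l_coset_def)
  then have "k \<otimes> b \<in> b <# R" using k(2) by (force simp: l_coset_def)
  then obtain r where r: "r \<in> R" "k \<otimes> b = b \<otimes> r" by (auto simp: l_coset_def)
  have "k = (k \<otimes> b) \<otimes> inv b" using k(1) b by (simp add: m_assoc)
  then show ?thesis using r by auto
qed

context mode begin

lemma keys_deg_mode: "Poly_Mapping.keys (deg_mode l m :: 'n orbit_type \<Rightarrow>\<^sub>0 int) \<subseteq> St_types"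
proof (cases "j = - j")
  case True
  then show ?thesis by (rule keys_deg_mode_self_conjugate)
next
  case False
  then interpret nonreal_mode l m j by unfold_locales
  show ?thesis by (rule keys_deg_mode_nonreal)
qed

lemma num_orbits_subgroup:
  assumes K: "K \<in> Poly_Mapping.keys (deg_mode l m :: 'n orbit_type \<Rightarrow>\<^sub>0 int)"
    and orb: "num_orbits H' K (orbit_type H) \<noteq> 0" and H: "H \<subseteq> carrier GG"
  obtains z where "z \<in> V" "z \<noteq> 0" "H \<subseteq> St z"
proof -
  obtain x0 where x0: "x0 \<in> V" "x0 \<noteq> 0" "K = orbit_type (St x0)" using K keys_deg_mode by blast
  obtain h where h: "h \<in> carrier GG" "rep K = St (act h x0)" using rep_orbit_type[OF x0(1)] unfolding x0(3) .
  define x where "x = act h x0"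
  have x: "x \<in> V" "x \<noteq> 0" "rep K = St x" using act_V act_eq_0 h x0 by (auto simp: x_def)
  have "{Q \<in> orbits GG (left_cosets (rep H') \<times> left_cosets (rep K)) diag_act.
     \<exists>y\<in>Q. orbit_type (stabilizer GG diag_act y) = orbit_type H} \<noteq> {}"
    using orb unfolding num_orbits_def by (metis card.empty)
  then obtain y0 g where y0: "y0 \<in> left_cosets (rep H') \<times> left_cosets (rep K)" and g: "g \<in> carrier GG"
    and y: "orbit_type (stabilizer GG diag_act (diag_act g y0)) = orbit_type H"
    unfolding orbits_def orbit_def by blast
  obtain A g' where g': "g' \<in> carrier GG" "y0 = (A, g' <#\<^bsub>GG\<^esub> St x)"
    using y0 unfolding left_cosets_def x(3) by blast
  define b where "b = g \<otimes>\<^bsub>GG\<^esub> g'"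
  have b: "b \<in> carrier GG" using g g' by (simp add: b_def)
  have B: "diag_act g y0 = (g <#\<^bsub>GG\<^esub> A, b <#\<^bsub>GG\<^esub> St x)"
    unfolding g'(2) diag_act_def prod.case b_def GG.lcos_m_assoc[OF St_subset g g'(1)] ..
  have sub: "stabilizer GG diag_act (diag_act g y0) \<subseteq> St (act b x)"
  proof
    fix k assume "k \<in> stabilizer GG diag_act (diag_act g y0)"
    then have k: "k \<in> carrier GG" "diag_act k (diag_act g y0) = diag_act g y0" unfolding stabilizer_def by blast+
    have "k <#\<^bsub>GG\<^esub> (b <#\<^bsub>GG\<^esub> St x) = b <#\<^bsub>GG\<^esub> St x" using k(2) unfolding B by (simp add: diag_act_def)
    then have "k \<in> conjugate b (St x)"
      using GG.coset_stabilizer_conjugate[OF subgroup_St[OF x(1)] b k(1)] unfolding mem_conjugate by blast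
    then show "k \<in> St (act b x)" unfolding conjugate_St[OF b x(1)] .
  qed
  \<comment> \<open>The orbit type determines the stabilizer only up to conjugacy. The conjugating
    element a is applied to the wave, so that H itself lies in the isotropy group of a
    translate.\<close>
  have "H = conjugate \<one>\<^bsub>GG\<^esub> H" using conjugate_one[OF H] by simp
  then have "H \<in> orbit_type (stabilizer GG diag_act (diag_act g y0))"
    unfolding y unfolding orbit_type_def using GG.one_closed by blast
  then obtain a where a: "a \<in> carrier GG" "H = conjugate a (stabilizer GG diag_act (diag_act g y0))"
    unfolding orbit_type_def by blast
  have "H \<subseteq> conjugate a (St (act b x))" unfolding a(2) by (rule conjugate_mono[OF sub])
  then have "H \<subseteq> St (act a (act b x))" unfolding conjugate_St[OF a(1) act_V[OF x(1)]] .
  moreover have "act a (act b x) \<in> V" "act a (act b x) \<noteq> 0"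
    using act_V act_eq_0 a(1) b x by auto
  ultimately show thesis using that by blast
qed

end

lemma keys_omega_mode_subgroup:
  fixes H :: "'n::finite gelem set"
  assumes "orbit_type H \<in> Poly_Mapping.keys (omega_mode a \<delta> c \<beta> \<tau>\<^sub>c p m)" and H: "H \<subseteq> carrier GG"
  obtains l and z :: "'n osc" where "(l, m) \<in> critical_pairs a \<delta> c \<tau>\<^sub>c CARD('n) p"
    "z \<in> V_mode l m" "z \<noteq> 0" "H \<subseteq> stabilizer GG act z"
proof -
  let ?S = "{q \<in> critical_pairs a \<delta> c \<tau>\<^sub>c CARD('n) p. snd q = m}"
  obtain H' K where K: "K \<in> Poly_Mapping.keys (\<Sum>(l, m)\<in>?S. frag_cmul (crossing_number a \<delta> c \<beta> \<tau>\<^sub>c TYPE('n) p l m) (deg_mode l m :: 'n orbit_type \<Rightarrow>\<^sub>0 int))"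
    and orb: "num_orbits H' K (orbit_type H) \<noteq> 0"
    by (rule keys_burnside_mult[OF assms(1)[unfolded omega_mode_def omega_restricted_def]])
  obtain l where l: "(l, m) \<in> critical_pairs a \<delta> c \<tau>\<^sub>c CARD('n) p"
    and K': "K \<in> Poly_Mapping.keys (frag_cmul (crossing_number a \<delta> c \<beta> \<tau>\<^sub>c TYPE('n) p l m) (deg_mode l m :: 'n orbit_type \<Rightarrow>\<^sub>0 int))"
    using subsetD[OF keys_sum K] by auto
  have K'': "K \<in> Poly_Mapping.keys (deg_mode l m :: 'n orbit_type \<Rightarrow>\<^sub>0 int)"
    using K' by (auto simp: in_keys_iff lookup_frag_cmul)
  have "0 < m" using l by (simp add: critical_pairs_def)
  then interpret mode l m "of_int_mod_ring (int l) :: 'n mod_ring" by unfold_locales simp_all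
  show thesis using num_orbits_subgroup[OF K'' orb H] that[OF l] by blast
qed

section \<open>Bifurcation from a critical pair\<close>

lemma critical_pair_bifurcates:
  fixes K :: "'n::finite gelem set" and x :: "'n osc"
  assumes "0 < a" "0 < \<delta>" "0 \<le> c" "0 < \<beta>" and p: "p \<in> param_space"
    and lm: "(l, m) \<in> critical_pairs a \<delta> c \<tau>\<^sub>c CARD('n) p"
    and x: "x \<in> V_mode l m" "x \<noteq> 0" "K \<subseteq> stabilizer GG act x"
  shows "bifurcates a \<delta> c \<beta> \<tau>\<^sub>c p K"
proof -
  obtain b \<tau> where p': "p = (b, \<tau>)" "0 < b" "0 \<le> \<tau>" using p unfolding param_space_def by auto
  have "0 < m" "Delta a \<delta> c \<tau>\<^sub>c CARD('n) l (\<i> * of_nat m) (b, \<tau>) = 0"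
    using lm p'(1) by (simp_all add: critical_pairs_def)
  moreover have "K \<subseteq> carrier GG" "\<And>g. g \<in> K \<Longrightarrow> act g x = x" using x(3) unfolding stabilizer_def by blast+
  ultimately show ?thesis unfolding p'(1) using fixed_wave_bifurcates[OF assms(1-4) p'(2,3)] x(1,2) by blast
qed

theorem theorem3p1:
  fixes a \<delta> c \<beta> \<tau>\<^sub>c :: real and p :: "real \<times> real"
  assumes "a > 0" "\<delta> > 0" "c \<ge> 0" "\<beta> > 0" "\<tau>\<^sub>c \<ge> 0"
    and isolated: "p isolated_in critical_set a \<delta> c \<tau>\<^sub>c CARD('n::finite)"
    and transversal: "\<And>l m. (l, m) \<in> critical_pairs a \<delta> c \<tau>\<^sub>c CARD('n) p \<Longrightarrow>
           crossing_speed a \<delta> c \<tau>\<^sub>c CARD('n) p l m \<noteq> 0"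
  shows "((omega a \<delta> c \<beta> \<tau>\<^sub>c p :: 'n orbit_type \<Rightarrow>\<^sub>0 int) \<noteq> 0 \<longrightarrow>
            bifurcation_point a \<delta> c \<beta> \<tau>\<^sub>c TYPE('n) p) \<and>
         (\<forall>m>0. \<forall>H :: 'n gelem set.
            closed_subgroup H \<and> maximal_occurring (orbit_type H) (omega_mode a \<delta> c \<beta> \<tau>\<^sub>c p m) \<longrightarrow>
            (\<forall>U :: ((real \<times> real) \<times> 'n osc) set. open U \<and> (p, 0) \<in> U \<longrightarrow>
               (\<exists>q x. (q, x) \<in> U \<and> q \<in> param_space \<and> Psi a \<delta> c \<beta> \<tau>\<^sub>c q x = 0 \<and>
                  x \<notin> const_space \<and>
                  (\<exists>g \<in> carrier GG. conjugate g H \<subseteq> stabilizer GG act x))))"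
proof (intro conjI impI allI; (elim conjE)?)
  have p: "p \<in> critical_set a \<delta> c \<tau>\<^sub>c CARD('n)" using isolated unfolding isolated_in_def by blast
  then have pp: "p \<in> param_space" unfolding critical_set_def by blast
  note bif = critical_pair_bifurcates[OF assms(1-4) pp]
  {
    \<comment> \<open>A point of the critical set has a critical pair, and the wave
      \<open>W 1 0\<close> of its mode starts a branch. With K empty no symmetry is imposed, and
      nonconstant solutions are in particular nonzero.\<close>
    obtain l m where lm: "(l, m) \<in> critical_pairs a \<delta> c \<tau>\<^sub>c CARD('n) p"
      using p unfolding critical_set_def critical_pairs_def by fastforce
    then have "0 < m" by (simp add: critical_pairs_def)
    then interpret mode l m "of_int_mod_ring (int l) :: 'n mod_ring" by unfold_locales simp_all
    have "amp l 1 0 (0 :: 'n mod_ring) = 1" by (simp add: amp_def)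
    then have nz: "W 1 0 \<noteq> 0" unfolding W_eq_0 by (metis zero_neq_one)
    have "bifurcates a \<delta> c \<beta> \<tau>\<^sub>c p ({} :: 'n gelem set)" by (rule bif[OF lm W_in_V nz]) simp
    moreover have "(0 :: 'n osc) \<in> const_space" unfolding const_space_def by (auto simp: zero_h2per.rep_eq)
    ultimately show "bifurcation_point a \<delta> c \<beta> \<tau>\<^sub>c TYPE('n) p"
      unfolding bifurcation_point_def bifurcates_def by metis
  next
    fix m :: nat and H :: "'n gelem set" and U :: "((real \<times> real) \<times> 'n osc) set"
    assume H: "closed_subgroup H" "maximal_occurring (orbit_type H) (omega_mode a \<delta> c \<beta> \<tau>\<^sub>c p m)"
      and U: "open U" "(p, 0) \<in> U"
    have sub: "subgroup H GG" using H(1) by (simp add: closed_subgroup_def)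
    have key: "orbit_type H \<in> Poly_Mapping.keys (omega_mode a \<delta> c \<beta> \<tau>\<^sub>c p m)" using H(2) by (simp add: maximal_occurring_def)
    obtain l and z :: "'n osc" where "(l, m) \<in> critical_pairs a \<delta> c \<tau>\<^sub>c CARD('n) p"
      "z \<in> V_mode l m" "z \<noteq> 0" "H \<subseteq> stabilizer GG act z"
      using keys_omega_mode_subgroup[OF key subgroup.subset[OF sub]] .
    then have "bifurcates a \<delta> c \<beta> \<tau>\<^sub>c p H" by (rule bif)
    then obtain q and x :: "'n osc" where qx: "(q, x) \<in> U" "q \<in> param_space" "Psi a \<delta> c \<beta> \<tau>\<^sub>c q x = 0" "x \<notin> const_space"
      "\<forall>g\<in>H. act g x = x"
      using U unfolding bifurcates_def by blast
    have HG: "H \<subseteq> carrier GG" using sub by (rule subgroup.subset)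
    \<comment> \<open>The solutions found are fixed by H itself, so the identity serves as
      conjugating element.\<close>
    have "conjugate \<one>\<^bsub>GG\<^esub> H \<subseteq> stabilizer GG act x"
      unfolding conjugate_one[OF HG] using HG qx(5) by (simp add: stabilizer_def subset_iff)
    then show "\<exists>q x. (q, x) \<in> U \<and> q \<in> param_space \<and> Psi a \<delta> c \<beta> \<tau>\<^sub>c q x = 0 \<and>
                  x \<notin> const_space \<and> (\<exists>g \<in> carrier GG. conjugate g H \<subseteq> stabilizer GG act x)"
      using qx GG.one_closed by blast
  }
qed

end
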